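(* Let $1<p<\infty$ and suppose $g\in L_\infty(\mathbb R)$ admits a Wiener-Hopf $p$-factorisation $g=g_-r^kg_+$. Then $T_g:H_p^+\to H_p^+$ is invertible if $k=0$, only left invertible (i.e. left invertible but not invertible) if $k>0$, and only right invertible if $k<0$. Moreover, denoting by $g_+^{-1}P^+g_-^{-1}I_+$ the bounded extension to $H_p^+$ of the operator $r_0\mapsto g_+^{-1}P^+(g_-^{-1}r_0)$, $r_0\in\mathcal R_0^+$: (i) for $k>0$ the operator $(g_+^{-1}P^+g_-^{-1}I_+)\,T_{r^{-k}}$ is a left inverse for $T_g$ and $\dim\ker T_g^*=k$; (ii) for $k<0$ the operator $T_{r^{-k}}\,(g_+^{-1}P^+g_-^{-1}I_+)$ is a right inverse for $T_g$ and $\dim\ker T_g=|k|$.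
   Context: All functions are complex-valued on $\mathbb R$, $L_p=L_p(\mathbb R)$, and $\frac1p+\frac1{p'}=1$. For $1\le p<\infty$, $H_p^\pm$ denotes the Hardy space of the upper/lower half-plane $\mathbb C^\pm$, identified via nontangential boundary values with a closed subspace of $L_p$. For $1<p<\infty$, $P^\pm=\frac12(I\pm S_{\mathbb R})$, where $S_{\mathbb R}f(x)=\frac1{\pi i}\,\mathrm{p.v.}\!\int_{\mathbb R}\frac{f(t)}{t-x}dt$, are the complementary bounded projections of $L_p$ onto $H_p^\pm$ along $H_p^\mp$. For $g\in L_\infty$, the Toeplitz operator $T_g:H_p^+\to H_p^+$ is $T_gf_+=P^+(gf_+)$; its adjoint is identified with $T_{\bar g}$ acting on $H_{p'}^+$. Let $\lambda_\pm(x)=x\pm i$, $\mathcal H_p^\pm=\lambda_\pm H_p^\pm$, $r(x)=\frac{x-i}{x+i}$. Let $\mathcal R$ be the set of rational functions without poles on $\mathbb R\cup\{\infty\}$ and $\mathcal R_0^+=\mathcal R\cap H_p^+$ (a dense subset of $H_p^+$). A Wiener-Hopf $p$-factorisation of $g\in L_\infty$ is a representation $g=g_-r^kg_+$ (a.e. on $\mathbb R$) with $k\in\mathbb Z$ such that (a) $g_+\in\mathcal H_{p'}^+$, $g_-\in\mathcal H_p^-$; (b) $g_+^{-1}\in\mathcal H_p^+$, $g_-^{-1}\in\mathcal H_{p'}^-$; (c) the operator $r_0\mapsto g_+^{-1}P^+(g_-^{-1}r_0)$ from $\mathcal R_0^+$ (with the $H_p^+$ norm) to $H_p^+$ is bounded.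 (In (c), $g_-^{-1}r_0\in L_{p'}$, so $P^+(g_-^{-1}r_0)$ is defined.) *)

theory Defs
  imports "HOL-Analysis.Analysis" "HOL-Computational_Algebra.Polynomial"
begin

section \<open>Functions on the real line modulo null sets\<close>

text \<open>
  The carrier type consists of all functions from the reals to the complex numbers modulo
  equality Lebesgue-almost everywhere.  Measurability is imposed by the function spaces below.
\<close>

quotient_type aefun = "real \<Rightarrow> complex" / "\<lambda>f g. AE x in lebesgue. f x = g x"
  morphisms rep_aefun ae_class
proof (rule equivpI)
  show "reflp (\<lambda>f g :: real \<Rightarrow> complex. AE x in lebesgue. f x = g x)"
    by (auto simp: reflp_def)
  show "symp (\<lambda>f g :: real \<Rightarrow> complex. AE x in lebesgue. f x = g x)"
    by (auto simp: symp_def eq_commute)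
  show "transp (\<lambda>f g :: real \<Rightarrow> complex. AE x in lebesgue. f x = g x)"
    unfolding transp_def by (intro allI impI) (erule (1) eventually_elim2, simp)
qed

instantiation aefun :: "{comm_ring_1, inverse}"
begin

lift_definition zero_aefun :: aefun is "\<lambda>x. 0" .
lift_definition one_aefun :: aefun is "\<lambda>x. 1" .
lift_definition plus_aefun :: "aefun \<Rightarrow> aefun \<Rightarrow> aefun" is "\<lambda>f g x. f x + g x"
  by (erule (1) eventually_elim2) simp
lift_definition minus_aefun :: "aefun \<Rightarrow> aefun \<Rightarrow> aefun" is "\<lambda>f g x. f x - g x"
  by (erule (1) eventually_elim2) simp
lift_definition uminus_aefun :: "aefun \<Rightarrow> aefun" is "\<lambda>f x. - f x"
  by (erule eventually_mono) simp
lift_definition times_aefun :: "aefun \<Rightarrow> aefun \<Rightarrow> aefun" is "\<lambda>f g x. f x * g x"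
  by (erule (1) eventually_elim2) simp
lift_definition inverse_aefun :: "aefun \<Rightarrow> aefun" is "\<lambda>f x. inverse (f x)"
  by (erule eventually_mono) simp
lift_definition divide_aefun :: "aefun \<Rightarrow> aefun \<Rightarrow> aefun" is "\<lambda>f g x. f x / g x"
  by (erule (1) eventually_elim2) simp

instance
proof
  have "\<not> (AE x in (lebesgue :: real measure). (0::complex) = 1)"
    by (simp add: AE_iff_null null_sets_def)
  then show "(0::aefun) \<noteq> 1" by transfer
qed (transfer, simp add: algebra_simps)+

end

lift_definition ae_scale :: "complex \<Rightarrow> aefun \<Rightarrow> aefun" is "\<lambda>c f x. c * f x"
  by (erule eventually_mono) simp

lift_definition ae_cnj :: "aefun \<Rightarrow> aefun" is "\<lambda>f x. cnj (f x)"
  by (erule eventually_mono) simp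

interpretation aefun: vector_space ae_scale
  by unfold_locales (transfer, simp add: algebra_simps)+

lemma lebesgue_integral_AE_cong:
  fixes f g :: "real \<Rightarrow> 'a :: euclidean_space"
  assumes "AE x in lebesgue. f x = g x"
  shows "integral\<^sup>L lebesgue f = integral\<^sup>L lebesgue g"
proof (cases "f \<in> borel_measurable lebesgue")
  case True
  then have "g \<in> borel_measurable lebesgue"
    using assms by (rule borel_measurable_AE)
  then show ?thesis using True assms by (intro integral_cong_AE)
next
  case False
  have "AE x in lebesgue. g x = f x" using assms by (auto simp: eq_commute)
  then have "g \<notin> borel_measurable lebesgue" using False borel_measurable_AE by blast
  then show ?thesis using False
    by (metis borel_measurable_integrable not_integrable_integral_eq)
qed

section \<open>Lebesgue and Hardy spaces\<close>

definition Lp :: "real \<Rightarrow> aefun set" where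
  "Lp p = {ae_class f | f. f \<in> borel_measurable lebesgue
                         \<and> integrable lebesgue (\<lambda>x. norm (f x) powr p)}"

lift_definition Lp_norm :: "real \<Rightarrow> aefun \<Rightarrow> real"
  is "\<lambda>p f. (LINT x|lebesgue. norm (f x) powr p) powr (1 / p)"
  by (rule arg_cong[where f = "\<lambda>t. t powr _"], rule lebesgue_integral_AE_cong)
     (erule eventually_mono, simp)

definition Linf :: "aefun set" where
  "Linf = {ae_class f | f. f \<in> borel_measurable lebesgue
                         \<and> (\<exists>C. AE x in lebesgue. norm (f x) \<le> C)}"

definition conj_exp :: "real \<Rightarrow> real" where
  "conj_exp p = p / (p - 1)"

text \<open>
  A sign \<open>s\<close>, equal to 1 or -1, selects the upper or lower half-plane, and likewise the
  superscript plus or minus in the spaces, projections and factors below.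
\<close>

definition half_plane :: "real \<Rightarrow> complex set" where
  "half_plane s = {z. s * Im z > 0}"

definition hardy_fun :: "real \<Rightarrow> real \<Rightarrow> (complex \<Rightarrow> complex) set" where
  "hardy_fun s p = {F. F holomorphic_on half_plane s \<and>
     (SUP y\<in>{0<..}. \<integral>\<^sup>+ x. ennreal (norm (F (Complex x (s * y))) powr p) \<partial>lebesgue) < \<infinity>}"

definition nt_region :: "real \<Rightarrow> real \<Rightarrow> real \<Rightarrow> complex set" where
  "nt_region s a x = {z. \<bar>Re z - x\<bar> < a * (s * Im z)}"

definition nt_limit :: "real \<Rightarrow> (complex \<Rightarrow> complex) \<Rightarrow> real \<Rightarrow> complex \<Rightarrow> bool" where
  "nt_limit s F x l \<longleftrightarrow>
     (\<forall>a>0. (F \<longlongrightarrow> l) (at (complex_of_real x) within nt_region s a x))"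

definition Hardy :: "real \<Rightarrow> real \<Rightarrow> aefun set" where
  "Hardy s p = {ae_class f | f. ae_class f \<in> Lp p \<and>
     (\<exists>F \<in> hardy_fun s p. AE x in lebesgue. nt_limit s F x (f x))}"

abbreviation Hplus :: "real \<Rightarrow> aefun set" where "Hplus \<equiv> Hardy 1"

text \<open>The functions \<open>x \<plusminus> \<i>\<close> and the weighted Hardy spaces they generate.\<close>

definition lam :: "real \<Rightarrow> aefun" where
  "lam s = ae_class (\<lambda>x. of_real x + of_real s * \<i>)"

definition weighted_Hardy :: "real \<Rightarrow> real \<Rightarrow> aefun set" where
  "weighted_Hardy s p = (\<lambda>h. lam s * h) ` Hardy s p"

definition r_pow :: "int \<Rightarrow> aefun" where
  "r_pow k = ae_class (\<lambda>x. ((of_real x - \<i>) / (of_real x + \<i>)) powi k)"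

text \<open>
  The condition on the degrees says that there is no pole at infinity.
\<close>

definition Rat_R :: "aefun set" where
  "Rat_R = {ae_class (\<lambda>x. poly P (of_real x) / poly Q (of_real x)) | P Q.
              (\<forall>x::real. poly Q (of_real x) \<noteq> 0) \<and> degree P \<le> degree Q}"

definition Rat0_plus :: "real \<Rightarrow> aefun set" where
  "Rat0_plus p = Rat_R \<inter> Hplus p"

section \<open>The Cauchy singular integral, Riesz projections and Toeplitz operators\<close>

text \<open>
  The principal value is the limit of the symmetrically truncated integrals.  On \<open>Lp p\<close> with
  \<open>1 < p < \<infinity>\<close> no truncation at infinity is needed.  Where the limit does not exist, the value
  is unspecified.
\<close>

lift_definition cauchy_sing :: "aefun \<Rightarrow> aefun"
  is "\<lambda>f x. 1 / (of_real pi * \<i>) *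
        Lim (at_right 0) (\<lambda>\<epsilon>. LINT t:{t. \<epsilon> < \<bar>t - x\<bar>}|lebesgue. f t / of_real (t - x))"
proof (rule AE_I2)
  fix f g :: "real \<Rightarrow> complex" and x :: real
  assume *: "AE x in lebesgue. f x = g x"
  have "(LINT t:{t. \<epsilon> < \<bar>t - x\<bar>}|lebesgue. f t / of_real (t - x))
      = (LINT t:{t. \<epsilon> < \<bar>t - x\<bar>}|lebesgue. g t / of_real (t - x))" for \<epsilon>
    unfolding set_lebesgue_integral_def
    by (rule lebesgue_integral_AE_cong) (rule eventually_mono[OF *], simp)
  then show "1 / (of_real pi * \<i>) *
        Lim (at_right 0) (\<lambda>\<epsilon>. LINT t:{t. \<epsilon> < \<bar>t - x\<bar>}|lebesgue. f t / of_real (t - x)) =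
      1 / (of_real pi * \<i>) *
        Lim (at_right 0) (\<lambda>\<epsilon>. LINT t:{t. \<epsilon> < \<bar>t - x\<bar>}|lebesgue. g t / of_real (t - x))"
    by simp
qed

definition riesz_proj :: "real \<Rightarrow> aefun \<Rightarrow> aefun" where
  "riesz_proj s f = ae_scale (1 / 2) (f + ae_scale (of_real s) (cauchy_sing f))"

abbreviation Pplus :: "aefun \<Rightarrow> aefun" where "Pplus \<equiv> riesz_proj 1"

definition toeplitz :: "aefun \<Rightarrow> aefun \<Rightarrow> aefun" where
  "toeplitz g f = Pplus (g * f)"

text \<open>
  The adjoint of the Toeplitz operator on \<open>Hplus p\<close>, under the usual identification of the dual
  space with \<open>Hplus (conj_exp p)\<close>, on which this operator acts.
\<close>

definition toeplitz_adj :: "aefun \<Rightarrow> aefun \<Rightarrow> aefun" where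
  "toeplitz_adj g = toeplitz (ae_cnj g)"

section \<open>Bounded operators on the Hardy space and one-sided inverses\<close>

definition bounded_op :: "real \<Rightarrow> (aefun \<Rightarrow> aefun) \<Rightarrow> bool" where
  "bounded_op p A \<longleftrightarrow>
     (\<forall>f\<in>Hplus p. A f \<in> Hplus p) \<and>
     (\<forall>f\<in>Hplus p. \<forall>h\<in>Hplus p. A (f + h) = A f + A h) \<and>
     (\<forall>c. \<forall>f\<in>Hplus p. A (ae_scale c f) = ae_scale c (A f)) \<and>
     (\<exists>C. \<forall>f\<in>Hplus p. Lp_norm p (A f) \<le> C * Lp_norm p f)"

definition left_inverse_op :: "real \<Rightarrow> (aefun \<Rightarrow> aefun) \<Rightarrow> (aefun \<Rightarrow> aefun) \<Rightarrow> bool" where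
  "left_inverse_op p B A \<longleftrightarrow>
     bounded_op p A \<and> bounded_op p B \<and> (\<forall>f\<in>Hplus p. B (A f) = f)"

definition right_inverse_op :: "real \<Rightarrow> (aefun \<Rightarrow> aefun) \<Rightarrow> (aefun \<Rightarrow> aefun) \<Rightarrow> bool" where
  "right_inverse_op p B A \<longleftrightarrow>
     bounded_op p A \<and> bounded_op p B \<and> (\<forall>f\<in>Hplus p. A (B f) = f)"

definition left_invertible_op :: "real \<Rightarrow> (aefun \<Rightarrow> aefun) \<Rightarrow> bool" where
  "left_invertible_op p A \<longleftrightarrow> (\<exists>B. left_inverse_op p B A)"

definition right_invertible_op :: "real \<Rightarrow> (aefun \<Rightarrow> aefun) \<Rightarrow> bool" where
  "right_invertible_op p A \<longleftrightarrow> (\<exists>B. right_inverse_op p B A)"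

definition invertible_op :: "real \<Rightarrow> (aefun \<Rightarrow> aefun) \<Rightarrow> bool" where
  "invertible_op p A \<longleftrightarrow> (\<exists>B. left_inverse_op p B A \<and> right_inverse_op p B A)"

definition ker_on :: "aefun set \<Rightarrow> (aefun \<Rightarrow> aefun) \<Rightarrow> aefun set" where
  "ker_on X A = {f \<in> X. A f = 0}"

section \<open>Wiener-Hopf factorisation\<close>

definition wh_op :: "aefun \<Rightarrow> aefun \<Rightarrow> aefun \<Rightarrow> aefun" where
  "wh_op gm gp r0 = inverse gp * Pplus (inverse gm * r0)"

text \<open>
  Since \<open>inverse 0 = 0\<close> holds pointwise, the requirement that the inverses exist is stated
  explicitly: \<open>gp * inverse gp = 1\<close> means that \<open>gp\<close> is nonzero almost everywhere.  Without it
  the zero function would have a factorisation.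
\<close>

definition wiener_hopf_factorisation ::
    "real \<Rightarrow> aefun \<Rightarrow> aefun \<Rightarrow> int \<Rightarrow> aefun \<Rightarrow> bool" where
  "wiener_hopf_factorisation p g gm k gp \<longleftrightarrow>
     g = gm * r_pow k * gp \<and>
     gp \<in> weighted_Hardy 1 (conj_exp p) \<and> gm \<in> weighted_Hardy (- 1) p \<and>
     gp * inverse gp = 1 \<and> gm * inverse gm = 1 \<and>
     inverse gp \<in> weighted_Hardy 1 p \<and> inverse gm \<in> weighted_Hardy (- 1) (conj_exp p) \<and>
     (\<forall>r0\<in>Rat0_plus p. wh_op gm gp r0 \<in> Hplus p) \<and>
     (\<exists>C. \<forall>r0\<in>Rat0_plus p. Lp_norm p (wh_op gm gp r0) \<le> C * Lp_norm p r0)"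

text \<open>
  The bounded extension to \<open>Hplus p\<close> of an operator given on the dense subspace
  \<open>Rat0_plus p\<close>; fixing the values outside \<open>Hplus p\<close> makes it unique as a HOL function.
\<close>

definition bounded_extension :: "real \<Rightarrow> (aefun \<Rightarrow> aefun) \<Rightarrow> (aefun \<Rightarrow> aefun)" where
  "bounded_extension p A = (THE B. bounded_op p B \<and> (\<forall>r0\<in>Rat0_plus p. B r0 = A r0) \<and>
                                   B \<in> extensional (Hplus p))"

end

theory Submission
  imports Defs "HOL-Complex_Analysis.Cauchy_Integral_Theorem" "HOL-Probability.Sinc_Integral"
begin

text \<open>
  The projection \<open>P\<^sup>+\<close> is bounded by the argument of M. Riesz: integrate the inequality
  \<open>\<bar>F\<bar>^p \<le> A (Re F)^p - B Re (F^p)\<close> for the Cauchy integral \<open>F\<close> of a nonnegative function and use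
  duality for \<open>p > 2\<close>.  The functions \<open>r^j / (x + \<i>)\<close> are dense by Stone-Weierstrass, those with
  \<open>j \<ge> 0\<close> lie in \<open>H\<^sup>+\<close> and those with \<open>j < 0\<close> in \<open>H\<^sup>-\<close>, so membership in a Hardy space is a
  condition on moments.  In particular a product of functions in \<open>H\<^sub>p\<^sup>-\<close> and \<open>H\<^sub>q\<^sup>-\<close>, multiplied by
  \<open>x - \<i>\<close>, lies in \<open>H\<^sub>p\<^sup>-\<close> as soon as it lies in \<open>L\<^sub>p\<close>.

  Let \<open>g\<^sub>0 = g\<^sub>- g\<^sub>+\<close> and let \<open>B\<close> be the bounded extension of \<open>g\<^sub>+\<^sup>-\<^sup>1 P\<^sup>+ g\<^sub>-\<^sup>-\<^sup>1\<close>.  For rational \<open>u\<close> the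
  difference \<open>u - g\<^sub>0 B u = g\<^sub>- (I - P\<^sup>+) g\<^sub>-\<^sup>-\<^sup>1 u\<close> lies in \<open>H\<^sub>p\<^sup>-\<close>, whence \<open>B\<close> is a right inverse of
  the Toeplitz operator of \<open>g\<^sub>0\<close>; that operator is injective, so \<open>B\<close> is its inverse.  The other
  cases follow from \<open>g = r^k g\<^sub>0\<close>.  If \<open>k = - n \<le> 0\<close> and \<open>f\<close> is in the kernel, then
  \<open>f g\<^sub>+ = r^n g\<^sub>-\<^sup>-\<^sup>1 h\<close> with \<open>h\<close> in \<open>H\<^sub>p\<^sup>-\<close>.  All but \<open>n\<close> moments of \<open>f g\<^sub>+ / (x + \<i>)\<close> vanish, so
  \<open>f\<close> is a combination of the functions \<open>r^j / ((x + \<i>) g\<^sub>+)\<close> with \<open>j < n\<close>.  The adjoint is the case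
  of the conjugate factorisation.
\<close>

section \<open>Function-level Lebesgue spaces\<close>

text \<open>A factorisation controls its operator only on rational functions, and its factors lie in
  weighted spaces, so a product such as \<open>gm * (u - Pplus u)\<close> belongs a priori to no
  space at all. It is saved by being equal to \<open>r0 - g0 * wh_op gm gp r0\<close>, which is
  visibly in \<open>Lp p\<close>; vanishing moments then place it in the minus space, with no appeal
  to inner and outer functions. The same moment count with \<open>n\<close> exceptional moments
  serves three times: for injectivity (\<open>n = 0\<close>), for the kernel, and, after
  conjugation, for the kernel of the adjoint. The inequality behind the Riesz bound rests on a
  cosine that is negative at the angle \<open>p * pi / 2\<close> and decreases up to there, which
  confines the direct argument to \<open>p \<le> 2\<close>. The estimates are made for Borel
  functions and for powers of norms. The factor \<open>2 powr p\<close> then replaces the triangle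
  inequality, and a free scaling parameter in Young's inequality replaces Hoelder's inequality;
  classes modulo null sets enter only once the analysis is complete.\<close>

definition Lfun :: "real \<Rightarrow> (real \<Rightarrow> complex) set" where
  "Lfun p = {f. f \<in> borel_measurable borel \<and> integrable lborel (\<lambda>x. norm (f x) powr p)}"

definition pint :: "real \<Rightarrow> (real \<Rightarrow> complex) \<Rightarrow> real" where
  "pint p f = (\<integral>x. norm (f x) powr p \<partial>lborel)"

lemma conj_exp_facts:
  assumes "1 < p"
  shows "1 < conj_exp p" "1 / p + 1 / conj_exp p = 1" "conj_exp (conj_exp p) = p"
    "(conj_exp p - 1) * (p - 1) = 1" "conj_exp p * (p - 1) = p"
  using assms by (auto simp: conj_exp_def field_simps)

lemma norm_add_powr_le:
  fixes a b :: complex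
  assumes "0 < p"
  shows "norm (a + b) powr p \<le> 2 powr p * (norm a powr p + norm b powr p)"
proof -
  have "norm (a + b) powr p \<le> (2 * max (norm a) (norm b)) powr p"
    using assms norm_triangle_ineq[of a b] by (intro powr_mono2) auto
  also have "\<dots> = 2 powr p * max (norm a) (norm b) powr p"
    by (simp add: powr_mult)
  also have "\<dots> \<le> 2 powr p * (norm a powr p + norm b powr p)"
    by (intro mult_left_mono) (auto simp: max_def)
  finally show ?thesis .
qed

lemma Lfun_measurable [measurable_dest]: "f \<in> Lfun p \<Longrightarrow> f \<in> borel_measurable borel"
  by (simp add: Lfun_def)

lemma Lfun_integrable: "f \<in> Lfun p \<Longrightarrow> integrable lborel (\<lambda>x. norm (f x) powr p)"
  by (simp add: Lfun_def)

lemma LfunI: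
  "f \<in> borel_measurable borel \<Longrightarrow> integrable lborel (\<lambda>x. norm (f x) powr p) \<Longrightarrow> f \<in> Lfun p"
  by (simp add: Lfun_def)

lemma pint_nonneg [simp]: "0 \<le> pint p f"
  by (simp add: pint_def)

lemma Lfun_bounded_by:
  assumes g: "g \<in> Lfun p" and [measurable]: "f \<in> borel_measurable borel" and "0 < p" "0 \<le> C"
    and le: "AE x in lborel. norm (f x) \<le> C * norm (g x)"
  shows "f \<in> Lfun p" "pint p f \<le> C powr p * pint p g"
proof -
  note [measurable] = Lfun_measurable[OF g]
  have le': "AE x in lborel. norm (f x) powr p \<le> C powr p * norm (g x) powr p"
    using le
  proof eventually_elim
    case (elim x)
    have "norm (f x) powr p \<le> (C * norm (g x)) powr p"
      using elim assms by (intro powr_mono2) auto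
    then show ?case using assms by (simp add: powr_mult)
  qed
  have int: "integrable lborel (\<lambda>x. C powr p * norm (g x) powr p)"
    using Lfun_integrable[OF g] by simp
  have int': "integrable lborel (\<lambda>x. norm (f x) powr p)"
    by (rule Bochner_Integration.integrable_bound[OF int]) (use le' in auto)
  show "f \<in> Lfun p" by (rule LfunI) (use int' in auto)
  have "pint p f \<le> (\<integral>x. C powr p * norm (g x) powr p \<partial>lborel)"
    unfolding pint_def by (intro integral_mono_AE int int' le')
  then show "pint p f \<le> C powr p * pint p g" by (simp add: pint_def)
qed

lemma Lfun_zero: "(\<lambda>x. 0) \<in> Lfun p"
  by (rule LfunI) auto

lemma Lfun_add:
  assumes f: "f \<in> Lfun p" and g: "g \<in> Lfun p" and "0 < p"
  shows "(\<lambda>x. f x + g x) \<in> Lfun p" "pint p (\<lambda>x. f x + g x) \<le> 2 powr p * (pint p f + pint p g)"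
proof -
  note [measurable] = Lfun_measurable[OF f] Lfun_measurable[OF g]
  have int: "integrable lborel (\<lambda>x. 2 powr p * (norm (f x) powr p + norm (g x) powr p))"
    using Lfun_integrable[OF g] Lfun_integrable[OF f] by simp
  have int': "integrable lborel (\<lambda>x. norm (f x + g x) powr p)"
    by (rule Bochner_Integration.integrable_bound[OF int]) (use norm_add_powr_le assms in auto)
  show "(\<lambda>x. f x + g x) \<in> Lfun p" by (rule LfunI) (use int' in auto)
  have "pint p (\<lambda>x. f x + g x) \<le> (\<integral>x. 2 powr p * (norm (f x) powr p + norm (g x) powr p) \<partial>lborel)"
    unfolding pint_def by (intro integral_mono int int' norm_add_powr_le assms)
  also have "\<dots> = 2 powr p * (pint p f + pint p g)"
    using Lfun_integrable[OF g] Lfun_integrable[OF f] by (simp add: pint_def)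
  finally show "pint p (\<lambda>x. f x + g x) \<le> 2 powr p * (pint p f + pint p g)" .
qed

lemma Lfun_cmult:
  assumes f: "f \<in> Lfun p" and "0 < p"
  shows "(\<lambda>x. c * f x) \<in> Lfun p" "pint p (\<lambda>x. c * f x) = norm c powr p * pint p f"
  using f assms by (auto simp: Lfun_def pint_def norm_mult powr_mult)

lemma Lfun_uminus:
  assumes f: "f \<in> Lfun p"
  shows "(\<lambda>x. - f x) \<in> Lfun p" "pint p (\<lambda>x. - f x) = pint p f"
  using f by (auto simp: Lfun_def pint_def)

lemma Lfun_diff:
  assumes f: "f \<in> Lfun p" and g: "g \<in> Lfun p" and "0 < p"
  shows "(\<lambda>x. f x - g x) \<in> Lfun p" "pint p (\<lambda>x. f x - g x) \<le> 2 powr p * (pint p f + pint p g)"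
  using Lfun_add[OF f Lfun_uminus(1)[OF g] \<open>0 < p\<close>] Lfun_uminus[OF g] by auto

lemma borel_measurable_cnj [measurable]: "cnj \<in> borel_measurable borel"
  by (intro borel_measurable_continuous_onI continuous_intros)

lemma Lfun_cnj:
  assumes f: "f \<in> Lfun p"
  shows "(\<lambda>x. cnj (f x)) \<in> Lfun p" "pint p (\<lambda>x. cnj (f x)) = pint p f"
  using f by (auto simp: Lfun_def pint_def intro: measurable_compose[OF _ borel_measurable_cnj])

lemma pint_cong_AE:
  assumes "AE x in lborel. f x = g x" "f \<in> borel_measurable borel" "g \<in> borel_measurable borel"
  shows "pint p f = pint p g"
  unfolding pint_def using assms by (intro integral_cong_AE) auto

lemma pint_minus_commute: "pint p (\<lambda>x. f x - g x) = pint p (\<lambda>x. g x - f x)"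
  by (simp add: pint_def norm_minus_commute)

lemma pint_triangle:
  assumes "f \<in> Lfun p" "g \<in> Lfun p" "h \<in> Lfun p" "0 < p"
  shows "pint p (\<lambda>x. f x - h x) \<le> 2 powr p * (pint p (\<lambda>x. f x - g x) + pint p (\<lambda>x. g x - h x))"
  using Lfun_add(2)[OF Lfun_diff(1)[OF assms(1,2,4)] Lfun_diff(1)[OF assms(2,3,4)] \<open>0 < p\<close>]
  by simp

lemma pint_eq_0:
  assumes "f \<in> Lfun p" "pint p f = 0" 
  shows "AE x in lborel. f x = 0"
proof -
  have "AE x in lborel. norm (f x) powr p = 0"
    using assms integral_nonneg_eq_0_iff_AE[OF Lfun_integrable[OF assms(1)]]
    by (auto simp: pint_def)
  then show ?thesis by eventually_elim simp
qed

lemma norm_mult_le_Young: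
  fixes a b :: complex
  assumes "1 < p"
  shows "norm (a * b) \<le> norm a powr p + norm b powr conj_exp p"
proof -
  let ?q = "conj_exp p"
  have "norm a * norm b \<le> norm a powr p / p + norm b powr ?q / ?q"
    using assms conj_exp_facts[OF assms] by (intro Youngs_inequality) auto
  also have "\<dots> \<le> norm a powr p / 1 + norm b powr ?q / 1"
    using assms conj_exp_facts[OF assms] by (intro add_mono divide_left_mono) auto
  finally show ?thesis by (simp add: norm_mult)
qed

lemma Lfun_mult_integrable:
  assumes "1 < p" and f: "f \<in> Lfun p" and g: "g \<in> Lfun (conj_exp p)"
  shows "integrable lborel (\<lambda>x. f x * g x)"
    "(\<integral>x. norm (f x * g x) \<partial>lborel) \<le> pint p f + pint (conj_exp p) g"
proof -
  note [measurable] = Lfun_measurable[OF f] Lfun_measurable[OF g]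
  have int: "integrable lborel (\<lambda>x. norm (f x) powr p + norm (g x) powr conj_exp p)"
    using Lfun_integrable[OF g] Lfun_integrable[OF f] by simp
  show int': "integrable lborel (\<lambda>x. f x * g x)"
    by (rule Bochner_Integration.integrable_bound[OF int])
      (use norm_mult_le_Young[OF \<open>1 < p\<close>] in auto)
  have "(\<integral>x. norm (f x * g x) \<partial>lborel) \<le> (\<integral>x. norm (f x) powr p + norm (g x) powr conj_exp p \<partial>lborel)"
    using int' by (intro integral_mono int norm_mult_le_Young assms) auto
  then show "(\<integral>x. norm (f x * g x) \<partial>lborel) \<le> pint p f + pint (conj_exp p) g"
    using Lfun_integrable[OF g] Lfun_integrable[OF f] by (simp add: pint_def)
qed

text \<open>Stands in for Hoelder's inequality. Replacing \<open>f\<close> by \<open>c * f\<close>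
  and \<open>g\<close> by \<open>g / c\<close> leaves the product alone, so \<open>c\<close> is free
  and can later favour whichever factor is under control.\<close>

lemma Young_scaled:
  assumes "1 < p" and f: "f \<in> Lfun p" and g: "g \<in> Lfun (conj_exp p)" and "0 < c"
  shows "norm (\<integral>x. f x * g x \<partial>lborel) \<le> c powr p * pint p f + c powr (- conj_exp p) * pint (conj_exp p) g"
proof -
  let ?q = "conj_exp p"
  have q: "0 < p" "0 < ?q" using assms conj_exp_facts[OF assms(1)] by auto
  have "norm (\<integral>x. f x * g x \<partial>lborel) = norm (\<integral>x. (of_real c * f x) * (of_real (1 / c) * g x) \<partial>lborel)"
    using assms by (simp add: field_simps)
  also have "\<dots> \<le> (\<integral>x. norm ((of_real c * f x) * (of_real (1 / c) * g x)) \<partial>lborel)"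
    by (rule integral_norm_bound)
  also have "\<dots> \<le> pint p (\<lambda>x. of_real c * f x) + pint ?q (\<lambda>x. of_real (1 / c) * g x)"
    by (intro Lfun_mult_integrable assms Lfun_cmult q)
  also have "\<dots> = c powr p * pint p f + c powr (- ?q) * pint ?q g"
    by (subst (1 2) Lfun_cmult(2)) (use assms q in \<open>auto simp: norm_divide powr_divide powr_minus_divide\<close>)
  finally show ?thesis .
qed

section \<open>Strong and weak convergence in the Lebesgue spaces\<close>

definition Lconv :: "real \<Rightarrow> (nat \<Rightarrow> real \<Rightarrow> complex) \<Rightarrow> (real \<Rightarrow> complex) \<Rightarrow> bool" where
  "Lconv p fs f \<longleftrightarrow> (\<forall>n. fs n \<in> Lfun p) \<and> f \<in> Lfun p \<and>
     (\<lambda>n. pint p (\<lambda>x. fs n x - f x)) \<longlonglongrightarrow> 0"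

text \<open>This is how \<open>Young_scaled\<close> is used: \<open>c\<close> is fixed first, so
  large that the term with \<open>B\<close> is at most half of the tolerance, and only then is
  \<open>n\<close> taken large.\<close>

lemma tendsto_0_from_scaled_bound:
  assumes a: "a \<longlonglongrightarrow> (0 :: real)" and "1 < p" "0 \<le> B"
    and le: "\<And>n c. 0 < c \<Longrightarrow> \<bar>b n\<bar> \<le> c powr p * a n + c powr (- conj_exp p) * B"
  shows "b \<longlonglongrightarrow> 0"
proof (rule LIMSEQ_I)
  fix e :: real assume e: "0 < e"
  let ?q = "conj_exp p"
  have q: "1 < ?q" using conj_exp_facts assms by auto
  \<comment> \<open>Solves \<open>c powr (- ?q) * (B + 1) = e / 2\<close>; the summand 1 covers
    \<open>B = 0\<close>.\<close>
  define c where "c = ((2 * (B + 1)) / e) powr (1 / ?q)"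
  have c: "0 < c" using e assms by (simp add: c_def)
  have "c powr (- ?q) = e / (2 * (B + 1))"
    using q e assms by (simp add: c_def powr_powr powr_minus)
  then have "c powr (- ?q) * B = e / 2 * (B / (B + 1))" by simp
  also have "\<dots> \<le> e / 2 * 1" using e assms by (intro mult_left_mono) auto
  finally have 1: "c powr (- ?q) * B \<le> e / 2" by simp
  have "(\<lambda>n. c powr p * a n) \<longlonglongrightarrow> c powr p * 0" by (intro tendsto_intros a)
  then have "\<forall>\<^sub>F n in sequentially. c powr p * a n < e / 2"
    using e by (intro order_tendstoD) auto
  then have "\<forall>\<^sub>F n in sequentially. norm (b n - 0) < e"
  proof eventually_elim
    case (elim n)
    show ?case using le[OF c, of n] 1 elim by simp
  qed
  then show "\<exists>no. \<forall>n\<ge>no. norm (b n - 0) < e" by (simp add: eventually_sequentially)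
qed

lemma Lconv_integral_mult:
  assumes "1 < p" and L: "Lconv p fs f" and k: "k \<in> Lfun (conj_exp p)"
  shows "(\<lambda>n. \<integral>x. fs n x * k x \<partial>lborel) \<longlonglongrightarrow> (\<integral>x. f x * k x \<partial>lborel)"
proof -
  have fs: "\<And>n. fs n \<in> Lfun p" and f: "f \<in> Lfun p" using L by (auto simp: Lconv_def)
  have "(\<lambda>n. norm ((\<integral>x. fs n x * k x \<partial>lborel) - (\<integral>x. f x * k x \<partial>lborel))) \<longlonglongrightarrow> 0"
  proof (rule tendsto_0_from_scaled_bound[where a = "\<lambda>n. pint p (\<lambda>x. fs n x - f x)"])
    fix n and c :: real assume c: "0 < c"
    have "(\<integral>x. fs n x * k x \<partial>lborel) - (\<integral>x. f x * k x \<partial>lborel) = (\<integral>x. (fs n x - f x) * k x \<partial>lborel)"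
      using Lfun_mult_integrable(1)[OF \<open>1 < p\<close> fs k] Lfun_mult_integrable(1)[OF \<open>1 < p\<close> f k]
      by (simp add: left_diff_distrib)
    then show "\<bar>norm ((\<integral>x. fs n x * k x \<partial>lborel) - (\<integral>x. f x * k x \<partial>lborel))\<bar>
        \<le> c powr p * pint p (\<lambda>x. fs n x - f x) + c powr (- conj_exp p) * pint (conj_exp p) k"
      using Young_scaled[OF \<open>1 < p\<close> Lfun_diff(1)[OF fs f] k c] assms by simp
  qed (use L assms in \<open>auto simp: Lconv_def\<close>)
  then show ?thesis by (metis LIM_zero_cancel tendsto_norm_zero_iff)
qed

text \<open>Transfers bounds to pointwise limits where no convergence in mean is known. The
  estimates for Cauchy integrals use it to remove truncations and to reach the real line.\<close>

lemma Lfun_Fatou: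
  assumes "0 < p" and fs: "\<And>n. fs n \<in> Lfun p" and C: "\<And>n. pint p (fs n) \<le> C"
    and [measurable]: "f \<in> borel_measurable borel"
    and lim: "AE x in lborel. (\<lambda>n. fs n x) \<longlonglongrightarrow> f x"
  shows "f \<in> Lfun p" "pint p f \<le> C"
proof -
  note [measurable] = Lfun_measurable[OF fs]
  have C0: "0 \<le> C" using C[of 0] pint_nonneg order_trans by blast
  have eq: "(\<integral>\<^sup>+x. norm (fs n x) powr p \<partial>lborel) = ennreal (pint p (fs n))" for n
    unfolding pint_def by (intro nn_integral_eq_integral Lfun_integrable fs) auto
  have "(\<integral>\<^sup>+x. norm (f x) powr p \<partial>lborel) = (\<integral>\<^sup>+x. liminf (\<lambda>n. ennreal (norm (fs n x) powr p)) \<partial>lborel)"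
  proof (rule nn_integral_cong_AE)
    show "AE x in lborel. ennreal (norm (f x) powr p) = liminf (\<lambda>n. ennreal (norm (fs n x) powr p))"
      using lim
    proof eventually_elim
      case (elim x)
      have "(\<lambda>n. ennreal (norm (fs n x) powr p)) \<longlonglongrightarrow> ennreal (norm (f x) powr p)"
        using elim \<open>0 < p\<close> by (intro tendsto_ennrealI tendsto_powr' tendsto_norm tendsto_const) auto
      then show ?case by (metis lim_imp_Liminf sequentially_bot)
    qed
  qed
  also have "\<dots> \<le> liminf (\<lambda>n. \<integral>\<^sup>+x. norm (fs n x) powr p \<partial>lborel)"
    by (rule nn_integral_liminf) measurable
  also have "\<dots> \<le> ennreal C"
    unfolding eq by (intro Liminf_le always_eventually) (use C in \<open>auto intro: ennreal_leI\<close>)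
  finally have le: "(\<integral>\<^sup>+x. norm (f x) powr p \<partial>lborel) \<le> ennreal C" .
  have int: "integrable lborel (\<lambda>x. norm (f x) powr p)"
    by (rule integrableI_bounded) (use le_less_trans[OF le ennreal_less_top] in auto)
  then show "f \<in> Lfun p" by (intro LfunI) auto
  have "ennreal (pint p f) \<le> ennreal C"
    using le unfolding pint_def by (subst (asm) nn_integral_eq_integral[OF int]) auto
  then show "pint p f \<le> C" using C0 by simp
qed

lemma Lconv_dominated:
  assumes "0 < p" and g: "g \<in> Lfun p" and [measurable]: "\<And>n. fs n \<in> borel_measurable borel"
    and fm [measurable]: "f \<in> borel_measurable borel"
    and lim: "AE x in lborel. (\<lambda>n. fs n x) \<longlonglongrightarrow> f x"
    and le: "\<And>n. AE x in lborel. norm (fs n x) \<le> norm (g x)"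
  shows "Lconv p fs f"
proof -
  note [measurable] = Lfun_measurable[OF g]
  have fs: "fs n \<in> Lfun p" "pint p (fs n) \<le> pint p g" for n
    using Lfun_bounded_by[OF g, of "fs n" 1] le assms by auto
  have f: "f \<in> Lfun p" by (rule Lfun_Fatou[OF \<open>0 < p\<close> fs fm lim])
  have lef: "AE x in lborel. norm (f x) \<le> norm (g x)"
  proof -
    have "AE x in lborel. \<forall>n. norm (fs n x) \<le> norm (g x)" using le by (simp add: AE_all_countable)
    with lim show ?thesis
    proof eventually_elim
      case (elim x)
      then show ?case by (intro LIMSEQ_le_const2[OF tendsto_norm]) auto
    qed
  qed
  have "(\<lambda>n. \<integral>x. norm (fs n x - f x) powr p \<partial>lborel) \<longlonglongrightarrow> (\<integral>x. 0 \<partial>(lborel :: real measure))"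
  proof (rule integral_dominated_convergence)
    show "integrable lborel (\<lambda>x. 2 powr p * norm (g x) powr p)"
      using Lfun_integrable[OF g] by simp
    show "AE x in lborel. (\<lambda>n. norm (fs n x - f x) powr p) \<longlonglongrightarrow> 0"
      using lim
    proof eventually_elim
      case (elim x)
      have "(\<lambda>n. norm (fs n x - f x) powr p) \<longlonglongrightarrow> norm (f x - f x) powr p"
        using elim \<open>0 < p\<close> by (intro tendsto_powr' tendsto_norm tendsto_intros) auto
      then show ?case by simp
    qed
    show "AE x in lborel. norm (norm (fs n x - f x) powr p) \<le> 2 powr p * norm (g x) powr p" for n
      using le[of n] lef
    proof eventually_elim
      case (elim x)
      have "norm (fs n x - f x) powr p \<le> (2 * norm (g x)) powr p"
        using elim \<open>0 < p\<close> norm_triangle_ineq4[of "fs n x" "f x"] by (intro powr_mono2) auto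
      then show ?case by (simp add: powr_mult)
    qed
  qed measurable
  then show ?thesis using fs f by (simp add: Lconv_def pint_def)
qed

text \<open>The product with \<open>k\<close> is capped at \<open>A * norm (k x) powr ?q\<close>.
  The capped part converges by domination, and the excess is at most \<open>A powr (1 - p)\<close>
  times a bounded quantity, hence small uniformly in \<open>n\<close> once \<open>A\<close> is
  large.\<close>

lemma weak_conv_bounded_AE:
  assumes "1 < p" and fs: "\<And>n. fs n \<in> Lfun p" and C: "\<And>n. pint p (fs n) \<le> C"
    and f: "f \<in> Lfun p" and lim: "AE x in lborel. (\<lambda>n. fs n x) \<longlonglongrightarrow> f x"
    and k: "k \<in> Lfun (conj_exp p)"
  shows "(\<lambda>n. \<integral>x. fs n x * k x \<partial>lborel) \<longlonglongrightarrow> (\<integral>x. f x * k x \<partial>lborel)"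
proof -
  let ?q = "conj_exp p"
  have q: "1 < ?q" "(?q - 1) * (p - 1) = 1" "0 < p" using conj_exp_facts assms by auto
  note [measurable] = Lfun_measurable[OF fs] Lfun_measurable[OF f] Lfun_measurable[OF k]
  define D where "D = 2 powr p * (C + pint p f)"
  have C0: "0 \<le> C" using C[of 0] pint_nonneg order_trans by blast
  have d: "(\<lambda>x. fs n x - f x) \<in> Lfun p" "pint p (\<lambda>x. fs n x - f x) \<le> D" for n
    using Lfun_diff[OF fs f, of n] C[of n] q unfolding D_def
    by (auto intro: order_trans mult_left_mono)
  \<comment> \<open>If \<open>norm u\<close> is below the threshold, the cap is inactive. Above it,
    \<open>(?q - 1) * (p - 1) = 1\<close> turns the failed inequality into
    \<open>norm v \<le> (norm u / A) powr (p - 1)\<close>.\<close>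
  have split: "norm (u * v) \<le> min (norm (u * v)) (A * norm v powr ?q) + A powr (1 - p) * norm u powr p"
    if A: "0 < A" for A and u v :: complex
  proof (cases "norm u \<le> A * norm v powr (?q - 1)")
    case True
    have "norm (u * v) \<le> A * norm v powr (?q - 1) * norm v"
      using True by (auto simp: norm_mult intro: mult_right_mono)
    also have "\<dots> = A * norm v powr ?q"
      by (cases "v = 0") (auto simp: powr_mult_base mult.commute mult.assoc powr_diff field_simps)
    finally show ?thesis using A by (auto simp: min_def)
  next
    case False
    then have "norm v powr (?q - 1) \<le> norm u / A" using A by (simp add: field_simps)
    then have "(norm v powr (?q - 1)) powr (p - 1) \<le> (norm u / A) powr (p - 1)"
      using assms by (intro powr_mono2) auto
    then have "norm v \<le> (norm u / A) powr (p - 1)"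
      using q by (simp add: powr_powr)
    then have "norm u * norm v \<le> norm u * (norm u / A) powr (p - 1)"
      by (rule mult_left_mono) simp
    also have "\<dots> = A powr (1 - p) * norm u powr p"
      using A by (cases "u = 0") (auto simp: powr_divide powr_diff field_simps)
    finally have "norm (u * v) \<le> A powr (1 - p) * norm u powr p" by (simp add: norm_mult)
    moreover have "0 \<le> min (norm (u * v)) (A * norm v powr ?q)" using A by simp
    ultimately show ?thesis by linarith
  qed
  have main: "(\<lambda>n. \<integral>x. norm ((fs n x - f x) * k x) \<partial>lborel) \<longlonglongrightarrow> 0"
  proof (rule LIMSEQ_I)
    fix e :: real assume e: "0 < e"
    \<comment> \<open>Makes \<open>A powr (1 - p) * (D + 1)\<close> equal to \<open>e / 2\<close>,
      where \<open>D\<close> bounds \<open>pint p\<close> of every difference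
      \<open>fs n - f\<close>.\<close>
    define A where "A = (2 * (D + 1) / e) powr (1 / (p - 1))"
    have D0: "0 \<le> D" using C0 by (simp add: D_def)
    have A: "0 < A" using e D0 by (simp add: A_def)
    have "A powr (1 - p) = (A powr (p - 1)) powr (-1)"
      using powr_minus_divide[of A "p - 1"] by (simp add: powr_powr)
    also have "A powr (p - 1) = 2 * (D + 1) / e"
      using e D0 assms by (simp add: A_def powr_powr)
    finally have "A powr (1 - p) * D = e / 2 * (D / (D + 1))"
      using e D0 by (simp add: powr_minus field_simps)
    also have "\<dots> \<le> e / 2 * 1" using e D0 by (intro mult_left_mono) auto
    finally have 1: "A powr (1 - p) * D \<le> e / 2" by simp
    let ?m = "\<lambda>n x. min (norm ((fs n x - f x) * k x)) (A * norm (k x) powr ?q)"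
    have intk: "integrable lborel (\<lambda>x. A * norm (k x) powr ?q)" using Lfun_integrable[OF k] by simp
    have intm: "integrable lborel (?m n)" for n
      by (rule Bochner_Integration.integrable_bound[OF intk]) (use A in auto)
    have "(\<lambda>n. \<integral>x. ?m n x \<partial>lborel) \<longlonglongrightarrow> (\<integral>x. 0 \<partial>(lborel :: real measure))"
    proof (rule integral_dominated_convergence[where w = "\<lambda>x. A * norm (k x) powr ?q"])
      show "AE x in lborel. (\<lambda>n. ?m n x) \<longlonglongrightarrow> 0"
        using lim
      proof eventually_elim
        case (elim x)
        have "(\<lambda>n. ?m n x) \<longlonglongrightarrow> min (norm ((f x - f x) * k x)) (A * norm (k x) powr ?q)"
          using elim by (intro tendsto_intros)
        then show ?case using A by (simp add: min_def)
      qed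
    qed (use intk A in auto)
    then have "\<forall>\<^sub>F n in sequentially. (\<integral>x. ?m n x \<partial>lborel) < e / 2"
      using e by (intro order_tendstoD) auto
    then have "\<forall>\<^sub>F n in sequentially. norm ((\<integral>x. norm ((fs n x - f x) * k x) \<partial>lborel) - 0) < e"
    proof eventually_elim
      case (elim n)
      have "(\<integral>x. norm ((fs n x - f x) * k x) \<partial>lborel) \<le>
          (\<integral>x. ?m n x + A powr (1 - p) * norm (fs n x - f x) powr p \<partial>lborel)"
        using Lfun_integrable[OF d(1)[of n]] intm[of n]
        by (intro integral_mono split A integrable_norm Lfun_mult_integrable(1)[OF \<open>1 < p\<close> d(1) k]) auto
      also have "\<dots> = (\<integral>x. ?m n x \<partial>lborel) + A powr (1 - p) * pint p (\<lambda>x. fs n x - f x)"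
        using Lfun_integrable[OF d(1)[of n]] intm[of n] by (simp add: pint_def)
      also have "\<dots> < e / 2 + A powr (1 - p) * D"
        by (intro add_less_le_mono elim mult_left_mono d) auto
      finally show ?case using 1 by (simp add: integral_nonneg)
    qed
    then show "\<exists>no. \<forall>n\<ge>no. norm ((\<integral>x. norm ((fs n x - f x) * k x) \<partial>lborel) - 0) < e"
      by (simp add: eventually_sequentially)
  qed
  have "(\<lambda>n. (\<integral>x. fs n x * k x \<partial>lborel) - (\<integral>x. f x * k x \<partial>lborel)) \<longlonglongrightarrow> 0"
  proof (rule Lim_null_comparison[OF _ main], rule always_eventually, rule allI)
    fix n
    have "(\<integral>x. fs n x * k x \<partial>lborel) - (\<integral>x. f x * k x \<partial>lborel) = (\<integral>x. (fs n x - f x) * k x \<partial>lborel)"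
      using Lfun_mult_integrable(1)[OF \<open>1 < p\<close> fs k] Lfun_mult_integrable(1)[OF \<open>1 < p\<close> f k]
      by (simp add: left_diff_distrib)
    then show "norm ((\<integral>x. fs n x * k x \<partial>lborel) - (\<integral>x. f x * k x \<partial>lborel))
        \<le> (\<integral>x. norm ((fs n x - f x) * k x) \<partial>lborel)"
      using integral_norm_bound[of lborel "\<lambda>x. (fs n x - f x) * k x"] by simp
  qed
  then show ?thesis by (rule LIM_zero_cancel)
qed

lemma norm_integral_le:
  fixes f :: "'a \<Rightarrow> 'b::{banach, second_countable_topology}"
  assumes "integrable M g" "\<And>x. norm (f x) \<le> g x"
  shows "norm (\<integral>x. f x \<partial>M) \<le> (\<integral>x. g x \<partial>M)"
proof -
  have "(\<integral>x. norm (f x) \<partial>M) \<le> (\<integral>x. g x \<partial>M)"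
    by (rule integral_mono') (use assms order_trans[OF norm_ge_zero] in auto)
  with integral_norm_bound[of M f] show ?thesis by linarith
qed

section \<open>Integrability of Cauchy kernels\<close>

lemma integrable_weight_powr:
  assumes "1 < q"
  shows "integrable lborel (\<lambda>t::real. norm (1 / (complex_of_real t + \<i>)) powr q)"
proof -
  have I: "(\<lambda>x. x powr (-q)) integrable_on {1::real..}"
    using has_integral_powr_to_inf[of "-q" 1] assms by (auto simp: has_integral_iff)
  have "set_integrable lebesgue {1..} (\<lambda>x::real. x powr (-q))"
    by (rule nonnegative_absolutely_integrable_1[OF I]) auto
  then have 1: "integrable lborel (\<lambda>x::real. indicator {1..} x *\<^sub>R (x powr (-q)))"
    unfolding set_integrable_def by (subst (asm) integrable_completion) auto
  have 2: "integrable lborel (\<lambda>x::real. indicator {1..} (-x) *\<^sub>R ((-x) powr (-q)))"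
    using lborel_integrable_real_affine[OF 1, of "-1" 0] by simp
  have 3: "integrable lborel (\<lambda>x::real. indicator {-1..1} x :: real)"
    by (rule integrable_real_indicator) auto
  have int: "integrable lborel (\<lambda>x::real. indicator {1..} x *\<^sub>R (x powr (-q)) +
      indicator {1..} (-x) *\<^sub>R ((-x) powr (-q)) + indicator {-1..1} x)"
    by (intro Bochner_Integration.integrable_add 1 2 3)
  show ?thesis
  proof (rule Bochner_Integration.integrable_bound[OF int])
    show "AE t in lborel. norm (norm (1 / (complex_of_real t + \<i>)) powr q) \<le>
       norm (indicator {1..} t *\<^sub>R (t powr (-q)) +
      indicator {1..} (-t) *\<^sub>R ((-t) powr (-q)) + indicator {-1..1} t)"
    proof (rule AE_I2)
      fix t :: real
      have le1: "norm (1 / (complex_of_real t + \<i>)) \<le> 1"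
        using abs_Im_le_cmod[of "complex_of_real t + \<i>"] by (simp add: norm_divide divide_le_eq)
      have *: "norm (1 / (complex_of_real t + \<i>)) powr q \<le> 1"
        using powr_mono2[of q, OF _ _ le1] assms by simp
      have **: "norm (1 / (complex_of_real t + \<i>)) powr q \<le> \<bar>t\<bar> powr (-q)" if "\<bar>t\<bar> \<ge> 1"
      proof -
        have "norm (1 / (complex_of_real t + \<i>)) \<le> 1 / \<bar>t\<bar>"
          using abs_Re_le_cmod[of "complex_of_real t + \<i>"] that
          by (auto simp: norm_divide intro!: divide_left_mono mult_pos_pos)
        then have "norm (1 / (complex_of_real t + \<i>)) powr q \<le> (1 / \<bar>t\<bar>) powr q"
          using assms by (intro powr_mono2) auto
        then show ?thesis using that by (simp add: powr_divide powr_minus_divide)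
      qed
      consider "t \<ge> 1" | "t \<le> -1" | "-1 < t" "t < 1" by linarith
      then show "norm (norm (1 / (complex_of_real t + \<i>)) powr q) \<le>
       norm (indicator {1..} t *\<^sub>R (t powr (-q)) +
      indicator {1..} (-t) *\<^sub>R ((-t) powr (-q)) + indicator {-1..1} t)"
        using * ** by cases (auto simp: indicator_def)
    qed
  qed measurable
qed

lemma Lfun_weight: "1 < q \<Longrightarrow> (\<lambda>t. 1 / (complex_of_real t + \<i>)) \<in> Lfun q"
  by (intro LfunI integrable_weight_powr) measurable

lemma of_real_minus_neq: "Im z \<noteq> 0 \<Longrightarrow> complex_of_real t - z \<noteq> 0"
  by (auto simp: complex_eq_iff)

text \<open>The kernel with pole at \<open>- \<i>\<close> dominates every other one, because
  \<open>norm (t - z)\<close> is at least \<open>\<bar>Im z\<bar>\<close>. One integrability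
  computation thus serves all Cauchy integrals.\<close>

lemma norm_cauchy_kernel_le:
  assumes "Im z \<noteq> 0"
  shows "norm (1 / (complex_of_real t - z)) \<le>
    (1 + norm (z + \<i>) / \<bar>Im z\<bar>) * norm (1 / (complex_of_real t + \<i>))"
proof -
  have 1: "\<bar>Im z\<bar> \<le> norm (complex_of_real t - z)" using abs_Im_le_cmod[of "complex_of_real t - z"] by simp
  have "norm (complex_of_real t + \<i>) \<le> norm (complex_of_real t - z) + norm (z + \<i>)"
    using norm_triangle_ineq[of "complex_of_real t - z" "z + \<i>"] by simp
  also have "\<dots> \<le> norm (complex_of_real t - z) + norm (complex_of_real t - z) * (norm (z + \<i>) / \<bar>Im z\<bar>)"
    using mult_right_mono[OF 1, of "norm (z + \<i>) / \<bar>Im z\<bar>"] assms by (simp add: field_simps)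
  finally have "norm (complex_of_real t + \<i>) \<le> norm (complex_of_real t - z) * (1 + norm (z + \<i>) / \<bar>Im z\<bar>)"
    by (simp add: algebra_simps)
  moreover have "complex_of_real t + \<i> \<noteq> 0" "complex_of_real t - z \<noteq> 0"
    using assms by (auto simp: complex_eq_iff)
  ultimately show ?thesis by (simp add: norm_divide field_simps)
qed

lemma Lfun_cauchy_kernel:
  assumes "1 < q" "Im z \<noteq> 0"
  shows "(\<lambda>t. 1 / (complex_of_real t - z)) \<in> Lfun q"
  by (rule Lfun_bounded_by(1)[OF Lfun_weight[OF \<open>1 < q\<close>],
        where C = "1 + norm (z + \<i>) / \<bar>Im z\<bar>"])
    (use assms norm_cauchy_kernel_le in auto)

section \<open>Cauchy integrals\<close>

text \<open>The Cauchy integral without the factor \<open>1 / (2 \<pi> \<i>)\<close>.\<close>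

definition KI :: "(real \<Rightarrow> complex) \<Rightarrow> complex \<Rightarrow> complex" where
  "KI f z = (\<integral>t. f t / (complex_of_real t - z) \<partial>lborel)"

lemma KI_integrable:
  assumes "1 < p" "f \<in> Lfun p" "Im z \<noteq> 0"
  shows "integrable lborel (\<lambda>t. f t / (complex_of_real t - z))"
  using Lfun_mult_integrable(1)[OF assms(1,2) Lfun_cauchy_kernel[OF _ assms(3)]]
    conj_exp_facts[OF assms(1)] by simp

lemma KI_add:
  assumes "1 < p" "f \<in> Lfun p" "g \<in> Lfun p" "Im z \<noteq> 0"
  shows "KI (\<lambda>x. f x + g x) z = KI f z + KI g z"
  unfolding KI_def using KI_integrable[OF assms(1,2,4)] KI_integrable[OF assms(1,3,4)]
  by (simp add: add_divide_distrib)

lemma KI_diff: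
  assumes "1 < p" "f \<in> Lfun p" "g \<in> Lfun p" "Im z \<noteq> 0"
  shows "KI (\<lambda>x. f x - g x) z = KI f z - KI g z"
  unfolding KI_def using KI_integrable[OF assms(1,2,4)] KI_integrable[OF assms(1,3,4)]
  by (simp add: diff_divide_distrib)

lemma KI_cmult: "KI (\<lambda>x. c * f x) z = c * KI f z"
  unfolding KI_def by (simp flip: times_divide_eq_right)

lemma KI_zero: "KI (\<lambda>x. 0) z = 0"
  by (simp add: KI_def)

text \<open>Conjugation exchanges the half-planes; facts about the lower one are obtained from the
  upper one through this identity.\<close>

lemma KI_cnj: "KI (\<lambda>x. cnj (f x)) z = cnj (KI f (cnj z))"
proof -
  have "KI (\<lambda>x. cnj (f x)) z = (\<integral>t. cnj (f t / (complex_of_real t - cnj z)) \<partial>lborel)"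
    by (simp add: KI_def)
  then show ?thesis unfolding KI_def
    using integral_bounded_linear'[OF bounded_linear_cnj bounded_linear_cnj,
        of lborel "\<lambda>t. f t / (complex_of_real t - cnj z)"] by simp
qed

lemma KI_Lconv:
  assumes "1 < p" "Lconv p fs f" "Im z \<noteq> 0"
  shows "(\<lambda>n. KI (fs n) z) \<longlonglongrightarrow> KI f z"
  using Lconv_integral_mult[OF assms(1,2) Lfun_cauchy_kernel[OF _ assms(3)]]
    conj_exp_facts[OF assms(1)] by (simp add: KI_def)

text \<open>After subtraction of the candidate derivative the difference quotient has integrand
  \<open>(z - z0) * (f t / ((t - z) * (t - z0)^2))\<close>. In the disc about \<open>z0\<close> of
  half its distance to the real line the denominators stay away from zero, so the error is of order
  \<open>norm (z - z0)\<close>.\<close>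

lemma KI_holomorphic:
  assumes "1 < p" and f: "f \<in> Lfun p" and S: "\<And>z. z \<in> S \<Longrightarrow> Im z \<noteq> 0"
  shows "KI f holomorphic_on S"
  unfolding holomorphic_on_def
proof
  fix z0 assume "z0 \<in> S"
  then have y0: "Im z0 \<noteq> 0" using S by auto
  let ?y = "\<bar>Im z0\<bar>"
  note [measurable] = Lfun_measurable[OF f]
  let ?w = "\<lambda>t. norm (f t / (complex_of_real t - z0))"
  have intw: "integrable lborel ?w" by (intro integrable_norm KI_integrable[OF \<open>1 < p\<close> f y0])
  have b: "?y \<le> norm (complex_of_real t - z0)" for t
    using abs_Im_le_cmod[of "complex_of_real t - z0"] by simp
  have int2: "integrable lborel (\<lambda>t. f t / (complex_of_real t - z0)\<^sup>2)"
  proof (rule Bochner_Integration.integrable_bound[of _ "\<lambda>t. (1 / ?y) * ?w t"])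
    show "AE t in lborel. norm (f t / (complex_of_real t - z0)\<^sup>2) \<le> norm ((1 / ?y) * ?w t)"
    proof (rule AE_I2)
      fix t
      have "norm (f t / (complex_of_real t - z0)\<^sup>2) = ?w t * (1 / norm (complex_of_real t - z0))"
        by (simp add: norm_divide norm_mult power2_eq_square)
      also have "\<dots> \<le> ?w t * (1 / ?y)"
        using b[of t] y0 by (intro mult_left_mono divide_left_mono mult_pos_pos) auto
      finally show "norm (f t / (complex_of_real t - z0)\<^sup>2) \<le> norm ((1 / ?y) * ?w t)"
        by (simp add: norm_mult norm_divide mult.commute)
    qed
  qed (use intw in auto)
  define D where "D = (\<integral>t. f t / (complex_of_real t - z0)\<^sup>2 \<partial>lborel)"
  have "(KI f has_field_derivative D) (at z0)"
    unfolding has_field_derivative_iff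
  proof (rule LIM_zero_cancel, rule Lim_null_comparison)
    show "((\<lambda>z. norm (z - z0) * (2 / ?y\<^sup>2 * (\<integral>t. ?w t \<partial>lborel))) \<longlongrightarrow> 0) (at z0)"
    proof -
      have "((\<lambda>z. norm (z - z0) * (2 / ?y\<^sup>2 * (\<integral>t. ?w t \<partial>lborel))) \<longlongrightarrow>
          norm (z0 - z0) * (2 / ?y\<^sup>2 * (\<integral>t. ?w t \<partial>lborel))) (at z0)"
        by (rule tendsto_mult_right) (intro tendsto_intros)
      then show ?thesis by simp
    qed
    have "\<forall>\<^sub>F z in at z0. z \<in> ball z0 (?y / 2)"
      using y0 by (intro eventually_at_in_open') auto
    moreover have "\<forall>\<^sub>F z in at z0. z \<noteq> z0" by (rule eventually_neq_at_within)
    ultimately show "\<forall>\<^sub>F z in at z0. norm ((KI f z - KI f z0) / (z - z0) - D) \<le>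
        norm (z - z0) * (2 / ?y\<^sup>2 * (\<integral>t. ?w t \<partial>lborel))"
    proof (eventually_elim, goal_cases)
      case (1 z)
      have zz: "norm (z - z0) < ?y / 2" using 1 by (simp add: dist_norm norm_minus_commute)
      have imz: "Im z \<noteq> 0"
        using zz abs_Im_le_cmod[of "z - z0"] y0 by auto
      have bz: "?y / 2 \<le> norm (complex_of_real t - z)" for t
        using b[of t] zz norm_triangle_ineq[of "complex_of_real t - z" "z - z0"] by simp
      have id: "f t / (complex_of_real t - z) / (z - z0) - f t / (complex_of_real t - z0) / (z - z0)
          - f t / (complex_of_real t - z0)\<^sup>2
          = (z - z0) * (f t / ((complex_of_real t - z) * (complex_of_real t - z0)\<^sup>2))" for t
      proof -
        have "a / u / d - a / v / d - a / v\<^sup>2 = d * (a / (u * v\<^sup>2))"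
          if "u \<noteq> 0" "v \<noteq> 0" "d \<noteq> 0" "v - u = d" for a u v d :: complex
        proof -
          have "a / u / d - a / v / d = a * (v - u) / (u * v * d)"
            using that(1-3) by (simp add: field_simps)
          also have "\<dots> = a / (u * v)" using that by simp
          finally have "a / u / d - a / v / d - a / v\<^sup>2 = a / (u * v) - a / v\<^sup>2" by simp
          also have "\<dots> = a * (v - u) / (u * v\<^sup>2)"
          proof -
            have "a / (u * v) = a * v / (u * v\<^sup>2)" "a / v\<^sup>2 = a * u / (u * v\<^sup>2)"
              using that(1,2) by (simp_all add: power2_eq_square)
            then show ?thesis by (simp add: diff_divide_distrib right_diff_distrib)
          qed
          finally show ?thesis using that by simp
        qed
        then show ?thesis
          using of_real_minus_neq[OF imz, of t] of_real_minus_neq[OF y0, of t] 1 by simp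
      qed
      have "(KI f z - KI f z0) / (z - z0) - D =
        (\<integral>t. f t / (complex_of_real t - z) / (z - z0) - f t / (complex_of_real t - z0) / (z - z0)
          - f t / (complex_of_real t - z0)\<^sup>2 \<partial>lborel)"
        using KI_integrable[OF \<open>1 < p\<close> f y0] KI_integrable[OF \<open>1 < p\<close> f imz] int2
        unfolding KI_def D_def by (simp add: diff_divide_distrib del: divide_divide_eq_left)
      also have "\<dots> = (\<integral>t. (z - z0) * (f t / ((complex_of_real t - z) * (complex_of_real t - z0)\<^sup>2)) \<partial>lborel)"
        unfolding id ..
      also have "norm \<dots> \<le> (\<integral>t. norm (z - z0) * (2 / ?y\<^sup>2) * ?w t \<partial>lborel)"
      proof (rule norm_integral_le)
        show "integrable lborel (\<lambda>t. norm (z - z0) * (2 / ?y\<^sup>2) * ?w t)" using intw by simp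
        fix t
        have "norm (f t / ((complex_of_real t - z) * (complex_of_real t - z0)\<^sup>2))
          = ?w t * (1 / (norm (complex_of_real t - z) * norm (complex_of_real t - z0)))"
          by (simp add: norm_divide norm_mult norm_power norm_mult power2_eq_square)
        also have "\<dots> \<le> ?w t * (1 / ((?y / 2) * ?y))"
          using y0 bz[of t] b[of t] by (intro mult_left_mono divide_left_mono mult_mono mult_pos_pos) auto
        finally have X: "norm (f t / ((complex_of_real t - z) * (complex_of_real t - z0)\<^sup>2))
            \<le> ?w t * (1 / ((?y / 2) * ?y))" .
        have "norm ((z - z0) * (f t / ((complex_of_real t - z) * (complex_of_real t - z0)\<^sup>2)))
            \<le> norm (z - z0) * (?w t * (1 / ((?y / 2) * ?y)))"
          by (subst norm_mult, rule mult_left_mono[OF X]) simp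
        also have "\<dots> = norm (z - z0) * (2 / ?y\<^sup>2) * ?w t" by (simp add: power2_eq_square)
        finally show "norm ((z - z0) * (f t / ((complex_of_real t - z) * (complex_of_real t - z0)\<^sup>2)))
            \<le> norm (z - z0) * (2 / ?y\<^sup>2) * ?w t" .
      qed
      finally show ?case by (simp add: mult_ac)
    qed
  qed
  then show "KI f field_differentiable at z0 within S"
    by (meson field_differentiable_at_within field_differentiable_def)
qed

section \<open>Lebesgue points\<close>

lemma Lfun_locally_integrable:
  assumes "1 < p" and f: "f \<in> Lfun p"
  shows "set_integrable lborel {a..b} (\<lambda>t. norm (f t - c))"
proof -
  note [measurable] = Lfun_measurable[OF f]
  have int: "integrable lborel (\<lambda>t. norm (f t) powr p + indicator {a..b} t * (1 + norm c))"
    using Lfun_integrable[OF f] by (intro Bochner_Integration.integrable_add integrable_mult_left integrable_real_indicator)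
      (auto simp: emeasure_lborel_Icc_eq)
  show ?thesis
    unfolding set_integrable_def
  proof (rule Bochner_Integration.integrable_bound[OF int])
    show "AE t in lborel. norm (indicator {a..b} t *\<^sub>R norm (f t - c)) \<le>
        norm (norm (f t) powr p + indicator {a..b} t * (1 + norm c))"
    proof (rule AE_I2)
      fix t
      have "norm (f t) \<le> 1 + norm (f t) powr p"
      proof (cases "norm (f t) \<le> 1")
        case False
        then have "norm (f t) powr 1 \<le> norm (f t) powr p" using \<open>1 < p\<close> by (intro powr_mono) auto
        then show ?thesis using False by simp
      qed (simp add: add_increasing2)
      then show "norm (indicator {a..b} t *\<^sub>R norm (f t - c)) \<le>
        norm (norm (f t) powr p + indicator {a..b} t * (1 + norm c))"
        using norm_triangle_ineq4[of "f t" c] by (auto simp: indicator_def)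
    qed
  qed measurable
qed

lemma AE_lborel_if_negligible:
  assumes "negligible N" "\<And>x. x \<notin> N \<Longrightarrow> P x"
  shows "AE x in lborel. P x"
proof -
  have "N \<in> null_sets lebesgue" using assms(1) by (simp add: negligible_iff_null_sets)
  then have "AE x in lebesgue. x \<notin> N" by (rule AE_not_in)
  then have "AE x in lebesgue. P x" by eventually_elim (use assms in auto)
  then show ?thesis by (simp add: AE_completion_iff)
qed

lemma AE_lborel_uminus:
  assumes "AE x in lborel. P x"
  shows "AE x :: real in lborel. P (- x)"
proof -
  obtain N where N: "N \<in> null_sets lborel" "{x. \<not> P x} \<subseteq> N"
    using assms by (auto simp: eventually_ae_filter)
  then have "AE x in distr lborel borel (uminus :: real \<Rightarrow> real). x \<notin> N"
    unfolding lborel_distr_uminus by (intro AE_not_in)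
  then have "AE x in lborel. - x \<notin> N"
    using N(1) by (subst (asm) AE_distr_iff) (auto simp: null_sets_def)
  then show ?thesis by eventually_elim (use N(2) in auto)
qed

text \<open>The differentiation theorem applied here averages over cubes with lower corner
  \<open>x\<close>, which on the real line are intervals to the right of \<open>x\<close>.\<close>

lemma AE_right_average:
  fixes g :: "real \<Rightarrow> real"
  assumes g: "\<And>a b. set_integrable lborel {a..b} g" 
  shows "AE x in lborel. \<forall>e>0. \<exists>d>0. \<forall>h. 0 < h \<and> h < d \<longrightarrow>
           (LINT t:{x..x+h}|lborel. g t) \<le> (g x + e) * h"
proof -
  have *: "g integrable_on cbox a b" for a b
    using set_borel_integral_eq_integral(1)[OF g[of a b]] by (simp add: cbox_interval)
  show ?thesis
  proof (rule integrable_ccontinuous_explicit[OF *])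
  fix N assume N: "negligible N"
    "\<And>x e. \<lbrakk>x \<notin> N; 0 < e\<rbrakk> \<Longrightarrow> \<exists>d>0. \<forall>h. 0 < h \<and> h < d \<longrightarrow>
        norm (integral (cbox x (x + h *\<^sub>R One)) g /\<^sub>R h ^ DIM(real) - g x) < e"
  show ?thesis
  proof (rule AE_lborel_if_negligible[OF N(1)], intro allI impI)
    fix x e :: real assume "x \<notin> N" "0 < e"
    from N(2)[OF this] obtain d where d: "d > 0"
      "\<And>h. 0 < h \<Longrightarrow> h < d \<Longrightarrow> norm (integral (cbox x (x + h *\<^sub>R One)) g /\<^sub>R h ^ DIM(real) - g x) < e"
      by blast
    show "\<exists>d>0. \<forall>h. 0 < h \<and> h < d \<longrightarrow> (LINT t:{x..x+h}|lborel. g t) \<le> (g x + e) * h"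
    proof (intro exI[of _ d] conjI allI impI d(1))
      fix h assume h: "0 < h \<and> h < d"
      have "(LINT t:{x..x+h}|lborel. g t) = integral {x..x+h} g"
        by (rule set_borel_integral_eq_integral(2)[OF g])
      moreover have "integral {x..x+h} g / h \<le> g x + e"
        using d(2)[of h] h by (simp add: cbox_interval abs_less_iff field_simps)
      ultimately show "(LINT t:{x..x+h}|lborel. g t) \<le> (g x + e) * h"
        using h by (simp add: field_simps)
    qed
  qed
  qed
qed

text \<open>The left half of the interval becomes a right half for the reflected function
  \<open>g (- t)\<close>; each half contributes about \<open>g x * h\<close>, hence the factor
  2.\<close>

lemma AE_symmetric_average:
  fixes g :: "real \<Rightarrow> real"
  assumes g: "\<And>a b. set_integrable lborel {a..b} g" and pos: "\<And>x. 0 \<le> g x"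
  shows "AE x in lborel. \<forall>e>0. \<exists>d>0. \<forall>h. 0 < h \<and> h < d \<longrightarrow>
           (\<integral>\<^sup>+t\<in>{x-h..x+h}. g t \<partial>lborel) \<le> ennreal ((2 * g x + e) * h)"
proof -
  have g': "set_integrable lborel {a..b} (\<lambda>t. g (-t))" for a b
  proof -
    have "(\<lambda>x. indicator {- b..- a} (- x) *\<^sub>R g (- x)) = (\<lambda>x. indicator {a..b} x *\<^sub>R g (- x))"
      by (auto simp: indicator_def fun_eq_iff)
    then show ?thesis
      using lborel_integrable_real_affine[OF g[of "-b" "-a", unfolded set_integrable_def], of "-1" 0]
      by (simp add: set_integrable_def)
  qed
  have neg: "AE x in lborel. \<forall>e>0. \<exists>d>0. \<forall>h. 0 < h \<and> h < d \<longrightarrow>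
           (LINT t:{-x..-x+h}|lborel. g (-t)) \<le> (g x + e) * h"
    using AE_lborel_uminus[OF AE_right_average[of "\<lambda>t. g (-t)", OF g']] by simp
  from neg AE_right_average[of g, OF g] show ?thesis
  proof eventually_elim
    case (elim x)
    show ?case
    proof (intro allI impI)
      fix e :: real assume e: "0 < e"
      obtain d1 where d1: "d1 > 0" "\<And>h. 0 < h \<Longrightarrow> h < d1 \<Longrightarrow> (LINT t:{-x..-x+h}|lborel. g (-t)) \<le> (g x + e/2) * h"
        using elim(1)[rule_format, of "e / 2"] e by auto
      obtain d2 where d2: "d2 > 0" "\<And>h. 0 < h \<Longrightarrow> h < d2 \<Longrightarrow> (LINT t:{x..x+h}|lborel. g t) \<le> (g x + e/2) * h"
        using elim(2)[rule_format, of "e / 2"] e by auto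
      show "\<exists>d>0. \<forall>h. 0 < h \<and> h < d \<longrightarrow> (\<integral>\<^sup>+t\<in>{x-h..x+h}. g t \<partial>lborel) \<le> ennreal ((2 * g x + e) * h)"
      proof (intro exI[of _ "min d1 d2"] conjI allI impI)
        fix h assume h: "0 < h \<and> h < min d1 d2"
        have le: "g t * indicator {x-h..x+h} t \<le> indicator {x-h..x} t *\<^sub>R g t + indicator {x..x+h} t *\<^sub>R g t" for t
          using pos[of t] by (auto simp: indicator_def)
        have int: "integrable lborel (\<lambda>t. indicator {x-h..x} t *\<^sub>R g t + indicator {x..x+h} t *\<^sub>R g t)"
          using g[of "x-h" x] g[of x "x+h"] by (auto simp: set_integrable_def)
        have "(\<integral>\<^sup>+t\<in>{x-h..x+h}. g t \<partial>lborel) \<le>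
            (\<integral>\<^sup>+t. ennreal (indicator {x-h..x} t *\<^sub>R g t + indicator {x..x+h} t *\<^sub>R g t) \<partial>lborel)"
          using le pos by (intro nn_integral_mono) (auto simp: indicator_def)
        also have "\<dots> = ennreal (\<integral>t. indicator {x-h..x} t *\<^sub>R g t + indicator {x..x+h} t *\<^sub>R g t \<partial>lborel)"
          by (rule nn_integral_eq_integral[OF int]) (auto simp: pos)
        also have "(\<integral>t. indicator {x-h..x} t *\<^sub>R g t + indicator {x..x+h} t *\<^sub>R g t \<partial>lborel)
            = (LINT t:{x-h..x}|lborel. g t) + (LINT t:{x..x+h}|lborel. g t)"
          using g[of "x-h" x] g[of x "x+h"] by (auto simp: set_integrable_def set_lebesgue_integral_def)
        also have "(LINT t:{x-h..x}|lborel. g t) = (LINT t:{-x..-x+h}|lborel. g (-t))"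
        proof -
          have "(\<lambda>t. indicator {x - h..x} (- t) *\<^sub>R g (- t)) = (\<lambda>t. indicator {- x..- x + h} t *\<^sub>R g (- t))"
            by (auto simp: indicator_def fun_eq_iff)
          then show ?thesis unfolding set_lebesgue_integral_def
            using lborel_integral_real_affine[of "-1" "\<lambda>t. indicator {x-h..x} t *\<^sub>R g t" 0] by simp
        qed
        also have "ennreal ((LINT t:{-x..-x+h}|lborel. g (-t)) + (LINT t:{x..x+h}|lborel. g t)) \<le>
            ennreal ((g x + e/2) * h + (g x + e/2) * h)"
          using d1(2)[of h] d2(2)[of h] h by (intro ennreal_leI add_mono) auto
        also have "(g x + e/2) * h + (g x + e/2) * h = (2 * g x + e) * h" by (simp add: algebra_simps)
        finally show "(\<integral>\<^sup>+t\<in>{x-h..x+h}. g t \<partial>lborel) \<le> ennreal ((2 * g x + e) * h)" .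
      qed (use d1 d2 in auto)
    qed
  qed
qed

definition lebesgue_point :: "(real \<Rightarrow> complex) \<Rightarrow> real \<Rightarrow> bool" where
  "lebesgue_point f x \<longleftrightarrow> (\<forall>e>0. \<exists>d>0. \<forall>h. 0 < h \<and> h < d \<longrightarrow>
     (\<integral>\<^sup>+t\<in>{x-h..x+h}. norm (f t - f x) \<partial>lborel) \<le> ennreal (e * h))"

text \<open>Averages of \<open>norm (f t - c)\<close> are controlled off one common null set for all
  \<open>c\<close> in a countable dense set; the value \<open>f x\<close> is then replaced by a
  nearby \<open>c\<close>.\<close>

lemma AE_lebesgue_point:
  assumes "1 < p" and f: "f \<in> Lfun p"
  shows "AE x in lborel. lebesgue_point f x"
proof -
  note [measurable] = Lfun_measurable[OF f]
  obtain D :: "complex set" where D: "countable D" "\<And>X. open X \<Longrightarrow> X \<noteq> {} \<Longrightarrow> \<exists>d\<in>D. d \<in> X"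
    by (rule countable_dense_setE) blast
  have "AE x in lborel. \<forall>c\<in>D. \<forall>e>0. \<exists>d>0. \<forall>h. 0 < h \<and> h < d \<longrightarrow>
           (\<integral>\<^sup>+t\<in>{x-h..x+h}. norm (f t - c) \<partial>lborel) \<le> ennreal ((2 * norm (f x - c) + e) * h)"
    by (intro AE_ball_countable' D AE_symmetric_average Lfun_locally_integrable[OF assms]) auto
  then show ?thesis
  proof eventually_elim
    case (elim x)
    show "lebesgue_point f x"
      unfolding lebesgue_point_def
    proof (intro allI impI)
      fix e :: real assume e: "0 < e"
      \<comment> \<open>The averages of \<open>norm (f t - c)\<close> cost
        \<open>2 * norm (f x - c) + e / 4\<close> per unit of \<open>h\<close>, and exchanging
        \<open>c\<close> for \<open>f x\<close> over an interval of length \<open>2 * h\<close>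
        another \<open>2 * norm (f x - c)\<close>; together this is less than
        \<open>3 * e / 4\<close>.\<close>
      obtain c where c: "c \<in> D" "norm (f x - c) < e / 8"
        using D(2)[of "ball (f x) (e / 8)"] e by (auto simp: dist_norm)
      obtain d where d: "d > 0" "\<And>h. 0 < h \<Longrightarrow> h < d \<Longrightarrow>
           (\<integral>\<^sup>+t\<in>{x-h..x+h}. norm (f t - c) \<partial>lborel) \<le> ennreal ((2 * norm (f x - c) + e / 4) * h)"
        using elim[rule_format, OF c(1), of "e / 4"] e by auto
      show "\<exists>d>0. \<forall>h. 0 < h \<and> h < d \<longrightarrow>
          (\<integral>\<^sup>+t\<in>{x-h..x+h}. norm (f t - f x) \<partial>lborel) \<le> ennreal (e * h)"
      proof (intro exI[of _ d] conjI allI impI d(1))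
        fix h assume h: "0 < h \<and> h < d"
        have "(\<integral>\<^sup>+t\<in>{x-h..x+h}. norm (f t - f x) \<partial>lborel) \<le>
            (\<integral>\<^sup>+t. ennreal (norm (f t - c)) * indicator {x-h..x+h} t + ennreal (norm (f x - c)) * indicator {x-h..x+h} t \<partial>lborel)"
        proof (intro nn_integral_mono)
          fix t
          have "ennreal (norm (f t - f x)) \<le> ennreal (norm (f t - c)) + ennreal (norm (f x - c))"
            using norm_triangle_ineq4[of "f t - c" "f x - c"] by (simp flip: ennreal_plus add: ennreal_leI)
          then show "ennreal (norm (f t - f x)) * indicator {x-h..x+h} t \<le>
            ennreal (norm (f t - c)) * indicator {x-h..x+h} t + ennreal (norm (f x - c)) * indicator {x-h..x+h} t"
            by (auto simp: indicator_def)
        qed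
        also have "\<dots> = (\<integral>\<^sup>+t\<in>{x-h..x+h}. norm (f t - c) \<partial>lborel) + ennreal (norm (f x - c)) * emeasure lborel {x-h..x+h}"
          by (simp add: nn_integral_add nn_integral_cmult_indicator)
        also have "\<dots> \<le> ennreal ((2 * norm (f x - c) + e / 4) * h) + ennreal (norm (f x - c) * (2 * h))"
          using d(2)[of h] h by (intro add_mono) (auto simp: ennreal_mult)
        also have "\<dots> = ennreal ((4 * norm (f x - c) + e / 4) * h)"
          using h e by (simp flip: ennreal_plus add: algebra_simps)
        also have "\<dots> \<le> ennreal (e * h)"
          using c h e by (intro ennreal_leI mult_right_mono) auto
        finally show "(\<integral>\<^sup>+t\<in>{x-h..x+h}. norm (f t - f x) \<partial>lborel) \<le> ennreal (e * h)" .
      qed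
    qed
  qed
qed

section \<open>The Poisson kernel\<close>

text \<open>The Poisson kernel without the factor \<open>1 / \<pi>\<close>.\<close>

definition pk :: "real \<Rightarrow> real \<Rightarrow> real" where
  "pk y s = y / (s\<^sup>2 + y\<^sup>2)"

lemma pk_measurable [measurable]: "pk y \<in> borel_measurable borel"
  unfolding pk_def by measurable

lemma pk_nonneg: "0 < y \<Longrightarrow> 0 \<le> pk y s"
  by (simp add: pk_def)

lemma pk_integral:
  assumes "0 < y"
  shows "integrable lborel (\<lambda>t. pk y (t - x))" "(\<integral>t. pk y (t - x) \<partial>lborel) = pi"
proof -
  have 1: "integrable lborel (\<lambda>t::real. inverse (1 + t\<^sup>2))"
    using integrable_inverse_1_plus_square by (simp add: set_integrable_def einterval_def)
  have 2: "(\<integral>t. inverse (1 + t\<^sup>2) \<partial>(lborel :: real measure)) = pi"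
    using LBINT_inverse_1_plus_square
    by (simp add: interval_lebesgue_integral_def set_lebesgue_integral_def einterval_def)
  have eq: "inverse (1 + (- x / y + (1 / y) * t)\<^sup>2) = y * pk y (t - x)" for t
  proof -
    have "1 + (- x / y + (1 / y) * t)\<^sup>2 = ((t - x)\<^sup>2 + y\<^sup>2) / y\<^sup>2"
      using assms by (simp add: field_simps power2_eq_square)
    then show ?thesis using assms by (simp add: pk_def power2_eq_square)
  qed
  have "integrable lborel (\<lambda>t. y * pk y (t - x))"
    using lborel_integrable_real_affine[OF 1, of "1 / y" "- x / y"] assms unfolding eq by simp
  then show "integrable lborel (\<lambda>t. pk y (t - x))" using assms by simp
  show "(\<integral>t. pk y (t - x) \<partial>lborel) = pi"
    using lborel_integral_real_affine[of "1 / y" "\<lambda>t. inverse (1 + t\<^sup>2)" "- x / y"] assms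
    unfolding eq 2 by simp
qed

lemma norm_of_real_minus_Complex:
  "(norm (complex_of_real t - Complex x y))\<^sup>2 = (t - x)\<^sup>2 + y\<^sup>2"
  by (simp add: cmod_power2)

lemma pk_le_cauchy_kernel:
  assumes "0 < y"
  shows "pk y (t - x) \<le> norm (1 / (complex_of_real t - Complex x y))"
proof -
  let ?n = "norm (complex_of_real t - Complex x y)"
  have n: "y \<le> ?n" using abs_Im_le_cmod[of "complex_of_real t - Complex x y"] assms by simp
  have "pk y (t - x) = y / ?n\<^sup>2" by (simp add: pk_def norm_of_real_minus_Complex)
  also have "\<dots> \<le> ?n / ?n\<^sup>2" using n by (intro divide_right_mono) auto
  finally have "pk y (t - x) \<le> ?n / ?n\<^sup>2" .
  moreover have "0 < ?n" using n assms by linarith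
  ultimately show ?thesis by (auto simp: norm_divide power2_eq_square split: if_splits)
qed

lemma pk_mult_integrable:
  assumes "1 < p" and f: "f \<in> Lfun p" and "0 < y"
  shows "integrable lborel (\<lambda>t. pk y (t - x) * norm (f t))"
    "integrable lborel (\<lambda>t. complex_of_real (pk y (t - x)) * f t)"
    "integrable lborel (\<lambda>t. pk y (t - x) * norm (f t - c))"
    "integrable lborel (\<lambda>t. complex_of_real (pk y (t - x)) * (f t - c))"
proof -
  note [measurable] = Lfun_measurable[OF f]
  have K: "integrable lborel (\<lambda>t. f t / (complex_of_real t - Complex x y))"
    using assms by (intro KI_integrable[OF assms(1,2)]) auto
  have le: "pk y (t - x) * norm (f t) \<le> norm (f t / (complex_of_real t - Complex x y))" for t
    using mult_right_mono[OF pk_le_cauchy_kernel[OF \<open>0 < y\<close>, of t x], of "norm (f t)"]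
    by (simp add: norm_divide)
  show 1: "integrable lborel (\<lambda>t. pk y (t - x) * norm (f t))"
    by (rule Bochner_Integration.integrable_bound[OF K]) (use le pk_nonneg[OF \<open>0 < y\<close>] in auto)
  have 2: "integrable lborel (\<lambda>t. pk y (t - x) * norm (f t) + pk y (t - x) * norm c)"
    using pk_integral(1)[OF \<open>0 < y\<close>] by (intro Bochner_Integration.integrable_add 1) auto
  show 3: "integrable lborel (\<lambda>t. pk y (t - x) * norm (f t - c))"
  proof (rule Bochner_Integration.integrable_bound[OF 2])
    have "norm (pk y (t - x) * norm (f t - c)) \<le> norm (pk y (t - x) * norm (f t) + pk y (t - x) * norm c)" for t
      using mult_left_mono[OF norm_triangle_ineq4[of "f t" c] pk_nonneg[OF \<open>0 < y\<close>, of "t - x"]]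
        pk_nonneg[OF \<open>0 < y\<close>, of "t - x"]
      by (simp add: ring_distribs)
    then show "AE t in lborel. norm (pk y (t - x) * norm (f t - c)) \<le> norm (pk y (t - x) * norm (f t) + pk y (t - x) * norm c)"
      by auto
  qed measurable
  show "integrable lborel (\<lambda>t. complex_of_real (pk y (t - x)) * f t)"
    by (rule Bochner_Integration.integrable_bound[OF 1]) (auto simp: norm_mult)
  show "integrable lborel (\<lambda>t. complex_of_real (pk y (t - x)) * (f t - c))"
    by (rule Bochner_Integration.integrable_bound[OF 3]) (auto simp: norm_mult)
qed

text \<open>The least \<open>k\<close> with \<open>\<bar>s\<bar> \<le> 2 ^ k * y\<close> locates
  \<open>s\<close> in a dyadic shell. The Poisson kernel is thus majorised by indicators of
  intervals of radius \<open>2 ^ k * y\<close> with weights \<open>4 / (y * 4 ^ k)\<close>, so that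
  averages control Poisson integrals.\<close>

lemma pk_dyadic:
  assumes y: "0 < y"
  shows "\<exists>k::nat. \<bar>s\<bar> \<le> 2 ^ k * y \<and> pk y s \<le> 4 / (y * 4 ^ k)"
proof -
  obtain n :: nat where "\<bar>s\<bar> / y < 2 ^ n" using real_arch_pow[of 2 "\<bar>s\<bar> / y"] by auto
  then have ex: "\<exists>k::nat. \<bar>s\<bar> \<le> 2 ^ k * y" using y by (intro exI[of _ n]) (auto simp: field_simps)
  define k where "k = (LEAST k::nat. \<bar>s\<bar> \<le> 2 ^ k * y)"
  have k: "\<bar>s\<bar> \<le> 2 ^ k * y" unfolding k_def using ex by (rule LeastI_ex)
  have "pk y s \<le> 4 / (y * 4 ^ k)"
  proof (cases k)
    case 0
    have "y * y \<le> 4 * (s\<^sup>2 + y\<^sup>2)" by (simp add: power2_eq_square)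
    then have "pk y s \<le> 4 / y"
      using y by (simp add: pk_def divide_le_eq le_divide_eq add_pos_nonneg mult.commute pos_divide_le_eq zero_less_power add_nonneg_pos)
    then show ?thesis using 0 by simp
  next
    case (Suc j)
    have "\<not> \<bar>s\<bar> \<le> 2 ^ j * y" using not_less_Least[of j "\<lambda>k. \<bar>s\<bar> \<le> 2 ^ k * y"] Suc by (simp add: k_def)
    then have "(2 ^ j * y)\<^sup>2 \<le> \<bar>s\<bar>\<^sup>2" using y by (intro power_mono) auto
    then have le: "4 ^ j * y\<^sup>2 \<le> s\<^sup>2" by (simp add: power_mult_distrib power_mult[symmetric] mult.commute[of j] power_mult)
    have "pk y s \<le> y / (4 ^ j * y\<^sup>2)"
      unfolding pk_def using y le by (intro divide_left_mono mult_pos_pos) (auto intro: add_increasing2 add_nonneg_pos)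
    also have "\<dots> = 4 / (y * 4 ^ k)" using y Suc by (simp add: power2_eq_square)
    finally show ?thesis .
  qed
  with k show ?thesis by blast
qed

text \<open>Close to \<open>x\<close> the dyadic majorant applies: the weight
  \<open>4 / (y * 4 ^ k)\<close> times an integral of at most \<open>e' * (2 ^ k * y)\<close> leaves
  a geometric series. Away from \<open>x\<close> the kernel is at most a constant times
  \<open>y * pk 1 (t - x)\<close>, and this contribution vanishes with \<open>y\<close>.\<close>

lemma lebesgue_point_poisson:
  assumes "1 < p" and f: "f \<in> Lfun p" and x: "lebesgue_point f x"
  shows "((\<lambda>y. \<integral>t. pk y (t - x) * norm (f t - f x) \<partial>lborel) \<longlongrightarrow> 0) (at_right 0)"
proof (rule tendstoI)
  fix e :: real assume "0 < e"
  \<comment> \<open>The dyadic series sums to \<open>8 * e'\<close> and the tail adds less than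
    \<open>e'\<close>.\<close>
  define e' where "e' = e / 10"
  have e': "0 < e'" using \<open>0 < e\<close> by (simp add: e'_def)
  note [measurable] = Lfun_measurable[OF f]
  let ?G = "\<lambda>t. norm (f t - f x)"
  obtain d where d: "d > 0" "\<And>h. 0 < h \<Longrightarrow> h < d \<Longrightarrow>
     (\<integral>\<^sup>+t\<in>{x-h..x+h}. ?G t \<partial>lborel) \<le> ennreal (e' * h)"
    using x e' unfolding lebesgue_point_def by blast
  define \<delta> where "\<delta> = d / 2"
  have \<delta>: "0 < \<delta>" "\<delta> < d" using d by (auto simp: \<delta>_def)
  define J where "J = (\<integral>t. pk 1 (t - x) * ?G t \<partial>lborel)"
  have J: "(\<integral>\<^sup>+t. ennreal (pk 1 (t - x) * ?G t) \<partial>lborel) = ennreal J" "0 \<le> J"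
    unfolding J_def using pk_mult_integrable(3)[OF assms(1,2), of 1 x "f x"] pk_nonneg[of 1]
    by (auto intro!: nn_integral_eq_integral Bochner_Integration.integral_nonneg)
  have bound: "(\<integral>t. pk y (t - x) * ?G t \<partial>lborel) \<le> 8 * e' + y * (1 + 1 / \<delta>\<^sup>2) * J" if y: "0 < y" for y
  proof -
    \<comment> \<open>The cap \<open>\<delta>\<close> keeps every interval within the range of the
      Lebesgue point estimate, and the capped intervals still cover all \<open>t\<close> with
      \<open>\<bar>t - x\<bar> \<le> \<delta>\<close>.\<close>
    define h where "h k = min (2 ^ k * y) \<delta>" for k :: nat
    have h: "0 < h k" "h k < d" "h k \<le> 2 ^ k * y" for k using y \<delta> by (auto simp: h_def)
    let ?T = "\<lambda>k t. ennreal (4 / (y * 4 ^ k)) * (ennreal (?G t) * indicator {x - h k..x + h k} t)"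
    have pw: "ennreal (pk y (t - x) * ?G t) \<le>
        (\<Sum>k. ?T k t) + ennreal (y * (1 + 1 / \<delta>\<^sup>2)) * ennreal (pk 1 (t - x) * ?G t)" for t
    proof (cases "\<bar>t - x\<bar> \<le> \<delta>")
      case True
      obtain k where k: "\<bar>t - x\<bar> \<le> 2 ^ k * y" "pk y (t - x) \<le> 4 / (y * 4 ^ k)"
        using pk_dyadic[OF y] by blast
      have "t \<in> {x - h k..x + h k}" using k True by (auto simp: h_def abs_le_iff)
      then have "?T k t = ennreal (4 / (y * 4 ^ k) * ?G t)"
        using y by (subst ennreal_mult) auto
      then have "ennreal (pk y (t - x) * ?G t) \<le> ?T k t"
        using mult_right_mono[OF k(2), of "?G t"] by (simp add: ennreal_leI)
      also have "\<dots> = sum (\<lambda>k. ?T k t) {k}" by simp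
      also have "\<dots> \<le> (\<Sum>k. ?T k t)" by (rule sum_le_suminf) auto
      finally show ?thesis by (simp add: add_increasing2)
    next
      case False
      let ?s = "t - x"
      have "\<delta>\<^sup>2 \<le> \<bar>?s\<bar>\<^sup>2" using False \<delta> by (intro power_mono) auto
      then have one: "1 \<le> ?s\<^sup>2 / \<delta>\<^sup>2" using \<delta> by (simp add: field_simps)
      have "?s\<^sup>2 + 1 \<le> (1 + 1 / \<delta>\<^sup>2) * (?s\<^sup>2 + y\<^sup>2)"
      proof -
        have "(1 + 1 / \<delta>\<^sup>2) * (?s\<^sup>2 + y\<^sup>2) = ?s\<^sup>2 + ?s\<^sup>2 / \<delta>\<^sup>2 + (1 + 1 / \<delta>\<^sup>2) * y\<^sup>2"
          by (simp add: algebra_simps)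
        moreover note one
        moreover have "0 \<le> (1 + 1 / \<delta>\<^sup>2) * y\<^sup>2" by simp
        ultimately show ?thesis by linarith
      qed
      moreover have "0 < ?s\<^sup>2 + y\<^sup>2" "0 < ?s\<^sup>2 + 1" using y by (auto intro: add_nonneg_pos)
      ultimately have "1 / (?s\<^sup>2 + y\<^sup>2) \<le> (1 + 1 / \<delta>\<^sup>2) * (1 / (?s\<^sup>2 + 1))"
        by (simp add: field_simps)
      then have "y * (1 / (?s\<^sup>2 + y\<^sup>2)) \<le> y * ((1 + 1 / \<delta>\<^sup>2) * (1 / (?s\<^sup>2 + 1)))"
        using y by (intro mult_left_mono) auto
      then have "pk y ?s \<le> y * (1 + 1 / \<delta>\<^sup>2) * pk 1 ?s"
        by (simp add: pk_def)
      then have "pk y ?s * ?G t \<le> y * (1 + 1 / \<delta>\<^sup>2) * (pk 1 ?s * ?G t)"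
        using mult_right_mono[of "pk y ?s" "y * (1 + 1 / \<delta>\<^sup>2) * pk 1 ?s" "?G t"] by (simp add: mult_ac)
      then have "ennreal (pk y (t - x) * ?G t) \<le> ennreal (y * (1 + 1 / \<delta>\<^sup>2)) * ennreal (pk 1 (t - x) * ?G t)"
        using y pk_nonneg[of 1 ?s] by (subst ennreal_mult[symmetric]) (auto intro!: ennreal_leI)
      then show ?thesis by (simp add: add_increasing)
    qed
    have "ennreal (\<integral>t. pk y (t - x) * ?G t \<partial>lborel) = (\<integral>\<^sup>+t. ennreal (pk y (t - x) * ?G t) \<partial>lborel)"
      using pk_nonneg[OF y] by (intro nn_integral_eq_integral[symmetric] pk_mult_integrable(3)[OF assms(1,2) y]) auto
    also have "\<dots> \<le> (\<integral>\<^sup>+t. (\<Sum>k. ?T k t) + ennreal (y * (1 + 1 / \<delta>\<^sup>2)) * ennreal (pk 1 (t - x) * ?G t) \<partial>lborel)"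
      by (intro nn_integral_mono pw)
    also have "\<dots> = (\<Sum>k. \<integral>\<^sup>+t. ?T k t \<partial>lborel) + ennreal (y * (1 + 1 / \<delta>\<^sup>2)) * ennreal J"
      by (subst nn_integral_add, measurable) (simp add: nn_integral_suminf nn_integral_cmult J)
    also have "(\<Sum>k. \<integral>\<^sup>+t. ?T k t \<partial>lborel) \<le> (\<Sum>k. ennreal (4 * e' * (1 / 2) ^ k))"
    proof (intro suminf_le allI)
      fix k
      have "(\<integral>\<^sup>+t. ?T k t \<partial>lborel) = ennreal (4 / (y * 4 ^ k)) * (\<integral>\<^sup>+t\<in>{x-h k..x+h k}. ?G t \<partial>lborel)"
        by (rule nn_integral_cmult) measurable
      also have "\<dots> \<le> ennreal (4 / (y * 4 ^ k)) * ennreal (e' * (2 ^ k * y))"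
        using d(2)[OF h(1,2), of k] h(3)[of k] e'
        by (intro mult_left_mono order_trans[OF d(2)[OF h(1,2)] ennreal_leI]) auto
      also have "\<dots> = ennreal (4 / (y * 4 ^ k) * (e' * (2 ^ k * y)))"
        using y e' by (intro ennreal_mult[symmetric]) auto
      also have "4 / (y * 4 ^ k) * (e' * (2 ^ k * y)) = 4 * e' * (1 / 2) ^ k"
      proof -
        have "(4::real) ^ k = 2 ^ k * 2 ^ k" by (simp flip: power_mult_distrib)
        then show ?thesis using y by (simp add: power_one_over field_simps)
      qed
      finally show "(\<integral>\<^sup>+t. ?T k t \<partial>lborel) \<le> ennreal (4 * e' * (1 / 2) ^ k)" .
    qed auto
    also have "(\<Sum>k. ennreal (4 * e' * (1 / 2) ^ k)) = ennreal (8 * e')"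
    proof -
      have "(\<lambda>k. 4 * e' * (1 / 2) ^ k) sums (4 * e' * (1 / (1 - 1 / 2)))"
        by (intro sums_mult geometric_sums) auto
      then show ?thesis using e' by (intro suminf_ennreal_eq) auto
    qed
    finally have "ennreal (\<integral>t. pk y (t - x) * ?G t \<partial>lborel) \<le> ennreal (8 * e' + y * (1 + 1 / \<delta>\<^sup>2) * J)"
      using y e' J by (simp add: ennreal_mult[symmetric] ennreal_plus[symmetric] del: ennreal_plus)
    then show ?thesis using y e' J by (subst (asm) ennreal_le_iff) auto
  qed
  have "((\<lambda>y. y * (1 + 1 / \<delta>\<^sup>2) * J) \<longlongrightarrow> 0 * (1 + 1 / \<delta>\<^sup>2) * J) (at_right 0)"
    by (rule tendsto_mult_right)+ (rule tendsto_ident_at)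
  then have "\<forall>\<^sub>F y in at_right 0. y * (1 + 1 / \<delta>\<^sup>2) * J < e'"
    using e' by (intro order_tendstoD) auto
  moreover have "\<forall>\<^sub>F y :: real in at_right 0. 0 < y" by (simp add: eventually_at_right_less)
  ultimately show "\<forall>\<^sub>F y in at_right 0. dist (\<integral>t. pk y (t - x) * ?G t \<partial>lborel) 0 < e"
  proof eventually_elim
    case (elim y)
    have "0 \<le> (\<integral>t. pk y (t - x) * ?G t \<partial>lborel)"
      using pk_nonneg[OF elim(2)] by (intro Bochner_Integration.integral_nonneg) auto
    moreover have "(\<integral>t. pk y (t - x) * ?G t \<partial>lborel) < 9 * e'" using bound[OF elim(2)] elim(1) by linarith
    moreover have "9 * e' \<le> e" using \<open>0 < e\<close> by (simp add: e'_def)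
    ultimately show ?case unfolding dist_real_def by linarith
  qed
qed

text \<open>The jump of the Cauchy integral across the real line is a Poisson integral, since
  \<open>1 / (t - z) - 1 / (t - cnj z)\<close> has numerator \<open>z - cnj z\<close> and, for real
  \<open>t\<close>, the squared distance of \<open>t\<close> and \<open>z\<close> as
  denominator.\<close>

lemma KI_diff_cnj:
  assumes "1 < p" and f: "f \<in> Lfun p" and z: "0 < Im z"
  shows "KI f z - KI f (cnj z) = 2 * \<i> * (\<integral>t. of_real (pk (Im z) (t - Re z)) * f t \<partial>lborel)"
proof -
  have "KI f z - KI f (cnj z) =
      (\<integral>t. f t / (complex_of_real t - z) - f t / (complex_of_real t - cnj z) \<partial>lborel)"
    unfolding KI_def using KI_integrable[OF assms(1,2), of z] KI_integrable[OF assms(1,2), of "cnj z"] z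
    by simp
  also have "\<dots> = (\<integral>t. 2 * \<i> * (of_real (pk (Im z) (t - Re z)) * f t) \<partial>lborel)"
  proof (intro Bochner_Integration.integral_cong refl)
    fix t
    have nz: "complex_of_real t - z \<noteq> 0" "complex_of_real t - cnj z \<noteq> 0"
      using z by (auto simp: complex_eq_iff)
    have "(complex_of_real t - z) * (complex_of_real t - cnj z) = of_real ((t - Re z)\<^sup>2 + (Im z)\<^sup>2)"
      by (simp add: complex_eq_iff power2_eq_square algebra_simps)
    moreover have "z - cnj z = 2 * \<i> * of_real (Im z)" by (simp add: complex_eq_iff)
    ultimately have "1 / (complex_of_real t - z) - 1 / (complex_of_real t - cnj z)
        = 2 * \<i> * of_real (pk (Im z) (t - Re z))"
      using nz by (simp add: pk_def diff_frac_eq)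
    then have "f t * (1 / (complex_of_real t - z) - 1 / (complex_of_real t - cnj z))
        = f t * (2 * \<i> * of_real (pk (Im z) (t - Re z)))" by simp
    then show "f t / (complex_of_real t - z) - f t / (complex_of_real t - cnj z) =
        2 * \<i> * (of_real (pk (Im z) (t - Re z)) * f t)"
      by (simp add: right_diff_distrib mult_ac)
  qed
  finally show ?thesis by simp
qed

text \<open>A Harnack type comparison: throughout a cone with vertex \<open>x\<close> one constant
  compares the kernel centred at \<open>x'\<close> with the kernel centred at \<open>x\<close>.
  Nontangential approach is thereby reduced to vertical approach.\<close>

lemma pk_nt_le:
  assumes a: "0 < a" and y: "0 < y" and x: "\<bar>x' - x\<bar> < a * y"
  shows "pk y (t - x') \<le> (2 + 2 * a\<^sup>2) * pk y (t - x)"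
proof -
  have "(t - x)\<^sup>2 \<le> 2 * (t - x')\<^sup>2 + 2 * (x' - x)\<^sup>2"
    using sum_squares_bound[of "t - x'" "x' - x"] by (simp add: power2_eq_square algebra_simps)
  moreover have "(x' - x)\<^sup>2 \<le> a\<^sup>2 * y\<^sup>2"
    using power_mono[of "\<bar>x' - x\<bar>" "a * y" 2] x by (simp add: power_mult_distrib)
  moreover have "0 \<le> a\<^sup>2 * (t - x')\<^sup>2" "0 \<le> y\<^sup>2" "2 * a\<^sup>2 * (t - x')\<^sup>2 = 2 * (a\<^sup>2 * (t - x')\<^sup>2)"
    "2 * a\<^sup>2 * y\<^sup>2 = 2 * (a\<^sup>2 * y\<^sup>2)" by auto
  ultimately have "(t - x)\<^sup>2 + y\<^sup>2 \<le> (2 + 2 * a\<^sup>2) * ((t - x')\<^sup>2 + y\<^sup>2)"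
    unfolding ring_distribs by linarith
  moreover have "0 < (t - x)\<^sup>2 + y\<^sup>2" "0 < (t - x')\<^sup>2 + y\<^sup>2" using y by (auto intro: add_nonneg_pos)
  ultimately have "1 / ((t - x')\<^sup>2 + y\<^sup>2) \<le> (2 + 2 * a\<^sup>2) * (1 / ((t - x)\<^sup>2 + y\<^sup>2))"
    by (simp add: field_simps)
  from mult_left_mono[OF this, of y] show ?thesis using y by (simp add: pk_def mult_ac)
qed

lemma poisson_minus_value:
  assumes "1 < p" and f: "f \<in> Lfun p" and y: "0 < y"
  shows "(\<integral>t. of_real (pk y (t - x')) * f t \<partial>lborel) / of_real pi - c =
    (\<integral>t. of_real (pk y (t - x')) * (f t - c) \<partial>lborel) / of_real pi"
proof -
  have "integrable lborel (\<lambda>t. complex_of_real (pk y (t - x')) * c)"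
    using pk_integral(1)[OF y, of x'] by (intro integrable_mult_left integrable_of_real) auto
  then have "(\<integral>t. of_real (pk y (t - x')) * (f t - c) \<partial>lborel) =
      (\<integral>t. of_real (pk y (t - x')) * f t \<partial>lborel) - (\<integral>t. of_real (pk y (t - x')) * c \<partial>lborel)"
    using pk_mult_integrable(2)[OF assms, of x'] by (simp add: right_diff_distrib)
  also have "(\<integral>t. complex_of_real (pk y (t - x')) * c \<partial>lborel) = of_real pi * c"
    using pk_integral[OF y, of x'] by simp
  finally show ?thesis by (simp add: diff_divide_distrib)
qed

lemma poisson_nt_limit:
  assumes "1 < p" and f: "f \<in> Lfun p" and x: "lebesgue_point f x"
  shows "nt_limit 1 (\<lambda>z. (KI f z - KI f (cnj z)) / (2 * of_real pi * \<i>)) x (f x)"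
  unfolding nt_limit_def
proof (intro allI impI)
  fix a :: real assume a: "0 < a"
  let ?F = "at (complex_of_real x) within nt_region 1 a x"
  let ?E = "\<lambda>y. \<integral>t. pk y (t - x) * norm (f t - f x) \<partial>lborel"
  have pos: "0 < Im z" "\<bar>Re z - x\<bar> < a * Im z" if "z \<in> nt_region 1 a x" for z
  proof -
    show "\<bar>Re z - x\<bar> < a * Im z" using that by (simp add: nt_region_def)
    then have "0 < a * Im z" by linarith
    then show "0 < Im z" using a by (simp add: zero_less_mult_iff)
  qed
  have ev: "\<forall>\<^sub>F z in ?F. z \<in> nt_region 1 a x" by (simp add: eventually_at_filter)
  have "filterlim Im (at_right 0) ?F"
    unfolding filterlim_at
  proof
    show "\<forall>\<^sub>F z in ?F. Im z \<in> {0<..} \<and> Im z \<noteq> 0"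
      using ev by eventually_elim (use pos in force)
    show "(Im \<longlongrightarrow> 0) ?F"
      using tendsto_Im[OF tendsto_ident_at[of "complex_of_real x" "nt_region 1 a x"]] by simp
  qed
  from filterlim_compose[OF lebesgue_point_poisson[OF assms] this]
  have lim: "((\<lambda>z. (2 + 2 * a\<^sup>2) / pi * ?E (Im z)) \<longlongrightarrow> (2 + 2 * a\<^sup>2) / pi * 0) ?F"
    by (intro tendsto_mult tendsto_const)
  show "((\<lambda>z. (KI f z - KI f (cnj z)) / (2 * of_real pi * \<i>)) \<longlongrightarrow> f x) ?F"
  proof (rule LIM_zero_cancel, rule Lim_null_comparison)
    show "((\<lambda>z. (2 + 2 * a\<^sup>2) / pi * ?E (Im z)) \<longlongrightarrow> 0) ?F" using lim by simp
    show "\<forall>\<^sub>F z in ?F. norm ((KI f z - KI f (cnj z)) / (2 * of_real pi * \<i>) - f x)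
        \<le> (2 + 2 * a\<^sup>2) / pi * ?E (Im z)"
      using ev
    proof eventually_elim
      case (elim z)
      note z = pos[OF elim]
      have "(KI f z - KI f (cnj z)) / (2 * of_real pi * \<i>) - f x =
          (\<integral>t. of_real (pk (Im z) (t - Re z)) * (f t - f x) \<partial>lborel) / of_real pi"
        unfolding KI_diff_cnj[OF assms(1,2) z(1)]
        using poisson_minus_value[OF assms(1,2) z(1), of "Re z" "f x"] by simp
      also have "norm \<dots> = norm (\<integral>t. of_real (pk (Im z) (t - Re z)) * (f t - f x) \<partial>lborel) / pi"
        by (simp add: norm_divide)
      also have "\<dots> \<le> (\<integral>t. (2 + 2 * a\<^sup>2) * (pk (Im z) (t - x) * norm (f t - f x)) \<partial>lborel) / pi"
      proof (intro divide_right_mono norm_integral_le)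
        show "integrable lborel (\<lambda>t. (2 + 2 * a\<^sup>2) * (pk (Im z) (t - x) * norm (f t - f x)))"
          using pk_mult_integrable(3)[OF assms(1,2) z(1)] by simp
        fix t
        show "norm (of_real (pk (Im z) (t - Re z)) * (f t - f x)) \<le> (2 + 2 * a\<^sup>2) * (pk (Im z) (t - x) * norm (f t - f x))"
          using mult_right_mono[OF pk_nt_le[OF a z, of t], of "norm (f t - f x)"]
            pk_nonneg[OF z(1), of "t - Re z"]
          by (simp add: norm_mult mult.assoc)
      qed auto
      finally show ?case by simp
    qed
  qed
qed

text \<open>The tangent of a convex function lies below its graph. Young's inequality for
  \<open>u * a powr (p - 1)\<close>, multiplied by \<open>p\<close>, is exactly this for the
  power.\<close>

lemma power_tangent_le:
  assumes "1 < p" "0 \<le> a" "0 \<le> (u :: real)"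
  shows "a powr p + p * a powr (p - 1) * (u - a) \<le> u powr p"
proof -
  let ?q = "conj_exp p"
  have q: "1 < ?q" "1 / p + 1 / ?q = 1" "?q * (p - 1) = p" using conj_exp_facts[OF assms(1)] by auto
  have "u * a powr (p - 1) \<le> u powr p / p + (a powr (p - 1)) powr ?q / ?q"
    using assms q by (intro Youngs_inequality) auto
  also have "(a powr (p - 1)) powr ?q = a powr p"
    using q by (simp add: powr_powr mult.commute)
  finally have "p * (u * a powr (p - 1)) \<le> p * (u powr p / p + a powr p / ?q)"
    using assms by (intro mult_left_mono) auto
  also have "\<dots> = u powr p + (p / ?q) * a powr p" using assms by (simp add: field_simps)
  also have "p / ?q = p - 1" using q assms by (simp add: field_simps)
  finally have "p * u * a powr (p - 1) \<le> u powr p + (p - 1) * a powr p" by (simp add: mult_ac)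
  moreover have "a powr p = a * a powr (p - 1)"
    using assms by (cases "a = 0") (auto simp: powr_mult_base)
  ultimately show ?thesis by (simp add: algebra_simps)
qed

text \<open>Jensen's inequality for the probability density \<open>pk y (t - x) / pi\<close>: the
  tangent inequality is taken at the mean \<open>a\<close> of \<open>norm (f t)\<close> and
  integrated, whereupon its linear term disappears.\<close>

lemma poisson_jensen:
  assumes "1 < p" and f: "f \<in> Lfun p" and y: "0 < y"
  shows "ennreal (norm ((\<integral>t. of_real (pk y (t - x)) * f t \<partial>lborel) / of_real pi) powr p)
    \<le> (\<integral>\<^sup>+t. ennreal (pk y (t - x) / pi * norm (f t) powr p) \<partial>lborel)"
proof -
  note [measurable] = Lfun_measurable[OF f]
  define a where "a = (\<integral>t. pk y (t - x) / pi * norm (f t) \<partial>lborel)"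
  have intpf: "integrable lborel (\<lambda>t. pk y (t - x) / pi * norm (f t))"
    using pk_mult_integrable(1)[OF assms, of x] by simp
  have a0: "0 \<le> a" unfolding a_def using pk_nonneg[OF y] by (intro Bochner_Integration.integral_nonneg) auto
  have le: "norm ((\<integral>t. of_real (pk y (t - x)) * f t \<partial>lborel) / of_real pi) \<le> a"
  proof -
    have "norm (\<integral>t. of_real (pk y (t - x)) * f t \<partial>lborel) \<le> (\<integral>t. pk y (t - x) * norm (f t) \<partial>lborel)"
      using pk_nonneg[OF y] by (intro norm_integral_le pk_mult_integrable[OF assms]) (auto simp: norm_mult)
    then show ?thesis by (simp add: a_def norm_divide divide_right_mono)
  qed
  have intp: "integrable lborel (\<lambda>t. pk y (t - x) / pi * norm (f t) powr p)"
  proof (rule Bochner_Integration.integrable_bound[of _ "\<lambda>t. 1 / (y * pi) * norm (f t) powr p"])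
    show "integrable lborel (\<lambda>t. 1 / (y * pi) * norm (f t) powr p)" using Lfun_integrable[OF f] by simp
    have "pk y s \<le> 1 / y" for s
    proof -
      have "pk y s \<le> y / y\<^sup>2" unfolding pk_def using y by (intro divide_left_mono mult_pos_pos) (auto intro: add_nonneg_pos)
      then show ?thesis using y by (simp add: power2_eq_square)
    qed
    then have "pk y (t - x) / pi * norm (f t) powr p \<le> (1 / y) / pi * norm (f t) powr p" for t
      by (intro mult_right_mono divide_right_mono) auto
    then show "AE t in lborel. norm (pk y (t - x) / pi * norm (f t) powr p) \<le> norm (1 / (y * pi) * norm (f t) powr p)"
      using y pk_nonneg[OF y] by auto
  qed measurable
  have eq: "(\<lambda>t. pk y (t - x) / pi * (a powr p + p * a powr (p - 1) * (norm (f t) - a))) =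
       (\<lambda>t. (a powr p - p * a powr (p - 1) * a) / pi * pk y (t - x) +
         p * a powr (p - 1) * (pk y (t - x) / pi * norm (f t)))"
    by (auto simp: fun_eq_iff field_simps)
  have int1: "integrable lborel (\<lambda>t. A * pk y (t - x))" for A
    using pk_integral(1)[OF y, of x] by simp
  have int2: "integrable lborel (\<lambda>t. B * (pk y (t - x) / pi * norm (f t)))" for B
    by (intro integrable_mult_right intpf)
  have lin: "(\<integral>t. A * pk y (t - x) + B * (pk y (t - x) / pi * norm (f t)) \<partial>lborel) = A * pi + B * a" for A B
    unfolding a_def Bochner_Integration.integral_add[OF int1 int2] integral_mult_right_zero pk_integral(2)[OF y] ..
  have "a powr p = (\<integral>t. pk y (t - x) / pi * (a powr p + p * a powr (p - 1) * (norm (f t) - a)) \<partial>lborel)"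
    unfolding eq lin by simp
  also have "\<dots> \<le> (\<integral>t. pk y (t - x) / pi * norm (f t) powr p \<partial>lborel)"
  proof (rule integral_mono)
    show "integrable lborel (\<lambda>t. pk y (t - x) / pi * (a powr p + p * a powr (p - 1) * (norm (f t) - a)))"
      unfolding eq by (intro Bochner_Integration.integrable_add int1 int2)
    show "pk y (t - x) / pi * (a powr p + p * a powr (p - 1) * (norm (f t) - a))
        \<le> pk y (t - x) / pi * norm (f t) powr p" for t
      using pk_nonneg[OF y] a0 assms by (intro mult_left_mono power_tangent_le) auto
  qed (rule intp)
  finally have "a powr p \<le> (\<integral>t. pk y (t - x) / pi * norm (f t) powr p \<partial>lborel)" .
  moreover have "norm ((\<integral>t. of_real (pk y (t - x)) * f t \<partial>lborel) / of_real pi) powr p \<le> a powr p"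
    using le assms by (intro powr_mono2) auto
  ultimately have "ennreal (norm ((\<integral>t. of_real (pk y (t - x)) * f t \<partial>lborel) / of_real pi) powr p)
    \<le> ennreal (\<integral>t. pk y (t - x) / pi * norm (f t) powr p \<partial>lborel)"
    by (intro ennreal_leI) linarith
  also have "\<dots> = (\<integral>\<^sup>+t. ennreal (pk y (t - x) / pi * norm (f t) powr p) \<partial>lborel)"
    using pk_nonneg[OF y] by (intro nn_integral_eq_integral[symmetric] intp) auto
  finally show ?thesis .
qed

text \<open>The kernel is symmetric in \<open>x\<close> and \<open>t\<close> and has mass 1 after
  division by \<open>pi\<close>, so Jensen's inequality followed by Fubini gives a
  contraction.\<close>

lemma poisson_contraction:
  assumes "1 < p" and f: "f \<in> Lfun p" and y: "0 < y"
  shows "(\<integral>\<^sup>+x. ennreal (norm ((\<integral>t. of_real (pk y (t - x)) * f t \<partial>lborel) / of_real pi) powr p) \<partial>lborel)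
    \<le> ennreal (pint p f)"
proof -
  note [measurable] = Lfun_measurable[OF f]
  have "(\<integral>\<^sup>+x. ennreal (norm ((\<integral>t. of_real (pk y (t - x)) * f t \<partial>lborel) / of_real pi) powr p) \<partial>lborel)
    \<le> (\<integral>\<^sup>+x. (\<integral>\<^sup>+t. ennreal (pk y (t - x) / pi * norm (f t) powr p) \<partial>lborel) \<partial>lborel)"
    by (intro nn_integral_mono poisson_jensen assms)
  also have "\<dots> = (\<integral>\<^sup>+t. (\<integral>\<^sup>+x. ennreal (pk y (t - x) / pi * norm (f t) powr p) \<partial>lborel) \<partial>lborel)"
    by (rule lborel_pair.Fubini') measurable
  also have "\<dots> = (\<integral>\<^sup>+t. ennreal (norm (f t) powr p) \<partial>lborel)"
  proof (intro nn_integral_cong)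
    fix t
    have sym: "pk y (t - x) = pk y (x - t)" for x by (simp add: pk_def power2_commute)
    have "(\<integral>\<^sup>+x. ennreal (pk y (t - x) / pi * norm (f t) powr p) \<partial>lborel) =
        ennreal (\<integral>x. pk y (x - t) / pi * norm (f t) powr p \<partial>lborel)"
      unfolding sym using pk_nonneg[OF y] pk_integral(1)[OF y, of t]
      by (intro nn_integral_eq_integral) auto
    then show "(\<integral>\<^sup>+x. ennreal (pk y (t - x) / pi * norm (f t) powr p) \<partial>lborel) = ennreal (norm (f t) powr p)"
      using pk_integral[OF y, of t] by simp
  qed
  also have "\<dots> = ennreal (pint p f)"
    unfolding pint_def by (intro nn_integral_eq_integral Lfun_integrable f) auto
  finally show ?thesis .
qed

section \<open>Hardy spaces and Cauchy integrals\<close>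

lemma measurable_on_horizontal_line:
  assumes "F holomorphic_on {z. 0 < Im z}" "0 < y"
  shows "(\<lambda>x. F (Complex x y)) \<in> borel_measurable borel"
  by (intro borel_measurable_continuous_onI
      continuous_on_compose2[OF holomorphic_on_imp_continuous_on[OF assms(1)]])
    (use assms(2) in \<open>auto simp: Complex_eq intro!: continuous_intros\<close>)

text \<open>Cauchy's theorem for a strip. A primitive \<open>P\<close> on the half-plane replaces
  the contour; the vertical side at abscissa \<open>x\<close> is bounded by \<open>J x\<close>, and
  \<open>J\<close> has a finite integral by Fubini. So the vertical sides cannot remain above a
  positive bound for all large \<open>X\<close>, which is enough.\<close>

lemma strip_shift:
  assumes H: "H holomorphic_on {z. 0 < Im z}" and a: "0 < a" "a \<le> b"
    and C: "\<And>y. a \<le> y \<Longrightarrow> y \<le> b \<Longrightarrow> (\<integral>\<^sup>+x. norm (H (Complex x y)) \<partial>lborel) \<le> ennreal C"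
  shows "(\<integral>x. H (Complex x a) \<partial>lborel) = (\<integral>x. H (Complex x b) \<partial>lborel)"
proof -
  let ?S = "{z. 0 < Im z}"
  have b: "0 < b" using a by simp
  have cont: "continuous_on ?S H" using H by (rule holomorphic_on_imp_continuous_on)
  have conv: "convex ?S" and op: "open ?S"
    by (simp_all add: convex_halfspace_Im_gt open_halfspace_Im_gt)
  obtain P where P: "\<And>z. z \<in> ?S \<Longrightarrow> (P has_field_derivative H z) (at z within ?S)"
    using holomorphic_convex_primitive'[OF conv op H] by blast
  have P': "(P has_field_derivative H z) (at z)" if "0 < Im z" for z
    using P[of z] that by (simp add: at_within_open[OF _ op])
  have hor: "((\<lambda>x. H (Complex x y)) has_integral (P (Complex X y) - P (Complex (-X) y))) {-X..X}"
    if "0 < y" "0 \<le> X" for X y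
  proof (rule fundamental_theorem_of_calculus)
    fix x
    have "((P \<circ> (\<lambda>x. Complex x y)) has_vector_derivative 1 * H (Complex x y)) (at x within {-X..X})"
      by (rule field_vector_diff_chain_within)
        (use that in \<open>auto simp: Complex_eq intro!: derivative_eq_intros
            has_field_derivative_at_within[OF P'] has_vector_derivative_real_field\<close>)
    then show "((\<lambda>x. P (Complex x y)) has_vector_derivative H (Complex x y)) (at x within {-X..X})"
      by (simp add: o_def)
  qed (use that in auto)
  have ver: "((\<lambda>y. \<i> * H (Complex x y)) has_integral (P (Complex x b) - P (Complex x a))) {a..b}" for x
  proof (rule fundamental_theorem_of_calculus)
    fix y assume y: "y \<in> {a..b}"
    have "((P \<circ> (\<lambda>y. Complex x y)) has_vector_derivative \<i> * H (Complex x y)) (at y within {a..b})"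
      by (rule field_vector_diff_chain_within)
        (use y a in \<open>auto simp: Complex_eq intro!: derivative_eq_intros
            has_field_derivative_at_within[OF P'] has_vector_derivative_real_field\<close>)
    then show "((\<lambda>y. P (Complex x y)) has_vector_derivative \<i> * H (Complex x y)) (at y within {a..b})"
      by (simp add: o_def)
  qed (use a in auto)
  \<comment> \<open>\<open>H\<close> is known to be continuous only in the open half-plane; cutting
    off to the closed strip inside it gives a Borel function on the whole plane.\<close>
  have ms: "(\<lambda>z. indicator {z. Im z \<in> {a..b}} z *\<^sub>R H z) \<in> borel_measurable borel"
  proof (rule borel_measurable_continuous_on_indicator)
    have "{z. Im z \<in> {a..b}} = {z. a \<le> Im z} \<inter> {z. Im z \<le> b}" by auto
    then show "{z. Im z \<in> {a..b}} \<in> sets borel"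
      by (simp add: borel_closed closed_halfspace_Im_ge closed_halfspace_Im_le closed_Int)
    show "continuous_on {z. Im z \<in> {a..b}} H"
      by (rule continuous_on_subset[OF cont]) (use a in auto)
  qed
  define G where "G x y = ennreal (norm (indicator {z. Im z \<in> {a..b}} (Complex x y) *\<^sub>R H (Complex x y)))" for x y
  have Geq: "G x y = ennreal (norm (H (Complex x y))) * indicator {a..b} y" for x y
    by (auto simp: G_def indicator_def)
  have G_meas [measurable]: "case_prod G \<in> borel_measurable (lborel \<Otimes>\<^sub>M lborel)"
  proof -
    have [measurable]: "(\<lambda>(x, y). Complex x y) \<in> borel \<rightarrow>\<^sub>M borel"
      unfolding Complex_eq case_prod_beta
      by (intro borel_measurable_continuous_onI continuous_intros)
    have "(\<lambda>w. ennreal (norm (indicator {z. Im z \<in> {a..b}} (case w of (x, y) \<Rightarrow> Complex x y)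
        *\<^sub>R H (case w of (x, y) \<Rightarrow> Complex x y)))) \<in> borel_measurable borel"
      by (rule measurable_compose[OF measurable_compose[OF _ ms]]) measurable
    moreover have "case_prod G = (\<lambda>w. ennreal (norm (indicator {z. Im z \<in> {a..b}} (case w of (x, y) \<Rightarrow> Complex x y)
        *\<^sub>R H (case w of (x, y) \<Rightarrow> Complex x y))))"
      by (simp only: fun_eq_iff split_paired_All G_def prod.case) simp
    ultimately show ?thesis by (simp only: lborel_prod measurable_lborel1 measurable_lborel2)
  qed
  define J where "J x = (\<integral>\<^sup>+y. G x y \<partial>lborel)" for x
  have J_meas [measurable]: "J \<in> borel_measurable borel"
    unfolding J_def by measurable
  have "(\<integral>\<^sup>+x. J x \<partial>lborel) = (\<integral>\<^sup>+y. (\<integral>\<^sup>+x. G x y \<partial>lborel) \<partial>lborel)"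
    unfolding J_def by (rule lborel_pair.Fubini'[symmetric]) measurable
  also have "\<dots> \<le> (\<integral>\<^sup>+y. ennreal C * indicator {a..b} y \<partial>lborel)"
    using C by (intro nn_integral_mono) (auto simp: Geq indicator_def)
  also have "\<dots> < \<infinity>" using a by (simp add: nn_integral_cmult_indicator ennreal_mult_less_top)
  finally have Jfin: "(\<integral>\<^sup>+x. J x \<partial>lborel) < \<infinity>" .
  have vbound: "ennreal (norm (P (Complex x b) - P (Complex x a))) \<le> J x" for x
  proof -
    have c: "continuous_on {a..b} (\<lambda>y. \<i> * H (Complex x y))"
      by (intro continuous_intros continuous_on_compose2[OF cont])
        (use a in \<open>auto simp: Complex_eq intro!: continuous_intros\<close>)
    note si = borel_integrable_atLeastAtMost'[OF c]
    have "P (Complex x b) - P (Complex x a) = (LINT y:{a..b}|lborel. \<i> * H (Complex x y))"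
      unfolding set_borel_integral_eq_integral(2)[OF si] by (rule integral_unique[OF ver, symmetric])
    then have "ennreal (norm (P (Complex x b) - P (Complex x a)))
        \<le> (\<integral>\<^sup>+y. norm (indicator {a..b} y *\<^sub>R (\<i> * H (Complex x y))) \<partial>lborel)"
      unfolding set_lebesgue_integral_def
      using integral_norm_bound_ennreal[OF si[unfolded set_integrable_def]] by simp
    also have "\<dots> = J x"
      unfolding J_def Geq by (intro nn_integral_cong) (auto simp: indicator_def norm_mult)
    finally show ?thesis .
  qed
  have intH: "integrable lborel (\<lambda>x. H (Complex x y))" if "a \<le> y" "y \<le> b" for y
  proof (rule integrableI_bounded)
    show "(\<lambda>x. H (Complex x y)) \<in> borel_measurable lborel"
      using measurable_on_horizontal_line[OF H, of y] a that by simp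
    show "(\<integral>\<^sup>+x. ennreal (norm (H (Complex x y))) \<partial>lborel) < \<infinity>"
      using le_less_trans[OF C[OF that] ennreal_less_top] by simp
  qed
  have lim: "((\<lambda>X. P (Complex X y) - P (Complex (-X) y)) \<longlongrightarrow> (\<integral>x. H (Complex x y) \<partial>lborel)) at_top"
    if y: "a \<le> y" "y \<le> b" for y
  proof -
    have y0: "0 < y" using a y by simp
    have "((\<lambda>X. \<integral>x. indicator {-X..X} x *\<^sub>R H (Complex x y) \<partial>lborel) \<longlongrightarrow> (\<integral>x. H (Complex x y) \<partial>lborel)) at_top"
    proof (rule integral_dominated_convergence_at_top[where w = "\<lambda>x. norm (H (Complex x y))"])
      show "AE x in lborel. ((\<lambda>X. indicator {-X..X} x *\<^sub>R H (Complex x y)) \<longlongrightarrow> H (Complex x y)) at_top"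
      proof (rule AE_I2)
        fix x :: real
        have "\<forall>\<^sub>F X in at_top. indicator {-X..X} x *\<^sub>R H (Complex x y) = H (Complex x y)"
          using eventually_ge_at_top[of "\<bar>x\<bar>"] by eventually_elim (auto simp: indicator_def abs_le_iff)
        then show "((\<lambda>X. indicator {-X..X} x *\<^sub>R H (Complex x y)) \<longlongrightarrow> H (Complex x y)) at_top"
          by (rule tendsto_eventually)
      qed
    qed (use intH[OF y] measurable_on_horizontal_line[OF H y0] in \<open>auto simp: indicator_def\<close>)
    moreover have "\<forall>\<^sub>F X in at_top. (\<integral>x. indicator {-X..X} x *\<^sub>R H (Complex x y) \<partial>lborel) =
        P (Complex X y) - P (Complex (-X) y)"
      using eventually_ge_at_top[of 0]
    proof eventually_elim
      case (elim X)
      have c: "continuous_on {-X..X} (\<lambda>x. H (Complex x y))"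
        by (intro continuous_intros continuous_on_compose2[OF cont])
          (use y0 in \<open>auto simp: Complex_eq intro!: continuous_intros\<close>)
      show ?case
        using set_borel_integral_eq_integral(2)[OF borel_integrable_atLeastAtMost'[OF c]]
          integral_unique[OF hor[OF y0 elim]] by (simp add: set_lebesgue_integral_def)
    qed
    ultimately show ?thesis by (rule Lim_transform_eventually)
  qed
  let ?L = "(\<integral>x. H (Complex x b) \<partial>lborel) - (\<integral>x. H (Complex x a) \<partial>lborel)"
  show ?thesis
  proof (rule ccontr)
    assume neq: "\<not> ?thesis"
    \<comment> \<open>Different line integrals would force \<open>e \<le> J X + J (- X)\<close> for
      all large \<open>X\<close>, against the finite integral of \<open>J\<close>.\<close>
    define e where "e = norm ?L / 2"
    have e: "0 < e" "e < norm ?L" using neq by (auto simp: e_def)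
    have "((\<lambda>X. norm ((P (Complex X b) - P (Complex (-X) b)) - (P (Complex X a) - P (Complex (-X) a)))) \<longlongrightarrow> norm ?L) at_top"
      by (intro tendsto_intros lim) (use a in auto)
    then have "\<forall>\<^sub>F X in at_top. e < norm ((P (Complex X b) - P (Complex (-X) b)) - (P (Complex X a) - P (Complex (-X) a)))"
      using e by (intro order_tendstoD)
    then obtain X0 where X0: "\<And>X. X \<ge> X0 \<Longrightarrow> e < norm ((P (Complex X b) - P (Complex (-X) b)) - (P (Complex X a) - P (Complex (-X) a)))"
      by (auto simp: eventually_at_top_linorder)
    have "ennreal e \<le> J X + J (- X)" if "X \<ge> X0" for X
    proof -
      have "e \<le> norm (P (Complex X b) - P (Complex X a)) + norm (P (Complex (-X) b) - P (Complex (-X) a))"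
        using X0[OF that] norm_triangle_ineq4[of "P (Complex X b) - P (Complex X a)" "P (Complex (-X) b) - P (Complex (-X) a)"]
        by (simp add: algebra_simps)
      then have "ennreal e \<le> ennreal (norm (P (Complex X b) - P (Complex X a))) + ennreal (norm (P (Complex (-X) b) - P (Complex (-X) a)))"
        by (simp flip: ennreal_plus add: ennreal_leI)
      also have "\<dots> \<le> J X + J (- X)" by (intro add_mono vbound)
      finally show ?thesis .
    qed
    then have "(\<integral>\<^sup>+x. ennreal e * indicator {X0..} x \<partial>lborel) \<le> (\<integral>\<^sup>+x. J x + J (- x) \<partial>lborel)"
      by (intro nn_integral_mono) (auto simp: indicator_def)
    also have "\<dots> = 2 * (\<integral>\<^sup>+x. J x \<partial>lborel)"
      using nn_integral_real_affine[of J "-1" 0] by (simp add: nn_integral_add mult_2)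
    also have "\<dots> < \<infinity>" using Jfin by (simp add: ennreal_mult_less_top)
    finally have "(\<integral>\<^sup>+x. ennreal e * indicator {X0..} x \<partial>lborel) < \<infinity>" .
    moreover have "(\<integral>\<^sup>+x. ennreal e * indicator {X0..} x \<partial>lborel) = \<infinity>"
    proof -
      have "ennreal e * of_nat n \<le> (\<integral>\<^sup>+x. ennreal e * indicator {X0..} x \<partial>lborel)" for n
      proof -
        have "(\<integral>\<^sup>+x. ennreal e * indicator {X0..X0 + n} x \<partial>lborel) \<le> (\<integral>\<^sup>+x. ennreal e * indicator {X0..} x \<partial>lborel)"
          by (intro nn_integral_mono) (auto simp: indicator_def)
        then show ?thesis by (simp add: nn_integral_cmult_indicator ennreal_of_nat_eq_real_of_nat)
      qed
      then have "ennreal (e * n) \<le> (\<integral>\<^sup>+x. ennreal e * indicator {X0..} x \<partial>lborel)" for n :: nat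
        using e by (simp add: ennreal_mult ennreal_of_nat_eq_real_of_nat)
      show ?thesis
      proof (rule ccontr)
        assume "\<not> ?thesis"
        then obtain B where B: "(\<integral>\<^sup>+x. ennreal e * indicator {X0..} x \<partial>lborel) = ennreal B" "0 \<le> B"
          by (metis ennreal_cases infinity_ennreal_def)
        obtain n :: nat where "B / e < n" using reals_Archimedean2 by blast
        moreover have "e * n \<le> B" using \<open>\<And>n. ennreal (e * real n) \<le> _\<close>[of n] B by simp
        ultimately show False using e by (simp add: field_simps)
      qed
    qed
    ultimately show False by simp
  qed
qed

lemma norm_inverse_le:
  fixes u v :: complex
  assumes "0 < norm v" "norm v \<le> norm u"
  shows "norm (1 / u) \<le> norm (1 / v)"
  using assms by (auto simp: norm_divide intro!: frac_le)

section \<open>Boundary values of Hardy functions\<close>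

lemma nt_limit_vertical:
  assumes "nt_limit 1 F x l" and a: "\<And>n. 0 < a n" "a \<longlonglongrightarrow> 0"
  shows "(\<lambda>n. F (Complex x (a n))) \<longlonglongrightarrow> l"
proof -
  have "(F \<longlongrightarrow> l) (at (complex_of_real x) within nt_region 1 1 x)"
    using assms(1) by (simp add: nt_limit_def)
  moreover have "filterlim (\<lambda>n. Complex x (a n)) (at (complex_of_real x) within nt_region 1 1 x) sequentially"
    unfolding filterlim_at
  proof
    show "\<forall>\<^sub>F n in sequentially. Complex x (a n) \<in> nt_region 1 1 x \<and> Complex x (a n) \<noteq> complex_of_real x"
      using a(1) by (intro always_eventually) (auto simp: nt_region_def complex_eq_iff less_imp_neq[symmetric])
    have "(\<lambda>n. of_real x + \<i> * of_real (a n)) \<longlonglongrightarrow> of_real x + \<i> * of_real 0"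
      by (intro tendsto_intros a)
    then show "(\<lambda>n. Complex x (a n)) \<longlonglongrightarrow> complex_of_real x" by (simp add: Complex_eq)
  qed
  ultimately show ?thesis by (rule filterlim_compose)
qed

lemma hardy_fun_bound:
  assumes F: "F \<in> hardy_fun 1 p" 
  obtains C where "0 \<le> C" "\<And>y. 0 < y \<Longrightarrow> (\<lambda>x. F (Complex x y)) \<in> Lfun p"
    "\<And>y. 0 < y \<Longrightarrow> pint p (\<lambda>x. F (Complex x y)) \<le> C"
proof -
  have hol: "F holomorphic_on {z. 0 < Im z}" using F by (simp add: hardy_fun_def half_plane_def)
  let ?s = "SUP y\<in>{0<..}. \<integral>\<^sup>+x. ennreal (norm (F (Complex x y)) powr p) \<partial>lborel"
  have s: "?s < \<infinity>" using F by (simp add: hardy_fun_def nn_integral_completion)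
  define C where "C = enn2real ?s"
  have le: "(\<integral>\<^sup>+x. ennreal (norm (F (Complex x y)) powr p) \<partial>lborel) \<le> ennreal C" if "0 < y" for y
    unfolding C_def using s that by (subst ennreal_enn2real) (auto intro: SUP_upper)
  have C0: "0 \<le> C" by (simp add: C_def)
  have int: "integrable lborel (\<lambda>x. norm (F (Complex x y)) powr p)" if "0 < y" for y
    by (rule integrableI_bounded)
      (use le_less_trans[OF le[OF that] ennreal_less_top] measurable_on_horizontal_line[OF hol that] in auto)
  show ?thesis
  proof (rule that[OF C0])
    fix y :: real assume y: "0 < y"
    show "(\<lambda>x. F (Complex x y)) \<in> Lfun p"
      by (rule LfunI[OF measurable_on_horizontal_line[OF hol y] int[OF y]])
    have "ennreal (pint p (\<lambda>x. F (Complex x y))) \<le> ennreal C"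
      using le[OF y] nn_integral_eq_integral[OF int[OF y]] by (simp add: pint_def)
    then show "pint p (\<lambda>x. F (Complex x y)) \<le> C" using C0 by simp
  qed
qed

text \<open>Line integrals that do not depend on the height are later shown to vanish by pushing the
  pole to infinity; the kernels are dominated by the one with pole \<open>w\<close>.\<close>

lemma cauchy_kernel_tendsto_0:
  assumes "1 < q" and w: "Im w < 0"
  shows "(\<lambda>n. pint q (\<lambda>x. 1 / (complex_of_real x - (w - \<i> * of_nat n)))) \<longlonglongrightarrow> 0"
proof -
  have "Lconv q (\<lambda>n x. 1 / (complex_of_real x - (w - \<i> * of_nat n))) (\<lambda>x. 0)"
  proof (rule Lconv_dominated[OF _ Lfun_cauchy_kernel[OF \<open>1 < q\<close>, of w]])
    show "AE x in lborel. (\<lambda>n. 1 / (complex_of_real x - (w - \<i> * of_nat n))) \<longlonglongrightarrow> 0"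
    proof (rule AE_I2)
      fix x :: real
      show "(\<lambda>n. 1 / (complex_of_real x - (w - \<i> * of_nat n))) \<longlonglongrightarrow> 0"
      proof (rule Lim_null_comparison)
        show "(\<lambda>n. 1 / (real n - Im w)) \<longlonglongrightarrow> 0" by real_asymp
        show "\<forall>\<^sub>F n in sequentially. norm (1 / (complex_of_real x - (w - \<i> * of_nat n))) \<le> 1 / (real n - Im w)"
        proof (rule always_eventually, rule allI)
          fix n
          show "norm (1 / (complex_of_real x - (w - \<i> * of_nat n))) \<le> 1 / (real n - Im w)"
            using abs_Im_le_cmod[of "complex_of_real x - (w - \<i> * of_nat n)"] w
              norm_inverse_le[of "of_real (real n - Im w)" "complex_of_real x - (w - \<i> * of_nat n)"]
            by (simp add: norm_divide del: of_real_diff)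
        qed
      qed
    qed
    show "AE x in lborel. norm (1 / (complex_of_real x - (w - \<i> * of_nat n))) \<le> norm (1 / (complex_of_real x - w))" for n
    proof (rule AE_I2)
      fix x :: real
      have "(norm (complex_of_real x - w))\<^sup>2 \<le> (norm (complex_of_real x - (w - \<i> * of_nat n)))\<^sup>2"
        unfolding cmod_power2 using w power_mono[of "- Im w" "real n - Im w" 2] by simp
      then have "norm (complex_of_real x - w) \<le> norm (complex_of_real x - (w - \<i> * of_nat n))"
        using power2_le_imp_le norm_ge_zero by blast
      moreover have "0 < norm (complex_of_real x - w)" using w of_real_minus_neq[of w x] by simp
      ultimately show "norm (1 / (complex_of_real x - (w - \<i> * of_nat n))) \<le> norm (1 / (complex_of_real x - w))"
        by (intro norm_inverse_le)
    qed
  qed (use assms in auto)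
  then show ?thesis by (simp add: Lconv_def)
qed

text \<open>\<open>F z / (z - w)\<close> is holomorphic in the upper half-plane, so its line
  integrals do not depend on the height; along high lines \<open>F\<close> keeps its bound while the
  kernel tends to zero. Writing the line at height \<open>a\<close> with a real variable moves the
  pole to \<open>w - \<i> * of_real a\<close>, which explains the form of the statement.\<close>

lemma hardy_KI_zero_line:
  assumes "1 < p" and F: "F \<in> hardy_fun 1 p" and a: "0 < a" and w: "Im w < 0"
  shows "KI (\<lambda>x. F (Complex x a)) (w - \<i> * of_real a) = 0"
proof -
  let ?q = "conj_exp p"
  have q: "1 < ?q" "conj_exp ?q = p" using conj_exp_facts[OF assms(1)] by auto
  have hol: "F holomorphic_on {z. 0 < Im z}" using F by (simp add: hardy_fun_def half_plane_def)
  obtain C where C: "0 \<le> C" "\<And>y. 0 < y \<Longrightarrow> (\<lambda>x. F (Complex x y)) \<in> Lfun p"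
    "\<And>y. 0 < y \<Longrightarrow> pint p (\<lambda>x. F (Complex x y)) \<le> C"
    using hardy_fun_bound[OF F] by blast
  let ?H = "\<lambda>z. F z / (z - w)"
  let ?k = "\<lambda>y x. 1 / (complex_of_real x - (w - \<i> * of_real y))"
  have Heq: "?H (Complex x y) = F (Complex x y) * ?k y x" for x y
    by (simp add: Complex_eq algebra_simps)
  have imk: "Im (w - \<i> * of_real y) \<noteq> 0" if "0 < y" for y using w that by simp
  have kL: "?k y \<in> Lfun ?q" if "0 < y" for y by (intro Lfun_cauchy_kernel q imk that)
  have kle: "pint ?q (?k y) \<le> pint ?q (\<lambda>x. 1 / (complex_of_real x - w))" if "0 < y" for y
  proof -
    have "pint ?q (?k y) \<le> 1 powr ?q * pint ?q (\<lambda>x. 1 / (complex_of_real x - w))"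
    proof (rule Lfun_bounded_by(2))
      show "AE x in lborel. norm (?k y x) \<le> 1 * norm (1 / (complex_of_real x - w))"
      proof (rule AE_I2)
        fix x :: real
        have "(norm (complex_of_real x - w))\<^sup>2 \<le> (norm (complex_of_real x - (w - \<i> * of_real y)))\<^sup>2"
          unfolding cmod_power2 using w that power_mono[of "- Im w" "y - Im w" 2] by simp
        then have "norm (complex_of_real x - w) \<le> norm (complex_of_real x - (w - \<i> * of_real y))"
          using power2_le_imp_le norm_ge_zero by blast
        moreover have "0 < norm (complex_of_real x - w)" using w of_real_minus_neq[of w x] by simp
        ultimately show "norm (?k y x) \<le> 1 * norm (1 / (complex_of_real x - w))"
          unfolding mult_1 by (intro norm_inverse_le)
      qed
    qed (use q w Lfun_cauchy_kernel in auto)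
    then show ?thesis by simp
  qed
  have shift: "(\<integral>x. ?H (Complex x a) \<partial>lborel) = (\<integral>x. ?H (Complex x b) \<partial>lborel)" if "a \<le> b" for b
  proof (rule strip_shift[OF _ a that, where C = "C + pint ?q (\<lambda>x. 1 / (complex_of_real x - w))"])
    show "?H holomorphic_on {z. 0 < Im z}"
      using hol w by (intro holomorphic_intros) auto
    fix y assume "a \<le> y" "y \<le> b"
    then have y: "0 < y" using a by simp
    have "(\<integral>\<^sup>+x. norm (?H (Complex x y)) \<partial>lborel) = ennreal (\<integral>x. norm (F (Complex x y) * ?k y x) \<partial>lborel)"
      unfolding Heq by (intro nn_integral_eq_integral integrable_norm Lfun_mult_integrable[OF assms(1) C(2) kL] y) auto
    also have "\<dots> \<le> ennreal (pint p (\<lambda>x. F (Complex x y)) + pint ?q (?k y))"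
      by (intro ennreal_leI Lfun_mult_integrable(2)[OF assms(1) C(2) kL] y)
    also have "\<dots> \<le> ennreal (C + pint ?q (\<lambda>x. 1 / (complex_of_real x - w)))"
      using C(3)[OF y] kle[OF y] by (intro ennreal_leI) linarith
    finally show "(\<integral>\<^sup>+x. norm (?H (Complex x y)) \<partial>lborel) \<le> ennreal (C + pint ?q (\<lambda>x. 1 / (complex_of_real x - w)))" .
  qed
  have KI_eq: "KI (\<lambda>x. F (Complex x y)) (w - \<i> * of_real y) = (\<integral>x. ?H (Complex x y) \<partial>lborel)" for y
    unfolding KI_def Heq by simp
  let ?I = "norm (KI (\<lambda>x. F (Complex x a)) (w - \<i> * of_real a))"
  have "(\<lambda>n::nat. ?I) \<longlonglongrightarrow> 0"
  proof (rule tendsto_0_from_scaled_bound[OF _ q(1) C(1)])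
    let ?w = "w - \<i> * of_real a"
    show "(\<lambda>n. pint ?q (\<lambda>x. 1 / (complex_of_real x - (?w - \<i> * of_nat n)))) \<longlonglongrightarrow> 0"
      by (rule cauchy_kernel_tendsto_0[OF q(1)]) (use w a in simp)
    fix n :: nat and c :: real assume c: "0 < c"
    have y: "0 < a + n" using a by simp
    have "KI (\<lambda>x. F (Complex x a)) ?w = (\<integral>x. ?k (a + n) x * F (Complex x (a + n)) \<partial>lborel)"
      unfolding KI_eq using shift[of "a + n"] unfolding Heq by (simp add: mult.commute)
    then have "?I \<le> c powr ?q * pint ?q (?k (a + n)) + c powr (- conj_exp ?q) * pint (conj_exp ?q) (\<lambda>x. F (Complex x (a + n)))"
      using Young_scaled[OF q(1) kL[OF y] _ c, of "\<lambda>x. F (Complex x (a + n))"] C(2)[OF y] by (simp add: q)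
    also have "\<dots> \<le> c powr ?q * pint ?q (?k (a + n)) + c powr (- conj_exp ?q) * C"
      using C(3)[OF y] by (intro add_left_mono mult_left_mono) (auto simp: q)
    also have "?k (a + n) = (\<lambda>x. 1 / (complex_of_real x - (?w - \<i> * of_nat n)))"
      by (simp add: fun_eq_iff algebra_simps)
    finally show "\<bar>?I\<bar> \<le> c powr ?q * pint ?q (\<lambda>x. 1 / (complex_of_real x - (?w - \<i> * of_nat n))) + c powr (- conj_exp ?q) * C"
      by simp
  qed
  then show ?thesis by (simp add: LIMSEQ_const_iff)
qed

text \<open>On lines approaching the real axis there is a uniform bound and convergence almost
  everywhere, but no convergence in mean yet. Weak convergence suffices because the kernel lies in
  the dual space.\<close>

lemma hardy_boundary_KI_zero:
  assumes "1 < p" and F: "F \<in> hardy_fun 1 p" and f: "f \<in> Lfun p"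
    and nt: "AE x in lborel. nt_limit 1 F x (f x)" and w: "Im w < 0"
  shows "KI f w = 0"
proof -
  let ?q = "conj_exp p"
  have q: "1 < ?q" using conj_exp_facts[OF assms(1)] by auto
  obtain C where C: "0 \<le> C" "\<And>y. 0 < y \<Longrightarrow> (\<lambda>x. F (Complex x y)) \<in> Lfun p"
    "\<And>y. 0 < y \<Longrightarrow> pint p (\<lambda>x. F (Complex x y)) \<le> C"
    using hardy_fun_bound[OF F] by blast
  \<comment> \<open>The summand 2 gives \<open>a n < - Im w\<close> from \<open>n = 0\<close> on, so
    that \<open>w + \<i> * of_real (a n)\<close> stays in the lower half-plane.\<close>
  define a where "a n = - Im w / real (n + 2)" for n
  have a: "0 < a n" for n using w by (simp add: a_def divide_neg_pos)
  have alim: "a \<longlonglongrightarrow> 0" unfolding a_def by real_asymp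
  have aw: "a n < - Im w" for n
  proof -
    have "- Im w / real (n + 2) < - Im w / 1"
      by (rule divide_strict_left_mono) (use w in auto)
    then show ?thesis by (simp add: a_def)
  qed
  have "(\<lambda>n. \<integral>x. F (Complex x (a n)) * (1 / (complex_of_real x - w)) \<partial>lborel) \<longlonglongrightarrow>
      (\<integral>x. f x * (1 / (complex_of_real x - w)) \<partial>lborel)"
  proof (rule weak_conv_bounded_AE[OF assms(1) C(2)[OF a] C(3)[OF a] f])
    show "AE x in lborel. (\<lambda>n. F (Complex x (a n))) \<longlonglongrightarrow> f x"
      using nt by eventually_elim (rule nt_limit_vertical[OF _ a alim])
    show "(\<lambda>x. 1 / (complex_of_real x - w)) \<in> Lfun ?q" using w by (intro Lfun_cauchy_kernel q) auto
  qed
  moreover have "(\<integral>x. F (Complex x (a n)) * (1 / (complex_of_real x - w)) \<partial>lborel) = 0" for n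
  proof -
    have "KI (\<lambda>x. F (Complex x (a n))) ((w + \<i> * of_real (a n)) - \<i> * of_real (a n)) = 0"
      by (rule hardy_KI_zero_line[OF assms(1) F a]) (use aw[of n] in simp)
    then show ?thesis by (simp add: KI_def)
  qed
  ultimately show ?thesis by (simp add: KI_def LIMSEQ_const_iff)
qed

text \<open>If the Cauchy integral vanishes below the real line, the jump formula makes it, divided
  by \<open>2 * pi * \<i>\<close>, the Poisson integral of \<open>f\<close> above. Contraction and
  nontangential convergence of Poisson integrals do the rest.\<close>

lemma hardy_fun_from_KI:
  assumes "1 < p" and f: "f \<in> Lfun p" and z: "\<And>w. Im w < 0 \<Longrightarrow> KI f w = 0"
  shows "(\<lambda>z. KI f z / (2 * of_real pi * \<i>)) \<in> hardy_fun 1 p"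
    "AE x in lborel. nt_limit 1 (\<lambda>z. KI f z / (2 * of_real pi * \<i>)) x (f x)"
proof -
  have eq: "KI f z / (2 * of_real pi * \<i>) = (\<integral>t. of_real (pk (Im z) (t - Re z)) * f t \<partial>lborel) / of_real pi"
    if "0 < Im z" for z
    using KI_diff_cnj[OF assms(1,2) that] z[of "cnj z"] that by (simp add: field_simps)
  have "(SUP y\<in>{0<..}. \<integral>\<^sup>+ x. ennreal (norm (KI f (Complex x (1 * y)) / (2 * of_real pi * \<i>)) powr p) \<partial>lebesgue)
      \<le> ennreal (pint p f)"
  proof (rule SUP_least)
    fix y :: real assume "y \<in> {0<..}"
    then have y: "0 < y" by simp
    show "(\<integral>\<^sup>+ x. ennreal (norm (KI f (Complex x (1 * y)) / (2 * of_real pi * \<i>)) powr p) \<partial>lebesgue) \<le> ennreal (pint p f)"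
      using poisson_contraction[OF assms(1,2) y] y by (simp add: nn_integral_completion eq)
  qed
  from le_less_trans[OF this ennreal_less_top]
  show "(\<lambda>z. KI f z / (2 * of_real pi * \<i>)) \<in> hardy_fun 1 p"
    unfolding hardy_fun_def half_plane_def
    by (auto intro!: holomorphic_intros KI_holomorphic[OF assms(1,2)])
  show "AE x in lborel. nt_limit 1 (\<lambda>z. KI f z / (2 * of_real pi * \<i>)) x (f x)"
    using AE_lebesgue_point[OF assms(1,2)]
  proof eventually_elim
    case (elim x)
    have N: "nt_limit 1 (\<lambda>z. (KI f z - KI f (cnj z)) / (2 * of_real pi * \<i>)) x (f x)"
      by (rule poisson_nt_limit[OF assms(1,2) elim])
    have E: "\<forall>\<^sub>F z in at (complex_of_real x) within nt_region 1 a x.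
        (KI f z - KI f (cnj z)) / (2 * of_real pi * \<i>) = KI f z / (2 * of_real pi * \<i>)" if "0 < a" for a
    proof -
      have "0 < Im z" if "z \<in> nt_region 1 a x" for z
      proof -
        have "0 < a * Im z" using that unfolding nt_region_def by auto
        then show ?thesis using \<open>0 < a\<close> by (simp add: zero_less_mult_iff)
      qed
      then show ?thesis using z by (auto simp: eventually_at_filter)
    qed
    show ?case
      unfolding nt_limit_def
    proof (intro allI impI)
      fix a :: real assume a: "0 < a"
      show "((\<lambda>z. KI f z / (2 * of_real pi * \<i>)) \<longlongrightarrow> f x) (at (complex_of_real x) within nt_region 1 a x)"
        by (rule Lim_transform_eventually[OF N[unfolded nt_limit_def, rule_format, OF a] E[OF a]])
    qed
  qed
qed

text \<open>The half sum of the Cauchy integrals at \<open>x \<plusminus> \<i> e\<close> has the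
  kernel \<open>s / (s^2 + e^2)\<close> with \<open>s = t - x\<close>, a smoothed
  \<open>1 / s\<close>. Its difference \<open>d\<close> from the truncated kernel is odd, so that
  \<open>f x\<close> may be subtracted from \<open>f\<close>, and is bounded by \<open>pk e\<close>,
  so that the Lebesgue point property applies.\<close>

lemma truncated_cauchy_integral:
  assumes "1 < p" and f: "f \<in> Lfun p" and x: "lebesgue_point f x"
  shows "((\<lambda>e. (LINT t:{t. e < \<bar>t - x\<bar>}|lborel. f t / of_real (t - x)) -
      (KI f (Complex x e) + KI f (Complex x (- e))) / 2) \<longlongrightarrow> 0) (at_right 0)"
proof (rule Lim_null_comparison[OF _ lebesgue_point_poisson[OF assms]])
  note [measurable] = Lfun_measurable[OF f]
  have "\<forall>\<^sub>F e :: real in at_right 0. 0 < e" by (simp add: eventually_at_right_less)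
  then show "\<forall>\<^sub>F e in at_right 0. norm ((LINT t:{t. e < \<bar>t - x\<bar>}|lborel. f t / of_real (t - x)) -
      (KI f (Complex x e) + KI f (Complex x (- e))) / 2) \<le> (\<integral>t. pk e (t - x) * norm (f t - f x) \<partial>lborel)"
  proof eventually_elim
    case (elim e)
    define d where "d s = (if e < \<bar>s\<bar> then 1 / s else 0) - s / (s\<^sup>2 + e\<^sup>2)" for s
    have [measurable]: "d \<in> borel_measurable borel" unfolding d_def by measurable
    have pos: "0 < s\<^sup>2 + e\<^sup>2" for s using elim by (auto intro: add_nonneg_pos)
    have dle: "\<bar>d s\<bar> \<le> pk e s" for s
    proof (cases "e < \<bar>s\<bar>")
      case True
      then have s: "s \<noteq> 0" using elim by auto
      have "d s = e\<^sup>2 / (s * (s\<^sup>2 + e\<^sup>2))"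
        using True s pos[of s] by (simp add: d_def field_simps power2_eq_square)
      then have "\<bar>d s\<bar> = pk e s * (e / \<bar>s\<bar>)"
        using elim pos[of s] by (simp add: abs_mult pk_def power2_eq_square)
      also have "\<dots> \<le> pk e s * 1"
        using True elim s by (intro mult_left_mono pk_nonneg) (auto simp: divide_le_eq)
      finally show ?thesis by simp
    next
      case False
      then have "\<bar>d s\<bar> = \<bar>s\<bar> / (s\<^sup>2 + e\<^sup>2)" using pos[of s] by (simp add: d_def)
      also have "\<dots> \<le> e / (s\<^sup>2 + e\<^sup>2)" using False pos[of s] by (intro divide_right_mono) auto
      finally show ?thesis by (simp add: pk_def)
    qed
    have dint: "integrable lborel (\<lambda>t. d (t - x))"
      by (rule Bochner_Integration.integrable_bound[OF pk_integral(1)[OF elim, of x]])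
        (use dle pk_nonneg[OF elim] in auto)
    have dodd: "d (- s) = - d s" for s by (simp add: d_def)
    have d0: "(\<integral>t. d (t - x) \<partial>lborel) = 0"
    proof -
      have "(\<integral>t. d (t - x) \<partial>lborel) = (\<integral>t. d (- (t - x)) \<partial>lborel)"
        using lborel_integral_real_affine[of "-1" "\<lambda>t. d (t - x)" "2 * x"] by (simp add: algebra_simps)
      also have "\<dots> = - (\<integral>t. d (t - x) \<partial>lborel)" unfolding dodd by simp
      finally show ?thesis by simp
    qed
    have dfint: "integrable lborel (\<lambda>t. of_real (d (t - x)) * f t)"
      by (rule Bochner_Integration.integrable_bound[OF pk_mult_integrable(1)[OF assms(1,2) elim, of x]])
        (use dle pk_nonneg[OF elim] in \<open>auto simp: norm_mult intro!: mult_right_mono\<close>)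
    have ker: "f t / (complex_of_real t - Complex x e) + f t / (complex_of_real t - Complex x (- e))
        = 2 * (of_real ((t - x) / ((t - x)\<^sup>2 + e\<^sup>2)) * f t)" for t
    proof -
      let ?u = "complex_of_real t - Complex x e" and ?v = "complex_of_real t - Complex x (- e)"
      have nz: "?u \<noteq> 0" "?v \<noteq> 0" using elim by (auto simp: complex_eq_iff)
      have uv: "?u * ?v = of_real ((t - x)\<^sup>2 + e\<^sup>2)" "?u + ?v = of_real (2 * (t - x))"
        by (simp_all add: complex_eq_iff power2_eq_square algebra_simps)
      have "f t / ?u + f t / ?v = f t * ((?u + ?v) / (?u * ?v))"
        using nz by (simp add: field_simps)
      also have "\<dots> = 2 * (of_real ((t - x) / ((t - x)\<^sup>2 + e\<^sup>2)) * f t)" unfolding uv by simp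
      finally show ?thesis .
    qed
    have K: "integrable lborel (\<lambda>t. f t / (complex_of_real t - Complex x e))"
      "integrable lborel (\<lambda>t. f t / (complex_of_real t - Complex x (- e)))"
      using elim by (intro KI_integrable[OF assms(1,2)]; simp)+
    have kint: "integrable lborel (\<lambda>t. of_real ((t - x) / ((t - x)\<^sup>2 + e\<^sup>2)) * f t)"
    proof -
      have half: "(\<lambda>t. (1 / 2) * (f t / (complex_of_real t - Complex x e) + f t / (complex_of_real t - Complex x (- e)))) =
          (\<lambda>t. of_real ((t - x) / ((t - x)\<^sup>2 + e\<^sup>2)) * f t)"
        unfolding ker by simp
      show ?thesis unfolding half[symmetric]
        by (intro integrable_mult_right Bochner_Integration.integrable_add K)
    qed
    have KIeq: "(KI f (Complex x e) + KI f (Complex x (- e))) / 2 =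
        (\<integral>t. of_real ((t - x) / ((t - x)\<^sup>2 + e\<^sup>2)) * f t \<partial>lborel)"
    proof -
      have "KI f (Complex x e) + KI f (Complex x (- e)) =
        (\<integral>t. 2 * (of_real ((t - x) / ((t - x)\<^sup>2 + e\<^sup>2)) * f t) \<partial>lborel)"
        unfolding KI_def ker[symmetric] by (rule Bochner_Integration.integral_add[OF K, symmetric])
      then show ?thesis unfolding integral_mult_right_zero by (simp only:) simp
    qed
    have "(LINT t:{t. e < \<bar>t - x\<bar>}|lborel. f t / of_real (t - x)) =
        (\<integral>t. of_real (d (t - x)) * f t + of_real ((t - x) / ((t - x)\<^sup>2 + e\<^sup>2)) * f t \<partial>lborel)"
      unfolding set_lebesgue_integral_def
      by (intro Bochner_Integration.integral_cong refl)
        (auto simp: d_def indicator_def algebra_simps)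
    also have "\<dots> = (\<integral>t. of_real (d (t - x)) * f t \<partial>lborel) + (\<integral>t. of_real ((t - x) / ((t - x)\<^sup>2 + e\<^sup>2)) * f t \<partial>lborel)"
      by (rule Bochner_Integration.integral_add[OF dfint kint])
    finally have "(LINT t:{t. e < \<bar>t - x\<bar>}|lborel. f t / of_real (t - x)) -
      (KI f (Complex x e) + KI f (Complex x (- e))) / 2 = (\<integral>t. of_real (d (t - x)) * f t \<partial>lborel)"
      unfolding KIeq by simp
    also have "\<dots> = (\<integral>t. of_real (d (t - x)) * (f t - f x) \<partial>lborel)"
    proof -
      have "integrable lborel (\<lambda>t. complex_of_real (d (t - x)) * f x)"
        using dint by (intro integrable_mult_left integrable_of_real) auto
      then have "(\<integral>t. of_real (d (t - x)) * (f t - f x) \<partial>lborel) =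
          (\<integral>t. of_real (d (t - x)) * f t \<partial>lborel) - (\<integral>t. of_real (d (t - x)) * f x \<partial>lborel)"
        using dfint by (simp add: right_diff_distrib)
      also have "(\<integral>t. complex_of_real (d (t - x)) * f x \<partial>lborel) = 0" using d0 by simp
      finally show ?thesis by simp
    qed
    also have "norm \<dots> \<le> (\<integral>t. pk e (t - x) * norm (f t - f x) \<partial>lborel)"
      by (intro norm_integral_le pk_mult_integrable[OF assms(1,2) elim])
        (use dle in \<open>auto simp: norm_mult intro!: mult_right_mono\<close>)
    finally show ?case .
  qed
qed

section \<open>The inequality of M. Riesz\<close>

text \<open>At angles near \<open>pi / 2\<close> the power of the cosine gives nothing, but there
  \<open>cos (p * \<theta>)\<close> is negative because \<open>1 < p\<close>, while
  \<open>p \<le> 2\<close> keeps \<open>p * \<theta>\<close> in the range up to \<open>pi\<close>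
  where the cosine decreases. \<open>B\<close> is chosen for the large angles, then \<open>A\<close>
  so large that it compensates for \<open>B\<close> at the small ones.\<close>

lemma cos_powr_inequality:
  assumes "1 < p" "p \<le> 2"
  obtains A B :: real where "0 \<le> A" "0 \<le> B"
    "\<And>\<theta>. \<bar>\<theta>\<bar> \<le> pi / 2 \<Longrightarrow> 1 \<le> A * cos \<theta> powr p - B * cos (p * \<theta>)"
proof -
  \<comment> \<open>Midway between the zero \<open>pi / (2 * p)\<close> of
    \<open>cos (p * \<theta>)\<close> and \<open>pi / 2\<close>.\<close>
  define \<theta>0 where "\<theta>0 = (pi / (2 * p) + pi / 2) / 2"
  have "pi / (2 * p) < pi / 2" using assms by (intro divide_strict_left_mono) auto
  then have t0: "pi / (2 * p) < \<theta>0" "\<theta>0 < pi / 2" "0 < \<theta>0"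
    using assms by (auto simp: \<theta>0_def add_pos_pos)
  have p0: "pi / 2 < p * \<theta>0" "p * \<theta>0 < pi"
  proof -
    have "p * (pi / (2 * p)) < p * \<theta>0" using t0 assms by (intro mult_strict_left_mono) auto
    then show "pi / 2 < p * \<theta>0" using assms by simp
    have "p * \<theta>0 \<le> 2 * \<theta>0" using t0 assms by (intro mult_right_mono) auto
    then show "p * \<theta>0 < pi" using t0 by linarith
  qed
  define c where "c = - cos (p * \<theta>0)"
  have c: "0 < c" using cos_monotone_0_pi[of "pi / 2" "p * \<theta>0"] p0 by (simp add: c_def)
  define d where "d = cos \<theta>0"
  have d: "0 < d" unfolding d_def using t0 by (intro cos_gt_zero_pi) auto
  define B where "B = 1 / c"
  define A where "A = (1 + B) / d powr p"
  have AB: "0 \<le> A" "0 \<le> B" using c d by (auto simp: A_def B_def)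
  show ?thesis
  proof (rule that[OF AB])
    fix \<theta> :: real assume th: "\<bar>\<theta>\<bar> \<le> pi / 2"
    have ceq: "cos \<theta> = cos \<bar>\<theta>\<bar>" "cos (p * \<theta>) = cos (p * \<bar>\<theta>\<bar>)" by (auto simp: abs_if)
    show "1 \<le> A * cos \<theta> powr p - B * cos (p * \<theta>)"
    proof (cases "\<bar>\<theta>\<bar> \<le> \<theta>0")
      case True
      have "d \<le> cos \<theta>"
        unfolding ceq d_def using True t0 by (intro cos_monotone_0_pi_le) auto
      then have "d powr p \<le> cos \<theta> powr p" using d assms by (intro powr_mono2) auto
      then have "A * d powr p \<le> A * cos \<theta> powr p" using AB by (intro mult_left_mono)
      moreover have "A * d powr p = 1 + B" using d by (simp add: A_def)
      moreover have "B * cos (p * \<theta>) \<le> B * 1" using AB by (intro mult_left_mono) auto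
      ultimately show ?thesis by simp
    next
      case False
      have "p * \<bar>\<theta>\<bar> \<le> 2 * (pi / 2)" using th assms by (intro mult_mono) auto
      moreover have "p * \<theta>0 \<le> p * \<bar>\<theta>\<bar>" using False assms by (intro mult_left_mono) auto
      ultimately have "cos (p * \<bar>\<theta>\<bar>) \<le> cos (p * \<theta>0)"
        using p0 by (intro cos_monotone_0_pi_le) auto
      then have "B * cos (p * \<theta>) \<le> B * (- c)" unfolding ceq using AB by (intro mult_left_mono) (auto simp: c_def)
      also have "\<dots> = -1" using c by (simp add: B_def)
      finally have "B * cos (p * \<theta>) \<le> -1" .
      moreover have "0 \<le> A * cos \<theta> powr p" using AB by simp
      ultimately show ?thesis by simp
    qed
  qed
qed

lemma Re_powr_inequality:
  assumes "1 < p" "p \<le> 2"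
  obtains A B :: real where "0 \<le> A" "0 \<le> B"
    "\<And>w. 0 < Re w \<Longrightarrow> norm w powr p \<le> A * Re w powr p - B * Re (w powr of_real p)"
proof -
  obtain A B where AB: "0 \<le> A" "0 \<le> B"
    "\<And>\<theta>. \<bar>\<theta>\<bar> \<le> pi / 2 \<Longrightarrow> 1 \<le> A * cos \<theta> powr p - B * cos (p * \<theta>)"
    using cos_powr_inequality[OF assms] by blast
  show ?thesis
  proof (rule that[OF AB(1,2)])
    fix w :: complex assume w: "0 < Re w"
    then have nz: "w \<noteq> 0" by auto
    define \<theta> where "\<theta> = Im (Ln w)"
    have th: "\<bar>\<theta>\<bar> \<le> pi / 2" using Re_Ln_pos_lt_imp[OF w] by (simp add: \<theta>_def)
    have Re: "Re w = norm w * cos \<theta>"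
    proof -
      have "w = exp (Ln w)" using nz by simp
      also have "Re \<dots> = exp (Re (Ln w)) * cos \<theta>" by (simp add: Re_exp \<theta>_def)
      finally show ?thesis using nz by simp
    qed
    have cos: "0 \<le> cos \<theta>" using th by (intro cos_ge_zero) auto
    have Rep: "Re (w powr of_real p) = norm w powr p * cos (p * \<theta>)"
      using nz by (simp add: powr_def Re_exp \<theta>_def)
    have "norm w powr p * 1 \<le> norm w powr p * (A * cos \<theta> powr p - B * cos (p * \<theta>))"
      using AB(3)[OF th] by (intro mult_left_mono) auto
    also have "\<dots> = A * Re w powr p - B * Re (w powr of_real p)"
      unfolding Rep unfolding Re using cos by (simp add: powr_mult algebra_simps)
    finally show "norm w powr p \<le> A * Re w powr p - B * Re (w powr of_real p)" by simp
  qed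
qed

text \<open>For real \<open>u\<close> the Cauchy integrals at \<open>z\<close> and
  \<open>cnj z\<close> are conjugate, so the jump formula computes the imaginary part of
  \<open>KI\<close>.\<close>

lemma Re_KI_of_real:
  assumes "1 < p" and f: "(\<lambda>t. complex_of_real (u t)) \<in> Lfun p" and z: "0 < Im z"
  shows "Re (KI (\<lambda>t. complex_of_real (u t)) z / (of_real pi * \<i>)) = (\<integral>t. pk (Im z) (t - Re z) * u t \<partial>lborel) / pi"
proof -
  let ?f = "\<lambda>t. complex_of_real (u t)"
  have "KI ?f (cnj z) = cnj (KI ?f z)"
    using KI_cnj[of ?f "cnj z"] by simp
  then have "2 * \<i> * of_real (Im (KI ?f z)) = 2 * \<i> * (\<integral>t. of_real (pk (Im z) (t - Re z)) * ?f t \<partial>lborel)"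
    using KI_diff_cnj[OF assms] by (simp add: complex_diff_cnj mult_ac)
  then have "complex_of_real (Im (KI ?f z)) = of_real (\<integral>t. pk (Im z) (t - Re z) * u t \<partial>lborel)"
    by (simp flip: of_real_mult)
  then have "Im (KI ?f z) = (\<integral>t. pk (Im z) (t - Re z) * u t \<partial>lborel)" by (simp only: of_real_eq_iff)
  moreover have "KI ?f z / (of_real pi * \<i>) = of_real (1 / pi) * (- \<i> * KI ?f z)"
    by (simp add: field_simps)
  ultimately show ?thesis by (simp add: Re_divide_of_real)
qed

text \<open>Bounded support yields decay of order \<open>1 / norm z\<close>. Its \<open>p\<close>-th
  power is integrable along horizontal lines, which makes the contour shift for a power of the
  Cauchy integral legitimate.\<close>

lemma norm_KI_decay:
  assumes u: "integrable lborel u" "\<And>t. M < \<bar>t\<bar> \<Longrightarrow> u t = 0" and M: "0 \<le> M"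
    and y: "0 < y0" "y0 \<le> Im z"
  shows "norm (KI u z) \<le> (1 + M / y0) * (\<integral>t. norm (u t) \<partial>lborel) * norm (1 / z)"
proof -
  have nz: "0 < norm z" using y abs_Im_le_cmod[of z] by auto
  have "norm (KI u z) \<le> (\<integral>t. (1 + M / y0) * norm (1 / z) * norm (u t) \<partial>lborel)"
    unfolding KI_def
  proof (rule norm_integral_le)
    show "integrable lborel (\<lambda>t. (1 + M / y0) * norm (1 / z) * norm (u t))" using u by simp
    fix t
    show "norm (u t / (complex_of_real t - z)) \<le> (1 + M / y0) * norm (1 / z) * norm (u t)"
    proof (cases "M < \<bar>t\<bar>")
      case False
      have b: "y0 \<le> norm (complex_of_real t - z)"
        using abs_Im_le_cmod[of "complex_of_real t - z"] y by simp
      have "norm z \<le> norm (complex_of_real t - z) + M"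
        using norm_triangle_ineq4[of "complex_of_real t" "complex_of_real t - z"] False by simp
      also have "M \<le> norm (complex_of_real t - z) * (M / y0)"
        using mult_right_mono[OF b, of "M / y0"] M y by simp
      finally have "norm z \<le> (1 + M / y0) * norm (complex_of_real t - z)" by (simp add: algebra_simps)
      then have "norm z / norm (complex_of_real t - z) \<le> 1 + M / y0"
        using b y by (subst pos_divide_le_eq) (auto simp del: zero_less_norm_iff)
      then have "norm z / norm (complex_of_real t - z) / norm z \<le> (1 + M / y0) / norm z"
        by (rule divide_right_mono) simp
      then have "1 / norm (complex_of_real t - z) \<le> (1 + M / y0) * (1 / norm z)"
        using nz by simp
      from mult_left_mono[OF this, of "norm (u t)"] show ?thesis
        by (simp add: norm_divide mult_ac)
    qed (use u in simp)
  qed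
  then show ?thesis by (simp add: mult_ac)
qed

text \<open>Apply the pointwise inequality to \<open>F = KI u / (\<pi> \<i>)\<close> and integrate over a horizontal line: the integral of
  \<open>F powr p\<close> does not depend on the line and tends to 0 at infinity, and \<open>Re F\<close> is a Poisson integral.\<close>

lemma riesz_bounded_support:
  fixes u :: "real \<Rightarrow> real"
  assumes p: "1 < p" "p \<le> 2" and AB: "0 \<le> A" "0 \<le> B"
    "\<And>w. 0 < Re w \<Longrightarrow> norm w powr p \<le> A * Re w powr p - B * Re (w powr of_real p)"
    and um [measurable]: "u \<in> borel_measurable borel" and u: "\<And>t. 0 \<le> u t" "\<And>t. u t \<le> M" "\<And>t. M < \<bar>t\<bar> \<Longrightarrow> u t = 0"
    and M: "0 < M" and y: "0 < y"
  shows "pint p (\<lambda>x. KI (\<lambda>t. complex_of_real (u t)) (Complex x y)) \<le> pi powr p * A * pint p (\<lambda>t. complex_of_real (u t))"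
    "(\<lambda>x. KI (\<lambda>t. complex_of_real (u t)) (Complex x y)) \<in> Lfun p"
proof -
  let ?f = "\<lambda>t. complex_of_real (u t)"
  have bd: "integrable lborel (\<lambda>t. indicator {-M..M} t * C :: real)" for C
    by (intro integrable_mult_left integrable_real_indicator) (auto simp: emeasure_lborel_Icc_eq)
  have iu: "integrable lborel u"
    by (rule Bochner_Integration.integrable_bound[OF bd[of M]])
      (use u in \<open>auto simp: indicator_def abs_le_iff\<close>)
  have fL: "?f \<in> Lfun p"
  proof (rule LfunI)
    show "integrable lborel (\<lambda>x. norm (?f x) powr p)"
    proof (rule Bochner_Integration.integrable_bound[OF bd[of "M powr p"]])
      have "norm (?f x) powr p \<le> indicator {-M..M} x * M powr p" for x
      proof (cases "M < \<bar>x\<bar>")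
        case False
        have "u x powr p \<le> M powr p" using u[of x] p by (intro powr_mono2) auto
        then show ?thesis using False u[of x] by (auto simp: indicator_def)
      qed (use u in auto)
      then show "AE x in lborel. norm (norm (?f x) powr p) \<le> norm (indicator {-M..M} x * M powr p)" by auto
    qed measurable
  qed measurable
  define F where "F z = KI ?f z / (of_real pi * \<i>)" for z
  define D where "D y0 = (1 + M / y0) * (\<integral>t. norm (?f t) \<partial>lborel) / pi" for y0
  have D0: "0 \<le> D y0" if "0 < y0" for y0 using M that by (simp add: D_def)
  have decay: "norm (F z) \<le> D y0 * norm (1 / z)" if "0 < y0" "y0 \<le> Im z" for z y0
  proof -
    have "norm (F z) = norm (KI ?f z) / pi" by (simp add: F_def norm_divide norm_mult)
    also have "\<dots> \<le> ((1 + M / y0) * (\<integral>t. norm (?f t) \<partial>lborel) * norm (1 / z)) / pi"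
      using norm_KI_decay[of ?f M y0 z] iu u M that by (intro divide_right_mono) auto
    finally show ?thesis by (simp add: D_def)
  qed
  have Fhol: "F holomorphic_on {z. 0 < Im z}"
    unfolding F_def by (intro holomorphic_intros KI_holomorphic[OF p(1) fL]) auto
  have FL: "(\<lambda>x. F (Complex x y)) \<in> Lfun p" if "0 < y" for y
  proof (rule Lfun_bounded_by(1))
    show "(\<lambda>x. 1 / (complex_of_real x - (- \<i> * of_real y))) \<in> Lfun p"
      using that p by (intro Lfun_cauchy_kernel) auto
    show "AE x in lborel. norm (F (Complex x y)) \<le> D y * norm (1 / (complex_of_real x - (- \<i> * of_real y)))"
      using decay[OF that, of "Complex x y" for x] by (simp add: Complex_eq)
  qed (use that p D0 measurable_on_horizontal_line[OF Fhol] in auto)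
  have KIF: "KI ?f z = (of_real pi * \<i>) * F z" for z by (simp add: F_def)
  show "(\<lambda>x. KI ?f (Complex x y)) \<in> Lfun p"
    unfolding KIF by (intro Lfun_cmult FL y) (use p in auto)
  have pintK: "pint p (\<lambda>x. KI ?f (Complex x y)) = pi powr p * pint p (\<lambda>x. F (Complex x y))"
    unfolding KIF by (subst Lfun_cmult(2)[OF FL[OF y]]) (use p in \<open>auto simp: norm_mult\<close>)
  \<comment> \<open>Strict positivity of \<open>Re (F z)\<close>, which keeps \<open>F\<close> off
    the branch cut of the power, fails when \<open>u = 0\<close> almost everywhere, so this case is
    treated separately.\<close>
  have "pint p (\<lambda>x. F (Complex x y)) \<le> A * pint p ?f"
  proof (cases "AE t in lborel. u t = 0")
    case True
    have "KI ?f z = 0" for z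
    proof -
      show ?thesis unfolding KI_def
        by (rule integral_eq_zero_AE) (use True in auto)
    qed
    then show ?thesis using AB p by (simp add: F_def pint_def)
  next
    case False
    have ReF: "Re (F z) = (\<integral>t. pk (Im z) (t - Re z) * u t \<partial>lborel) / pi" if "0 < Im z" for z
      unfolding F_def by (rule Re_KI_of_real[OF p(1) fL that])
    have pos: "0 < Re (F z)" if z: "0 < Im z" for z
    proof -
      have int: "integrable lborel (\<lambda>t. pk (Im z) (t - Re z) * u t)"
        using pk_mult_integrable(1)[OF p(1) fL z, of "Re z"] u by simp
      have pkpos: "0 < pk (Im z) s" for s using z by (simp add: pk_def add_nonneg_pos)
      have "0 \<le> (\<integral>t. pk (Im z) (t - Re z) * u t \<partial>lborel)"
        using u pk_nonneg[OF z] by (intro Bochner_Integration.integral_nonneg) auto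
      moreover have "(\<integral>t. pk (Im z) (t - Re z) * u t \<partial>lborel) \<noteq> 0"
      proof
        assume "(\<integral>t. pk (Im z) (t - Re z) * u t \<partial>lborel) = 0"
        then have "AE t in lborel. pk (Im z) (t - Re z) * u t = 0"
          using integral_nonneg_eq_0_iff_AE[OF int] u pk_nonneg[OF z] by auto
        then have "AE t in lborel. u t = 0"
          by eventually_elim (use pkpos in \<open>auto simp: less_imp_neq[symmetric]\<close>)
        then show False using False by contradiction
      qed
      ultimately show ?thesis unfolding ReF[OF z] by simp
    qed
    let ?H = "\<lambda>z. F z powr of_real p"
    have Hhol: "?H holomorphic_on {z. 0 < Im z}"
      by (intro holomorphic_intros Fhol) (use pos in \<open>force simp: complex_nonpos_Reals_iff\<close>)
    have nH: "norm (?H z) = norm (F z) powr p" for z by (simp add: norm_powr_real_powr')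
    have Hint: "integrable lborel (\<lambda>x. ?H (Complex x b))" if "0 < b" for b
      by (rule Bochner_Integration.integrable_bound[OF Lfun_integrable[OF FL[OF that]]])
        (use measurable_on_horizontal_line[OF Hhol that] in \<open>auto simp: nH\<close>)
    have w: "complex_of_real x - (- \<i> * of_real b) = Complex x b" for x b by (simp add: Complex_eq)
    have bound: "norm (F (Complex x b)) powr p \<le> D y powr p * norm (1 / Complex x b) powr p" if "y \<le> b" for x b
    proof -
      have "norm (F (Complex x b)) powr p \<le> (D y * norm (1 / Complex x b)) powr p"
        using p decay[OF y, of "Complex x b"] that by (intro powr_mono2) auto
      then show ?thesis using D0[OF y] by (simp add: powr_mult)
    qed
    have intb: "integrable lborel (\<lambda>x. norm (1 / Complex x b) powr p)" if "0 < b" for b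
      using Lfun_integrable[OF Lfun_cauchy_kernel[OF p(1), of "- \<i> * of_real b"]] that unfolding w by simp
    have Hle: "norm (\<integral>x. ?H (Complex x b) \<partial>lborel) \<le> D y powr p * pint p (\<lambda>x. 1 / Complex x b)" if "y \<le> b" for b
    proof -
      have "norm (\<integral>x. ?H (Complex x b) \<partial>lborel) \<le> (\<integral>x. D y powr p * norm (1 / Complex x b) powr p \<partial>lborel)"
        by (rule norm_integral_le) (use intb[of b] bound that y nH in auto)
      then show ?thesis by (simp add: pint_def)
    qed
    have shift: "(\<integral>x. ?H (Complex x y) \<partial>lborel) = (\<integral>x. ?H (Complex x b) \<partial>lborel)" if "y \<le> b" for b
    proof (rule strip_shift[OF Hhol y that])
      fix y' assume y': "y \<le> y'" "y' \<le> b"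
      have "norm (1 / Complex x y') \<le> norm (1 / Complex x y)" for x
      proof (rule norm_inverse_le)
        show "0 < norm (Complex x y)" using y by (auto simp: complex_eq_iff)
        show "norm (Complex x y) \<le> norm (Complex x y')"
          using y' y by (simp add: norm_complex_def power_mono)
      qed
      then have "norm (1 / Complex x y') powr p \<le> norm (1 / Complex x y) powr p" for x
        using p by (intro powr_mono2) auto
      then have "norm (?H (Complex x y')) \<le> D y powr p * norm (1 / Complex x y) powr p" for x
        unfolding nH using bound[OF y'(1), of x] by (meson mult_left_mono order_trans powr_ge_zero)
      then have "(\<integral>\<^sup>+x. norm (?H (Complex x y')) \<partial>lborel) \<le> (\<integral>\<^sup>+x. ennreal (D y powr p * norm (1 / Complex x y) powr p) \<partial>lborel)"
        by (intro nn_integral_mono ennreal_leI)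
      also have "\<dots> = ennreal (\<integral>x. D y powr p * norm (1 / Complex x y) powr p \<partial>lborel)"
        by (intro nn_integral_eq_integral) (use intb[OF y] in auto)
      finally show "(\<integral>\<^sup>+x. norm (?H (Complex x y')) \<partial>lborel) \<le> ennreal (\<integral>x. D y powr p * norm (1 / Complex x y) powr p \<partial>lborel)" .
    qed
    have H0: "(\<integral>x. ?H (Complex x y) \<partial>lborel) = 0"
    proof -
      have "(\<lambda>n. pint p (\<lambda>x. 1 / (complex_of_real x - (- \<i> * of_real y - \<i> * of_nat n)))) \<longlonglongrightarrow> 0"
        by (rule cauchy_kernel_tendsto_0[OF p(1)]) (use y in simp)
      then have "(\<lambda>n. D y powr p * pint p (\<lambda>x. 1 / Complex x (y + real n))) \<longlonglongrightarrow> 0"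
        by (intro tendsto_mult_right_zero) (simp add: Complex_eq algebra_simps)
      then have "(\<lambda>n::nat. (\<integral>x. ?H (Complex x y) \<partial>lborel)) \<longlonglongrightarrow> 0"
      proof (rule Lim_null_comparison[rotated], intro always_eventually allI)
        fix n :: nat
        show "norm (\<integral>x. ?H (Complex x y) \<partial>lborel) \<le> D y powr p * pint p (\<lambda>x. 1 / Complex x (y + real n))"
          unfolding shift[of "y + real n", simplified] by (rule Hle) simp
      qed
      then show ?thesis by (simp add: LIMSEQ_const_iff)
    qed
    let ?R = "\<lambda>x. Re (F (Complex x y))"
    have RL: "(\<lambda>x. complex_of_real (?R x)) \<in> Lfun p"
      by (rule Lfun_bounded_by(1)[OF FL[OF y], where C = 1])
        (use p abs_Re_le_cmod measurable_on_horizontal_line[OF Fhol y] in auto)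
    have "pint p (\<lambda>x. F (Complex x y)) \<le> (\<integral>x. A * norm (complex_of_real (?R x)) powr p - B * Re (?H (Complex x y)) \<partial>lborel)"
      unfolding pint_def
    proof (rule integral_mono)
      show "integrable lborel (\<lambda>x. A * norm (complex_of_real (?R x)) powr p - B * Re (?H (Complex x y)))"
        using Lfun_integrable[OF RL] Hint[OF y] by (intro Bochner_Integration.integrable_diff integrable_mult_right integrable_Re) auto
      fix x
      show "norm (F (Complex x y)) powr p \<le> A * norm (complex_of_real (?R x)) powr p - B * Re (?H (Complex x y))"
        using AB(3)[OF pos[of "Complex x y"]] pos[of "Complex x y"] y by simp
    qed (rule Lfun_integrable[OF FL[OF y]])
    also have "\<dots> = A * pint p (\<lambda>x. complex_of_real (?R x)) - B * Re (\<integral>x. ?H (Complex x y) \<partial>lborel)"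
      using Lfun_integrable[OF RL] Hint[OF y]
      by (subst Bochner_Integration.integral_diff) (auto simp: pint_def simp del: norm_of_real)
    also have "\<dots> = A * pint p (\<lambda>x. complex_of_real (?R x))" using H0 by simp
    also have "\<dots> \<le> A * pint p ?f"
    proof (intro mult_left_mono AB)
      have eq: "complex_of_real (?R x) = (\<integral>t. of_real (pk y (t - x)) * ?f t \<partial>lborel) / of_real pi" for x
        using ReF[of "Complex x y"] y by (simp flip: of_real_mult)
      have "ennreal (pint p (\<lambda>x. complex_of_real (?R x))) = (\<integral>\<^sup>+x. ennreal (norm (complex_of_real (?R x)) powr p) \<partial>lborel)"
        unfolding pint_def by (intro nn_integral_eq_integral[symmetric] Lfun_integrable RL) auto
      also have "\<dots> \<le> ennreal (pint p ?f)"
        unfolding eq by (rule poisson_contraction[OF p(1) fL y])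
      finally show "pint p (\<lambda>x. complex_of_real (?R x)) \<le> pint p ?f" by simp
    qed
    finally show ?thesis .
  qed
  then show "pint p (\<lambda>x. KI ?f (Complex x y)) \<le> pi powr p * A * pint p ?f"
    unfolding pintK by (simp add: mult.assoc)
qed

lemma KI_line_measurable:
  assumes "1 < p" "f \<in> Lfun p" "0 < y"
  shows "(\<lambda>x. KI f (Complex x y)) \<in> borel_measurable borel"
  by (rule measurable_on_horizontal_line[OF KI_holomorphic[OF assms(1,2)] assms(3)]) auto

text \<open>Uniform in the height \<open>y\<close>, so that \<open>Lfun_Fatou\<close> can carry the
  bound to the boundary.\<close>

definition riesz_bound :: "real \<Rightarrow> real \<Rightarrow> bool" where
  "riesz_bound p K \<longleftrightarrow> 0 \<le> K \<and> (\<forall>f\<in>Lfun p. \<forall>y>0. (\<lambda>x. KI f (Complex x y)) \<in> Lfun p \<and>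
     pint p (\<lambda>x. KI f (Complex x y)) \<le> K * pint p f)"

text \<open>Cutting off both values and support gives functions covered by the bounded case, with a
  constant independent of the cut. The Cauchy integrals converge pointwise, and
  \<open>Lfun_Fatou\<close> removes the cut.\<close>

lemma riesz_nonneg:
  assumes p: "1 < p" "p \<le> 2"
  obtains K where "0 \<le> K" "\<And>u y. (\<lambda>t. complex_of_real (u t)) \<in> Lfun p \<Longrightarrow> (\<And>t. 0 \<le> u t) \<Longrightarrow> 0 < y \<Longrightarrow>
     (\<lambda>x. KI (\<lambda>t. complex_of_real (u t)) (Complex x y)) \<in> Lfun p \<and>
     pint p (\<lambda>x. KI (\<lambda>t. complex_of_real (u t)) (Complex x y)) \<le> K * pint p (\<lambda>t. complex_of_real (u t))"
proof -
  obtain A B where AB: "0 \<le> A" "0 \<le> B"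
    "\<And>w. 0 < Re w \<Longrightarrow> norm w powr p \<le> A * Re w powr p - B * Re (w powr of_real p)"
    using Re_powr_inequality[OF p] by blast
  show ?thesis
  proof (rule that[of "pi powr p * A"])
    show "0 \<le> pi powr p * A" using AB by simp
    fix u :: "real \<Rightarrow> real" and y :: real
    let ?f = "\<lambda>t. complex_of_real (u t)"
    assume f: "?f \<in> Lfun p" and u: "\<And>t. 0 \<le> u t" and y: "0 < y"
    have um [measurable]: "u \<in> borel_measurable borel"
    proof -
      note [measurable] = Lfun_measurable[OF f]
      have "(\<lambda>t. Re (?f t)) \<in> borel_measurable borel" by measurable
      then show ?thesis by simp
    qed
    define v where "v n t = min (u t) (real n + 1) * indicator {- (real n + 1)..real n + 1} t" for n t
    have vm [measurable]: "v n \<in> borel_measurable borel" for n unfolding v_def by measurable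
    have v: "0 \<le> v n t" "v n t \<le> real n + 1" "real n + 1 < \<bar>t\<bar> \<Longrightarrow> v n t = 0" "v n t \<le> u t" for n t
      using u[of t] by (auto simp: v_def indicator_def)
    have conv: "Lconv p (\<lambda>n t. complex_of_real (v n t)) ?f"
    proof (rule Lconv_dominated[OF _ f])
      show "AE t in lborel. (\<lambda>n. complex_of_real (v n t)) \<longlonglongrightarrow> complex_of_real (u t)"
      proof (rule AE_I2)
        fix t
        obtain N :: nat where N: "max (u t) \<bar>t\<bar> \<le> N" using real_arch_simple by blast
        have "v n t = u t" if "n \<ge> N" for n
        proof -
          have "real N \<le> real n" using that by simp
          then show ?thesis using N by (auto simp: v_def indicator_def)
        qed
        then have "\<forall>\<^sub>F n in sequentially. complex_of_real (v n t) = complex_of_real (u t)"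
          by (auto simp: eventually_sequentially)
        then show "(\<lambda>n. complex_of_real (v n t)) \<longlonglongrightarrow> complex_of_real (u t)"
          by (rule tendsto_eventually)
      qed
    qed (use p v u in auto)
    have vL: "(\<lambda>t. complex_of_real (v n t)) \<in> Lfun p" for n using conv by (simp add: Lconv_def)
    have pv: "pint p (\<lambda>t. complex_of_real (v n t)) \<le> pint p ?f" for n
      using Lfun_bounded_by(2)[OF f, of "\<lambda>t. complex_of_real (v n t)" 1] v[of n] u p by auto
    have R: "(\<lambda>x. KI (\<lambda>t. complex_of_real (v n t)) (Complex x y)) \<in> Lfun p"
      "pint p (\<lambda>x. KI (\<lambda>t. complex_of_real (v n t)) (Complex x y)) \<le> pi powr p * A * pint p ?f" for n
    proof -
      note r = riesz_bounded_support[OF p AB, of "v n" "real n + 1" y]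
      show "(\<lambda>x. KI (\<lambda>t. complex_of_real (v n t)) (Complex x y)) \<in> Lfun p"
        by (rule r) (use v y in auto)
      have "pint p (\<lambda>x. KI (\<lambda>t. complex_of_real (v n t)) (Complex x y)) \<le> pi powr p * A * pint p (\<lambda>t. complex_of_real (v n t))"
        by (rule r) (use v y in auto)
      also have "\<dots> \<le> pi powr p * A * pint p ?f" using AB by (intro mult_left_mono pv) auto
      finally show "pint p (\<lambda>x. KI (\<lambda>t. complex_of_real (v n t)) (Complex x y)) \<le> pi powr p * A * pint p ?f" .
    qed
    have lim: "AE x in lborel. (\<lambda>n. KI (\<lambda>t. complex_of_real (v n t)) (Complex x y)) \<longlonglongrightarrow> KI ?f (Complex x y)"
      by (rule AE_I2, rule KI_Lconv[OF p(1) conv]) (use y in auto)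
    show "(\<lambda>x. KI ?f (Complex x y)) \<in> Lfun p \<and> pint p (\<lambda>x. KI ?f (Complex x y)) \<le> pi powr p * A * pint p ?f"
      using Lfun_Fatou[OF _ R KI_line_measurable[OF p(1) f y] lim] p by auto
  qed
qed

lemma riesz_le_2:
  assumes p: "1 < p" "p \<le> 2"
  shows "\<exists>K. riesz_bound p K"
proof -
  obtain K where K: "0 \<le> K" "\<And>u y. (\<lambda>t. complex_of_real (u t)) \<in> Lfun p \<Longrightarrow> (\<And>t. 0 \<le> u t) \<Longrightarrow> 0 < y \<Longrightarrow>
     (\<lambda>x. KI (\<lambda>t. complex_of_real (u t)) (Complex x y)) \<in> Lfun p \<and>
     pint p (\<lambda>x. KI (\<lambda>t. complex_of_real (u t)) (Complex x y)) \<le> K * pint p (\<lambda>t. complex_of_real (u t))"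
    using riesz_nonneg[OF p] by blast
  have p0: "0 < p" using p by simp
  define K' where "K' = 2 powr p * (2 powr p * (K + K) + 2 powr p * (K + K))"
  have "riesz_bound p K'"
    unfolding riesz_bound_def
  proof (intro conjI ballI allI impI)
    show "0 \<le> K'" using K by (simp add: K'_def)
    fix f y assume f: "f \<in> Lfun p" and y: "(0::real) < y"
    note [measurable] = Lfun_measurable[OF f]
    \<comment> \<open>Positive and negative parts of the real and imaginary parts: each is
      nonnegative and dominated by \<open>norm (f t)\<close>.\<close>
    define a where "a t = complex_of_real (max 0 (Re (f t)))" for t
    define b where "b t = complex_of_real (max 0 (- Re (f t)))" for t
    define c where "c t = complex_of_real (max 0 (Im (f t)))" for t
    define d where "d t = complex_of_real (max 0 (- Im (f t)))" for t
    have le: "norm (a t) \<le> norm (f t)" "norm (b t) \<le> norm (f t)" "norm (c t) \<le> norm (f t)" "norm (d t) \<le> norm (f t)" for t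
      using abs_Re_le_cmod[of "f t"] abs_Im_le_cmod[of "f t"] by (auto simp: a_def b_def c_def d_def)
    have m [measurable]: "a \<in> borel_measurable borel" "b \<in> borel_measurable borel" "c \<in> borel_measurable borel" "d \<in> borel_measurable borel"
      unfolding a_def b_def c_def d_def by measurable
    have bd: "g \<in> Lfun p \<and> pint p g \<le> pint p f" if "g \<in> borel_measurable borel" "\<And>t. norm (g t) \<le> norm (f t)" for g
      using Lfun_bounded_by[OF f that(1) p0, of 1] that(2) by simp
    have L: "a \<in> Lfun p" "b \<in> Lfun p" "c \<in> Lfun p" "d \<in> Lfun p"
      using bd[OF m(1) le(1)] bd[OF m(2) le(2)] bd[OF m(3) le(3)] bd[OF m(4) le(4)] by simp_all
    have P: "pint p a \<le> pint p f" "pint p b \<le> pint p f" "pint p c \<le> pint p f" "pint p d \<le> pint p f"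
      using bd[OF m(1) le(1)] bd[OF m(2) le(2)] bd[OF m(3) le(3)] bd[OF m(4) le(4)] by simp_all
    let ?k = "\<lambda>g x. KI g (Complex x y)"
    have kk: "?k a \<in> Lfun p \<and> pint p (?k a) \<le> K * pint p a" "?k b \<in> Lfun p \<and> pint p (?k b) \<le> K * pint p b"
      "?k c \<in> Lfun p \<and> pint p (?k c) \<le> K * pint p c" "?k d \<in> Lfun p \<and> pint p (?k d) \<le> K * pint p d"
      using K(2)[of "\<lambda>t. max 0 (Re (f t))", OF L(1)[unfolded a_def] _ y]
        K(2)[of "\<lambda>t. max 0 (- Re (f t))", OF L(2)[unfolded b_def] _ y]
        K(2)[of "\<lambda>t. max 0 (Im (f t))", OF L(3)[unfolded c_def] _ y]
        K(2)[of "\<lambda>t. max 0 (- Im (f t))", OF L(4)[unfolded d_def] _ y]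
      unfolding a_def b_def c_def d_def by auto
    have kb: "pint p (?k a) \<le> K * pint p f" "pint p (?k b) \<le> K * pint p f" "pint p (?k c) \<le> K * pint p f" "pint p (?k d) \<le> K * pint p f"
      using kk P[THEN mult_left_mono[OF _ K(1)]] by linarith+
    have imz: "Im (Complex x y) \<noteq> 0" for x using y by simp
    have "f = (\<lambda>t. (a t - b t) + \<i> * (c t - d t))"
      by (auto simp: fun_eq_iff a_def b_def c_def d_def complex_eq_iff)
    then have "?k f = ?k (\<lambda>t. (a t - b t) + \<i> * (c t - d t))" by simp
    also have "\<dots> = (\<lambda>x. (?k a x - ?k b x) + \<i> * (?k c x - ?k d x))"
      by (simp add: fun_eq_iff KI_add[OF p(1) Lfun_diff(1)[OF L(1,2) p0] Lfun_cmult(1)[OF Lfun_diff(1)[OF L(3,4) p0] p0] imz]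
          KI_cmult KI_diff[OF p(1) L(1,2) imz] KI_diff[OF p(1) L(3,4) imz])
    finally have eq: "?k f = (\<lambda>x. (?k a x - ?k b x) + \<i> * (?k c x - ?k d x))" .
    have ab: "(\<lambda>x. ?k a x - ?k b x) \<in> Lfun p" "pint p (\<lambda>x. ?k a x - ?k b x) \<le> 2 powr p * (pint p (?k a) + pint p (?k b))"
      using Lfun_diff[of "?k a" p "?k b"] kk p0 by auto
    have cd: "(\<lambda>x. ?k c x - ?k d x) \<in> Lfun p" "pint p (\<lambda>x. ?k c x - ?k d x) \<le> 2 powr p * (pint p (?k c) + pint p (?k d))"
      using Lfun_diff[of "?k c" p "?k d"] kk p0 by auto
    have icd: "(\<lambda>x. \<i> * (?k c x - ?k d x)) \<in> Lfun p" "pint p (\<lambda>x. \<i> * (?k c x - ?k d x)) = pint p (\<lambda>x. ?k c x - ?k d x)"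
      using Lfun_cmult[OF cd(1) p0, of \<i>] by auto
    show "?k f \<in> Lfun p" unfolding eq by (rule Lfun_add(1)[OF ab(1) icd(1) p0])
    have "pint p (?k f) \<le> 2 powr p * (pint p (\<lambda>x. ?k a x - ?k b x) + pint p (\<lambda>x. ?k c x - ?k d x))"
      unfolding eq using Lfun_add(2)[OF ab(1) icd(1) p0] icd(2) by simp
    also have "\<dots> \<le> 2 powr p * (2 powr p * (K * pint p f + K * pint p f) + 2 powr p * (K * pint p f + K * pint p f))"
      by (intro mult_left_mono add_mono order_trans[OF ab(2)] order_trans[OF cd(2)] kb) auto
    also have "\<dots> = K' * pint p f" by (simp add: K'_def algebra_simps)
    finally show "pint p (?k f) \<le> K' * pint p f" .
  qed
  then show ?thesis by blast
qed

lemma pint_cauchy_kernel_shift: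
  "pint q (\<lambda>t. 1 / (complex_of_real t - Complex x y)) = pint q (\<lambda>t. 1 / (complex_of_real t - Complex 0 y))"
  unfolding pint_def
  using lborel_integral_real_affine[of 1 "\<lambda>t. norm (1 / (complex_of_real t - Complex x y)) powr q" x]
  by (simp add: Complex_eq algebra_simps)

text \<open>Fubini's theorem; integrability of \<open>h\<close> and a bound on the inner integral
  that does not depend on \<open>x\<close> give absolute convergence. Exchanging the roles of
  \<open>x\<close> and \<open>t\<close> in the kernel changes its sign and reflects the
  height.\<close>

lemma KI_duality:
  assumes p: "1 < p" and f: "f \<in> Lfun p" and y: "0 < y"
    and h: "h \<in> Lfun (conj_exp p)" and h1: "integrable lborel h"
  shows "(\<integral>x. KI f (Complex x y) * h x \<partial>lborel) = - (\<integral>t. f t * KI h (Complex t (- y)) \<partial>lborel)"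
proof -
  let ?q = "conj_exp p"
  have q: "1 < ?q" using conj_exp_facts[OF p] by simp
  note [measurable] = Lfun_measurable[OF f] Lfun_measurable[OF h]
  define G where "G x t = f t / (complex_of_real t - Complex x y) * h x" for x t
  have cm [measurable]: "(\<lambda>(x, t). complex_of_real t - Complex x y) \<in> borel_measurable (lborel \<Otimes>\<^sub>M lborel)"
    unfolding Complex_eq by measurable
  have Gm: "case_prod G \<in> borel_measurable (lborel \<Otimes>\<^sub>M lborel)"
    unfolding G_def by measurable
  have imz: "Im (Complex x y) \<noteq> 0" for x using y by simp
  define c where "c = pint p f + pint ?q (\<lambda>t. 1 / (complex_of_real t - Complex 0 y))"
  have "integrable (lborel \<Otimes>\<^sub>M lborel) (case_prod G)"
  proof (rule lborel_pair.Fubini_integrable[OF Gm])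
    have eq: "(\<integral>t. norm (case_prod G (x, t)) \<partial>lborel) = (\<integral>t. norm (f t / (complex_of_real t - Complex x y)) \<partial>lborel) * norm (h x)" for x
      unfolding G_def prod.case norm_mult by (rule integral_mult_left_zero)
    have le: "(\<integral>t. norm (f t / (complex_of_real t - Complex x y)) \<partial>lborel) \<le> c" for x
      using Lfun_mult_integrable(2)[OF p f Lfun_cauchy_kernel[OF q imz[of x]]]
      unfolding pint_cauchy_kernel_shift[of ?q x y] c_def by simp
    have ge: "0 \<le> (\<integral>t. norm (f t / (complex_of_real t - Complex x y)) \<partial>lborel)" for x by simp
    show "integrable lborel (\<lambda>x. \<integral>t. norm (case_prod G (x, t)) \<partial>lborel)"
    proof (rule Bochner_Integration.integrable_bound[of _ "\<lambda>x. c * norm (h x)"])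
      show "integrable lborel (\<lambda>x. c * norm (h x))" using h1 by simp
      show "(\<lambda>x. \<integral>t. norm (case_prod G (x, t)) \<partial>lborel) \<in> borel_measurable lborel"
      proof -
        have "(\<lambda>w. norm (case_prod G w)) \<in> borel_measurable (lborel \<Otimes>\<^sub>M lborel)"
          using Gm by measurable
        then have "(\<lambda>(x, t). norm (case_prod G (x, t))) \<in> borel_measurable (lborel \<Otimes>\<^sub>M lborel)"
          by (simp only: split_beta' prod.collapse)
        then show ?thesis by (rule lborel.borel_measurable_lebesgue_integral)
      qed
      show "AE x in lborel. norm (\<integral>t. norm (case_prod G (x, t)) \<partial>lborel) \<le> norm (c * norm (h x))"
        unfolding eq using le ge order_trans[OF ge le]
        by (auto simp: abs_mult intro!: mult_right_mono)
    qed
    show "AE x in lborel. integrable lborel (\<lambda>t. case_prod G (x, t))"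
      unfolding G_def prod.case by (intro AE_I2 integrable_mult_left KI_integrable[OF p f imz])
  qed
  from lborel_pair.Fubini_integral[OF this]
  have "(\<integral>x. (\<integral>t. G x t \<partial>lborel) \<partial>lborel) = (\<integral>t. (\<integral>x. G x t \<partial>lborel) \<partial>lborel)" by simp
  moreover have "(\<integral>t. G x t \<partial>lborel) = KI f (Complex x y) * h x" for x
    unfolding G_def KI_def by (rule integral_mult_left_zero)
  moreover have "(\<integral>x. G x t \<partial>lborel) = - (f t * KI h (Complex t (- y)))" for t
  proof -
    have Gxt: "G x t = - (f t * (h x / (complex_of_real x - Complex t (- y))))" for x
    proof -
      have c: "complex_of_real t - Complex x y = - (complex_of_real x - Complex t (- y))"
        by (simp add: complex_eq_iff)
      show ?thesis unfolding G_def c divide_minus_right by simp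
    qed
    show ?thesis unfolding Gxt KI_def Bochner_Integration.integral_minus integral_mult_right_zero ..
  qed
  ultimately show ?thesis by simp
qed

text \<open>The Cauchy integral \<open>g\<close> of \<open>f\<close> along a line is tested against
  the extremal function of its own cut-off. The Cauchy operator then moves to the other side, where
  the bound for the conjugate exponent is available.\<close>

lemma riesz_dual:
  assumes p: "1 < p" and K: "riesz_bound (conj_exp p) K"
  shows "\<exists>K'. riesz_bound p K'"
proof -
  let ?q = "conj_exp p"
  have q: "1 < ?q" "?q * (p - 1) = p" using conj_exp_facts[OF p] by auto
  have K0: "0 \<le> K" using K by (simp add: riesz_bound_def)
  \<comment> \<open>Chosen so that \<open>c powr (- ?q) * K\<close> is at most \<open>1 / 2\<close>;
    the term with \<open>pint p (gn n)\<close> on the right can then be absorbed.\<close>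
  define c where "c = (2 * (K + 1)) powr (1 / ?q)"
  have c: "0 < c" using K0 by (simp add: c_def)
  have cK: "c powr (- ?q) * K \<le> 1 / 2"
  proof -
    have "c powr (- ?q) = 1 / (2 * (K + 1))"
      using q K0 by (simp add: c_def powr_powr powr_minus_divide)
    then have "c powr (- ?q) * K = K / (2 * (K + 1))" by simp
    also have "\<dots> \<le> 1 / 2" using K0 by (subst pos_divide_le_eq) auto
    finally show ?thesis .
  qed
  have "riesz_bound p (2 * c powr p)"
    unfolding riesz_bound_def
  proof (intro conjI ballI allI impI)
    show "0 \<le> 2 * c powr p" by simp
    fix f y assume f: "f \<in> Lfun p" and y: "(0::real) < y"
    define g where "g x = KI f (Complex x y)" for x
    have gm [measurable]: "g \<in> borel_measurable borel" unfolding g_def by (rule KI_line_measurable[OF p f y])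
    have gcont: "continuous_on UNIV g"
      unfolding g_def
      by (intro continuous_on_compose2[OF holomorphic_on_imp_continuous_on[OF KI_holomorphic[OF p f, of "{z. 0 < Im z}"]]])
        (use y in \<open>auto simp: Complex_eq intro!: continuous_intros\<close>)
    define I where "I n = {- real n..real n}" for n :: nat
    have [measurable]: "I n \<in> sets borel" for n by (simp add: I_def)
    have bound: "\<exists>B\<ge>0. \<forall>x\<in>I n. norm (g x) \<le> B" for n
    proof -
      have "bounded (g ` I n)"
        by (intro compact_imp_bounded compact_continuous_image continuous_on_subset[OF gcont]) (auto simp: I_def)
      then obtain B where "\<And>x. x \<in> I n \<Longrightarrow> norm (g x) \<le> B" by (auto simp: bounded_iff)
      then show ?thesis by (intro exI[of _ "max 0 B"]) (auto simp: le_max_iff_disj)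
    qed
    \<comment> \<open>The cut-off makes the \<open>p\<close>-th power integrable before any bound is
      known, which the absorption requires.\<close>
    define gn where "gn n x = g x * indicator (I n) x" for n x
    have [measurable]: "gn n \<in> borel_measurable borel" for n unfolding gn_def by measurable
    have bd: "integrable lborel (\<lambda>t. indicator (I n) t * C :: real)" for n C
      unfolding I_def
      by (intro integrable_mult_left integrable_real_indicator) (auto simp: emeasure_lborel_Icc_eq)
    have gnL: "gn n \<in> Lfun p" for n
    proof -
      obtain B where B: "0 \<le> B" "\<And>x. x \<in> I n \<Longrightarrow> norm (g x) \<le> B" using bound[of n] by blast
      have le: "norm (gn n x) powr p \<le> indicator (I n) x * B powr p" for x
        using B(2)[of x] p by (auto simp: gn_def indicator_def intro!: powr_mono2)
      have "integrable lborel (\<lambda>x. norm (gn n x) powr p)"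
        by (rule Bochner_Integration.integrable_bound[OF bd[of n "B powr p"]])
          (use le in auto)
      then show ?thesis by (intro LfunI) auto
    qed
    have gnP: "pint p (gn n) \<le> 2 * c powr p * pint p f" for n
    proof -
      obtain B where B: "0 \<le> B" "\<And>x. x \<in> I n \<Longrightarrow> norm (g x) \<le> B" using bound[of n] by blast
      \<comment> \<open>The extremal function of duality: both \<open>g x * h x\<close> and
        \<open>norm (h x) powr ?q\<close> equal \<open>norm (gn n x) powr p\<close>.\<close>
      define h where "h x = of_real (norm (gn n x) powr (p - 2)) * cnj (gn n x)" for x
      have [measurable]: "h \<in> borel_measurable borel"
        unfolding h_def by (intro borel_measurable_times borel_measurable_of_real measurable_compose[OF _ borel_measurable_cnj]) measurable
      have nh: "norm (h x) = norm (gn n x) powr (p - 1)" for x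
      proof (cases "gn n x = 0")
        case False
        have "norm (h x) = norm (gn n x) * norm (gn n x) powr (p - 2)"
          by (simp add: h_def norm_mult del: of_real_mult)
        then show ?thesis by (simp add: powr_mult_base)
      qed (simp add: h_def)
      have nhq: "norm (h x) powr ?q = norm (gn n x) powr p" for x
        using q by (simp add: nh powr_powr mult.commute)
      have hL: "h \<in> Lfun ?q" "pint ?q h = pint p (gn n)"
        using Lfun_integrable[OF gnL[of n]] by (auto simp: Lfun_def pint_def nhq)
      have h1: "integrable lborel h"
      proof (rule Bochner_Integration.integrable_bound[OF bd[of n "B powr (p - 1)"]])
        have "norm (h x) \<le> indicator (I n) x * B powr (p - 1)" for x
          using B(2)[of x] p unfolding nh by (auto simp: gn_def indicator_def intro!: powr_mono2)
        then show "AE x in lborel. norm (h x) \<le> norm (indicator (I n) x * B powr (p - 1))" by auto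
      qed measurable
      have gh: "g x * h x = of_real (norm (gn n x) powr p)" for x
      proof (cases "gn n x = 0")
        case False
        then have gx: "g x = gn n x" by (auto simp: gn_def indicator_def split: if_splits)
        have "g x * h x = of_real (norm (gn n x) powr (p - 2)) * (gn n x * cnj (gn n x))"
          by (simp add: h_def gx mult_ac)
        also have "gn n x * cnj (gn n x) = of_real ((norm (gn n x))\<^sup>2)" by (rule complex_norm_square[symmetric])
        also have "of_real (norm (gn n x) powr (p - 2)) * \<dots> = complex_of_real (norm (gn n x) powr (p - 2) * (norm (gn n x))\<^sup>2)"
          by simp
        also have "norm (gn n x) powr (p - 2) * (norm (gn n x))\<^sup>2 = norm (gn n x) powr p"
          using False by (simp add: powr_diff)
        finally show ?thesis .
      qed (simp add: h_def)
      have ch: "(\<lambda>x. cnj (h x)) \<in> Lfun ?q" "pint ?q (\<lambda>x. cnj (h x)) = pint p (gn n)"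
        using Lfun_cnj[OF hL(1)] hL(2) by auto
      define k where "k t = KI h (Complex t (- y))" for t
      have keq: "k = (\<lambda>t. cnj (KI (\<lambda>x. cnj (h x)) (Complex t y)))"
      proof
        fix t
        have "cnj (Complex t y) = Complex t (- y)" by (simp add: complex_eq_iff)
        then show "k t = cnj (KI (\<lambda>x. cnj (h x)) (Complex t y))" by (simp add: k_def KI_cnj)
      qed
      have kL: "k \<in> Lfun ?q" "pint ?q k \<le> K * pint p (gn n)"
        using K ch y Lfun_cnj[of "\<lambda>t. KI (\<lambda>x. cnj (h x)) (Complex t y)" ?q] unfolding keq riesz_bound_def by auto
      have "complex_of_real (pint p (gn n)) = (\<integral>x. g x * h x \<partial>lborel)"
        unfolding gh pint_def by simp
      also have "\<dots> = - (\<integral>t. f t * k t \<partial>lborel)"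
        unfolding g_def k_def by (rule KI_duality[OF p f y hL(1) h1])
      finally have "pint p (gn n) = norm (\<integral>t. f t * k t \<partial>lborel)"
        by (metis abs_of_nonneg norm_minus_cancel norm_of_real pint_nonneg)
      also have "\<dots> \<le> c powr p * pint p f + c powr (- ?q) * pint ?q k"
        by (rule Young_scaled[OF p f kL(1) c])
      also have "c powr (- ?q) * pint ?q k \<le> c powr (- ?q) * (K * pint p (gn n))"
        by (intro mult_left_mono kL) auto
      also have "\<dots> \<le> 1 / 2 * pint p (gn n)"
        using mult_right_mono[OF cK, of "pint p (gn n)"] by (simp add: mult.assoc)
      finally show ?thesis by simp
    qed
    have lim: "AE x in lborel. (\<lambda>n. gn n x) \<longlonglongrightarrow> g x"
    proof (rule AE_I2)
      fix x :: real
      define N where "N = nat \<lceil>\<bar>x\<bar>\<rceil>"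
      have N: "\<bar>x\<bar> \<le> real N" unfolding N_def by (rule real_nat_ceiling_ge)
      have "gn n x = g x" if "n \<ge> N" for n
      proof -
        have "real N \<le> real n" using that by simp
        then have "x \<in> I n" using N unfolding I_def by (simp add: abs_le_iff)
        then show ?thesis by (simp add: gn_def)
      qed
      then have "\<forall>\<^sub>F n in sequentially. gn n x = g x"
        unfolding eventually_sequentially by (intro exI[of _ N] allI impI)
      then show "(\<lambda>n. gn n x) \<longlonglongrightarrow> g x"
        by (rule tendsto_eventually)
    qed
    have "g \<in> Lfun p" "pint p g \<le> 2 * c powr p * pint p f"
      using Lfun_Fatou[OF _ gnL gnP gm lim] p by auto
    then show "(\<lambda>x. KI f (Complex x y)) \<in> Lfun p" "pint p (\<lambda>x. KI f (Complex x y)) \<le> 2 * c powr p * pint p f"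
      by (simp_all add: g_def[abs_def])
  qed
  then show ?thesis by blast
qed

theorem riesz_inequality:
  assumes "1 < p"
  shows "\<exists>K. riesz_bound p K"
proof (cases "p \<le> 2")
  case False
  have "conj_exp p \<le> 2" using False by (simp add: conj_exp_def field_simps)
  then show ?thesis
    using riesz_le_2[of "conj_exp p"] conj_exp_facts[OF assms] riesz_dual[OF assms] by auto
qed (use riesz_le_2 assms in auto)

section \<open>Density of rational functions\<close>

text \<open>Finite linear combinations of functions, not of classes. The inductive form lets linear
  properties pass from the generators by rule induction.\<close>

inductive_set lspan :: "(real \<Rightarrow> complex) set \<Rightarrow> (real \<Rightarrow> complex) set" for B where
  lspan_zero: "(\<lambda>t. 0) \<in> lspan B"
| lspan_step: "b \<in> B \<Longrightarrow> g \<in> lspan B \<Longrightarrow> (\<lambda>t. c * b t + g t) \<in> lspan B"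

lemma lspan_base: "b \<in> B \<Longrightarrow> b \<in> lspan B"
  using lspan_step[of b B "\<lambda>t. 0" 1] lspan_zero by simp

lemma lspan_add:
  assumes "f \<in> lspan B" "g \<in> lspan B"
  shows "(\<lambda>t. f t + g t) \<in> lspan B"
  using assms(1)
proof induction
  case (lspan_step b f c)
  then show ?case using lspan.lspan_step[of b B "\<lambda>t. f t + g t" c] by (simp add: add.assoc)
qed (simp add: assms)

lemma lspan_cmult:
  assumes "f \<in> lspan B"
  shows "(\<lambda>t. a * f t) \<in> lspan B"
  using assms
proof induction
  case (lspan_step b f c)
  then show ?case using lspan.lspan_step[of b B "\<lambda>t. a * f t" "a * c"] by (simp add: algebra_simps)
qed (simp add: lspan_zero)

lemma lspan_mult:
  assumes f: "f \<in> lspan B" and g: "g \<in> lspan C"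
    and BC: "\<And>b c. b \<in> B \<Longrightarrow> c \<in> C \<Longrightarrow> (\<lambda>t. b t * c t) \<in> lspan D"
  shows "(\<lambda>t. f t * g t) \<in> lspan D"
  using f
proof induction
  case (lspan_step b f a)
  have "(\<lambda>t. b t * g t) \<in> lspan D"
    using g
  proof induction
    case (lspan_step c' g' a')
    have "(\<lambda>t. a' * (b t * c' t) + b t * g' t) \<in> lspan D"
      using lspan_add[OF lspan_cmult[OF BC[OF \<open>b \<in> B\<close> lspan_step(1)], of a'] lspan_step(3)] .
    then show ?case by (simp add: algebra_simps)
  qed (simp add: lspan_zero)
  from lspan_add[OF lspan_cmult[OF this, of a] lspan_step(3)]
  show ?case by (simp add: algebra_simps)
qed (simp add: lspan_zero)

lemma lspan_mono_map:
  assumes f: "f \<in> lspan B" and "\<And>b. b \<in> B \<Longrightarrow> (\<lambda>t. b t * m t) \<in> lspan D"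
  shows "(\<lambda>t. f t * m t) \<in> lspan D"
  using f
proof induction
  case (lspan_step b f a)
  from lspan_add[OF lspan_cmult[OF assms(2)[OF lspan_step(1)], of a] lspan_step(3)]
  show ?case by (simp add: algebra_simps)
qed (simp add: lspan_zero)

lemma lspan_Lfun:
  assumes "f \<in> lspan B" "B \<subseteq> Lfun p" "0 < p"
  shows "f \<in> Lfun p"
  using assms(1) by induction (use assms in \<open>auto intro!: Lfun_zero Lfun_add Lfun_cmult\<close>)

text \<open>The Cayley transform, which carries the real line onto the unit circle without the point
  1.\<close>

definition rr :: "real \<Rightarrow> complex" where
  "rr t = (complex_of_real t - \<i>) / (complex_of_real t + \<i>)"

lemma of_real_plus_i_nonzero [simp]:
  "complex_of_real t + \<i> \<noteq> 0" "\<i> + complex_of_real t \<noteq> 0" "complex_of_real t \<noteq> \<i>"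
  by (auto simp: complex_eq_iff)

lemma rr_nonzero [simp]: "rr t \<noteq> 0"
  by (simp add: rr_def)

lemma cnj_rr: "cnj (rr t) = inverse (rr t)"
  by (simp add: rr_def)

lemma norm_rr [simp]: "norm (rr t) = 1"
proof -
  have "norm (complex_of_real t - \<i>) = norm (complex_of_real t + \<i>)"
    by (simp add: norm_complex_def)
  then show ?thesis by (simp add: rr_def norm_divide)
qed

lemma rr_continuous: "continuous_on UNIV rr"
  unfolding rr_def[abs_def] by (intro continuous_intros) auto

lemma rr_measurable [measurable]: "rr \<in> borel_measurable borel"
  by (intro borel_measurable_continuous_onI rr_continuous)

lemma rr_powi_measurable [measurable]: "(\<lambda>t. rr t powi j) \<in> borel_measurable borel"
  by (intro borel_measurable_continuous_onI continuous_intros rr_continuous) auto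

lemma norm_rr_powi [simp]: "norm (rr t powi j) = 1"
  by (simp add: norm_power_int)

lemma rr_minus_1: "rr t - 1 = - 2 * \<i> / (complex_of_real t + \<i>)"
  by (simp add: rr_def field_simps)

lemma inj_rr: "inj rr"
proof (rule injI)
  fix s t assume "rr s = rr t"
  then have "rr s - 1 = rr t - 1" by simp
  then have "complex_of_real s + \<i> = complex_of_real t + \<i>"
    unfolding rr_minus_1 by (simp add: divide_eq_eq eq_divide_eq)
  then show "s = t" by simp
qed

definition bb :: "int \<Rightarrow> real \<Rightarrow> complex" where
  "bb j t = rr t powi j / (complex_of_real t + \<i>)"

lemma bb_measurable [measurable]: "bb j \<in> borel_measurable borel"
  unfolding bb_def by measurable

lemma norm_bb: "norm (bb j t) = norm (1 / (complex_of_real t + \<i>))"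
  by (simp add: bb_def norm_divide)

lemma bb_Lfun: "1 < p \<Longrightarrow> bb j \<in> Lfun p"
  by (rule Lfun_bounded_by(1)[OF Lfun_weight, where C = 1]) (auto simp: norm_bb)

lemma rr_powi_mult_bb: "rr t powi k * bb j t = bb (k + j) t"
  by (simp add: bb_def power_int_add)

text \<open>Since \<open>1 / (t - \<i>) = inverse (rr t) / (t + \<i>)\<close>, the index is shifted
  by one; conjugation thus maps the indices \<open>j \<ge> 0\<close> exactly onto the indices
  \<open>j < 0\<close>.\<close>

lemma cnj_bb: "cnj (bb j t) = bb (- j - 1) t"
proof -
  have "cnj (rr t powi j) = rr t powi (- j)"
    by (simp add: complex_cnj_power_int cnj_rr power_int_inverse power_int_minus)
  moreover have "complex_of_real t - \<i> = rr t * (complex_of_real t + \<i>)" by (simp add: rr_def)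
  ultimately have "cnj (bb j t) = rr t powi (- j) / (rr t * (complex_of_real t + \<i>))"
    by (simp add: bb_def)
  also have "\<dots> = rr t powi (- j - 1) / (complex_of_real t + \<i>)"
    by (simp add: power_int_diff)
  finally show ?thesis by (simp add: bb_def)
qed

text \<open>Laurent polynomials in \<open>r\<close>.\<close>

definition LP :: "(real \<Rightarrow> complex) set" where
  "LP = lspan (range (\<lambda>j t. rr t powi j))"

lemma LP_powi: "(\<lambda>t. rr t powi j) \<in> LP"
  unfolding LP_def by (rule lspan_base) auto

lemma LP_mult: "f \<in> LP \<Longrightarrow> g \<in> LP \<Longrightarrow> (\<lambda>t. f t * g t) \<in> LP"
  unfolding LP_def
proof (rule lspan_mult, assumption, assumption)
  fix b c assume "b \<in> range (\<lambda>j t. rr t powi j)" "c \<in> range (\<lambda>j t. rr t powi j)"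
  then obtain j k :: int where "b = (\<lambda>t. rr t powi j)" "c = (\<lambda>t. rr t powi k)" by blast
  then have "(\<lambda>t. b t * c t) = (\<lambda>t. rr t powi (j + k))" by (simp add: power_int_add)
  then show "(\<lambda>t. b t * c t) \<in> lspan (range (\<lambda>j t. rr t powi j))"
    by (simp add: lspan_base)
qed

lemma LP_const: "(\<lambda>t. c) \<in> LP"
  using lspan_cmult[of "\<lambda>t. rr t powi 0" _ c] LP_powi[of 0] unfolding LP_def by simp

text \<open>On the unit circle the conjugate is the inverse, so the real and imaginary parts of
  \<open>rr t\<close>, and with them every real linear functional, are Laurent polynomials in
  \<open>rr t\<close>. Sums and products stay within them.\<close>

lemma LP_real_polynomial:
  assumes "real_polynomial_function q"
  shows "(\<lambda>t. complex_of_real (q (rr t))) \<in> LP"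
  using assms
proof induction
  case (linear f)
  then interpret f: bounded_linear f .
  have "complex_of_real (f (rr t)) = (of_real (f 1) - \<i> * of_real (f \<i>)) / 2 * rr t powi 1
      + (of_real (f 1) + \<i> * of_real (f \<i>)) / 2 * rr t powi (-1)" for t
  proof -
    have "f (rr t) = f (Re (rr t) *\<^sub>R 1 + Im (rr t) *\<^sub>R \<i>)"
      by (rule arg_cong[where f = f]) (simp add: complex_eq_iff)
    also have "\<dots> = Re (rr t) * f 1 + Im (rr t) * f \<i>"
      by (simp only: f.add f.scaleR real_scaleR_def)
    finally have 1: "complex_of_real (f (rr t)) = of_real (Re (rr t)) * of_real (f 1) + of_real (Im (rr t)) * of_real (f \<i>)"
      by simp
    have 2: "complex_of_real (Re (rr t)) = (rr t + inverse (rr t)) / 2"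
      unfolding cnj_rr[symmetric] by (simp add: complex_eq_iff)
    have 3: "complex_of_real (Im (rr t)) = - \<i> * (rr t - inverse (rr t)) / 2"
      unfolding cnj_rr[symmetric] by (simp add: complex_eq_iff)
    show ?thesis unfolding 1 2 3 by (simp add: power_int_minus algebra_simps add_divide_distrib diff_divide_distrib)
  qed
  then show ?case
    using lspan_add[OF lspan_cmult lspan_cmult, OF LP_powi[of 1, unfolded LP_def] LP_powi[of "-1", unfolded LP_def]]
    unfolding LP_def by presburger
next
  case (const c)
  then show ?case by (rule LP_const)
next
  case (add f g)
  then show ?case using lspan_add unfolding LP_def by (simp add: of_real_add)
next
  case (mult f g)
  then show ?case using LP_mult by simp
qed

text \<open>The function is moved to the circle by the inverse Cayley transform
  \<open>\<tau>\<close>. The point 1 corresponds to infinity, and bounded support makes the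
  transported function vanish near it, so it is continuous on the whole compact circle and
  polynomial approximation applies.\<close>

lemma stone_weierstrass_LP:
  fixes c :: "real \<Rightarrow> complex"
  assumes c: "continuous_on UNIV c" and supp: "\<And>t. M < \<bar>t\<bar> \<Longrightarrow> c t = 0" and e: "0 < e"
  shows "\<exists>h\<in>LP. \<forall>t. norm (c t - h t) \<le> e"
proof -
  define \<tau> where "\<tau> z = Re (\<i> * (1 + z) / (1 - z))" for z
  have tau_rr: "\<tau> (rr t) = t" for t
  proof -
    have "(1 + rr t) / (1 - rr t) = - \<i> * of_real t"
      by (simp add: rr_def field_simps)
    then have "\<i> * (1 + rr t) / (1 - rr t) = of_real t" by (metis (no_types) mult.assoc mult_minus_left mult_minus_right i_squared minus_minus mult_1 times_divide_eq_right)
    then show ?thesis by (simp add: \<tau>_def)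
  qed
  have rr1: "rr t \<noteq> 1" for t using rr_minus_1[of t] by (auto simp: divide_eq_eq)
  define C where "C z = (if z = 1 then 0 else c (\<tau> z))" for z
  \<comment> \<open>On the circle \<open>\<i> * (1 + z) / (1 - z)\<close> is real, hence equal to
    \<open>\<tau> z\<close>; the identity shows that \<open>\<bar>\<tau> z\<bar>\<close> is large
    near 1.\<close>
  have tau_norm: "(\<tau> z)\<^sup>2 * (norm (1 - z))\<^sup>2 = (norm (1 + z))\<^sup>2" if "norm z = 1" "z \<noteq> 1" for z
  proof -
    have "Im (\<i> * (1 + z) / (1 - z)) = 0"
    proof -
      have "(Re z)\<^sup>2 + (Im z)\<^sup>2 = 1" using that by (simp add: norm_complex_def)
      then have "Re z * Re z + Im z * Im z = 1" by (simp add: power2_eq_square)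
      then show ?thesis by (simp add: Im_divide algebra_simps)
    qed
    then have "\<i> * (1 + z) / (1 - z) = of_real (\<tau> z)" by (simp add: \<tau>_def complex_eq_iff)
    then have "norm (\<i> * (1 + z) / (1 - z)) = \<bar>\<tau> z\<bar>" by simp
    then have "norm (1 + z) / norm (1 - z) = \<bar>\<tau> z\<bar>"
      by (simp only: norm_divide norm_mult norm_ii mult_1)
    then have "\<bar>\<tau> z\<bar> * norm (1 - z) = norm (1 + z)"
      using that by (simp add: divide_eq_eq)
    then have "(\<bar>\<tau> z\<bar> * norm (1 - z))\<^sup>2 = (norm (1 + z))\<^sup>2" by simp
    then show ?thesis by (simp add: power_mult_distrib)
  qed
  have "continuous_on (sphere 0 1) C"
    unfolding continuous_on_eq_continuous_within
  proof
    fix z :: complex assume z: "z \<in> sphere 0 1"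
    show "continuous (at z within sphere 0 1) C"
    proof (cases "z = 1")
      case False
      have "isCont \<tau> z" unfolding \<tau>_def by (intro continuous_Re continuous_intros) (use False in auto)
      moreover have "isCont c (\<tau> z)" using c by (simp add: continuous_on_eq_continuous_at)
      ultimately have "isCont (c \<circ> \<tau>) z" by (rule continuous_at_compose)
      then have "((\<lambda>z. c (\<tau> z)) \<longlongrightarrow> C z) (at z within sphere 0 1)"
        using False by (auto simp: C_def isCont_def o_def intro: tendsto_within_subset)
      moreover have "\<forall>\<^sub>F w in at z within sphere 0 1. c (\<tau> w) = C w"
      proof -
        have "\<forall>\<^sub>F w in nhds z. w \<noteq> 1" using False by (rule t1_space_nhds)
        then show ?thesis unfolding eventually_at_filter by eventually_elim (simp add: C_def)
      qed
      ultimately show ?thesis unfolding continuous_within by (rule Lim_transform_eventually)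
    next
      case True
      have "((\<lambda>z. (norm (1 + z))\<^sup>2 - (max M 0)\<^sup>2 * (norm (1 - z))\<^sup>2) \<longlongrightarrow> (norm (1 + 1 :: complex))\<^sup>2 - (max M 0)\<^sup>2 * (norm (1 - 1 :: complex))\<^sup>2) (at (1::complex) within sphere 0 1)"
        by (intro tendsto_intros)
      then have "\<forall>\<^sub>F z in at (1::complex) within sphere 0 1. 0 < (norm (1 + z))\<^sup>2 - (max M 0)\<^sup>2 * (norm (1 - z))\<^sup>2"
        by (rule order_tendstoD) simp
      moreover have "\<forall>\<^sub>F z in at (1::complex) within sphere 0 1. z \<noteq> 1 \<and> z \<in> sphere 0 1"
        unfolding eventually_at_filter by simp
      ultimately have "\<forall>\<^sub>F z in at (1::complex) within sphere 0 1. C z = 0"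
      proof eventually_elim
        case (elim w)
        then have w: "norm w = 1" "w \<noteq> 1" by auto
        have "(max M 0)\<^sup>2 * (norm (1 - w))\<^sup>2 < (\<tau> w)\<^sup>2 * (norm (1 - w))\<^sup>2"
          using elim(1) tau_norm[OF w] by simp
        then have "(max M 0)\<^sup>2 < (\<bar>\<tau> w\<bar>)\<^sup>2"
          using w by (simp add: mult_less_cancel_right)
        then have "max M 0 < \<bar>\<tau> w\<bar>" by (rule power_less_imp_less_base) simp
        then show ?case using w supp[of "\<tau> w"] by (simp add: C_def)
      qed
      then have "(C \<longlongrightarrow> 0) (at (1::complex) within sphere 0 1)" by (rule tendsto_eventually)
      then show ?thesis using True by (simp add: continuous_within C_def)
    qed
  qed
  from Stone_Weierstrass_polynomial_function[OF _ this e]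
  obtain g where g: "polynomial_function g" "\<And>x. x \<in> sphere 0 1 \<Longrightarrow> norm (C x - g x) < e" by auto
  have "real_polynomial_function (Re \<circ> g)" "real_polynomial_function (Im \<circ> g)"
    using g(1) bounded_linear_Re bounded_linear_Im unfolding polynomial_function_def by auto
  from LP_real_polynomial[OF this(1)] LP_real_polynomial[OF this(2)]
  have "(\<lambda>t. of_real (Re (g (rr t))) + \<i> * of_real (Im (g (rr t)))) \<in> LP"
    unfolding LP_def by (simp add: lspan_add lspan_cmult)
  then have "(\<lambda>t. g (rr t)) \<in> LP" by (simp flip: complex_eq)
  moreover have "norm (c t - g (rr t)) \<le> e" for t
    using g(2)[of "rr t"] rr1[of t] by (simp add: C_def tau_rr)
  ultimately show ?thesis by (auto intro!: bexI[of _ "\<lambda>t. g (rr t)"])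
qed

lemma continuous_approximation:
  fixes f :: "real \<Rightarrow> complex"
  assumes [measurable]: "f \<in> borel_measurable borel" and B: "\<And>t. norm (f t) \<le> B" "0 < B"
  obtains c M where "\<And>n. continuous_on UNIV (c n)" "\<And>n t. M n < \<bar>t\<bar> \<Longrightarrow> c n t = 0"
    "\<And>n t. norm (c n t) \<le> B" "AE t in lborel. (\<lambda>n. c n t) \<longlonglongrightarrow> f t"
proof -
  have "f measurable_on UNIV" by (rule lebesgue_measurable_imp_measurable_on) (auto intro: measurable_completion)
  then obtain N g where N: "negligible N" and g: "\<And>n. continuous_on UNIV (g n)"
    and lim: "\<And>x. x \<notin> N \<Longrightarrow> (\<lambda>n. g n x) \<longlonglongrightarrow> f x"
    unfolding measurable_on_def by auto
  \<comment> \<open>Radial clamping to the disc of radius \<open>B\<close>: continuous, and the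
    identity on the values of \<open>f\<close>.\<close>
  define cl where "cl z = z / of_real (max 1 (norm z / B))" for z :: complex
  \<comment> \<open>A trapezoidal cut-off, equal to 1 on \<open>[-n, n]\<close>.\<close>
  define \<phi> where "\<phi> n t = complex_of_real (max 0 (min 1 (real n + 1 - \<bar>t\<bar>)))" for n :: nat and t :: real
  have clcont: "continuous_on UNIV cl"
    unfolding cl_def by (intro continuous_intros) (use B in auto)
  have clB: "norm (cl z) \<le> B" for z
  proof (cases "norm z / B \<le> 1")
    case True
    then show ?thesis using B by (simp add: cl_def max_def field_simps)
  next
    case False
    then have "cl z = z / of_real (norm z / B)" by (simp add: cl_def max_def)
    then show ?thesis using False B by (simp add: norm_divide norm_mult)
  qed
  have clid: "cl z = z" if "norm z \<le> B" for z
    using that B by (simp add: cl_def max_def)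
  show ?thesis
  proof (rule that[of "\<lambda>n t. cl (g n t) * \<phi> n t" "\<lambda>n. real n + 1"])
    fix n
    show "continuous_on UNIV (\<lambda>t. cl (g n t) * \<phi> n t)"
      unfolding \<phi>_def by (intro continuous_intros continuous_on_compose2[OF clcont] g) auto
    fix t
    show "cl (g n t) * \<phi> n t = 0" if "real n + 1 < \<bar>t\<bar>" using that by (simp add: \<phi>_def)
    have "norm (\<phi> n t) \<le> 1" by (simp add: \<phi>_def)
    then show "norm (cl (g n t) * \<phi> n t) \<le> B"
      using mult_mono[OF clB[of "g n t"] \<open>norm (\<phi> n t) \<le> 1\<close>] B(2) by (simp add: norm_mult)
  next
    show "AE t in lborel. (\<lambda>n. cl (g n t) * \<phi> n t) \<longlonglongrightarrow> f t"
    proof (rule AE_lborel_if_negligible[OF N])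
      fix t assume "t \<notin> N"
      have 1: "(\<lambda>n. cl (g n t)) \<longlonglongrightarrow> cl (f t)"
        using clcont lim[OF \<open>t \<notin> N\<close>]
        by (auto simp: continuous_on_eq_continuous_at intro: isCont_tendsto_compose)
      define K where "K = nat \<lceil>\<bar>t\<bar>\<rceil>"
      have K: "\<bar>t\<bar> \<le> real K" unfolding K_def by (rule real_nat_ceiling_ge)
      have "\<phi> n t = 1" if "K \<le> n" for n
      proof -
        have "real K \<le> real n" using that by simp
        then show ?thesis using K by (simp add: \<phi>_def)
      qed
      then have "\<forall>\<^sub>F n in sequentially. \<phi> n t = 1"
        unfolding eventually_sequentially by (intro exI[of _ K] allI impI)
      then have 2: "(\<lambda>n. \<phi> n t) \<longlonglongrightarrow> 1" by (rule tendsto_eventually)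
      show "(\<lambda>n. cl (g n t) * \<phi> n t) \<longlonglongrightarrow> f t"
        using tendsto_mult[OF 1 2] clid[OF B(1)[of t]] by simp
    qed
  qed
qed

lemma LP_divide_in_bb_span: "h \<in> LP \<Longrightarrow> (\<lambda>t. h t / (complex_of_real t + \<i>)) \<in> lspan (range bb)"
proof -
  assume h: "h \<in> LP"
  have "(\<lambda>t. h t * (1 / (complex_of_real t + \<i>))) \<in> lspan (range bb)"
  proof (rule lspan_mono_map[OF h[unfolded LP_def]])
    fix b assume "b \<in> range (\<lambda>j t. rr t powi j)"
    then obtain j :: int where "b = (\<lambda>t. rr t powi j)" by blast
    then have "(\<lambda>t. b t * (1 / (complex_of_real t + \<i>))) = bb j" by (simp add: fun_eq_iff bb_def)
    then show "(\<lambda>t. b t * (1 / (complex_of_real t + \<i>))) \<in> lspan (range bb)"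
      by (simp add: lspan_base)
  qed
  then show ?thesis by simp
qed

lemma LP_bounded:
  assumes "h \<in> LP"
  shows "h \<in> borel_measurable borel" "\<exists>B. \<forall>t. norm (h t) \<le> B"
proof -
  have "h \<in> borel_measurable borel \<and> (\<exists>B. \<forall>t. norm (h t) \<le> B)"
    using assms unfolding LP_def
  proof induction
    case (lspan_step b g c)
    then obtain j B where j: "b = (\<lambda>t. rr t powi j)" and B: "\<And>t. norm (g t) \<le> B" by auto
    have "norm (c * b t + g t) \<le> norm c + B" for t
      using norm_triangle_ineq[of "c * b t" "g t"] B[of t] by (simp add: j norm_mult)
    moreover have [measurable]: "g \<in> borel_measurable borel" using lspan_step by blast
    have "(\<lambda>t. c * b t + g t) \<in> borel_measurable borel" unfolding j by measurable
    ultimately show ?case by blast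
  qed (auto intro!: exI[of _ 0])
  then show "h \<in> borel_measurable borel" "\<exists>B. \<forall>t. norm (h t) \<le> B" by auto
qed

text \<open>Under \<open>r\<close> the line becomes the unit circle, so this is the uniqueness of Fourier coefficients.\<close>

lemma integrable_fourier_zero:
  assumes f: "integrable lborel f" and fm: "f \<in> borel_measurable borel"
    and z: "\<And>j::int. (\<integral>t. f t * rr t powi j \<partial>lborel) = 0"
  shows "AE t in lborel. f t = 0"
proof -
  note [measurable] = fm
  have bint: "integrable lborel (\<lambda>t. f t * h t)" if "h \<in> borel_measurable borel" "\<And>t. norm (h t) \<le> B" for h B
  proof (rule Bochner_Integration.integrable_bound[of _ "\<lambda>t. norm (f t) * B"])
    show "AE t in lborel. norm (f t * h t) \<le> norm (norm (f t) * B)"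
      using that(2) order_trans[OF norm_ge_zero that(2)] by (auto simp: norm_mult intro!: mult_left_mono)
  qed (use f that(1) in auto)
  have LP0: "(\<integral>t. f t * h t \<partial>lborel) = 0" if "h \<in> LP" for h
    using that unfolding LP_def
  proof induction
    case (lspan_step b g c)
    then obtain j where j: "b = (\<lambda>t. rr t powi j)" by auto
    have g: "g \<in> LP" using lspan_step by (simp add: LP_def)
    obtain B where B: "\<And>t. norm (g t) \<le> B" using LP_bounded(2)[OF g] by blast
    have 1: "integrable lborel (\<lambda>t. f t * g t)" by (rule bint[OF LP_bounded(1)[OF g] B])
    have 2: "integrable lborel (\<lambda>t. f t * rr t powi j)" by (rule bint[of _ 1]) auto
    have "(\<integral>t. f t * (c * b t + g t) \<partial>lborel) = (\<integral>t. c * (f t * rr t powi j) + f t * g t \<partial>lborel)"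
      by (simp add: j algebra_simps)
    also have "\<dots> = (\<integral>t. c * (f t * rr t powi j) \<partial>lborel) + (\<integral>t. f t * g t \<partial>lborel)"
      by (rule Bochner_Integration.integral_add[OF integrable_mult_right[OF 2] 1])
    also have "\<dots> = 0" unfolding integral_mult_right_zero using z lspan_step by simp
    finally show ?case .
  qed simp
  have cont0: "(\<integral>t. f t * c t \<partial>lborel) = 0" if c: "continuous_on UNIV c" "\<And>t. M < \<bar>t\<bar> \<Longrightarrow> c t = 0" for c M
  proof (rule ccontr)
    let ?I = "\<integral>t. f t * c t \<partial>lborel" and ?N = "\<integral>t. norm (f t) \<partial>lborel"
    assume ne: "?I \<noteq> 0"
    \<comment> \<open>Makes \<open>norm ?I = 2 * ((?N + 1) * e)\<close>, which is incompatible with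
      the estimate \<open>norm ?I \<le> ?N * e\<close> obtained below.\<close>
    define e where "e = norm ?I / (?N + 1) / 2"
    have N: "0 \<le> ?N" by simp
    have e: "0 < e" unfolding e_def using ne N by (intro divide_pos_pos) (auto simp: add_nonneg_pos)
    obtain h where h: "h \<in> LP" "\<And>t. norm (c t - h t) \<le> e"
      using stone_weierstrass_LP[OF c e] by blast
    obtain B where B: "\<And>t. norm (h t) \<le> B" using LP_bounded(2)[OF h(1)] by blast
    note hm [measurable] = LP_bounded(1)[OF h(1)]
    have [measurable]: "c \<in> borel_measurable borel" by (rule borel_measurable_continuous_onI[OF c(1)])
    have i1: "integrable lborel (\<lambda>t. f t * (c t - h t))" by (rule bint[OF _ h(2)]) measurable
    have i2: "integrable lborel (\<lambda>t. f t * h t)" by (rule bint[OF hm B])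
    have "?I = (\<integral>t. f t * (c t - h t) + f t * h t \<partial>lborel)" by (simp add: algebra_simps)
    also have "\<dots> = (\<integral>t. f t * (c t - h t) \<partial>lborel)"
      unfolding Bochner_Integration.integral_add[OF i1 i2] LP0[OF h(1)] by simp
    also have "norm \<dots> \<le> (\<integral>t. norm (f t) * e \<partial>lborel)"
      by (rule norm_integral_le) (use f h(2) in \<open>auto simp: norm_mult intro!: mult_left_mono\<close>)
    also have "\<dots> = ?N * e" by simp
    finally have "norm ?I \<le> ?N * e" .
    moreover have "norm ?I = 2 * ((?N + 1) * e)"
    proof -
      have "a = 2 * (b * (a / b / 2))" if "0 < b" for a b :: real using that by simp
      from this[of "?N + 1" "norm ?I"] N show ?thesis unfolding e_def by linarith
    qed
    moreover have "0 < (?N + 1) * e"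
      by (rule mult_pos_pos[OF add_nonneg_pos[OF N zero_less_one] e])
    ultimately show False using e by (simp add: algebra_simps)
  qed
  \<comment> \<open>The conjugate sign turns \<open>f\<close> into its modulus. It is only
    measurable, hence the approximation by continuous functions of bounded support.\<close>
  define s where "s t = cnj (sgn (f t))" for t
  have sm: "s \<in> borel_measurable borel"
    unfolding s_def sgn_div_norm by (intro measurable_compose[OF _ borel_measurable_cnj]) measurable
  have s1: "norm (s t) \<le> 1" for t by (simp add: s_def norm_sgn)
  obtain c M where c: "\<And>n. continuous_on UNIV (c n)" "\<And>n t. M n < \<bar>t\<bar> \<Longrightarrow> c n t = 0"
    "\<And>n t. norm (c n t) \<le> 1" "AE t in lborel. (\<lambda>n. c n t) \<longlonglongrightarrow> s t"
    using continuous_approximation[OF sm s1 zero_less_one] by blast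
  have cm [measurable]: "c n \<in> borel_measurable borel" for n by (rule borel_measurable_continuous_onI[OF c(1)])
  note [measurable] = sm
  have "(\<lambda>n. \<integral>t. f t * c n t \<partial>lborel) \<longlonglongrightarrow> (\<integral>t. f t * s t \<partial>lborel)"
  proof (rule integral_dominated_convergence[where w = "\<lambda>t. norm (f t)"])
    show "AE t in lborel. (\<lambda>n. f t * c n t) \<longlonglongrightarrow> f t * s t"
      using c(4) by eventually_elim (intro tendsto_intros)
    show "AE t in lborel. norm (f t * c n t) \<le> norm (f t)" for n
      using c(3) by (auto simp: norm_mult intro!: mult_left_le)
  qed (use f in auto)
  then have "(\<integral>t. f t * s t \<partial>lborel) = 0"
    using cont0[OF c(1,2)] by (simp add: LIMSEQ_const_iff)
  moreover have "f t * s t = of_real (norm (f t))" for t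
  proof (cases "f t = 0")
    case False
    have "f t * s t = of_real ((norm (f t))\<^sup>2) / of_real (norm (f t))"
      unfolding complex_norm_square by (simp add: s_def sgn_div_norm scaleR_conv_of_real field_simps)
    then show ?thesis using False by (simp add: power2_eq_square)
  qed (simp add: s_def)
  ultimately have "(\<integral>t. norm (f t) \<partial>lborel) = 0" by simp
  then have "AE t in lborel. norm (f t) = 0"
    using integral_nonneg_eq_0_iff_AE[of lborel "\<lambda>t. norm (f t)"] f by simp
  then show ?thesis by simp
qed

text \<open>Truncation in size and support comes first, then a continuous \<open>d\<close> of
  bounded support, then a Laurent polynomial \<open>h\<close> uniformly close to
  \<open>d t * (t + \<i>)\<close>. Dividing by \<open>t + \<i>\<close> turns the uniform error into
  a small multiple of a function in \<open>Lfun p\<close>.\<close>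

lemma bb_span_dense:
  assumes p: "1 < p" and f: "f \<in> Lfun p"
  shows "\<exists>fs. (\<forall>n. fs n \<in> lspan (range bb)) \<and> Lconv p fs f"
proof -
  have p0: "0 < p" using p by simp
  note fm [measurable] = Lfun_measurable[OF f]
  have bsub: "range bb \<subseteq> Lfun p" using bb_Lfun[OF p] by auto
  have approx: "\<exists>g\<in>lspan (range bb). pint p (\<lambda>x. f x - g x) < e" if e: "0 < e" for e
  proof -
    \<comment> \<open>The triangle inequality with factor \<open>2 powr p\<close> is used twice; the
      three errors then add up to at most \<open>3 * e / 4\<close>.\<close>
    define E where "E = e / (2 powr p * 2 powr p) / 4"
    have E: "0 < E" using e by (simp add: E_def)
    define I where "I n = {- (real n + 1)..real n + 1}" for n :: nat
    have [measurable]: "I n \<in> sets borel" for n by (simp add: I_def)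
    define f1 where "f1 n t = f t * indicator ({t. norm (f t) \<le> real n + 1} \<inter> I n) t" for n t
    have f1m [measurable]: "f1 n \<in> borel_measurable borel" for n unfolding f1_def by measurable
    have "Lconv p f1 f"
    proof (rule Lconv_dominated[OF p0 f])
      show "AE t in lborel. (\<lambda>n. f1 n t) \<longlonglongrightarrow> f t"
      proof (rule AE_I2)
        fix t :: real
        define N where "N = nat \<lceil>max (norm (f t)) \<bar>t\<bar>\<rceil>"
        have N: "max (norm (f t)) \<bar>t\<bar> \<le> real N" unfolding N_def by (rule real_nat_ceiling_ge)
        have "f1 n t = f t" if "N \<le> n" for n
        proof -
          have "real N \<le> real n" using that by simp
          then have "norm (f t) \<le> real n + 1" "t \<in> I n" using N by (auto simp: I_def abs_le_iff)
          then show ?thesis by (simp add: f1_def)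
        qed
        then have "\<forall>\<^sub>F n in sequentially. f1 n t = f t"
          unfolding eventually_sequentially by (intro exI[of _ N] allI impI)
        then show "(\<lambda>n. f1 n t) \<longlonglongrightarrow> f t" by (rule tendsto_eventually)
      qed
    qed (auto simp: f1_def indicator_def)
    then have f1L: "\<And>n. f1 n \<in> Lfun p" and "(\<lambda>n. pint p (\<lambda>x. f1 n x - f x)) \<longlonglongrightarrow> 0"
      by (auto simp: Lconv_def)
    then have "\<forall>\<^sub>F n in sequentially. pint p (\<lambda>x. f1 n x - f x) < E" using E by (intro order_tendstoD) auto
    then obtain n where n: "pint p (\<lambda>x. f1 n x - f x) < E" by (auto simp: eventually_sequentially)
    have f1B: "norm (f1 n t) \<le> real n + 1" for t by (auto simp: f1_def indicator_def)
    have n1: "0 < real n + 1" by simp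
    obtain c M where c: "\<And>k. continuous_on UNIV (c k)" "\<And>k t. M k < \<bar>t\<bar> \<Longrightarrow> c k t = 0"
      "\<And>k t. norm (c k t) \<le> real n + 1" "AE t in lborel. (\<lambda>k. c k t) \<longlonglongrightarrow> f1 n t"
      using continuous_approximation[OF f1m f1B n1] by blast
    \<comment> \<open>The supports of the \<open>c k\<close> may grow with \<open>k\<close>. This
      second cut-off, equal to 1 wherever \<open>f1 n\<close> is nonzero, provides one dominating
      function for all \<open>k\<close>.\<close>
    define \<phi> where "\<phi> t = complex_of_real (max 0 (min 1 (real n + 2 - \<bar>t\<bar>)))" for t :: real
    have phic: "continuous_on UNIV \<phi>" unfolding \<phi>_def by (intro continuous_intros)
    define d where "d k t = c k t * \<phi> t" for k t
    have dc: "continuous_on UNIV (d k)" for k unfolding d_def by (intro continuous_intros c phic)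
    have ds: "d k t = 0" if "real n + 2 < \<bar>t\<bar>" for k t using that by (simp add: d_def \<phi>_def)
    have [measurable]: "d k \<in> borel_measurable borel" for k by (rule borel_measurable_continuous_onI[OF dc])
    have phi1: "norm (\<phi> t) \<le> 1" for t by (simp add: \<phi>_def)
    define w where "w t = complex_of_real ((real n + 1) * indicator {- (real n + 2)..real n + 2} t)" for t
    have nw: "norm (w t) = (real n + 1) * indicator {- (real n + 2)..real n + 2} t" for t
      unfolding w_def norm_of_real by (simp add: indicator_def)
    have wL: "w \<in> Lfun p"
    proof (rule LfunI)
      have "norm (w t) powr p = indicator {- (real n + 2)..real n + 2} t * (real n + 1) powr p" for t
        unfolding nw by (simp add: indicator_def)
      then show "integrable lborel (\<lambda>t. norm (w t) powr p)"
        by (simp add: integrable_real_indicator emeasure_lborel_Icc_eq)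
    qed (unfold w_def, measurable)
    have dw: "norm (d k t) \<le> norm (w t)" for k t
    proof (cases "real n + 2 < \<bar>t\<bar>")
      case False
      have "norm (d k t) \<le> (real n + 1) * 1" unfolding d_def norm_mult by (intro mult_mono c phi1) auto
      then show ?thesis using False unfolding nw by (auto simp: indicator_def)
    qed (simp add: ds)
    have "Lconv p d (f1 n)"
    proof (rule Lconv_dominated[OF p0 wL])
      show "AE t in lborel. (\<lambda>k. d k t) \<longlonglongrightarrow> f1 n t"
        using c(4)
      proof eventually_elim
        case (elim t)
        have "(\<lambda>k. d k t) \<longlonglongrightarrow> f1 n t * \<phi> t" unfolding d_def by (intro tendsto_intros elim)
        moreover have "f1 n t * \<phi> t = f1 n t"
          by (auto simp: f1_def \<phi>_def I_def indicator_def)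
        ultimately show ?case by simp
      qed
    qed (use dw in auto)
    then have dL: "\<And>k. d k \<in> Lfun p" and "(\<lambda>k. pint p (\<lambda>x. d k x - f1 n x)) \<longlonglongrightarrow> 0"
      by (auto simp: Lconv_def)
    then have "\<forall>\<^sub>F k in sequentially. pint p (\<lambda>x. d k x - f1 n x) < E" using E by (intro order_tendstoD) auto
    then obtain k where k: "pint p (\<lambda>x. d k x - f1 n x) < E" by (auto simp: eventually_sequentially)
    let ?w = "\<lambda>t. 1 / (complex_of_real t + \<i>)"
    define \<epsilon> where "\<epsilon> = (E / (pint p ?w + 1)) powr (1 / p)"
    have w0: "0 < pint p ?w + 1" by (simp add: add_nonneg_pos)
    have eps: "0 < \<epsilon>" using E w0 by (simp add: \<epsilon>_def)
    have "continuous_on UNIV (\<lambda>t. d k t * (complex_of_real t + \<i>))" by (intro continuous_intros dc)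
    from stone_weierstrass_LP[OF this _ eps, of "real n + 2"]
    obtain h where h: "h \<in> LP" "\<And>t. norm (d k t * (complex_of_real t + \<i>) - h t) \<le> \<epsilon>" using ds by auto
    define g where "g t = h t / (complex_of_real t + \<i>)" for t
    have g: "g \<in> lspan (range bb)" unfolding g_def by (rule LP_divide_in_bb_span[OF h(1)])
    have gL: "g \<in> Lfun p" by (rule lspan_Lfun[OF g bsub p0])
    have "pint p (\<lambda>x. d k x - g x) \<le> \<epsilon> powr p * pint p ?w"
    proof (rule Lfun_bounded_by(2)[OF Lfun_weight[OF p]])
      have "d k t - g t = (d k t * (complex_of_real t + \<i>) - h t) * ?w t" for t
        by (simp add: g_def field_simps)
      then show "AE t in lborel. norm (d k t - g t) \<le> \<epsilon> * norm (?w t)"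
        using h(2) by (simp only: norm_mult) (intro AE_I2 mult_right_mono, auto)
    qed (use Lfun_measurable[OF gL] eps p0 in auto)
    also have "\<dots> \<le> E"
    proof -
      have "\<epsilon> powr p = E / (pint p ?w + 1)" using E w0 p0 by (simp add: \<epsilon>_def powr_powr)
      then have "\<epsilon> powr p * pint p ?w = E * (pint p ?w / (pint p ?w + 1))" by simp
      also have "\<dots> \<le> E * 1"
        using E by (intro mult_left_mono divide_le_eq_1_pos[OF w0, THEN iffD2]) auto
      finally show ?thesis by simp
    qed
    finally have gk: "pint p (\<lambda>x. d k x - g x) \<le> E" .
    have "pint p (\<lambda>x. f x - g x) \<le> 2 powr p * (pint p (\<lambda>x. f x - f1 n x) + pint p (\<lambda>x. f1 n x - g x))"
      by (rule pint_triangle[OF f f1L gL p0])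
    also have "\<dots> \<le> 2 powr p * (E + 2 powr p * (E + E))"
    proof (intro mult_left_mono add_mono)
      show "pint p (\<lambda>x. f x - f1 n x) \<le> E" using n by (subst pint_minus_commute) simp
      have "pint p (\<lambda>x. f1 n x - g x) \<le> 2 powr p * (pint p (\<lambda>x. f1 n x - d k x) + pint p (\<lambda>x. d k x - g x))"
        by (rule pint_triangle[OF f1L dL gL p0])
      also have "\<dots> \<le> 2 powr p * (E + E)"
        using k gk pint_minus_commute[of p "f1 n" "d k"] by (intro mult_left_mono add_mono) auto
      finally show "pint p (\<lambda>x. f1 n x - g x) \<le> 2 powr p * (E + E)" .
    qed auto
    also have "\<dots> \<le> 2 powr p * (2 powr p * E + 2 powr p * (E + E))"
    proof -
      have "1 \<le> (2::real) powr p" using p by (intro ge_one_powr_ge_zero) auto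
      then show ?thesis using E by (intro mult_left_mono add_right_mono) auto
    qed
    also have "\<dots> = (2 powr p * 2 powr p) * (3 * E)" by (simp add: algebra_simps)
    also have "\<dots> < e" using e by (simp add: E_def)
    finally show ?thesis using g by blast
  qed
  define fs where "fs n = (SOME g. g \<in> lspan (range bb) \<and> pint p (\<lambda>x. f x - g x) < 1 / (real n + 1))" for n :: nat
  have "\<exists>g. g \<in> lspan (range bb) \<and> pint p (\<lambda>x. f x - g x) < 1 / (real n + 1)" for n :: nat
    using approx[of "1 / (real n + 1)"] by auto
  from someI_ex[OF this]
  have fs: "fs n \<in> lspan (range bb)" "pint p (\<lambda>x. f x - fs n x) < 1 / (real n + 1)" for n
    by (simp_all add: fs_def)
  have "(\<lambda>n. pint p (\<lambda>x. fs n x - f x)) \<longlonglongrightarrow> 0"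
  proof (rule tendsto_sandwich[of "\<lambda>n. 0" _ _ "\<lambda>n. 1 / (real n + 1)"])
    show "\<forall>\<^sub>F n in sequentially. pint p (\<lambda>x. fs n x - f x) \<le> 1 / (real n + 1)"
    proof (intro always_eventually allI)
      fix n
      show "pint p (\<lambda>x. fs n x - f x) \<le> 1 / (real n + 1)"
        using fs(2)[of n] pint_minus_commute[of p f "fs n"] by simp
    qed
    show "(\<lambda>n. 1 / (real n + 1)) \<longlonglongrightarrow> 0" by real_asymp
  qed auto
  then have "Lconv p fs f" using fs(1) lspan_Lfun[OF _ bsub p0] f by (auto simp: Lconv_def)
  then show ?thesis using fs(1) by blast
qed

text \<open>The Riesz-Fischer argument. Along a subsequence the \<open>p\<close>-th powers of the
  weighted differences \<open>2 ^ k * d k\<close> have summable integrals, so almost everywhere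
  \<open>norm (d k x)\<close> is at most a constant times \<open>(1 / 2) ^ k\<close> and the
  subsequence converges.\<close>

lemma Lfun_complete:
  assumes p: "0 < p" and fs: "\<And>n. fs n \<in> Lfun p"
    and cauchy: "\<And>e. 0 < e \<Longrightarrow> \<exists>N. \<forall>m\<ge>N. \<forall>n\<ge>N. pint p (\<lambda>x. fs m x - fs n x) < e"
  shows "\<exists>g. Lconv p fs g"
proof -
  note [measurable] = Lfun_measurable[OF fs]
  define N where "N e = (SOME N. \<forall>m\<ge>N. \<forall>n\<ge>N. pint p (\<lambda>x. fs m x - fs n x) < e)" for e
  have N: "pint p (\<lambda>x. fs m x - fs n x) < e" if "0 < e" "N e \<le> m" "N e \<le> n" for e m n
    using someI_ex[OF cauchy[OF that(1)]] that(2,3) unfolding N_def by blast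
  define q where "q = (1/2) powr p"
  have q: "0 < q" by (simp add: q_def)
  \<comment> \<open>The factor \<open>q ^ k\<close> cancels \<open>(2 ^ k) powr p\<close>, and the
    summable \<open>(1 / 2) ^ k\<close> remains.\<close>
  define e where "e k = (q / 2) ^ k" for k :: nat
  have e: "0 < e k" for k using q by (simp add: e_def)
  define s where "s = rec_nat (N (e 0)) (\<lambda>k m. Suc (max m (N (e (Suc k)))))"
  have s_Suc: "s (Suc k) = Suc (max (s k) (N (e (Suc k))))" for k by (simp add: s_def)
  have s_mono: "s k \<le> s (Suc k)" for k by (simp add: s_Suc)
  have sN: "N (e k) \<le> s k" for k by (cases k) (auto simp: s_def)
  have s_ge: "k \<le> s k" for k
  proof (induction k)
    case (Suc k)
    then show ?case by (simp add: s_Suc)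
  qed simp
  define d where "d k x = fs (s (Suc k)) x - fs (s k) x" for k x
  have [measurable]: "d k \<in> borel_measurable borel" for k unfolding d_def by measurable
  have dL: "d k \<in> Lfun p" for k unfolding d_def by (rule Lfun_diff(1)[OF fs fs p])
  have dP: "pint p (d k) < e k" for k
    unfolding d_def by (rule N[OF e]) (use sN[of k] s_mono[of k] in auto)
  have q2: "(2 ^ k :: real) powr p * q ^ k = 1" for k
  proof -
    have "q ^ k = ((1 / 2) ^ k) powr p" by (simp add: q_def powr_power powr_realpow[symmetric] powr_powr mult.commute)
    then have "(2 ^ k :: real) powr p * q ^ k = (2 ^ k * (1 / 2) ^ k) powr p" by (simp add: powr_mult)
    then show ?thesis by (simp flip: power_mult_distrib)
  qed
  have "(\<integral>\<^sup>+x. (\<Sum>k. ennreal (norm (2 ^ k * d k x) powr p)) \<partial>lborel) = (\<Sum>k. \<integral>\<^sup>+x. ennreal (norm (2 ^ k * d k x) powr p) \<partial>lborel)"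
    by (rule nn_integral_suminf) measurable
  also have "\<dots> \<le> (\<Sum>k. ennreal ((1/2) ^ k))"
  proof (intro suminf_le allI)
    fix k
    have "(\<integral>\<^sup>+x. ennreal (norm (2 ^ k * d k x) powr p) \<partial>lborel) = ennreal (pint p (\<lambda>x. 2 ^ k * d k x))"
      unfolding pint_def by (intro nn_integral_eq_integral Lfun_integrable Lfun_cmult dL p) auto
    also have "pint p (\<lambda>x. 2 ^ k * d k x) = (2 ^ k) powr p * pint p (d k)"
      by (subst Lfun_cmult(2)[OF dL p]) (simp add: norm_power)
    also have "ennreal \<dots> \<le> ennreal ((2 ^ k) powr p * e k)"
      using dP[of k] by (intro ennreal_leI mult_left_mono) auto
    also have "(2 ^ k) powr p * e k = (1/2) ^ k"
      using q2[of k] by (simp add: e_def power_divide)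
    finally show "(\<integral>\<^sup>+x. ennreal (norm (2 ^ k * d k x) powr p) \<partial>lborel) \<le> ennreal ((1/2) ^ k)" .
  qed auto
  also have "\<dots> < \<infinity>"
  proof -
    have "(\<Sum>k. ennreal ((1/2) ^ k)) = ennreal (1 / (1 - 1/2))"
      by (intro suminf_ennreal_eq geometric_sums) auto
    then show ?thesis by simp
  qed
  finally have "AE x in lborel. (\<Sum>k. ennreal (norm (2 ^ k * d k x) powr p)) \<noteq> \<infinity>"
    by (intro nn_integral_PInf_AE) auto
  then have conv: "AE x in lborel. convergent (\<lambda>k. fs (s k) x)"
  proof eventually_elim
    case (elim x)
    let ?T = "\<Sum>k. ennreal (norm (2 ^ k * d k x) powr p)"
    define C where "C = enn2real ?T"
    have "?T < top" using elim by (simp only: infinity_ennreal_def less_top)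
    from ennreal_enn2real[OF this] have C: "?T = ennreal C" "0 \<le> C"
      unfolding C_def by (simp_all only: enn2real_nonneg)
    have le: "norm (d k x) \<le> C powr (1 / p) * (1 / 2) ^ k" for k
    proof -
      have "ennreal (norm (2 ^ k * d k x) powr p) = (\<Sum>i\<in>{k}. ennreal (norm (2 ^ i * d i x) powr p))" by simp
      also have "\<dots> \<le> ?T" by (rule sum_le_suminf) auto
      also have "\<dots> = ennreal C" by (rule C(1))
      finally have "norm (2 ^ k * d k x) powr p \<le> C" using C(2) by (simp add: ennreal_le_iff)
      then have "(norm (2 ^ k * d k x) powr p) powr (1 / p) \<le> C powr (1 / p)"
        using p by (intro powr_mono2) auto
      then have "2 ^ k * norm (d k x) \<le> C powr (1 / p)"
        using p by (simp add: powr_powr norm_mult norm_power)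
      then show ?thesis by (simp add: power_one_over field_simps)
    qed
    have "summable (\<lambda>k. d k x)"
      by (rule summable_comparison_test'[of "\<lambda>k. C powr (1 / p) * (1 / 2) ^ k" 0])
        (use le in \<open>auto intro!: summable_mult summable_geometric\<close>)
    then have "convergent (\<lambda>n. \<Sum>k<n. d k x)" by (simp add: summable_iff_convergent)
    then obtain L where "(\<lambda>n. \<Sum>k<n. d k x) \<longlonglongrightarrow> L" by (auto simp: convergent_def)
    moreover have "(\<Sum>k<n. d k x) = fs (s n) x - fs (s 0) x" for n
      unfolding d_def by (rule sum_lessThan_telescope)
    ultimately have "(\<lambda>n. fs (s n) x - fs (s 0) x + fs (s 0) x) \<longlonglongrightarrow> L + fs (s 0) x"
      by (intro tendsto_add) auto
    then show ?case by (auto simp: convergent_def)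
  qed
  define g where "g x = lim (\<lambda>k. fs (s k) x)" for x
  have gm [measurable]: "g \<in> borel_measurable borel" unfolding g_def by measurable
  have gl: "AE x in lborel. (\<lambda>k. fs (s k) x) \<longlonglongrightarrow> g x"
    using conv by eventually_elim (simp add: g_def convergent_LIMSEQ_iff)
  \<comment> \<open>Only a subsequence converges pointwise. Letting the second index of the Cauchy
    condition run through it, Fatou's lemma yields convergence in mean of the whole
    sequence.\<close>
  have main: "(\<lambda>x. fs n x - g x) \<in> Lfun p \<and> pint p (\<lambda>x. fs n x - g x) \<le> \<epsilon>" if eps: "0 < \<epsilon>" and n: "N \<epsilon> \<le> n" for \<epsilon> n
  proof -
    let ?f = "\<lambda>k x. fs n x - fs (s (k + N \<epsilon>)) x"
    have L: "?f k \<in> Lfun p" for k by (rule Lfun_diff(1)[OF fs fs p])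
    have P: "pint p (?f k) \<le> \<epsilon>" for k
      using N[OF eps n, of "s (k + N \<epsilon>)"] s_ge[of "k + N \<epsilon>"] by simp
    have M: "(\<lambda>x. fs n x - g x) \<in> borel_measurable borel" by measurable
    have T: "AE x in lborel. (\<lambda>k. ?f k x) \<longlonglongrightarrow> fs n x - g x"
      using gl
    proof eventually_elim
      case (elim x)
      from LIMSEQ_ignore_initial_segment[OF elim, of "N \<epsilon>"] show ?case by (intro tendsto_intros)
    qed
    show ?thesis using Lfun_Fatou[OF p L P M T] by simp
  qed
  have "(\<lambda>x. fs (N 1) x - (fs (N 1) x - g x)) \<in> Lfun p"
    by (rule Lfun_diff(1)[OF fs _ p]) (use main[of 1 "N 1"] in simp)
  then have gL: "g \<in> Lfun p" by simp
  have "(\<lambda>n. pint p (\<lambda>x. fs n x - g x)) \<longlonglongrightarrow> 0"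
  proof (rule LIMSEQ_I)
    fix r :: real assume r: "0 < r"
    show "\<exists>no. \<forall>n\<ge>no. norm (pint p (\<lambda>x. fs n x - g x) - 0) < r"
      using main[of "r / 2"] r by (intro exI[of _ "N (r / 2)"]) fastforce
  qed
  then show ?thesis using fs gL unfolding Lconv_def by blast
qed

section \<open>The Riesz projection\<close>

text \<open>The boundary values of Hardy functions are the functions whose Cauchy integral vanishes
  on the opposite half-plane.\<close>

definition Ap :: "real \<Rightarrow> (real \<Rightarrow> complex) set" where
  "Ap p = {f \<in> Lfun p. \<forall>w. Im w < 0 \<longrightarrow> KI f w = 0}"

definition Am :: "real \<Rightarrow> (real \<Rightarrow> complex) set" where
  "Am p = {f \<in> Lfun p. \<forall>w. 0 < Im w \<longrightarrow> KI f w = 0}"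

lemma Ap_cnj: "f \<in> Ap p \<Longrightarrow> (\<lambda>t. cnj (f t)) \<in> Am p"
  by (auto simp: Ap_def Am_def Lfun_cnj KI_cnj)

lemma Am_cnj: "f \<in> Am p \<Longrightarrow> (\<lambda>t. cnj (f t)) \<in> Ap p"
  by (auto simp: Ap_def Am_def Lfun_cnj KI_cnj)

lemma Ap_closed:
  assumes "1 < p" "Lconv p fs f" "\<And>n. fs n \<in> Ap p"
  shows "f \<in> Ap p"
proof -
  have "KI f w = 0" if "Im w < 0" for w
    using KI_Lconv[OF assms(1,2), of w] assms(3) that by (simp add: Ap_def LIMSEQ_const_iff)
  then show ?thesis using assms by (simp add: Ap_def Lconv_def)
qed

lemma Am_closed:
  assumes "1 < p" "Lconv p fs f" "\<And>n. fs n \<in> Am p"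
  shows "f \<in> Am p"
proof -
  have "KI f w = 0" if "0 < Im w" for w
    using KI_Lconv[OF assms(1,2), of w] assms(3) that by (simp add: Am_def LIMSEQ_const_iff)
  then show ?thesis using assms by (simp add: Am_def Lconv_def)
qed

lemma Ap_lin:
  assumes p: "1 < p"
  shows "(\<lambda>t. 0) \<in> Ap p" "f \<in> Ap p \<Longrightarrow> g \<in> Ap p \<Longrightarrow> (\<lambda>t. f t + g t) \<in> Ap p"
    "f \<in> Ap p \<Longrightarrow> g \<in> Ap p \<Longrightarrow> (\<lambda>t. f t - g t) \<in> Ap p"
    "f \<in> Ap p \<Longrightarrow> (\<lambda>t. c * f t) \<in> Ap p"
  using p by (auto simp: Ap_def Lfun_zero KI_zero KI_cmult Lfun_cmult KI_add[OF p] KI_diff[OF p] Lfun_add Lfun_diff)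

lemma Am_lin:
  assumes p: "1 < p"
  shows "(\<lambda>t. 0) \<in> Am p" "f \<in> Am p \<Longrightarrow> g \<in> Am p \<Longrightarrow> (\<lambda>t. f t + g t) \<in> Am p"
    "f \<in> Am p \<Longrightarrow> g \<in> Am p \<Longrightarrow> (\<lambda>t. f t - g t) \<in> Am p"
    "f \<in> Am p \<Longrightarrow> (\<lambda>t. c * f t) \<in> Am p"
  using p by (auto simp: Am_def Lfun_zero KI_zero KI_cmult Lfun_cmult KI_add[OF p] KI_diff[OF p] Lfun_add Lfun_diff)

lemma Ap_lspan: "1 < p \<Longrightarrow> B \<subseteq> Ap p \<Longrightarrow> f \<in> lspan B \<Longrightarrow> f \<in> Ap p"
  by (erule lspan.induct) (auto intro!: Ap_lin)

lemma Am_lspan: "1 < p \<Longrightarrow> B \<subseteq> Am p \<Longrightarrow> f \<in> lspan B \<Longrightarrow> f \<in> Am p"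
  by (erule lspan.induct) (auto intro!: Am_lin)

text \<open>The boundary values come from
  \<open>((z - \<i>) / (z + \<i>)) ^ nat j / (z + \<i>)\<close>. The quotient has modulus at most 1
  in the upper half-plane, and \<open>1 / (z + \<i>)\<close> is dominated by its value at the point
  of the real line below \<open>z\<close>.\<close>

lemma bb_Ap:
  assumes p: "1 < p" and j: "0 \<le> j"
  shows "bb j \<in> Ap p"
proof -
  define F where "F z = ((z - \<i>) / (z + \<i>)) ^ nat j / (z + \<i>)" for z
  have Fbb: "F (of_real t) = bb j t" for t
    using j by (simp add: F_def bb_def rr_def power_int_def)
  have nz: "z + \<i> \<noteq> 0" if "0 \<le> Im z" for z
    using that by (auto simp: complex_eq_iff)
  have hol: "F holomorphic_on {z. 0 < Im z}"
    unfolding F_def by (intro holomorphic_intros) (use nz in auto)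
  have le: "norm (F (Complex x y)) \<le> norm (1 / (complex_of_real x + \<i>))" if "0 < y" for x y
  proof -
    let ?z = "Complex x y"
    have "norm (?z - \<i>) \<le> norm (?z + \<i>)"
      unfolding norm_complex_def using that by (simp add: power2_eq_square algebra_simps)
    then have "norm ((?z - \<i>) / (?z + \<i>)) \<le> 1" using nz[of ?z] that by (simp add: norm_divide divide_le_eq_1)
    then have "norm ((?z - \<i>) / (?z + \<i>)) ^ nat j \<le> 1" by (intro power_le_one) auto
    moreover have "norm (1 / (?z + \<i>)) \<le> norm (1 / (complex_of_real x + \<i>))"
    proof (rule norm_inverse_le)
      show "0 < norm (complex_of_real x + \<i>)" by simp
      show "norm (complex_of_real x + \<i>) \<le> norm (Complex x y + \<i>)"
        using that by (auto simp: norm_complex_def intro!: real_sqrt_le_mono power_mono)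
    qed
    ultimately have "norm ((?z - \<i>) / (?z + \<i>)) ^ nat j * norm (1 / (?z + \<i>)) \<le> 1 * norm (1 / (complex_of_real x + \<i>))"
      by (intro mult_mono) auto
    then show ?thesis by (simp add: F_def norm_divide norm_power)
  qed
  have "(SUP y\<in>{0<..}. \<integral>\<^sup>+ x. ennreal (norm (F (Complex x (1 * y))) powr p) \<partial>lebesgue)
      \<le> (\<integral>\<^sup>+ x. ennreal (norm (1 / (complex_of_real x + \<i>)) powr p) \<partial>lebesgue)"
    using p le by (intro SUP_least nn_integral_mono ennreal_leI powr_mono2) auto
  also have "\<dots> < \<infinity>"
    using integrable_weight_powr[OF p] by (simp add: nn_integral_completion nn_integral_eq_integral)
  finally have Fh: "F \<in> hardy_fun 1 p"
    using hol by (simp add: hardy_fun_def half_plane_def)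
  have nt: "nt_limit 1 F x (bb j x)" for x
  proof -
    have "isCont F (of_real x)"
      unfolding F_def by (intro continuous_intros) (use nz[of "of_real x"] in auto)
    then show ?thesis unfolding nt_limit_def isCont_def Fbb by (auto intro: tendsto_within_subset)
  qed
  have "KI (bb j) w = 0" if "Im w < 0" for w
    by (rule hardy_boundary_KI_zero[OF p Fh bb_Lfun[OF p] _ that]) (use nt in auto)
  then show ?thesis using bb_Lfun[OF p] by (simp add: Ap_def)
qed

lemma bb_Am:
  assumes p: "1 < p" and j: "j < 0"
  shows "bb j \<in> Am p"
  using Ap_cnj[OF bb_Ap[OF p, of "- j - 1"]] j by (simp add: cnj_bb)

lemma Ap_poisson:
  assumes p: "1 < p" and g: "g \<in> Ap p"
  shows "AE x in lborel. nt_limit 1 (\<lambda>z. KI g z / (2 * of_real pi * \<i>)) x (g x)"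
  using hardy_fun_from_KI(2)[OF p, of g] g by (simp add: Ap_def)

text \<open>Above the real line the Cauchy integral of \<open>g + h\<close> is that of
  \<open>g\<close>, since \<open>h\<close> contributes nothing. The Riesz bound is uniform in the
  height and the boundary values are \<open>2 * pi * \<i> * g\<close>; the surplus factor, of
  modulus greater than 1, is dropped.\<close>

lemma Ap_bound:
  assumes p: "1 < p" and K: "riesz_bound p K" and g: "g \<in> Ap p" and h: "h \<in> Am p"
  shows "pint p g \<le> K * pint p (\<lambda>x. g x + h x)"
proof -
  have L: "g \<in> Lfun p" "h \<in> Lfun p" using g h by (auto simp: Ap_def Am_def)
  have p0: "0 < p" using p by simp
  have fL: "(\<lambda>x. g x + h x) \<in> Lfun p" by (rule Lfun_add(1)[OF L p0])
  define y where "y n = 1 / (real n + 1)" for n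
  have y: "0 < y n" for n by (simp add: y_def)
  have y0: "y \<longlonglongrightarrow> 0" unfolding y_def by real_asymp
  let ?f = "\<lambda>n x. KI (\<lambda>x. g x + h x) (Complex x (y n))"
  have eq: "?f n x = KI g (Complex x (y n))" for n x
    using KI_add[OF p L, of "Complex x (y n)"] h y[of n] by (simp add: Am_def less_imp_neq[symmetric])
  have R: "?f n \<in> Lfun p" "pint p (?f n) \<le> K * pint p (\<lambda>x. g x + h x)" for n
    using K fL y[of n] unfolding riesz_bound_def by auto
  let ?c = "2 * of_real pi * \<i> :: complex"
  have lim: "AE x in lborel. (\<lambda>n. ?f n x) \<longlonglongrightarrow> ?c * g x"
    using Ap_poisson[OF p g]
  proof eventually_elim
    case (elim x)
    have "(\<lambda>n. ?c * (KI g (Complex x (y n)) / ?c)) \<longlonglongrightarrow> ?c * g x"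
      by (intro tendsto_mult_left nt_limit_vertical[OF elim y y0])
    then show ?case unfolding eq by simp
  qed
  have "pint p (\<lambda>x. ?c * g x) \<le> K * pint p (\<lambda>x. g x + h x)"
  proof (rule Lfun_Fatou(2)[OF p0 R _ lim])
    note [measurable] = Lfun_measurable[OF L(1)]
    show "(\<lambda>x. ?c * g x) \<in> borel_measurable borel" by measurable
  qed
  moreover have "pint p g \<le> pint p (\<lambda>x. ?c * g x)"
  proof -
    have "1 powr p \<le> norm ?c powr p"
      using pi_gt3 p0 by (intro powr_mono2) (auto simp: norm_mult)
    then have "1 * pint p g \<le> norm ?c powr p * pint p g" by (intro mult_right_mono) auto
    then show ?thesis by (simp only: Lfun_cmult(2)[OF L(1) p0] mult_1)
  qed
  ultimately show ?thesis by simp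
qed

lemma bb_span_split:
  assumes "f \<in> lspan (range bb)"
  shows "\<exists>g\<in>lspan (bb ` {0..}). \<exists>h\<in>lspan (bb ` {..<0}). f = (\<lambda>t. g t + h t)"
  using assms
proof induction
  case lspan_zero
  show ?case by (intro bexI[of _ "\<lambda>t. 0"]) (auto intro: lspan.lspan_zero)
next
  case (lspan_step b f c)
  then obtain g h j where gh: "g \<in> lspan (bb ` {0..})" "h \<in> lspan (bb ` {..<0})" "f = (\<lambda>t. g t + h t)" and j: "b = bb j"
    by auto
  show ?case
  proof (cases "0 \<le> j")
    case True
    have "(\<lambda>t. c * b t + g t) \<in> lspan (bb ` {0..})"
      by (rule lspan.lspan_step) (use True j gh in auto)
    then show ?thesis using gh by (intro bexI[of _ "\<lambda>t. c * b t + g t"] bexI[of _ h]) (auto simp: algebra_simps)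
  next
    case False
    have "(\<lambda>t. c * b t + h t) \<in> lspan (bb ` {..<0})"
      by (rule lspan.lspan_step) (use False j gh in auto)
    then show ?thesis using gh by (intro bexI[of _ g] bexI[of _ "\<lambda>t. c * b t + h t"]) (auto simp: algebra_simps)
  qed
qed

text \<open>On the span of the \<open>bb j\<close> the splitting by the sign of \<open>j\<close> is
  explicit, and \<open>Ap_bound\<close> makes the plus parts of an approximating sequence Cauchy.
  The approximants \<open>gs\<close> of the plus part are recorded because density in the Hardy
  space is derived from them.\<close>

lemma riesz_projection:
  assumes p: "1 < p"
  shows "\<exists>K\<ge>0. \<forall>f\<in>Lfun p. \<exists>g\<in>Ap p. (\<lambda>x. f x - g x) \<in> Am p \<and> pint p g \<le> K * pint p f \<and>
    (\<exists>gs. (\<forall>n. gs n \<in> lspan (bb ` {0..})) \<and> Lconv p gs g)"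
proof -
  obtain K where K: "riesz_bound p K" using riesz_inequality[OF p] by blast
  then have K0: "0 \<le> K" by (simp add: riesz_bound_def)
  have p0: "0 < p" using p by simp
  show ?thesis
  proof (intro exI[of _ K] conjI K0 ballI)
    fix f assume f: "f \<in> Lfun p"
    obtain fs where fs: "\<And>n. fs n \<in> lspan (range bb)" and conv: "Lconv p fs f"
      using bb_span_dense[OF p f] by blast
    have "\<forall>n. \<exists>g h. g \<in> lspan (bb ` {0..}) \<and> h \<in> lspan (bb ` {..<0}) \<and> fs n = (\<lambda>t. g t + h t)"
      using bb_span_split[OF fs] by blast
    then obtain gs where "\<forall>n. \<exists>h. gs n \<in> lspan (bb ` {0..}) \<and> h \<in> lspan (bb ` {..<0}) \<and> fs n = (\<lambda>t. gs n t + h t)"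
      using choice[of "\<lambda>n g. \<exists>h. g \<in> lspan (bb ` {0..}) \<and> h \<in> lspan (bb ` {..<0}) \<and> fs n = (\<lambda>t. g t + h t)"] by blast
    then obtain hs where gh: "\<forall>n. gs n \<in> lspan (bb ` {0..}) \<and> hs n \<in> lspan (bb ` {..<0}) \<and> fs n = (\<lambda>t. gs n t + hs n t)"
      using choice[of "\<lambda>n h. gs n \<in> lspan (bb ` {0..}) \<and> h \<in> lspan (bb ` {..<0}) \<and> fs n = (\<lambda>t. gs n t + h t)"] by blast
    have gA: "gs n \<in> Ap p" for n
      by (rule Ap_lspan[OF p, of "bb ` {0..}"]) (use gh bb_Ap[OF p] in auto)
    have hA: "hs n \<in> Am p" for n
      by (rule Am_lspan[OF p, of "bb ` {..<0}"]) (use gh bb_Am[OF p] in auto)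
    have gL: "gs n \<in> Lfun p" for n using gA[of n] by (simp add: Ap_def)
    have fL: "fs n \<in> Lfun p" for n using conv by (simp add: Lconv_def)
    have diff: "pint p (\<lambda>x. gs m x - gs n x) \<le> K * pint p (\<lambda>x. fs m x - fs n x)" for m n
    proof -
      have "pint p (\<lambda>x. gs m x - gs n x) \<le> K * pint p (\<lambda>x. (gs m x - gs n x) + (hs m x - hs n x))"
        by (rule Ap_bound[OF p K Ap_lin(3)[OF p gA gA] Am_lin(3)[OF p hA hA]])
      also have "(\<lambda>x. (gs m x - gs n x) + (hs m x - hs n x)) = (\<lambda>x. fs m x - fs n x)"
        using gh by (simp add: fun_eq_iff)
      finally show ?thesis .
    qed
    have "\<exists>g. Lconv p gs g"
    proof (rule Lfun_complete[OF p0 gL])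
      fix e :: real assume e: "0 < e"
      \<comment> \<open>Two errors \<open>e'\<close> pass through the factors
        \<open>2 powr p\<close> and \<open>K\<close>; the summand 1 makes the final inequality
        strict.\<close>
      define e' where "e' = e / (K * 2 powr p * 2 + 1)"
      have den: "0 < K * 2 powr p * 2 + 1" using K0 by (simp add: add_nonneg_pos)
      have e': "0 < e'" using e den by (simp add: e'_def)
      have "\<forall>\<^sub>F n in sequentially. pint p (\<lambda>x. fs n x - f x) < e'"
        using conv e' unfolding Lconv_def by (intro order_tendstoD) auto
      then obtain N where N: "\<And>n. N \<le> n \<Longrightarrow> pint p (\<lambda>x. fs n x - f x) < e'"
        by (auto simp: eventually_sequentially)
      show "\<exists>N. \<forall>m\<ge>N. \<forall>n\<ge>N. pint p (\<lambda>x. gs m x - gs n x) < e"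
      proof (intro exI[of _ N] allI impI)
        fix m n assume mn: "N \<le> m" "N \<le> n"
        have "pint p (\<lambda>x. gs m x - gs n x) \<le> K * pint p (\<lambda>x. fs m x - fs n x)" by (rule diff)
        also have "\<dots> \<le> K * (2 powr p * (e' + e'))"
        proof (intro mult_left_mono K0)
          have "pint p (\<lambda>x. fs m x - fs n x) \<le> 2 powr p * (pint p (\<lambda>x. fs m x - f x) + pint p (\<lambda>x. f x - fs n x))"
            by (rule pint_triangle[OF fL f fL p0])
          also have "\<dots> \<le> 2 powr p * (e' + e')"
            using N[OF mn(1)] N[OF mn(2)] pint_minus_commute[of p f "fs n"] by (intro mult_left_mono add_mono) auto
          finally show "pint p (\<lambda>x. fs m x - fs n x) \<le> 2 powr p * (e' + e')" .
        qed
        also have "\<dots> = (K * 2 powr p * 2) * e'" by (simp add: algebra_simps)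
        also have "\<dots> < (K * 2 powr p * 2 + 1) * e'" using e' by (simp add: algebra_simps)
        also have "\<dots> = e" using den by (simp add: e'_def)
        finally show "pint p (\<lambda>x. gs m x - gs n x) < e" .
      qed
    qed
    then obtain g where g: "Lconv p gs g" by blast
    have gin: "g \<in> Ap p" by (rule Ap_closed[OF p g gA])
    have gL': "g \<in> Lfun p" using g by (simp add: Lconv_def)
    have hconv: "Lconv p hs (\<lambda>x. f x - g x)"
      unfolding Lconv_def
    proof (intro conjI allI)
      show "hs n \<in> Lfun p" for n using hA[of n] by (simp add: Am_def)
      show "(\<lambda>x. f x - g x) \<in> Lfun p" by (rule Lfun_diff(1)[OF f gL' p0])
      show "(\<lambda>n. pint p (\<lambda>x. hs n x - (f x - g x))) \<longlonglongrightarrow> 0"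
      proof (rule tendsto_sandwich[of "\<lambda>n. 0" _ _ "\<lambda>n. 2 powr p * (pint p (\<lambda>x. fs n x - f x) + pint p (\<lambda>x. gs n x - g x))"])
        have E: "(\<lambda>x. hs n x - (f x - g x)) = (\<lambda>x. (fs n x - f x) - (gs n x - g x))" for n
          using gh by (simp add: fun_eq_iff)
        have "pint p (\<lambda>x. hs n x - (f x - g x)) \<le> 2 powr p * (pint p (\<lambda>x. fs n x - f x) + pint p (\<lambda>x. gs n x - g x))" for n
          unfolding E by (rule Lfun_diff(2)[OF Lfun_diff(1)[OF fL[of n] f p0] Lfun_diff(1)[OF gL[of n] gL' p0] p0])
        then show "\<forall>\<^sub>F n in sequentially. pint p (\<lambda>x. hs n x - (f x - g x)) \<le> 2 powr p * (pint p (\<lambda>x. fs n x - f x) + pint p (\<lambda>x. gs n x - g x))"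
          by simp
        have "(\<lambda>n. 2 powr p * (pint p (\<lambda>x. fs n x - f x) + pint p (\<lambda>x. gs n x - g x))) \<longlonglongrightarrow> 2 powr p * (0 + 0)"
          using conv g unfolding Lconv_def by (intro tendsto_intros) auto
        then show "(\<lambda>n. 2 powr p * (pint p (\<lambda>x. fs n x - f x) + pint p (\<lambda>x. gs n x - g x))) \<longlonglongrightarrow> 0" by simp
      qed auto
    qed
    have hin: "(\<lambda>x. f x - g x) \<in> Am p" by (rule Am_closed[OF p hconv hA])
    have "pint p g \<le> K * pint p f" using Ap_bound[OF p K gin hin] by simp
    then show "\<exists>g\<in>Ap p. (\<lambda>x. f x - g x) \<in> Am p \<and> pint p g \<le> K * pint p f \<and>
        (\<exists>gs. (\<forall>n. gs n \<in> lspan (bb ` {0..})) \<and> Lconv p gs g)"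
      using gin hin g gh by (intro bexI[of _ g] conjI exI[of _ gs]) auto
  qed
qed

section \<open>Principal values and uniqueness of the splitting\<close>

lemma nt_limit_vertical_filter:
  assumes "nt_limit 1 F x l"
  shows "((\<lambda>y. F (Complex x y)) \<longlongrightarrow> l) (at_right 0)"
proof -
  have 1: "(F \<longlongrightarrow> l) (at (complex_of_real x) within nt_region 1 1 x)"
    using assms by (simp add: nt_limit_def)
  have 2: "filterlim (Complex x) (at (complex_of_real x) within nt_region 1 1 x) (at_right 0)"
    unfolding filterlim_at
  proof
    have "\<forall>\<^sub>F y :: real in at_right 0. 0 < y" by (simp add: eventually_at_right_less)
    then show "\<forall>\<^sub>F y in at_right 0. Complex x y \<in> nt_region 1 1 x \<and> Complex x y \<noteq> complex_of_real x"
      by eventually_elim (auto simp: nt_region_def complex_eq_iff)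
    have "((\<lambda>y. of_real x + \<i> * of_real y) \<longlongrightarrow> of_real x + \<i> * of_real 0) (at_right 0)"
      by (intro tendsto_intros)
    then show "(Complex x \<longlongrightarrow> complex_of_real x) (at_right 0)" by (simp add: Complex_eq[abs_def])
  qed
  show ?thesis by (rule filterlim_compose[OF 1 2])
qed

text \<open>The truncations approach the half sum of the two Cauchy integrals, that is, the upper
  value minus half the jump. The upper value is that of \<open>g\<close> and tends to
  \<open>2 * pi * \<i> * g x\<close>, the jump to \<open>2 * pi * \<i> * f x\<close>. Consequently
  half the sum of \<open>f\<close> and its singular integral is \<open>g\<close>.\<close>

lemma singular_integral_eq:
  assumes p: "1 < p" and f: "f \<in> Lfun p" and g: "g \<in> Ap p" and h: "(\<lambda>x. f x - g x) \<in> Am p"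
  shows "AE x in lborel. 1 / (of_real pi * \<i>) *
    Lim (at_right 0) (\<lambda>\<epsilon>. LINT t:{t. \<epsilon> < \<bar>t - x\<bar>}|lebesgue. f t / of_real (t - x)) = 2 * g x - f x"
proof -
  have gL: "g \<in> Lfun p" using g by (simp add: Ap_def)
  note [measurable] = Lfun_measurable[OF f]
  have KIfg: "KI f z = KI g z" if "0 < Im z" for z
    using h KI_diff[OF p f gL, of z] that by (auto simp: Am_def)
  let ?c = "2 * of_real pi * \<i> :: complex"
  from AE_lebesgue_point[OF p f] Ap_poisson[OF p g] show ?thesis
  proof eventually_elim
    case (elim x)
    let ?T = "\<lambda>\<epsilon>. LINT t:{t. \<epsilon> < \<bar>t - x\<bar>}|lborel. f t / of_real (t - x)"
    have 1: "((\<lambda>e. ?T e - (KI f (Complex x e) + KI f (Complex x (- e))) / 2) \<longlongrightarrow> 0) (at_right 0)"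
      by (rule truncated_cauchy_integral[OF p f elim(1)])
    have 2: "((\<lambda>e. (KI f (Complex x e) - KI f (Complex x (- e))) / ?c) \<longlongrightarrow> f x) (at_right 0)"
      using nt_limit_vertical_filter[OF poisson_nt_limit[OF p f elim(1)]] by (simp add: complex_cnj)
    have 3: "((\<lambda>e. KI g (Complex x e) / ?c) \<longlongrightarrow> g x) (at_right 0)"
      by (rule nt_limit_vertical_filter[OF elim(2)])
    have "((\<lambda>e. (?T e - (KI f (Complex x e) + KI f (Complex x (- e))) / 2) + (?c * (KI g (Complex x e) / ?c)
        - ?c / 2 * ((KI f (Complex x e) - KI f (Complex x (- e))) / ?c))) \<longlongrightarrow> 0 + (?c * g x - ?c / 2 * f x)) (at_right 0)"
      by (intro tendsto_intros 1 2 3)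
    moreover have "\<forall>\<^sub>F e in at_right 0. (?T e - (KI f (Complex x e) + KI f (Complex x (- e))) / 2) + (?c * (KI g (Complex x e) / ?c)
        - ?c / 2 * ((KI f (Complex x e) - KI f (Complex x (- e))) / ?c)) = ?T e"
    proof -
      have "\<forall>\<^sub>F y :: real in at_right 0. 0 < y" by (simp add: eventually_at_right_less)
      then show ?thesis
        by eventually_elim (simp add: KIfg field_simps)
    qed
    ultimately have "(?T \<longlongrightarrow> 0 + (?c * g x - ?c / 2 * f x)) (at_right 0)"
      by (rule Lim_transform_eventually)
    moreover have "?T = (\<lambda>\<epsilon>. LINT t:{t. \<epsilon> < \<bar>t - x\<bar>}|lebesgue. f t / of_real (t - x))"
      unfolding set_lebesgue_integral_def by (intro ext integral_completion[symmetric]) measurable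
    ultimately have "Lim (at_right 0) (\<lambda>\<epsilon>. LINT t:{t. \<epsilon> < \<bar>t - x\<bar>}|lebesgue. f t / of_real (t - x)) = 0 + (?c * g x - ?c / 2 * f x)"
      by (intro tendsto_Lim) auto
    then show ?case by (simp add: field_simps)
  qed
qed

lemma KI_cong_AE:
  assumes "AE x in lborel. f x = g x" "f \<in> borel_measurable borel" "g \<in> borel_measurable borel"
  shows "KI f z = KI g z"
  unfolding KI_def by (rule integral_cong_AE) (use assms in auto)

lemma Lfun_cong_AE:
  assumes "AE x in lborel. f x = g x" "f \<in> Lfun p" "g \<in> borel_measurable borel"
  shows "g \<in> Lfun p"
proof -
  note [measurable] = assms(3) Lfun_measurable[OF assms(2)]
  have "integrable lborel (\<lambda>x. norm (g x) powr p)"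
    by (rule integrable_cong_AE_imp[OF Lfun_integrable[OF assms(2)]]) (use assms(1) in auto)
  then show ?thesis using assms(3) by (rule LfunI[rotated])
qed

lemma Am_cong_AE:
  assumes "AE x in lborel. f x = g x" "f \<in> Am p" "g \<in> borel_measurable borel"
  shows "g \<in> Am p"
  using assms Lfun_cong_AE[OF assms(1) _ assms(3)] KI_cong_AE[OF assms(1) _ assms(3)] Lfun_measurable
  by (fastforce simp: Am_def)

text \<open>The Cauchy integral vanishes above the real line, while its boundary values from there,
  divided by \<open>2 * pi * \<i>\<close>, recover \<open>f\<close>.\<close>

lemma Ap_Am_zero:
  assumes p: "1 < p" and f: "f \<in> Ap p" "f \<in> Am p"
  shows "AE x in lborel. f x = 0"
  using Ap_poisson[OF p f(1)]
proof eventually_elim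
  case (elim x)
  have "((\<lambda>y. KI f (Complex x y) / (2 * of_real pi * \<i>)) \<longlongrightarrow> f x) (at_right 0)"
    by (rule nt_limit_vertical_filter[OF elim])
  moreover have "\<forall>\<^sub>F y in at_right 0. KI f (Complex x y) / (2 * of_real pi * \<i>) = 0"
  proof -
    have "\<forall>\<^sub>F y :: real in at_right 0. 0 < y" by (simp add: eventually_at_right_less)
    then show ?thesis by eventually_elim (use f(2) in \<open>simp add: Am_def\<close>)
  qed
  ultimately have "((\<lambda>y. 0) \<longlongrightarrow> f x) (at_right (0::real))" by (rule Lim_transform_eventually)
  then show ?case using tendsto_unique[OF _ _ tendsto_const[of "0::complex" "at_right (0::real)"]] by auto
qed

text \<open>By uniqueness of the splitting \<open>u\<close> is its own plus part, and the plus part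
  comes with approximants from the span.\<close>

lemma Ap_dense:
  assumes p: "1 < p" and u: "u \<in> Ap p"
  shows "\<exists>gs. (\<forall>n. gs n \<in> lspan (bb ` {0..})) \<and> Lconv p gs u"
proof -
  have uL: "u \<in> Lfun p" using u by (simp add: Ap_def)
  obtain K where K: "\<forall>f\<in>Lfun p. \<exists>g\<in>Ap p. (\<lambda>x. f x - g x) \<in> Am p \<and> pint p g \<le> K * pint p f \<and>
    (\<exists>gs. (\<forall>n. gs n \<in> lspan (bb ` {0..})) \<and> Lconv p gs g)"
    using riesz_projection[OF p] by blast
  obtain g gs where g: "g \<in> Ap p" "(\<lambda>x. u x - g x) \<in> Am p" and gs: "\<forall>n. gs n \<in> lspan (bb ` {0..})" "Lconv p gs g"
    using bspec[OF K uL] by blast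
  have gL: "g \<in> Lfun p" using g by (simp add: Ap_def)
  have z: "AE x in lborel. u x - g x = 0" by (rule Ap_Am_zero[OF p Ap_lin(3)[OF p u g(1)] g(2)])
  have "pint p (\<lambda>x. gs n x - u x) = pint p (\<lambda>x. gs n x - g x)" for n
  proof (rule pint_cong_AE)
    have gsL: "gs n \<in> Lfun p" using gs(2) by (simp add: Lconv_def)
    note [measurable] = Lfun_measurable[OF gsL] Lfun_measurable[OF uL] Lfun_measurable[OF gL]
    show "AE x in lborel. gs n x - u x = gs n x - g x" using z by eventually_elim simp
    show "(\<lambda>x. gs n x - u x) \<in> borel_measurable borel" "(\<lambda>x. gs n x - g x) \<in> borel_measurable borel"
      by measurable
  qed
  then have "Lconv p gs u" using gs(2) uL by (simp add: Lconv_def)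
  then show ?thesis using gs(1) by blast
qed

lemma Lfun_mult_bounded:
  assumes f: "f \<in> Lfun p" and p: "0 < p" and hm: "h \<in> borel_measurable borel" and h: "\<And>t. norm (h t) \<le> B"
  shows "(\<lambda>t. f t * h t) \<in> Lfun p"
proof (rule Lfun_bounded_by(1)[OF f _ p])
  show "(\<lambda>t. f t * h t) \<in> borel_measurable borel" using Lfun_measurable[OF f] hm by measurable
  show "0 \<le> B" using order_trans[OF norm_ge_zero h[of 0]] .
  show "AE x in lborel. norm (f x * h x) \<le> B * norm (f x)"
    using mult_left_mono[OF h norm_ge_zero] by (intro AE_I2) (simp add: norm_mult mult.commute)
qed

lemma rr_divide: "rr t * (1 / (complex_of_real t - \<i>)) = 1 / (complex_of_real t + \<i>)"
  by (simp add: rr_def)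

text \<open>The weight is \<open>1 / (t^2 + 1)\<close>, which the Cayley transform turns into arc
  length up to a constant, so this is the orthogonality of powers on the circle. It is read off from
  the vanishing Cauchy integrals of \<open>bb\<close> at \<open>- \<i>\<close> and
  \<open>\<i>\<close>; the exponent 2 there is an arbitrary choice.\<close>

lemma moment_weight:
  "(\<integral>t. rr t powi m * (1 / (complex_of_real t + \<i>) * (1 / (complex_of_real t - \<i>))) \<partial>lborel) = (if m = 0 then of_real pi else 0)"
proof -
  have w: "1 / (complex_of_real t + \<i>) * (1 / (complex_of_real t - \<i>)) = of_real (pk 1 t)" for t
  proof -
    have "(complex_of_real t + \<i>) * (complex_of_real t - \<i>) = of_real (t\<^sup>2 + 1)"
      by (simp add: algebra_simps power2_eq_square)
    then show ?thesis by (simp add: pk_def)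
  qed
  consider "m = 0" | "0 < m" | "m < 0" by linarith
  then show ?thesis
  proof cases
    case 1
    then show ?thesis using pk_integral[of 1 0] unfolding w by simp
  next
    case 2
    have "rr t powi m * (1 / (complex_of_real t + \<i>) * (1 / (complex_of_real t - \<i>))) = bb (m - 1) t / (complex_of_real t - (- \<i>))" for t
    proof -
      have "rr t powi m = rr t powi (m - 1) * rr t" by (simp add: power_int_diff)
      then have "rr t powi m * (1 / (complex_of_real t + \<i>) * (1 / (complex_of_real t - \<i>))) =
          rr t powi (m - 1) * (1 / (complex_of_real t + \<i>)) * (rr t * (1 / (complex_of_real t - \<i>)))"
        by (simp only: mult_ac)
      then show ?thesis unfolding rr_divide by (simp add: bb_def)
    qed
    then have "(\<integral>t. rr t powi m * (1 / (complex_of_real t + \<i>) * (1 / (complex_of_real t - \<i>))) \<partial>lborel) = KI (bb (m - 1)) (- \<i>)"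
      by (simp add: KI_def)
    also have "\<dots> = 0" using bb_Ap[of 2 "m - 1"] 2 by (simp add: Ap_def)
    finally show ?thesis using 2 by simp
  next
    case 3
    have "rr t powi m * (1 / (complex_of_real t + \<i>) * (1 / (complex_of_real t - \<i>))) = bb m t / (complex_of_real t - \<i>)" for t
      by (simp add: bb_def field_simps)
    then have "(\<integral>t. rr t powi m * (1 / (complex_of_real t + \<i>) * (1 / (complex_of_real t - \<i>))) \<partial>lborel) = KI (bb m) \<i>"
      by (simp add: KI_def)
    also have "\<dots> = 0" using bb_Am[of 2 m] 3 by (simp add: Am_def)
    finally show ?thesis using 3 by simp
  qed
qed

text \<open>The summand 1 in the exponent comes from
  \<open>1 / (t + \<i>) = rr t / (t - \<i>)\<close>.\<close>

lemma bb_mult_eq: "bb a t * bb b t = rr t powi (a + b + 1) * (1 / (complex_of_real t + \<i>) * (1 / (complex_of_real t - \<i>)))"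
proof -
  have "bb a t * bb b t = rr t powi a * rr t powi b * (1 / (complex_of_real t + \<i>) * (1 / (complex_of_real t + \<i>)))"
    by (simp add: bb_def)
  also have "1 / (complex_of_real t + \<i>) * (1 / (complex_of_real t + \<i>)) =
      1 / (complex_of_real t + \<i>) * (rr t * (1 / (complex_of_real t - \<i>)))"
    by (simp only: rr_divide)
  also have "rr t powi a * rr t powi b * \<dots> = rr t powi (a + b + 1) * (1 / (complex_of_real t + \<i>) * (1 / (complex_of_real t - \<i>)))"
    by (simp add: power_int_add)
  finally show ?thesis .
qed

section \<open>Moments of products\<close>

lemma lspan_moment_limit:
  assumes p: "1 < p" and L: "Lconv p gs u" and gs: "\<And>n. gs n \<in> lspan B" and k: "k \<in> Lfun (conj_exp p)"
    and B: "B \<subseteq> Lfun p" "\<And>b. b \<in> B \<Longrightarrow> (\<integral>t. b t * k t \<partial>lborel) = 0"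
  shows "(\<integral>t. u t * k t \<partial>lborel) = 0"
proof -
  have p0: "0 < p" using p by simp
  have "(\<integral>t. g t * k t \<partial>lborel) = 0" if "g \<in> lspan B" for g
    using that
  proof induction
    case (lspan_step b g c)
    have 1: "integrable lborel (\<lambda>t. b t * k t)" by (rule Lfun_mult_integrable(1)[OF p _ k]) (use B lspan_step in auto)
    have 2: "integrable lborel (\<lambda>t. g t * k t)"
      by (rule Lfun_mult_integrable(1)[OF p lspan_Lfun[OF lspan_step(2) B(1) p0] k])
    have "(\<integral>t. (c * b t + g t) * k t \<partial>lborel) = (\<integral>t. c * (b t * k t) + g t * k t \<partial>lborel)"
      by (simp add: algebra_simps)
    also have "\<dots> = (\<integral>t. c * (b t * k t) \<partial>lborel) + (\<integral>t. g t * k t \<partial>lborel)"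
      by (rule Bochner_Integration.integral_add[OF integrable_mult_right[OF 1] 2])
    also have "\<dots> = 0" unfolding integral_mult_right_zero using B(2)[OF lspan_step(1)] lspan_step by simp
    finally show ?case .
  qed simp
  then show ?thesis using Lconv_integral_mult[OF p L k] gs by (simp add: LIMSEQ_const_iff)
qed

text \<open>Density is applied to one factor at a time. What remains are integrals of
  \<open>bb c t * bb (a + j) t\<close> with all indices nonnegative, where the exponent
  \<open>c + (a + j) + 1\<close> is positive and the moment therefore zero.\<close>

lemma Ap_moment:
  assumes p: "1 < p" and u: "u \<in> Ap p" and v: "v \<in> Ap (conj_exp p)" and j: "0 \<le> j"
  shows "(\<integral>t. u t * v t * rr t powi j \<partial>lborel) = 0"
proof -
  let ?q = "conj_exp p"
  have q: "1 < ?q" "conj_exp ?q = p" using conj_exp_facts[OF p] by auto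
  have vL: "v \<in> Lfun ?q" using v by (simp add: Ap_def)
  have sub: "bb ` A \<subseteq> Lfun r" if "1 < r" for A r using bb_Lfun[OF that] by auto
  obtain us where us: "\<And>n. us n \<in> lspan (bb ` {0..})" "Lconv p us u" using Ap_dense[OF p u] by blast
  obtain vs where vs: "\<And>n. vs n \<in> lspan (bb ` {0..})" "Lconv ?q vs v" using Ap_dense[OF q(1) v] by blast
  have vb: "(\<integral>t. v t * bb (a + j) t \<partial>lborel) = 0" if "0 \<le> a" for a
  proof (rule lspan_moment_limit[OF q(1) vs(2,1) _ sub[OF q(1)]])
    show "bb (a + j) \<in> Lfun (conj_exp ?q)" using bb_Lfun[OF p] q by simp
    fix b assume "b \<in> bb ` {0..}"
    then obtain c where c: "b = bb c" "0 \<le> c" by auto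
    then have "c + (a + j) + 1 \<noteq> 0" using that j by simp
    then show "(\<integral>t. b t * bb (a + j) t \<partial>lborel) = 0"
      unfolding c bb_mult_eq moment_weight by simp
  qed
  have "(\<integral>t. u t * (v t * rr t powi j) \<partial>lborel) = 0"
  proof (rule lspan_moment_limit[OF p us(2,1) _ sub[OF p]])
    show "(\<lambda>t. v t * rr t powi j) \<in> Lfun ?q"
      by (rule Lfun_mult_bounded[OF vL, where B = 1]) (use q in auto)
    fix b assume "b \<in> bb ` {0..}"
    then obtain a where a: "b = bb a" "0 \<le> a" by auto
    have E: "b t * (v t * rr t powi j) = v t * bb (a + j) t" for t
      by (simp add: a bb_def power_int_add mult_ac)
    show "(\<integral>t. b t * (v t * rr t powi j) \<partial>lborel) = 0" unfolding E by (rule vb[OF a(2)])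
  qed
  then show ?thesis by (simp add: mult.assoc)
qed

lemma cnj_rr_powi: "cnj (rr t powi j) = rr t powi (- j)"
  by (simp add: complex_cnj_power_int cnj_rr power_int_inverse power_int_minus)

lemma Am_moment:
  assumes p: "1 < p" and u: "u \<in> Am p" and v: "v \<in> Am (conj_exp p)" and j: "j \<le> 0"
  shows "(\<integral>t. u t * v t * rr t powi j \<partial>lborel) = 0"
proof -
  have "(\<integral>t. cnj (u t) * cnj (v t) * rr t powi (- j) \<partial>lborel) = 0"
    by (rule Ap_moment[OF p Am_cnj[OF u] Am_cnj[OF v]]) (use j in simp)
  moreover have "cnj (u t) * cnj (v t) * rr t powi (- j) = cnj (u t * v t * rr t powi j)" for t
    by (simp add: cnj_rr_powi del: complex_cnj_power_int)
  ultimately have "cnj (\<integral>t. u t * v t * rr t powi j \<partial>lborel) = 0"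
    using integral_bounded_linear'[OF bounded_linear_cnj bounded_linear_cnj, of lborel "\<lambda>t. u t * v t * rr t powi j"] by simp
  then show ?thesis by simp
qed

text \<open>All moments of the plus part \<open>g\<close> vanish: for \<open>j \<ge> 0\<close>
  because a product of two plus functions is integrated, for \<open>j < 0\<close> by assumption,
  since those of \<open>f - g\<close> vanish as well. They are the Fourier coefficients of
  \<open>g / (t + \<i>)\<close>, so \<open>g\<close> is zero and \<open>f\<close> is its own minus
  part.\<close>

lemma Am_if_moments:
  assumes p: "1 < p" and f: "f \<in> Lfun p" and m: "\<And>j. j < 0 \<Longrightarrow> (\<integral>t. f t * bb j t \<partial>lborel) = 0"
  shows "f \<in> Am p"
proof -
  let ?q = "conj_exp p"
  have q: "1 < ?q" "conj_exp ?q = p" using conj_exp_facts[OF p] by auto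
  obtain K where K: "\<forall>f\<in>Lfun p. \<exists>g\<in>Ap p. (\<lambda>x. f x - g x) \<in> Am p \<and> pint p g \<le> K * pint p f \<and>
    (\<exists>gs. (\<forall>n. gs n \<in> lspan (bb ` {0..})) \<and> Lconv p gs g)"
    using riesz_projection[OF p] by blast
  obtain g where g: "g \<in> Ap p" "(\<lambda>x. f x - g x) \<in> Am p" using bspec[OF K f] by blast
  have gL: "g \<in> Lfun p" using g by (simp add: Ap_def)
  have z: "(\<integral>t. g t * bb j t \<partial>lborel) = 0" for j
  proof (cases "0 \<le> j")
    case True
    show ?thesis using Ap_moment[OF p g(1) bb_Ap[OF q(1) True], of 0] by simp
  next
    case False
    then have "(\<integral>t. (f t - g t) * bb j t \<partial>lborel) = 0"
      using Am_moment[OF p g(2) bb_Am[OF q(1), of j], of 0] by simp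
    moreover have "(\<integral>t. (f t - g t) * bb j t \<partial>lborel) = (\<integral>t. f t * bb j t \<partial>lborel) - (\<integral>t. g t * bb j t \<partial>lborel)"
      unfolding left_diff_distrib
      by (intro Bochner_Integration.integral_diff Lfun_mult_integrable(1)[OF p _ bb_Lfun[OF q(1)]] f gL)
    ultimately show ?thesis using m[of j] False by simp
  qed
  have "AE t in lborel. g t * (1 / (complex_of_real t + \<i>)) = 0"
  proof (rule integrable_fourier_zero)
    show "integrable lborel (\<lambda>t. g t * (1 / (complex_of_real t + \<i>)))"
      by (rule Lfun_mult_integrable(1)[OF p gL Lfun_weight[OF q(1)]])
    show "(\<lambda>t. g t * (1 / (complex_of_real t + \<i>))) \<in> borel_measurable borel"
      using Lfun_measurable[OF gL] by measurable
    show "(\<integral>t. g t * (1 / (complex_of_real t + \<i>)) * rr t powi j \<partial>lborel) = 0" for j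
      using z[of j] by (simp add: bb_def)
  qed
  then have "AE t in lborel. f t - g t = f t" by eventually_elim simp
  then show ?thesis by (rule Am_cong_AE[OF _ g(2) Lfun_measurable[OF f]])
qed

text \<open>A principle of Smirnov type. The factor \<open>t - \<i>\<close> combines with
  \<open>bb j t\<close> to \<open>rr t powi (j + 1)\<close>, and \<open>j < 0\<close> makes this
  exponent at most 0, so the moments are those of a product of two minus functions.\<close>

lemma Am_smirnov:
  assumes p: "1 < p" and u: "u \<in> Am p" and v: "v \<in> Am (conj_exp p)"
    and L: "(\<lambda>t. (complex_of_real t - \<i>) * u t * v t) \<in> Lfun p"
  shows "(\<lambda>t. (complex_of_real t - \<i>) * u t * v t) \<in> Am p"
proof (rule Am_if_moments[OF p L])
  fix j :: int assume j: "j < 0"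
  have E: "(complex_of_real t - \<i>) * u t * v t * bb j t = u t * v t * rr t powi (j + 1)" for t
    by (simp add: bb_def power_int_add rr_def)
  show "(\<integral>t. (complex_of_real t - \<i>) * u t * v t * bb j t \<partial>lborel) = 0"
    unfolding E by (rule Am_moment[OF p u v]) (use j in simp)
qed

text \<open>The moments of \<open>u v\<close> against \<open>r^k\<close> vanish for \<open>k \<ge> 0\<close> by the left-hand side and for
  \<open>k < - n\<close> by the right-hand side; the remaining \<open>n\<close> of them give the coefficients.\<close>

lemma product_is_rational:
  assumes p: "1 < p" and u: "u \<in> Ap p" and v: "v \<in> Ap (conj_exp p)" and u': "u' \<in> Am p" and v': "v' \<in> Am (conj_exp p)"
    and eq: "AE t in lborel. u t * v t = rr t powi (int n + 1) * (u' t * v' t)"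
  shows "\<exists>c. AE t in lborel. u t * v t = (\<Sum>j<n. c j * (rr t powi int j / (complex_of_real t + \<i>)\<^sup>2))"
proof -
  let ?q = "conj_exp p"
  have L: "u \<in> Lfun p" "v \<in> Lfun ?q" "u' \<in> Lfun p" "v' \<in> Lfun ?q" using u v u' v' by (auto simp: Ap_def Am_def)
  note [measurable] = L[THEN Lfun_measurable]
  define w where "w t = 1 / (complex_of_real t + \<i>) * (1 / (complex_of_real t - \<i>))" for t
  have [measurable]: "w \<in> borel_measurable borel" unfolding w_def by measurable
  have mw: "(\<integral>t. rr t powi m * w t \<partial>lborel) = (if m = 0 then of_real pi else 0)" for m
    unfolding w_def by (rule moment_weight)
  have wint: "integrable lborel (\<lambda>t. rr t powi m * w t)" for m
  proof -
    have "integrable lborel (\<lambda>t. bb m t / (complex_of_real t - \<i>))"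
      by (rule KI_integrable[OF p bb_Lfun[OF p]]) simp
    then show ?thesis by (simp add: bb_def w_def)
  qed
  have uvint: "integrable lborel (\<lambda>t. u t * v t)" by (rule Lfun_mult_integrable(1)[OF p L(1,2)])
  have uvr: "integrable lborel (\<lambda>t. u t * v t * rr t powi k)" for k
    by (rule Bochner_Integration.integrable_bound[OF uvint]) (auto simp: norm_mult)
  \<comment> \<open>The moment against \<open>rr t powi (- int j - 1)\<close> singles out the term
    with \<open>rr t powi (int j + 1)\<close>, and \<open>pi\<close> is the total mass of
    \<open>w\<close>.\<close>
  define c where "c j = (\<integral>t. u t * v t * rr t powi (- int j - 1) \<partial>lborel) / of_real pi" for j :: nat
  define \<phi> where "\<phi> t = u t * v t - (\<Sum>j<n. c j * (rr t powi (int j + 1) * w t))" for t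
  have sint: "integrable lborel (\<lambda>t. \<Sum>j<n. c j * (rr t powi (int j + 1) * w t))"
    by (intro Bochner_Integration.integrable_sum integrable_mult_right wint)
  have high: "(\<integral>t. u t * v t * rr t powi k \<partial>lborel) = 0" if "0 \<le> k" for k by (rule Ap_moment[OF p u v that])
  have low: "(\<integral>t. u t * v t * rr t powi k \<partial>lborel) = 0" if "k \<le> - int n - 1" for k
  proof -
    have "(\<integral>t. u t * v t * rr t powi k \<partial>lborel) = (\<integral>t. u' t * v' t * rr t powi (int n + 1 + k) \<partial>lborel)"
    proof (rule integral_cong_AE)
      show "AE t in lborel. u t * v t * rr t powi k = u' t * v' t * rr t powi (int n + 1 + k)"
        using eq by eventually_elim (simp add: power_int_add)
    qed measurable
    also have "\<dots> = 0" by (rule Am_moment[OF p u' v']) (use that in simp)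
    finally show ?thesis .
  qed
  have "AE t in lborel. \<phi> t = 0"
  proof (rule integrable_fourier_zero)
    show "integrable lborel \<phi>" unfolding \<phi>_def by (intro Bochner_Integration.integrable_diff uvint sint)
    show "\<phi> \<in> borel_measurable borel" unfolding \<phi>_def by measurable
    fix k :: int
    have "(\<integral>t. \<phi> t * rr t powi k \<partial>lborel) = (\<integral>t. u t * v t * rr t powi k - (\<Sum>j<n. c j * (rr t powi (int j + 1 + k) * w t)) \<partial>lborel)"
    proof -
      have "(\<Sum>j<n. c j * (rr t powi (int j + 1) * w t)) * rr t powi k = (\<Sum>j<n. c j * (rr t powi (int j + 1 + k) * w t))" for t
        unfolding sum_distrib_right by (intro sum.cong refl) (simp add: power_int_add)
      then have E: "\<phi> t * rr t powi k = u t * v t * rr t powi k - (\<Sum>j<n. c j * (rr t powi (int j + 1 + k) * w t))" for t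
        by (simp only: \<phi>_def left_diff_distrib)
      show ?thesis unfolding E ..
    qed
    also have "\<dots> = (\<integral>t. u t * v t * rr t powi k \<partial>lborel) - (\<Sum>j<n. c j * (if int j + 1 + k = 0 then of_real pi else 0))"
    proof -
      have 1: "integrable lborel (\<lambda>t. c j * (rr t powi (int j + 1 + k) * w t))" for j
        by (intro integrable_mult_right wint)
      have 2: "integrable lborel (\<lambda>t. \<Sum>j<n. c j * (rr t powi (int j + 1 + k) * w t))"
        by (intro Bochner_Integration.integrable_sum 1)
      show ?thesis
        unfolding Bochner_Integration.integral_diff[OF uvr 2] Bochner_Integration.integral_sum[OF 1]
          integral_mult_right_zero mw ..
    qed
    also have "\<dots> = 0"
    proof (cases "\<exists>j<n. int j + 1 + k = 0")
      case True
      then obtain i where i0: "i < n" "int i + 1 + k = 0" by blast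
      then have i: "i < n" "k = - int i - 1" by auto
      have "(\<Sum>j<n. c j * (if int j + 1 + k = 0 then of_real pi else 0)) = (\<Sum>j<n. if j = i then c i * of_real pi else 0)"
        by (intro sum.cong) (auto simp: i)
      also have "\<dots> = c i * of_real pi" using i by simp
      finally show ?thesis by (simp add: c_def i)
    next
      case False
      then have "(\<Sum>j<n. c j * (if int j + 1 + k = 0 then of_real pi else 0)) = 0" by (intro sum.neutral) auto
      moreover have "0 \<le> k \<or> k \<le> - int n - 1"
      proof (rule ccontr)
        assume "\<not> ?thesis"
        then have "nat (- k - 1) < n" "int (nat (- k - 1)) + 1 + k = 0" by auto
        then show False using False by blast
      qed
      ultimately show ?thesis using high low by auto
    qed
    finally show "(\<integral>t. \<phi> t * rr t powi k \<partial>lborel) = 0" .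
  qed
  then have "AE t in lborel. u t * v t = (\<Sum>j<n. c j * (rr t powi int j / (complex_of_real t + \<i>)\<^sup>2))"
  proof eventually_elim
    case (elim t)
    have "rr t powi (int j + 1) * w t = rr t powi int j / (complex_of_real t + \<i>)\<^sup>2" for j :: nat
      by (simp add: power_int_add rr_def power2_eq_square w_def)
    then show ?case using elim by (simp add: \<phi>_def)
  qed
  then show ?thesis by blast
qed

section \<open>Passage to almost everywhere classes\<close>

lemma ae_class_eq_iff: "ae_class f = ae_class g \<longleftrightarrow> (AE x in lborel. f x = g x)"
  by (simp add: aefun.abs_eq_iff AE_completion_iff)

lemmas ae_ops = plus_aefun.abs_eq minus_aefun.abs_eq uminus_aefun.abs_eq times_aefun.abs_eq
  inverse_aefun.abs_eq zero_aefun.abs_eq one_aefun.abs_eq ae_scale.abs_eq ae_cnj.abs_eq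

text \<open>The spaces are defined by Lebesgue measurable functions, whereas the analysis is carried
  out with Borel functions; this shows that both give the same classes.\<close>

lemma borel_representative:
  fixes f :: "real \<Rightarrow> complex"
  assumes "f \<in> borel_measurable lebesgue"
  shows "\<exists>f'\<in>borel_measurable borel. AE x in lborel. f x = f' x"
proof -
  have "(\<lambda>x. Re (f x)) \<in> borel_measurable lebesgue" "(\<lambda>x. Im (f x)) \<in> borel_measurable lebesgue"
    using assms by measurable
  then obtain a b where ab: "a \<in> borel_measurable borel" "AE x in lborel. Re (f x) = a x"
      "b \<in> borel_measurable borel" "AE x in lborel. Im (f x) = b x"
    using completion_ex_borel_measurable_real[of "\<lambda>x. Re (f x)" lborel]
      completion_ex_borel_measurable_real[of "\<lambda>x. Im (f x)" lborel] by auto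
  show ?thesis
  proof (rule bexI[of _ "\<lambda>x. of_real (a x) + \<i> * of_real (b x)"])
    show "AE x in lborel. f x = of_real (a x) + \<i> * of_real (b x)"
      using ab(2,4) by eventually_elim (simp add: complex_eq_iff)
    show "(\<lambda>x. of_real (a x) + \<i> * of_real (b x)) \<in> borel_measurable borel"
      using ab(1,3) by measurable
  qed
qed

lemma Lp_eq: "Lp p = ae_class ` Lfun p"
proof
  show "ae_class ` Lfun p \<subseteq> Lp p"
  proof
    fix u assume "u \<in> ae_class ` Lfun p"
    then obtain f where f: "f \<in> Lfun p" "u = ae_class f" by auto
    note [measurable] = Lfun_measurable[OF f(1)]
    have "f \<in> borel_measurable lebesgue" by (rule measurable_completion) measurable
    moreover have "integrable lebesgue (\<lambda>x. norm (f x) powr p)"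
      by (subst integrable_completion) (use Lfun_integrable[OF f(1)] in auto)
    ultimately show "u \<in> Lp p" using f by (auto simp: Lp_def)
  qed
  show "Lp p \<subseteq> ae_class ` Lfun p"
  proof
    fix u assume "u \<in> Lp p"
    then obtain f where f: "u = ae_class f" "f \<in> borel_measurable lebesgue" "integrable lebesgue (\<lambda>x. norm (f x) powr p)"
      by (auto simp: Lp_def)
    obtain f' where f': "f' \<in> borel_measurable borel" "AE x in lborel. f x = f' x"
      using borel_representative[OF f(2)] by blast
    note [measurable] = f'(1)
    have fm: "f' \<in> borel_measurable lebesgue" by (rule measurable_completion) measurable
    have "integrable lebesgue (\<lambda>x. norm (f' x) powr p)"
    proof (rule integrable_cong_AE_imp[OF f(3)])
      show "AE x in lebesgue. norm (f x) powr p = norm (f' x) powr p"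
        using AE_completion[OF f'(2)] by eventually_elim simp
      show "(\<lambda>x. norm (f' x) powr p) \<in> borel_measurable lebesgue" using fm by measurable
    qed
    then have "integrable lborel (\<lambda>x. norm (f' x) powr p)"
      by (subst (asm) integrable_completion) auto
    then have "f' \<in> Lfun p" by (intro LfunI f')
    moreover have "u = ae_class f'" using f'(2) by (simp add: f(1) ae_class_eq_iff)
    ultimately show "u \<in> ae_class ` Lfun p" by blast
  qed
qed

lemma Lp_norm_class:
  assumes "f \<in> Lfun p"
  shows "Lp_norm p (ae_class f) = pint p f powr (1 / p)"
proof -
  note [measurable] = Lfun_measurable[OF assms]
  show ?thesis unfolding Lp_norm.abs_eq pint_def by (subst integral_completion) auto
qed

text \<open>Setting the function to 0 where it exceeds an essential bound changes it on a null set
  only and makes the bound hold everywhere.\<close>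

lemma Linf_representative:
  assumes "u \<in> Linf"
  obtains f B where "f \<in> borel_measurable borel" "\<And>t. norm (f t) \<le> B" "0 \<le> B" "u = ae_class f"
proof -
  obtain f C where f: "u = ae_class f" "f \<in> borel_measurable lebesgue" "AE x in lebesgue. norm (f x) \<le> C"
    using assms by (auto simp: Linf_def)
  obtain f' where f': "f' \<in> borel_measurable borel" "AE x in lborel. f x = f' x"
    using borel_representative[OF f(2)] by blast
  note [measurable] = f'(1)
  have C: "AE x in lborel. norm (f x) \<le> C" using f(3) by (simp add: AE_completion_iff)
  define h where "h t = (if norm (f' t) \<le> C then f' t else 0)" for t
  show ?thesis
  proof (rule that[of h "max C 0"])
    show "h \<in> borel_measurable borel" unfolding h_def by measurable
    show "norm (h t) \<le> max C 0" for t by (simp add: h_def le_max_iff_disj)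
    have "AE x in lborel. f x = h x" using C f'(2) by eventually_elim (simp add: h_def)
    then show "u = ae_class h" by (simp add: f(1) ae_class_eq_iff)
  qed simp
qed

lemma LinfI:
  assumes "f \<in> borel_measurable borel" "\<And>t. norm (f t) \<le> B"
  shows "ae_class f \<in> Linf"
proof -
  have "f \<in> borel_measurable lebesgue" by (rule measurable_completion) (use assms in simp)
  then show ?thesis using assms(2) by (auto simp: Linf_def)
qed

text \<open>Schwarz reflection; through it the Hardy spaces of the lower half-plane are derived from
  those of the upper one.\<close>

lemma hardy_fun_cnj:
  assumes "F \<in> hardy_fun s p"
  shows "(\<lambda>z. cnj (F (cnj z))) \<in> hardy_fun (- s) p"
proof -
  have img: "cnj ` half_plane (- s) = half_plane s"
  proof
    show "half_plane s \<subseteq> cnj ` half_plane (- s)"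
    proof
      fix z assume "z \<in> half_plane s"
      then show "z \<in> cnj ` half_plane (- s)" by (intro image_eqI[of _ _ "cnj z"]) (auto simp: half_plane_def)
    qed
  qed (auto simp: half_plane_def)
  have op: "open (half_plane (- s))"
    unfolding half_plane_def by (intro open_Collect_less continuous_intros)
  have "cnj \<circ> F \<circ> cnj holomorphic_on half_plane (- s)"
    by (rule holomorphic_on_compose_cnj_cnj) (use assms op in \<open>auto simp: img hardy_fun_def\<close>)
  moreover have "cnj (Complex x (- (s * y))) = Complex x (s * y)" for x y by (simp add: complex_eq_iff)
  ultimately show ?thesis using assms by (simp add: hardy_fun_def o_def)
qed

lemma nt_limit_cnj:
  assumes "nt_limit s F x l"
  shows "nt_limit (- s) (\<lambda>z. cnj (F (cnj z))) x (cnj l)"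
  unfolding nt_limit_def
proof (intro allI impI)
  fix a :: real assume a: "0 < a"
  have 1: "(F \<longlongrightarrow> l) (at (complex_of_real x) within nt_region s a x)"
    using assms a by (simp add: nt_limit_def)
  have 2: "filterlim cnj (at (complex_of_real x) within nt_region s a x) (at (complex_of_real x) within nt_region (- s) a x)"
    unfolding filterlim_at
  proof
    show "\<forall>\<^sub>F z in at (complex_of_real x) within nt_region (- s) a x. cnj z \<in> nt_region s a x \<and> cnj z \<noteq> complex_of_real x"
      unfolding eventually_at_filter
      by (rule always_eventually) (auto simp: nt_region_def complex_eq_iff)
    show "(cnj \<longlongrightarrow> complex_of_real x) (at (complex_of_real x) within nt_region (- s) a x)"
      using tendsto_cnj[OF tendsto_ident_at[of "complex_of_real x" "nt_region (- s) a x"]] by simp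
  qed
  show "((\<lambda>z. cnj (F (cnj z))) \<longlongrightarrow> cnj l) (at (complex_of_real x) within nt_region (- s) a x)"
    by (rule tendsto_cnj[OF filterlim_compose[OF 1 2]])
qed

lemma ae_cnj_cnj [simp]: "ae_cnj (ae_cnj u) = u"
  by transfer simp

lemma ae_cnj_Lp: "u \<in> Lp p \<Longrightarrow> ae_cnj u \<in> Lp p"
  unfolding Lp_eq using Lfun_cnj(1) by (auto simp: ae_ops)

lemma ae_cnj_Hardy:
  assumes "u \<in> Hardy s p"
  shows "ae_cnj u \<in> Hardy (- s) p"
proof -
  obtain f F where f: "u = ae_class f" "ae_class f \<in> Lp p" "F \<in> hardy_fun s p" "AE x in lebesgue. nt_limit s F x (f x)"
    using assms by (auto simp: Hardy_def)
  have "AE x in lebesgue. nt_limit (- s) (\<lambda>z. cnj (F (cnj z))) x (cnj (f x))"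
    using f(4) by eventually_elim (rule nt_limit_cnj)
  moreover have "ae_class (\<lambda>x. cnj (f x)) \<in> Lp p" using ae_cnj_Lp[OF f(2)] by (simp add: ae_ops)
  ultimately show ?thesis
    unfolding Hardy_def using hardy_fun_cnj[OF f(3)] by (auto simp: f(1) ae_ops)
qed

text \<open>One inclusion takes the Cauchy integral as the Hardy function, the other is Cauchy's
  theorem applied to given boundary values. Henceforth membership means vanishing of a Cauchy
  integral.\<close>

lemma Hardy_plus:
  assumes p: "1 < p"
  shows "Hardy 1 p = ae_class ` Ap p"
proof
  show "ae_class ` Ap p \<subseteq> Hardy 1 p"
  proof
    fix u assume "u \<in> ae_class ` Ap p"
    then obtain f where f: "f \<in> Ap p" "u = ae_class f" by auto
    then have fL: "f \<in> Lfun p" by (simp add: Ap_def)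
    have "ae_class f \<in> Lp p" using fL by (auto simp: Lp_eq)
    then show "u \<in> Hardy 1 p"
      unfolding Hardy_def f(2)
      using hardy_fun_from_KI[OF p fL] f(1) by (auto simp: Ap_def AE_completion_iff intro!: exI[of _ f])
  qed
  show "Hardy 1 p \<subseteq> ae_class ` Ap p"
  proof
    fix u assume "u \<in> Hardy 1 p"
    then obtain f F where f: "u = ae_class f" "ae_class f \<in> Lp p" "F \<in> hardy_fun 1 p" "AE x in lborel. nt_limit 1 F x (f x)"
      by (auto simp: Hardy_def AE_completion_iff)
    obtain f' where f': "f' \<in> Lfun p" "ae_class f = ae_class f'" using f(2) by (auto simp: Lp_eq)
    have "AE x in lborel. nt_limit 1 F x (f' x)"
      using f(4) f'(2)[unfolded ae_class_eq_iff] by eventually_elim simp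
    then have "f' \<in> Ap p"
      using hardy_boundary_KI_zero[OF p f(3) f'(1)] f'(1) by (simp add: Ap_def)
    then show "u \<in> ae_class ` Ap p" using f(1) f'(2) by auto
  qed
qed

lemma Hardy_minus:
  assumes p: "1 < p"
  shows "Hardy (- 1) p = ae_class ` Am p"
proof
  show "Hardy (- 1) p \<subseteq> ae_class ` Am p"
  proof
    fix u assume "u \<in> Hardy (- 1) p"
    from ae_cnj_Hardy[OF this] obtain f where f: "f \<in> Ap p" "ae_cnj u = ae_class f"
      unfolding minus_minus Hardy_plus[OF p] by auto
    then have "u = ae_class (\<lambda>x. cnj (f x))" by (metis ae_cnj.abs_eq ae_cnj_cnj)
    then show "u \<in> ae_class ` Am p" using Ap_cnj[OF f(1)] by blast
  qed
  show "ae_class ` Am p \<subseteq> Hardy (- 1) p"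
  proof
    fix u assume "u \<in> ae_class ` Am p"
    then obtain f where f: "f \<in> Am p" "u = ae_class f" by auto
    have "ae_class (\<lambda>x. cnj (f x)) \<in> Hardy 1 p" unfolding Hardy_plus[OF p] using Am_cnj[OF f(1)] by blast
    from ae_cnj_Hardy[OF this] show "u \<in> Hardy (- 1) p" by (simp add: f(2) ae_ops)
  qed
qed

text \<open>Any splitting into a plus and a minus part computes the projection; this is the only
  place where its definition by principal values is unfolded.\<close>

lemma Pplus_class:
  assumes p: "1 < p" and f: "f \<in> Lfun p" and g: "g \<in> Ap p" and h: "(\<lambda>x. f x - g x) \<in> Am p"
  shows "Pplus (ae_class f) = ae_class g"
  using singular_integral_eq[OF assms]
  unfolding riesz_proj_def cauchy_sing.abs_eq ae_ops ae_class_eq_iff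
  by (auto elim!: eventually_mono)

lemma Pplus_Lp:
  assumes p: "1 < p" and u: "u \<in> Lp p"
  shows "Pplus u \<in> Hardy 1 p" "u - Pplus u \<in> Hardy (- 1) p"
proof -
  obtain f where f: "f \<in> Lfun p" "u = ae_class f" using u by (auto simp: Lp_eq)
  obtain K where "\<forall>f\<in>Lfun p. \<exists>g\<in>Ap p. (\<lambda>x. f x - g x) \<in> Am p \<and> pint p g \<le> K * pint p f \<and>
    (\<exists>gs. (\<forall>n. gs n \<in> lspan (bb ` {0..})) \<and> Lconv p gs g)"
    using riesz_projection[OF p] by blast
  from bspec[OF this f(1)] obtain g where g: "g \<in> Ap p" "(\<lambda>x. f x - g x) \<in> Am p" by blast
  have P: "Pplus u = ae_class g" unfolding f(2) by (rule Pplus_class[OF p f(1) g])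
  then have "u - Pplus u = ae_class (\<lambda>x. f x - g x)" by (simp add: f(2) minus_aefun.abs_eq)
  then show "Pplus u \<in> Hardy 1 p" "u - Pplus u \<in> Hardy (- 1) p"
    using g P unfolding Hardy_plus[OF p] Hardy_minus[OF p] by auto
qed

lemma Pplus_bounded:
  assumes p: "1 < p"
  shows "\<exists>C\<ge>0. \<forall>u\<in>Lp p. Lp_norm p (Pplus u) \<le> C * Lp_norm p u"
proof -
  obtain K where K0: "0 \<le> K" and K: "\<forall>f\<in>Lfun p. \<exists>g\<in>Ap p. (\<lambda>x. f x - g x) \<in> Am p \<and> pint p g \<le> K * pint p f \<and>
    (\<exists>gs. (\<forall>n. gs n \<in> lspan (bb ` {0..})) \<and> Lconv p gs g)"
    using riesz_projection[OF p] by blast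
  show ?thesis
  proof (intro exI[of _ "K powr (1 / p)"] conjI ballI)
    fix u assume "u \<in> Lp p"
    then obtain f where f: "f \<in> Lfun p" "u = ae_class f" by (auto simp: Lp_eq)
    obtain g where g: "g \<in> Ap p" "(\<lambda>x. f x - g x) \<in> Am p" "pint p g \<le> K * pint p f"
      using bspec[OF K f(1)] by blast
    have gL: "g \<in> Lfun p" using g by (simp add: Ap_def)
    have "Lp_norm p (Pplus u) = pint p g powr (1 / p)"
      unfolding f(2) Pplus_class[OF p f(1) g(1,2)] by (rule Lp_norm_class[OF gL])
    also have "\<dots> \<le> (K * pint p f) powr (1 / p)" using g(3) p by (intro powr_mono2) auto
    also have "\<dots> = K powr (1 / p) * Lp_norm p u"
      using K0 by (simp add: f(2) Lp_norm_class[OF f(1)] powr_mult)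
    finally show "Lp_norm p (Pplus u) \<le> K powr (1 / p) * Lp_norm p u" .
  qed simp
qed

lemma Pplus_add:
  assumes p: "1 < p" and u: "u \<in> Lp p" and v: "v \<in> Lp p"
  shows "Pplus (u + v) = Pplus u + Pplus v"
proof -
  obtain f where f: "f \<in> Lfun p" "u = ae_class f" using u by (auto simp: Lp_eq)
  obtain h where h: "h \<in> Lfun p" "v = ae_class h" using v by (auto simp: Lp_eq)
  obtain K where K: "\<forall>f\<in>Lfun p. \<exists>g\<in>Ap p. (\<lambda>x. f x - g x) \<in> Am p \<and> pint p g \<le> K * pint p f \<and>
    (\<exists>gs. (\<forall>n. gs n \<in> lspan (bb ` {0..})) \<and> Lconv p gs g)"
    using riesz_projection[OF p] by blast
  obtain a where a: "a \<in> Ap p" "(\<lambda>x. f x - a x) \<in> Am p" using bspec[OF K f(1)] by blast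
  obtain b where b: "b \<in> Ap p" "(\<lambda>x. h x - b x) \<in> Am p" using bspec[OF K h(1)] by blast
  have "(\<lambda>x. (f x - a x) + (h x - b x)) \<in> Am p" by (rule Am_lin(2)[OF p a(2) b(2)])
  then have "(\<lambda>x. (f x + h x) - (a x + b x)) \<in> Am p" by (simp add: algebra_simps)
  then have "Pplus (ae_class (\<lambda>x. f x + h x)) = ae_class (\<lambda>x. a x + b x)"
    using p f(1) h(1) a(1) b(1) by (intro Pplus_class Lfun_add(1) Ap_lin(2)) simp_all
  then show ?thesis
    unfolding f(2) h(2) Pplus_class[OF p f(1) a] Pplus_class[OF p h(1) b] ae_ops .
qed

lemma Pplus_scale:
  assumes p: "1 < p" and u: "u \<in> Lp p"
  shows "Pplus (ae_scale c u) = ae_scale c (Pplus u)"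
proof -
  obtain f where f: "f \<in> Lfun p" "u = ae_class f" using u by (auto simp: Lp_eq)
  obtain K where K: "\<forall>f\<in>Lfun p. \<exists>g\<in>Ap p. (\<lambda>x. f x - g x) \<in> Am p \<and> pint p g \<le> K * pint p f \<and>
    (\<exists>gs. (\<forall>n. gs n \<in> lspan (bb ` {0..})) \<and> Lconv p gs g)"
    using riesz_projection[OF p] by blast
  obtain a where a: "a \<in> Ap p" "(\<lambda>x. f x - a x) \<in> Am p" using bspec[OF K f(1)] by blast
  have "(\<lambda>x. c * (f x - a x)) \<in> Am p" by (rule Am_lin(4)[OF p a(2)])
  then have "(\<lambda>x. c * f x - c * a x) \<in> Am p" by (simp add: algebra_simps)
  then have "Pplus (ae_class (\<lambda>x. c * f x)) = ae_class (\<lambda>x. c * a x)"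
    using p f(1) a(1) by (intro Pplus_class Lfun_cmult(1) Ap_lin(4)) simp_all
  then show ?thesis unfolding f(2) Pplus_class[OF p f(1) a] ae_ops .
qed

lemma Pplus_Hplus:
  assumes p: "1 < p" and u: "u \<in> Hardy 1 p"
  shows "Pplus u = u"
proof -
  obtain f where f: "f \<in> Ap p" "u = ae_class f" using u by (auto simp: Hardy_plus[OF p])
  show ?thesis unfolding f(2)
    by (rule Pplus_class[OF p]) (use f Am_lin(1)[OF p] in \<open>auto simp: Ap_def\<close>)
qed

lemma Pplus_Hminus:
  assumes p: "1 < p" and u: "u \<in> Hardy (- 1) p"
  shows "Pplus u = 0"
proof -
  obtain f where f: "f \<in> Am p" "u = ae_class f" using u by (auto simp: Hardy_minus[OF p])
  show ?thesis unfolding f(2) zero_aefun_def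
    by (rule Pplus_class[OF p]) (use f Ap_lin(1)[OF p] in \<open>auto simp: Am_def\<close>)
qed

text \<open>Multiplication by \<open>rr t powi k\<close> moves the generator \<open>bb j\<close> to
  \<open>bb (k + j)\<close> and preserves \<open>pint p\<close>, so the claim passes from the span
  to its closure.\<close>

lemma Ap_rr:
  assumes p: "1 < p" and f: "f \<in> Ap p" and k: "0 \<le> k"
  shows "(\<lambda>t. rr t powi k * f t) \<in> Ap p"
proof -
  have p0: "0 < p" using p by simp
  obtain gs where gs: "\<And>n. gs n \<in> lspan (bb ` {0..})" "Lconv p gs f" using Ap_dense[OF p f] by blast
  have "(\<lambda>t. gs n t * rr t powi k) \<in> lspan (bb ` {0..})" for n
  proof (rule lspan_mono_map[OF gs(1)])
    fix b assume "b \<in> bb ` {0..}"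
    then obtain j where j: "b = bb j" "0 \<le> j" by auto
    have "(\<lambda>t. b t * rr t powi k) = bb (k + j)" by (simp add: fun_eq_iff j rr_powi_mult_bb[symmetric] mult.commute)
    then show "(\<lambda>t. b t * rr t powi k) \<in> lspan (bb ` {0..})" using j k by (auto intro: lspan_base)
  qed
  then have A: "(\<lambda>t. gs n t * rr t powi k) \<in> Ap p" for n
    by (rule Ap_lspan[OF p, rotated]) (use bb_Ap[OF p] in auto)
  have L: "(\<lambda>t. h t * rr t powi k) \<in> Lfun p" if "h \<in> Lfun p" for h
    by (rule Lfun_mult_bounded[OF that p0, where B = 1]) auto
  have "Lconv p (\<lambda>n t. gs n t * rr t powi k) (\<lambda>t. f t * rr t powi k)"
    using gs(2) L unfolding Lconv_def pint_def left_diff_distrib[symmetric] norm_mult norm_rr_powi by simp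
  from Ap_closed[OF p this A] show ?thesis by (simp add: mult.commute)
qed

lemma Am_rr:
  assumes p: "1 < p" and f: "f \<in> Am p" and k: "k \<le> 0"
  shows "(\<lambda>t. rr t powi k * f t) \<in> Am p"
  using Ap_cnj[OF Ap_rr[OF p Am_cnj[OF f], of "- k"]] k
  by (simp add: cnj_rr_powi del: complex_cnj_power_int)

text \<open>The constant 4 is a crude substitute for the triangle inequality.\<close>

lemma Lp_add:
  assumes p1: "1 < p" and u: "u \<in> Lp p" and v: "v \<in> Lp p"
  shows "u + v \<in> Lp p" "Lp_norm p (u + v) \<le> 4 * (Lp_norm p u + Lp_norm p v)"
proof -
  have p: "0 < p" using p1 by simp
  obtain f where f: "f \<in> Lfun p" "u = ae_class f" using u by (auto simp: Lp_eq)
  obtain h where h: "h \<in> Lfun p" "v = ae_class h" using v by (auto simp: Lp_eq)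
  have eq: "u + v = ae_class (\<lambda>x. f x + h x)" by (simp add: f h ae_ops)
  have L: "(\<lambda>x. f x + h x) \<in> Lfun p" by (rule Lfun_add(1)[OF f(1) h(1) p])
  then show "u + v \<in> Lp p" unfolding eq by (auto simp: Lp_eq)
  define a where "a = Lp_norm p u"
  define b where "b = Lp_norm p v"
  have ab: "0 \<le> a" "0 \<le> b" unfolding a_def b_def f(2) h(2) Lp_norm_class[OF f(1)] Lp_norm_class[OF h(1)] by auto
  have pa: "pint p f = a powr p" "pint p h = b powr p"
    unfolding a_def b_def f(2) h(2) Lp_norm_class[OF f(1)] Lp_norm_class[OF h(1)] using p by (simp_all add: powr_powr)
  have "pint p (\<lambda>x. f x + h x) \<le> 2 powr p * (a powr p + b powr p)"
    using Lfun_add(2)[OF f(1) h(1) p] by (simp add: pa)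
  also have "\<dots> \<le> 2 powr p * (2 * (a + b) powr p)"
    using powr_mono2[of p a "a + b"] powr_mono2[of p b "a + b"] ab p by (intro mult_left_mono) auto
  finally have "pint p (\<lambda>x. f x + h x) powr (1 / p) \<le> (2 powr p * (2 * (a + b) powr p)) powr (1 / p)"
    using p by (intro powr_mono2) auto
  also have "\<dots> = 2 * 2 powr (1 / p) * (a + b)"
    using p ab by (simp add: powr_mult powr_powr)
  finally have le: "Lp_norm p (u + v) \<le> 2 * 2 powr (1 / p) * (a + b)"
    unfolding eq Lp_norm_class[OF L] .
  have "2 powr (1 / p) \<le> (2::real) powr 1" using p1 by (intro powr_mono) auto
  then have "2 * 2 powr (1 / p) * (a + b) \<le> 2 * 2 * (a + b)" using ab by (intro mult_right_mono mult_left_mono) auto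
  with le show "Lp_norm p (u + v) \<le> 4 * (Lp_norm p u + Lp_norm p v)" by (simp add: a_def b_def)
qed

lemma Lp_scale:
  assumes p: "1 < p" and u: "u \<in> Lp p"
  shows "ae_scale c u \<in> Lp p" "Lp_norm p (ae_scale c u) = norm c * Lp_norm p u"
proof -
  have p0: "0 < p" using p by simp
  obtain f where f: "f \<in> Lfun p" "u = ae_class f" using u by (auto simp: Lp_eq)
  have eq: "ae_scale c u = ae_class (\<lambda>x. c * f x)" by (simp add: f ae_ops)
  have L: "(\<lambda>x. c * f x) \<in> Lfun p" by (rule Lfun_cmult(1)[OF f(1) p0])
  then show "ae_scale c u \<in> Lp p" unfolding eq by (auto simp: Lp_eq)
  show "Lp_norm p (ae_scale c u) = norm c * Lp_norm p u"
    unfolding eq unfolding f(2) Lp_norm_class[OF L] Lp_norm_class[OF f(1)] Lfun_cmult(2)[OF f(1) p0]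
    using p0 by (simp add: powr_mult powr_powr)
qed

lemma ae_scale_minus_one: "ae_scale (- 1) u = - u"
  by transfer simp

lemma Lp_diff:
  assumes p: "1 < p" and u: "u \<in> Lp p" and v: "v \<in> Lp p"
  shows "u - v \<in> Lp p" "Lp_norm p (u - v) \<le> 4 * (Lp_norm p u + Lp_norm p v)"
  using Lp_add[OF p u Lp_scale(1)[OF p v, of "-1"]] Lp_scale(2)[OF p v, of "-1"]
  by (simp_all add: ae_scale_minus_one)

lemma Lp_norm_nonneg: "0 \<le> Lp_norm p u"
  by transfer simp

lemma Lp_norm_zero: "1 < p \<Longrightarrow> Lp_norm p 0 = 0"
  by transfer simp

lemma Lp_norm_eq_0:
  assumes p: "1 < p" and u: "u \<in> Lp p" and z: "Lp_norm p u = 0"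
  shows "u = 0"
proof -
  obtain f where f: "f \<in> Lfun p" "u = ae_class f" using u by (auto simp: Lp_eq)
  have "pint p f = 0" using z unfolding f(2) Lp_norm_class[OF f(1)] by simp
  then have "AE x in lborel. f x = 0" by (rule pint_eq_0[OF f(1)])
  then show ?thesis by (simp add: f(2) zero_aefun_def ae_class_eq_iff)
qed

section \<open>Multiplication by bounded functions and by powers of r\<close>

lemma Linf_mult_Lp:
  assumes p: "1 < p" and g: "g \<in> Linf"
  shows "\<exists>C\<ge>0. \<forall>u\<in>Lp p. g * u \<in> Lp p \<and> Lp_norm p (g * u) \<le> C * Lp_norm p u"
proof -
  have p0: "0 < p" using p by simp
  obtain h B where h: "h \<in> borel_measurable borel" "\<And>t. norm (h t) \<le> B" "0 \<le> B" "g = ae_class h"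
    using Linf_representative[OF g] by blast
  show ?thesis
  proof (intro exI[of _ B] conjI ballI h)
    fix u assume "u \<in> Lp p"
    then obtain f where f: "f \<in> Lfun p" "u = ae_class f" by (auto simp: Lp_eq)
    have eq: "g * u = ae_class (\<lambda>x. h x * f x)" by (simp add: f h ae_ops)
    have m: "(\<lambda>x. h x * f x) \<in> borel_measurable borel" using h(1) Lfun_measurable[OF f(1)] by measurable
    have le: "AE x in lborel. norm (h x * f x) \<le> B * norm (f x)"
      using h(2) by (auto simp: norm_mult intro!: mult_right_mono)
    note L = Lfun_bounded_by[OF f(1) m p0 h(3) le]
    show "g * u \<in> Lp p" unfolding eq using L(1) by (auto simp: Lp_eq)
    have "pint p (\<lambda>x. h x * f x) powr (1 / p) \<le> (B powr p * pint p f) powr (1 / p)"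
      using L(2) p0 by (intro powr_mono2) auto
    also have "\<dots> = B * pint p f powr (1 / p)" using p0 h(3) by (simp add: powr_mult powr_powr)
    finally show "Lp_norm p (g * u) \<le> B * Lp_norm p u"
      unfolding eq unfolding f(2) Lp_norm_class[OF L(1)] Lp_norm_class[OF f(1)] .
  qed
qed

lemma Linf_mult_in_Lp: "1 < p \<Longrightarrow> g \<in> Linf \<Longrightarrow> u \<in> Lp p \<Longrightarrow> g * u \<in> Lp p"
  using Linf_mult_Lp by blast

lemma Linf_mult:
  assumes "g \<in> Linf" "h \<in> Linf"
  shows "g * h \<in> Linf"
proof -
  obtain a A where a: "a \<in> borel_measurable borel" "\<And>t. norm (a t) \<le> A" "0 \<le> A" "g = ae_class a"
    using Linf_representative[OF assms(1)] by blast
  obtain b B where b: "b \<in> borel_measurable borel" "\<And>t. norm (b t) \<le> B" "0 \<le> B" "h = ae_class b"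
    using Linf_representative[OF assms(2)] by blast
  have "ae_class (\<lambda>t. a t * b t) \<in> Linf"
    by (rule LinfI[where B = "A * B"]) (use a b in \<open>auto simp: norm_mult intro!: mult_mono\<close>)
  then show ?thesis by (simp add: a b ae_ops)
qed

lemma Linf_cnj:
  assumes "g \<in> Linf"
  shows "ae_cnj g \<in> Linf"
proof -
  obtain a A where a: "a \<in> borel_measurable borel" "\<And>t. norm (a t) \<le> A" "0 \<le> A" "g = ae_class a"
    using Linf_representative[OF assms(1)] by blast
  have "ae_class (\<lambda>t. cnj (a t)) \<in> Linf"
    by (rule LinfI[where B = A]) (use a measurable_compose[OF a(1) borel_measurable_cnj] in auto)
  then show ?thesis by (simp add: a ae_ops)
qed

lemma Hardy_Lp: "u \<in> Hardy s p \<Longrightarrow> u \<in> Lp p"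
  by (auto simp: Hardy_def)

lemma Hplus_lin:
  assumes p: "1 < p"
  shows "0 \<in> Hplus p" "u \<in> Hplus p \<Longrightarrow> v \<in> Hplus p \<Longrightarrow> u + v \<in> Hplus p"
    "u \<in> Hplus p \<Longrightarrow> v \<in> Hplus p \<Longrightarrow> u - v \<in> Hplus p" "u \<in> Hplus p \<Longrightarrow> ae_scale c u \<in> Hplus p"
  unfolding Hardy_plus[OF p] by (auto simp: ae_ops intro!: imageI Ap_lin[OF p])

lemma r_pow_eq: "r_pow k = ae_class (\<lambda>t. rr t powi k)"
  by (simp add: r_pow_def rr_def)

lemma r_pow_Linf: "r_pow k \<in> Linf"
  unfolding r_pow_eq by (rule LinfI[where B = 1]) auto

lemma r_pow_mult: "r_pow j * r_pow k = r_pow (j + k)"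
  by (simp add: r_pow_eq ae_ops power_int_add)

lemma r_pow_0: "r_pow 0 = 1"
  by (simp add: r_pow_eq ae_ops)

lemma r_pow_cancel: "r_pow k * (r_pow (- k) * u) = u" "r_pow (- k) * (r_pow k * u) = u"
  by (simp_all add: mult.assoc[symmetric] r_pow_mult r_pow_0)

lemma r_pow_cnj: "ae_cnj (r_pow k) = r_pow (- k)"
  by (simp add: r_pow_eq ae_ops cnj_rr_powi del: complex_cnj_power_int)

lemma r_pow_Hplus: "1 < p \<Longrightarrow> 0 \<le> k \<Longrightarrow> u \<in> Hplus p \<Longrightarrow> r_pow k * u \<in> Hplus p"
  unfolding Hardy_plus r_pow_eq by (auto simp: ae_ops intro!: imageI Ap_rr)

lemma r_pow_Hminus: "1 < p \<Longrightarrow> k \<le> 0 \<Longrightarrow> u \<in> Hardy (- 1) p \<Longrightarrow> r_pow k * u \<in> Hardy (- 1) p"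
  unfolding Hardy_minus r_pow_eq by (auto simp: ae_ops intro!: imageI Am_rr)

section \<open>Convergence of classes and completeness of the Hardy space\<close>

definition aconv :: "real \<Rightarrow> (nat \<Rightarrow> aefun) \<Rightarrow> aefun \<Rightarrow> bool" where
  "aconv p us u \<longleftrightarrow> (\<forall>n. us n \<in> Lp p) \<and> u \<in> Lp p \<and> (\<lambda>n. Lp_norm p (us n - u)) \<longlonglongrightarrow> 0"

lemma aconv_class:
  assumes p: "1 < p" and L: "Lconv p fs f"
  shows "aconv p (\<lambda>n. ae_class (fs n)) (ae_class f)"
proof -
  have fL: "fs n \<in> Lfun p" "f \<in> Lfun p" for n using L by (auto simp: Lconv_def)
  have d: "(\<lambda>x. fs n x - f x) \<in> Lfun p" for n using p by (intro Lfun_diff(1) fL) auto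
  have eq: "ae_class (fs n) - ae_class f = ae_class (\<lambda>x. fs n x - f x)" for n by (simp add: ae_ops)
  have "(\<lambda>n. pint p (\<lambda>x. fs n x - f x) powr (1 / p)) \<longlonglongrightarrow> 0 powr (1 / p)"
    using L p unfolding Lconv_def by (intro tendsto_powr') auto
  then have "(\<lambda>n. Lp_norm p (ae_class (fs n) - ae_class f)) \<longlonglongrightarrow> 0"
    unfolding eq Lp_norm_class[OF d] by simp
  then show ?thesis using fL unfolding aconv_def Lp_eq by blast
qed

lemma Hplus_complete:
  assumes p: "1 < p" and us: "\<And>n. us n \<in> Hplus p"
    and cauchy: "\<And>e. 0 < e \<Longrightarrow> \<exists>N. \<forall>m\<ge>N. \<forall>n\<ge>N. Lp_norm p (us m - us n) < e"
  shows "\<exists>v\<in>Hplus p. aconv p us v"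
proof -
  have p0: "0 < p" using p by simp
  have "\<forall>n. \<exists>f. f \<in> Ap p \<and> us n = ae_class f" using us unfolding Hardy_plus[OF p] by blast
  from choice[OF this] obtain fs where fs: "\<And>n. fs n \<in> Ap p" "\<And>n. us n = ae_class (fs n)" by blast
  have fL: "fs n \<in> Lfun p" for n using fs(1) by (simp add: Ap_def)
  have d: "(\<lambda>x. fs m x - fs n x) \<in> Lfun p" for m n by (intro Lfun_diff(1) fL p0)
  have N: "Lp_norm p (us m - us n) = pint p (\<lambda>x. fs m x - fs n x) powr (1 / p)" for m n
    unfolding fs(2) minus_aefun.abs_eq by (rule Lp_norm_class[OF d])
  have "\<exists>g. Lconv p fs g"
  proof (rule Lfun_complete[OF p0 fL])
    fix e :: real assume e: "0 < e"
    then have "0 < e powr (1 / p)" by simp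
    from cauchy[OF this] obtain M where M: "\<And>m n. M \<le> m \<Longrightarrow> M \<le> n \<Longrightarrow> Lp_norm p (us m - us n) < e powr (1 / p)" by blast
    show "\<exists>N. \<forall>m\<ge>N. \<forall>n\<ge>N. pint p (\<lambda>x. fs m x - fs n x) < e"
    proof (intro exI[of _ M] allI impI)
      fix m n assume "M \<le> m" "M \<le> n"
      from M[OF this] have lt: "pint p (\<lambda>x. fs m x - fs n x) powr (1 / p) < e powr (1 / p)" unfolding N .
      show "pint p (\<lambda>x. fs m x - fs n x) < e"
      proof (rule ccontr)
        assume "\<not> ?thesis"
        then have "e powr (1 / p) \<le> pint p (\<lambda>x. fs m x - fs n x) powr (1 / p)"
          using e p0 by (intro powr_mono2) auto
        then show False using lt by simp
      qed
    qed
  qed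
  then obtain g where g: "Lconv p fs g" by blast
  have "g \<in> Ap p" by (rule Ap_closed[OF p g fs(1)])
  moreover have "aconv p us (ae_class g)" using aconv_class[OF p g] by (simp add: fs(2)[symmetric])
  ultimately show ?thesis unfolding Hardy_plus[OF p] by blast
qed

text \<open>Reflected polynomials turn the behaviour at infinity into values at 0. The factor
  \<open>0 ^ (degree Q - degree P)\<close> is 1 for equal degrees and 0 otherwise.\<close>

lemma poly_quotient_at_infinity:
  fixes P Q :: "complex poly"
  assumes deg: "degree P \<le> degree Q" and Q: "Q \<noteq> 0"
  shows "((\<lambda>t::real. poly P (of_real t) / poly Q (of_real t)) \<longlongrightarrow> 0 ^ (degree Q - degree P) * (lead_coeff P / lead_coeff Q)) at_infinity"
proof -
  let ?s = "\<lambda>t::real. complex_of_real (inverse t)"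
  have "(?s \<longlongrightarrow> complex_of_real 0) at_infinity" by (intro tendsto_of_real tendsto_inverse_0)
  then have s: "(?s \<longlongrightarrow> 0) at_infinity" by (simp only: of_real_0)
  have pl: "((\<lambda>t. poly (reflect_poly R) (?s t)) \<longlongrightarrow> lead_coeff R) at_infinity" for R
  proof -
    have "isCont (poly (reflect_poly R)) 0" by (rule poly_isCont)
    from isCont_tendsto_compose[OF this s] show ?thesis by (simp add: poly_0_coeff_0)
  qed
  have "((\<lambda>t. ?s t ^ (degree Q - degree P) * (poly (reflect_poly P) (?s t) / poly (reflect_poly Q) (?s t))) \<longlongrightarrow>
      0 ^ (degree Q - degree P) * (lead_coeff P / lead_coeff Q)) at_infinity"
    by (intro tendsto_intros s pl) (use Q in auto)
  moreover have "\<forall>\<^sub>F t in at_infinity. ?s t ^ (degree Q - degree P) * (poly (reflect_poly P) (?s t) / poly (reflect_poly Q) (?s t))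
      = poly P (of_real t) / poly Q (of_real t)"
    unfolding eventually_at_infinity
  proof (intro exI[of _ 1] allI impI)
    fix t :: real assume "1 \<le> norm t"
    then have t: "t \<noteq> 0" by auto
    have R: "poly (reflect_poly R) (?s t) = ?s t ^ degree R * poly R (of_real t)" for R
      using poly_reflect_poly_nz[of "?s t" R] t by simp
    have "?s t ^ degree Q = ?s t ^ (degree Q - degree P) * ?s t ^ degree P"
      using deg by (simp flip: power_add)
    then show "?s t ^ (degree Q - degree P) * (poly (reflect_poly P) (?s t) / poly (reflect_poly Q) (?s t))
      = poly P (of_real t) / poly Q (of_real t)"
      unfolding R using t by (simp add: field_simps)
  qed
  ultimately show ?thesis by (rule Lim_transform_eventually)
qed

lemma poly_quotient_continuous:
  fixes P Q :: "complex poly"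
  assumes "\<And>t::real. poly Q (of_real t) \<noteq> 0"
  shows "continuous_on UNIV (\<lambda>t::real. poly P (of_real t) / poly Q (of_real t))"
  using assms by (intro continuous_intros) auto

lemma poly_quotient_bounded:
  fixes P Q :: "complex poly"
  assumes deg: "degree P \<le> degree Q" and Q: "\<And>t::real. poly Q (of_real t) \<noteq> 0"
  shows "\<exists>B. \<forall>t::real. norm (poly P (of_real t) / poly Q (of_real t)) \<le> B"
proof -
  let ?f = "\<lambda>t::real. poly P (of_real t) / poly Q (of_real t)"
  have "Q \<noteq> 0" using Q[of 0] by auto
  from tendsto_norm[OF poly_quotient_at_infinity[OF deg this]]
  obtain L where "((\<lambda>t. norm (?f t)) \<longlongrightarrow> L) at_infinity" by blast
  then have "\<forall>\<^sub>F t in at_infinity. norm (?f t) < L + 1" by (rule order_tendstoD) simp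
  then obtain R where R: "\<And>t. R \<le> \<bar>t\<bar> \<Longrightarrow> norm (?f t) < L + 1" by (auto simp: eventually_at_infinity)
  have "bounded (?f ` {-R..R})"
    by (intro compact_imp_bounded compact_continuous_image continuous_on_subset[OF poly_quotient_continuous[OF Q]]) auto
  then obtain B where B: "\<And>t. t \<in> {-R..R} \<Longrightarrow> norm (?f t) \<le> B" unfolding bounded_iff by blast
  have "norm (?f t) \<le> max B (L + 1)" for t
  proof (cases "R \<le> \<bar>t\<bar>")
    case True
    then show ?thesis using R[OF True] by linarith
  next
    case False
    then have "t \<in> {-R..R}" by (simp add: abs_le_iff not_le abs_less_iff)
    from B[OF this] show ?thesis by linarith
  qed
  then show ?thesis by blast
qed

lemma not_Lfun_limit:
  assumes p: "1 < p" and f: "f \<in> Lfun p" and lim: "(f \<longlongrightarrow> L) at_infinity"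
  shows "L = 0"
proof (rule ccontr)
  assume "L \<noteq> 0"
  define c where "c = (norm L / 2) powr p"
  have c: "0 < c" using \<open>L \<noteq> 0\<close> by (simp add: c_def)
  have "\<forall>\<^sub>F t in at_infinity. norm L / 2 < norm (f t)"
    by (rule order_tendstoD(1)[OF tendsto_norm[OF lim]]) (use \<open>L \<noteq> 0\<close> in simp)
  then obtain R where R: "\<And>t. R \<le> \<bar>t\<bar> \<Longrightarrow> norm L / 2 < norm (f t)" by (auto simp: eventually_at_infinity)
  have le: "c * real n \<le> pint p f" for n :: nat
  proof -
    let ?I = "{max R 0..max R 0 + real n}"
    have "(\<integral>t. c * indicator ?I t \<partial>lborel) \<le> pint p f"
      unfolding pint_def
    proof (rule integral_mono)
      show "integrable lborel (\<lambda>t. c * indicator ?I t)"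
        by (intro integrable_mult_right integrable_real_indicator) (auto simp: emeasure_lborel_Icc_eq)
      fix t
      show "c * indicator ?I t \<le> norm (f t) powr p"
      proof (cases "t \<in> ?I")
        case True
        then have "norm L / 2 \<le> norm (f t)" using R[of t] by auto
        then show ?thesis using True p unfolding c_def by (simp add: powr_mono2)
      qed simp
    qed (rule Lfun_integrable[OF f])
    then show ?thesis by simp
  qed
  obtain n :: nat where "pint p f / c < real n" using reals_Archimedean2 by blast
  then show False using le[of n] c by (simp add: field_simps)
qed

text \<open>A rational function in \<open>Lp p\<close> must tend to 0 at infinity, so its numerator,
  unless zero, has the smaller degree and one factor \<open>x - \<i>\<close> can be absorbed. This
  is precisely the weight carried by \<open>inverse gm\<close>.\<close>

lemma Rat0_plus_decay:
  assumes p: "1 < p" and r: "r \<in> Rat0_plus p"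
  shows "lam (- 1) * r \<in> Linf"
proof -
  obtain P Q where PQ: "r = ae_class (\<lambda>x. poly P (of_real x) / poly Q (of_real x))"
      "\<And>x::real. poly Q (of_real x) \<noteq> 0" "degree P \<le> degree Q"
    using r by (auto simp: Rat0_plus_def Rat_R_def)
  let ?f = "\<lambda>x::real. poly P (of_real x) / poly Q (of_real x)"
  have fm: "?f \<in> borel_measurable borel"
    by (rule borel_measurable_continuous_onI[OF poly_quotient_continuous[OF PQ(2)]])
  have Q0: "Q \<noteq> 0" using PQ(2)[of 0] by auto
  have "r \<in> Lp p" using r Hardy_Lp by (auto simp: Rat0_plus_def)
  then obtain f where f: "f \<in> Lfun p" "r = ae_class f" by (auto simp: Lp_eq)
  have "AE x in lborel. f x = ?f x" using f(2) PQ(1) by (simp add: ae_class_eq_iff[symmetric])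
  from Lfun_cong_AE[OF this f(1) fm] have "?f \<in> Lfun p" .
  from not_Lfun_limit[OF p this poly_quotient_at_infinity[OF PQ(3) Q0]]
  have "P = 0 \<or> degree P < degree Q" using Q0 PQ(3) by (auto simp: power_0_left split: if_splits)
  then have "degree ([:- \<i>, 1:] * P) \<le> degree Q"
  proof
    assume "degree P < degree Q"
    then show ?thesis using degree_mult_le[of "[:- \<i>, 1:]" P] by simp
  qed simp
  from poly_quotient_bounded[OF this PQ(2)]
  obtain B where B: "\<And>t::real. norm (poly ([:- \<i>, 1:] * P) (of_real t) / poly Q (of_real t)) \<le> B" by blast
  have "ae_class (\<lambda>t::real. poly ([:- \<i>, 1:] * P) (of_real t) / poly Q (of_real t)) \<in> Linf"
    by (rule LinfI[OF _ B]) (rule borel_measurable_continuous_onI[OF poly_quotient_continuous[OF PQ(2)]])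
  moreover have "lam (- 1) * r = ae_class (\<lambda>t::real. poly ([:- \<i>, 1:] * P) (of_real t) / poly Q (of_real t))"
    by (simp add: lam_def PQ(1) ae_ops algebra_simps)
  ultimately show ?thesis by simp
qed

lemma Rat_R_add:
  assumes "u \<in> Rat_R" "v \<in> Rat_R"
  shows "u + v \<in> Rat_R"
proof -
  obtain P Q where PQ: "u = ae_class (\<lambda>x. poly P (of_real x) / poly Q (of_real x))"
      "\<And>x::real. poly Q (of_real x) \<noteq> 0" "degree P \<le> degree Q"
    using assms(1) by (auto simp: Rat_R_def)
  obtain P' Q' where PQ': "v = ae_class (\<lambda>x. poly P' (of_real x) / poly Q' (of_real x))"
      "\<And>x::real. poly Q' (of_real x) \<noteq> 0" "degree P' \<le> degree Q'"
    using assms(2) by (auto simp: Rat_R_def)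
  have Q0: "Q \<noteq> 0" "Q' \<noteq> 0" using PQ(2)[of 0] PQ'(2)[of 0] by auto
  have "u + v = ae_class (\<lambda>x. poly (P * Q' + P' * Q) (of_real x) / poly (Q * Q') (of_real x))"
    using PQ(2) PQ'(2) by (simp add: PQ(1) PQ'(1) ae_ops add_frac_eq)
  moreover have "degree (P * Q' + P' * Q) \<le> degree (Q * Q')"
  proof (rule degree_add_le)
    show "degree (P * Q') \<le> degree (Q * Q')"
      using degree_mult_le[of P Q'] PQ(3) Q0 by (simp add: degree_mult_eq)
    show "degree (P' * Q) \<le> degree (Q * Q')"
      using degree_mult_le[of P' Q] PQ'(3) Q0 by (simp add: degree_mult_eq)
  qed
  moreover have "\<forall>x::real. poly (Q * Q') (of_real x) \<noteq> 0" using PQ(2) PQ'(2) by simp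
  ultimately show ?thesis unfolding Rat_R_def by blast
qed

lemma Rat_R_scale:
  assumes "u \<in> Rat_R"
  shows "ae_scale c u \<in> Rat_R"
proof -
  obtain P Q where PQ: "u = ae_class (\<lambda>x. poly P (of_real x) / poly Q (of_real x))"
      "\<And>x::real. poly Q (of_real x) \<noteq> 0" "degree P \<le> degree Q"
    using assms(1) by (auto simp: Rat_R_def)
  have "ae_scale c u = ae_class (\<lambda>x. poly (smult c P) (of_real x) / poly Q (of_real x))"
    by (simp add: PQ(1) ae_ops)
  moreover have "degree (smult c P) \<le> degree Q" using PQ(3) degree_smult_le[of c P] by linarith
  ultimately show ?thesis unfolding Rat_R_def using PQ(2) by blast
qed

lemma Rat0_plus_lin:
  assumes p: "1 < p"
  shows "u \<in> Rat0_plus p \<Longrightarrow> v \<in> Rat0_plus p \<Longrightarrow> u + v \<in> Rat0_plus p"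
    "u \<in> Rat0_plus p \<Longrightarrow> ae_scale c u \<in> Rat0_plus p"
  unfolding Rat0_plus_def using Rat_R_add Rat_R_scale Hplus_lin[OF p] by auto

lemma bb_Rat_R:
  assumes "0 \<le> j"
  shows "ae_class (bb j) \<in> Rat_R"
proof -
  let ?P = "[:- \<i>, 1:] ^ nat j" and ?Q = "[:\<i>, 1:] ^ Suc (nat j)"
  have "bb j x = poly ?P (of_real x) / poly ?Q (of_real x)" for x
    using assms by (simp add: bb_def rr_def power_int_def power_divide algebra_simps)
  then have "ae_class (bb j) = ae_class (\<lambda>x. poly ?P (of_real x) / poly ?Q (of_real x))" by presburger
  moreover have "degree ?P \<le> degree ?Q" by (simp only: degree_linear_power)
  moreover have "\<forall>x::real. poly ?Q (of_real x) \<noteq> 0" by (simp add: poly_power del: power_Suc)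
  ultimately show ?thesis unfolding Rat_R_def by blast
qed

lemma bb_span_Rat0_plus:
  assumes p: "1 < p" and f: "f \<in> lspan (bb ` {0..})"
  shows "ae_class f \<in> Rat0_plus p"
proof -
  have "ae_class f \<in> Rat_R"
    using f
  proof induction
    case lspan_zero
    have "ae_scale 0 (ae_class (bb 0)) \<in> Rat_R" by (intro Rat_R_scale bb_Rat_R) simp
    then show ?case by (simp add: ae_ops)
  next
    case (lspan_step b g c)
    then have "ae_scale c (ae_class b) + ae_class g \<in> Rat_R"
      by (intro Rat_R_add Rat_R_scale) (auto intro: bb_Rat_R)
    then show ?case by (simp add: ae_ops)
  qed
  moreover have "f \<in> Ap p" by (rule Ap_lspan[OF p _ f]) (use bb_Ap[OF p] in auto)
  ultimately show ?thesis unfolding Rat0_plus_def Hardy_plus[OF p] by blast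
qed

lemma Rat0_plus_dense:
  assumes p: "1 < p" and u: "u \<in> Hplus p"
  shows "\<exists>rs. (\<forall>n. rs n \<in> Rat0_plus p) \<and> aconv p rs u"
proof -
  obtain f where f: "f \<in> Ap p" "u = ae_class f" using u by (auto simp: Hardy_plus[OF p])
  obtain gs where gs: "\<And>n. gs n \<in> lspan (bb ` {0..})" "Lconv p gs f" using Ap_dense[OF p f(1)] by blast
  show ?thesis
    using aconv_class[OF p gs(2)] bb_span_Rat0_plus[OF p gs(1)] unfolding f(2)
    by (intro exI[of _ "\<lambda>n. ae_class (gs n)"]) auto
qed

section \<open>Bounded extensions\<close>

lemma tendsto_bound_zero:
  fixes a :: real
  assumes "\<And>n. a \<le> b n" "b \<longlonglongrightarrow> 0"
  shows "a \<le> 0"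
  by (rule LIMSEQ_le_const[OF assms(2)]) (use assms(1) in auto)

lemma bounded_op_nonneg:
  assumes "bounded_op p A"
  obtains C where "0 \<le> C" "\<And>f. f \<in> Hplus p \<Longrightarrow> Lp_norm p (A f) \<le> C * Lp_norm p f"
proof -
  obtain C where C: "\<And>f. f \<in> Hplus p \<Longrightarrow> Lp_norm p (A f) \<le> C * Lp_norm p f"
    using assms unfolding bounded_op_def by blast
  show ?thesis
  proof (rule that[of "max C 0"])
    fix f assume "f \<in> Hplus p"
    from C[OF this] show "Lp_norm p (A f) \<le> max C 0 * Lp_norm p f"
      using mult_right_mono[OF max.cobounded1[of C 0] Lp_norm_nonneg[of p f]] by linarith
  qed simp
qed

lemma bounded_op_lin:
  assumes p: "1 < p" and A: "bounded_op p A"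
  shows "f \<in> Hplus p \<Longrightarrow> A f \<in> Hplus p" "f \<in> Hplus p \<Longrightarrow> h \<in> Hplus p \<Longrightarrow> A (f + h) = A f + A h"
    "f \<in> Hplus p \<Longrightarrow> A (ae_scale c f) = ae_scale c (A f)"
    "f \<in> Hplus p \<Longrightarrow> h \<in> Hplus p \<Longrightarrow> A (f - h) = A f - A h" "A 0 = 0"
proof -
  show 1: "f \<in> Hplus p \<Longrightarrow> A f \<in> Hplus p" for f using A unfolding bounded_op_def by blast
  show 2: "f \<in> Hplus p \<Longrightarrow> h \<in> Hplus p \<Longrightarrow> A (f + h) = A f + A h" for f h using A unfolding bounded_op_def by blast
  show 3: "f \<in> Hplus p \<Longrightarrow> A (ae_scale c f) = ae_scale c (A f)" for f c using A unfolding bounded_op_def by blast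
  show "A (f - h) = A f - A h" if "f \<in> Hplus p" "h \<in> Hplus p"
    using 2[OF that(1) Hplus_lin(4)[OF p that(2), of "-1"]] 3[OF that(2), of "-1"] by (simp add: ae_scale_minus_one)
  show "A 0 = 0" using 3[OF Hplus_lin(1)[OF p], of 0] by simp
qed

lemma bounded_op_comp:
  assumes "bounded_op p A" "bounded_op p B"
  shows "bounded_op p (A \<circ> B)"
proof -
  obtain C where C: "0 \<le> C" "\<And>f. f \<in> Hplus p \<Longrightarrow> Lp_norm p (A f) \<le> C * Lp_norm p f"
    using bounded_op_nonneg[OF assms(1)] by blast
  obtain D where D: "0 \<le> D" "\<And>f. f \<in> Hplus p \<Longrightarrow> Lp_norm p (B f) \<le> D * Lp_norm p f"
    using bounded_op_nonneg[OF assms(2)] by blast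
  have B: "f \<in> Hplus p \<Longrightarrow> B f \<in> Hplus p" for f using assms(2) unfolding bounded_op_def by blast
  have "Lp_norm p ((A \<circ> B) f) \<le> (C * D) * Lp_norm p f" if "f \<in> Hplus p" for f
    using order_trans[OF C(2)[OF B[OF that]] mult_left_mono[OF D(2)[OF that] C(1)]] by (simp add: mult.assoc)
  moreover have "\<forall>f\<in>Hplus p. (A \<circ> B) f \<in> Hplus p" "\<forall>f\<in>Hplus p. \<forall>h\<in>Hplus p. (A \<circ> B) (f + h) = (A \<circ> B) f + (A \<circ> B) h"
    "\<forall>c. \<forall>f\<in>Hplus p. (A \<circ> B) (ae_scale c f) = ae_scale c ((A \<circ> B) f)"
    using assms B unfolding bounded_op_def by auto
  ultimately show ?thesis unfolding bounded_op_def by blast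
qed

lemma bounded_op_eq_on_dense:
  assumes p: "1 < p" and A: "bounded_op p A" and B: "bounded_op p B"
    and eq: "\<And>r. r \<in> Rat0_plus p \<Longrightarrow> A r = B r" and u: "u \<in> Hplus p"
  shows "A u = B u"
proof -
  obtain rs where rs: "\<And>n. rs n \<in> Rat0_plus p" "aconv p rs u" using Rat0_plus_dense[OF p u] by blast
  have rH: "rs n \<in> Hplus p" for n using rs(1) by (simp add: Rat0_plus_def)
  obtain C where C: "0 \<le> C" "\<And>f. f \<in> Hplus p \<Longrightarrow> Lp_norm p (A f) \<le> C * Lp_norm p f"
    using bounded_op_nonneg[OF A] by blast
  obtain D where D: "0 \<le> D" "\<And>f. f \<in> Hplus p \<Longrightarrow> Lp_norm p (B f) \<le> D * Lp_norm p f"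
    using bounded_op_nonneg[OF B] by blast
  note Al = bounded_op_lin[OF p A] and Bl = bounded_op_lin[OF p B]
  have "Lp_norm p (A u - B u) \<le> 4 * ((C + D) * Lp_norm p (rs n - u))" for n
  proof -
    have d: "rs n - u \<in> Hplus p" by (rule Hplus_lin(3)[OF p rH u])
    have "A u - B u = B (rs n - u) - A (rs n - u)"
      using Al(4)[OF rH u] Bl(4)[OF rH u] eq[OF rs(1)] by simp
    then have "Lp_norm p (A u - B u) \<le> 4 * (Lp_norm p (B (rs n - u)) + Lp_norm p (A (rs n - u)))"
      using Lp_diff(2)[OF p Hardy_Lp[OF Bl(1)[OF d]] Hardy_Lp[OF Al(1)[OF d]]] by simp
    also have "\<dots> \<le> 4 * (D * Lp_norm p (rs n - u) + C * Lp_norm p (rs n - u))"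
      using C(2)[OF d] D(2)[OF d] by simp
    finally show ?thesis by (simp add: algebra_simps)
  qed
  moreover have "(\<lambda>n. 4 * ((C + D) * Lp_norm p (rs n - u))) \<longlonglongrightarrow> 0"
    using rs(2) unfolding aconv_def by (intro tendsto_mult_right_zero) auto
  ultimately have "Lp_norm p (A u - B u) \<le> 0" by (rule tendsto_bound_zero)
  then have "Lp_norm p (A u - B u) = 0" using Lp_norm_nonneg[of p "A u - B u"] by simp
  then have "A u - B u = 0"
    by (intro Lp_norm_eq_0[OF p] Lp_diff(1)[OF p] Hardy_Lp[OF Al(1)[OF u]] Hardy_Lp[OF Bl(1)[OF u]])
  then show ?thesis by simp
qed

text \<open>\<open>R u v\<close> relates \<open>u\<close> to the limits of \<open>A\<close> along
  rational sequences converging to \<open>u\<close>. Completeness makes it total, the bound makes it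
  single-valued, and adding or scaling sequences makes it linear.\<close>

lemma bounded_extension_exists:
  assumes p: "1 < p" and AH: "\<And>r. r \<in> Rat0_plus p \<Longrightarrow> A r \<in> Hplus p"
    and Aadd: "\<And>r s. r \<in> Rat0_plus p \<Longrightarrow> s \<in> Rat0_plus p \<Longrightarrow> A (r + s) = A r + A s"
    and Ascale: "\<And>r c. r \<in> Rat0_plus p \<Longrightarrow> A (ae_scale c r) = ae_scale c (A r)"
    and C: "0 \<le> C" "\<And>r. r \<in> Rat0_plus p \<Longrightarrow> Lp_norm p (A r) \<le> C * Lp_norm p r"
  shows "\<exists>B. bounded_op p B \<and> (\<forall>r\<in>Rat0_plus p. B r = A r)"
proof -
  let ?D = "Rat0_plus p"
  have DH: "r \<in> ?D \<Longrightarrow> r \<in> Hplus p" for r by (simp add: Rat0_plus_def)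
  have Ddiff: "r - s \<in> ?D" "A (r - s) = A r - A s" if "r \<in> ?D" "s \<in> ?D" for r s
    using Rat0_plus_lin(1)[OF p that(1) Rat0_plus_lin(2)[OF p that(2), of "-1"]]
      Aadd[OF that(1) Rat0_plus_lin(2)[OF p that(2), of "-1"]] Ascale[OF that(2), of "-1"]
    by (simp_all add: ae_scale_minus_one)
  define R where "R u v \<longleftrightarrow> v \<in> Hplus p \<and> (\<exists>rs. (\<forall>n. rs n \<in> ?D) \<and> aconv p rs u \<and> aconv p (\<lambda>n. A (rs n)) v)" for u v
  have ex: "\<exists>v. R u v" if u: "u \<in> Hplus p" for u
  proof -
    obtain rs where rs: "\<And>n. rs n \<in> ?D" "aconv p rs u" using Rat0_plus_dense[OF p u] by blast
    have "\<exists>v\<in>Hplus p. aconv p (\<lambda>n. A (rs n)) v"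
    proof (rule Hplus_complete[OF p AH[OF rs(1)]])
      fix e :: real assume e: "0 < e"
      \<comment> \<open>Here 8 is 4 times 2: two errors \<open>e'\<close> pass through the triangle
        inequality with constant 4.\<close>
      define e' where "e' = e / (8 * C + 1)"
      have den: "0 < 8 * C + 1" using C by simp
      have e': "0 < e'" using e den by (simp add: e'_def)
      have "\<forall>\<^sub>F n in sequentially. Lp_norm p (rs n - u) < e'"
        using rs(2) e' unfolding aconv_def by (intro order_tendstoD) auto
      then obtain N where N: "\<And>n. N \<le> n \<Longrightarrow> Lp_norm p (rs n - u) < e'" by (auto simp: eventually_sequentially)
      show "\<exists>N. \<forall>m\<ge>N. \<forall>n\<ge>N. Lp_norm p (A (rs m) - A (rs n)) < e"
      proof (intro exI[of _ N] allI impI)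
        fix m n assume mn: "N \<le> m" "N \<le> n"
        have "Lp_norm p (A (rs m) - A (rs n)) \<le> C * Lp_norm p (rs m - rs n)"
          using C(2)[OF Ddiff(1)[OF rs(1) rs(1)]] Ddiff(2)[OF rs(1) rs(1)] by simp
        also have "\<dots> \<le> C * (4 * (e' + e'))"
        proof (intro mult_left_mono C)
          have L: "rs k - u \<in> Lp p" for k by (rule Lp_diff(1)[OF p Hardy_Lp[OF DH[OF rs(1)]] Hardy_Lp[OF u]])
          have "Lp_norm p (rs m - rs n) \<le> 4 * (Lp_norm p (rs m - u) + Lp_norm p (rs n - u))"
            using Lp_diff(2)[OF p L[of m] L[of n]] by simp
          then show "Lp_norm p (rs m - rs n) \<le> 4 * (e' + e')" using N[OF mn(1)] N[OF mn(2)] by simp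
        qed
        also have "\<dots> < (8 * C + 1) * e'" using e' by (simp add: algebra_simps)
        also have "\<dots> = e" using den by (simp add: e'_def)
        finally show "Lp_norm p (A (rs m) - A (rs n)) < e" .
      qed
    qed
    then show ?thesis using rs unfolding R_def by blast
  qed
  \<comment> \<open>The constant 4 enters twice, once in comparing \<open>v\<close> with
    \<open>A (rs n)\<close> and once in comparing \<open>rs n\<close> with \<open>u\<close>.\<close>
  have bound: "Lp_norm p v \<le> 16 * C * Lp_norm p u" if Ruv: "R u v" for u v
  proof -
    obtain rs where v: "v \<in> Hplus p" and rs: "\<And>n. rs n \<in> ?D" "aconv p rs u" "aconv p (\<lambda>n. A (rs n)) v"
      using Ruv unfolding R_def by blast
    have uL: "u \<in> Lp p" using rs(2) by (simp add: aconv_def)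
    have vL: "v \<in> Lp p" by (rule Hardy_Lp[OF v])
    have "Lp_norm p v - 16 * C * Lp_norm p u \<le> 4 * Lp_norm p (A (rs n) - v) + 16 * C * Lp_norm p (rs n - u)" for n
    proof -
      have AL: "A (rs n) \<in> Lp p" by (rule Hardy_Lp[OF AH[OF rs(1)]])
      have rL: "rs n \<in> Lp p" by (rule Hardy_Lp[OF DH[OF rs(1)]])
      have "Lp_norm p v \<le> 4 * (Lp_norm p (A (rs n)) + Lp_norm p (A (rs n) - v))"
        using Lp_diff(2)[OF p AL Lp_diff(1)[OF p AL vL]] by simp
      moreover have "Lp_norm p (A (rs n)) \<le> C * Lp_norm p (rs n)" by (rule C(2)[OF rs(1)])
      moreover have "C * Lp_norm p (rs n) \<le> C * (4 * (Lp_norm p (rs n - u) + Lp_norm p u))"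
        using Lp_add(2)[OF p Lp_diff(1)[OF p rL uL] uL] C by (intro mult_left_mono) auto
      ultimately show ?thesis by (simp add: algebra_simps)
    qed
    moreover have "(\<lambda>n. 4 * Lp_norm p (A (rs n) - v) + 16 * C * Lp_norm p (rs n - u)) \<longlonglongrightarrow> 0"
      using rs(2,3) unfolding aconv_def by (intro tendsto_add_zero tendsto_mult_right_zero) auto
    ultimately have "Lp_norm p v - 16 * C * Lp_norm p u \<le> 0" by (rule tendsto_bound_zero)
    then show ?thesis by simp
  qed
  have aadd: "aconv p (\<lambda>n. us n + vs n) (u + v)" if uv: "aconv p us u" "aconv p vs v" for us vs u v
  proof -
    have L: "\<And>n. us n \<in> Lp p" "u \<in> Lp p" "\<And>n. vs n \<in> Lp p" "v \<in> Lp p" using uv by (auto simp: aconv_def)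
    have "(\<lambda>n. Lp_norm p (us n + vs n - (u + v))) \<longlonglongrightarrow> 0"
    proof (rule tendsto_sandwich[of "\<lambda>n. 0" _ _ "\<lambda>n. 4 * (Lp_norm p (us n - u) + Lp_norm p (vs n - v))"])
      have "Lp_norm p ((us n - u) + (vs n - v)) \<le> 4 * (Lp_norm p (us n - u) + Lp_norm p (vs n - v))" for n
        by (intro Lp_add(2)[OF p] Lp_diff(1)[OF p] L)
      moreover have "us n + vs n - (u + v) = (us n - u) + (vs n - v)" for n by simp
      ultimately show "\<forall>\<^sub>F n in sequentially. Lp_norm p (us n + vs n - (u + v)) \<le> 4 * (Lp_norm p (us n - u) + Lp_norm p (vs n - v))"
        by (intro always_eventually allI) (simp only:)
      show "(\<lambda>n. 4 * (Lp_norm p (us n - u) + Lp_norm p (vs n - v))) \<longlonglongrightarrow> 0"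
        using uv unfolding aconv_def by (intro tendsto_mult_right_zero tendsto_add_zero) auto
    qed (use Lp_norm_nonneg in auto)
    then show ?thesis using L Lp_add(1)[OF p] unfolding aconv_def by blast
  qed
  have ascale: "aconv p (\<lambda>n. ae_scale c (us n)) (ae_scale c u)" if us: "aconv p us u" for us u c
  proof -
    have L: "\<And>n. us n \<in> Lp p" "u \<in> Lp p" using us by (auto simp: aconv_def)
    have "Lp_norm p (ae_scale c (us n) - ae_scale c u) = norm c * Lp_norm p (us n - u)" for n
      using Lp_scale(2)[OF p Lp_diff(1)[OF p L(1) L(2)], of c n] by (simp add: aefun.scale_right_diff_distrib)
    then have "(\<lambda>n. Lp_norm p (ae_scale c (us n) - ae_scale c u)) \<longlonglongrightarrow> 0"
      using us unfolding aconv_def by (simp add: tendsto_mult_right_zero)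
    then show ?thesis using L Lp_scale(1)[OF p] unfolding aconv_def by blast
  qed
  have Radd: "R (u + u') (v + v')" if uv: "R u v" "R u' v'" for u v u' v'
  proof -
    obtain rs where rs: "v \<in> Hplus p" "\<And>n. rs n \<in> ?D" "aconv p rs u" "aconv p (\<lambda>n. A (rs n)) v"
      using uv(1) unfolding R_def by blast
    obtain ss where ss: "v' \<in> Hplus p" "\<And>n. ss n \<in> ?D" "aconv p ss u'" "aconv p (\<lambda>n. A (ss n)) v'"
      using uv(2) unfolding R_def by blast
    have "aconv p (\<lambda>n. A (rs n + ss n)) (v + v')"
      using aadd[OF rs(4) ss(4)] Aadd[OF rs(2) ss(2)] by simp
    then show ?thesis
      unfolding R_def using aadd[OF rs(3) ss(3)] Rat0_plus_lin(1)[OF p rs(2) ss(2)] Hplus_lin(2)[OF p rs(1) ss(1)]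
      by (intro conjI exI[of _ "\<lambda>n. rs n + ss n"]) auto
  qed
  have Rscale: "R (ae_scale c u) (ae_scale c v)" if uv: "R u v" for u v c
  proof -
    obtain rs where rs: "v \<in> Hplus p" "\<And>n. rs n \<in> ?D" "aconv p rs u" "aconv p (\<lambda>n. A (rs n)) v"
      using uv(1) unfolding R_def by blast
    have "aconv p (\<lambda>n. A (ae_scale c (rs n))) (ae_scale c v)"
      using ascale[OF rs(4)] Ascale[OF rs(2)] by simp
    then show ?thesis
      unfolding R_def using ascale[OF rs(3)] Rat0_plus_lin(2)[OF p rs(2)] Hplus_lin(4)[OF p rs(1)]
      by (intro conjI exI[of _ "\<lambda>n. ae_scale c (rs n)"]) auto
  qed
  have uniq: "v = v'" if uv: "R u v" "R u v'" for u v v'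
  proof -
    have "R (u + ae_scale (- 1) u) (v + ae_scale (- 1) v')" by (rule Radd[OF uv(1) Rscale[OF uv(2)]])
    then have R0: "R 0 (v - v')" by (simp add: ae_scale_minus_one)
    have "Lp_norm p (v - v') \<le> 0" using bound[OF R0] Lp_norm_zero[OF p] by simp
    then have "Lp_norm p (v - v') = 0" using Lp_norm_nonneg[of p "v - v'"] by simp
    moreover have "v - v' \<in> Lp p" using R0 Hardy_Lp unfolding R_def by blast
    ultimately have "v - v' = 0" by (intro Lp_norm_eq_0[OF p])
    then show ?thesis by simp
  qed
  define B where "B u = (SOME v. R u v)" for u
  have B: "R u (B u)" if "u \<in> Hplus p" for u unfolding B_def by (rule someI_ex[OF ex[OF that]])
  have "bounded_op p B"
    unfolding bounded_op_def
  proof (intro conjI ballI allI exI)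
    show "B f \<in> Hplus p" if "f \<in> Hplus p" for f using B[OF that] unfolding R_def by blast
    show "B (f + h) = B f + B h" if "f \<in> Hplus p" "h \<in> Hplus p" for f h
      by (rule uniq[OF B[OF Hplus_lin(2)[OF p that]] Radd[OF B[OF that(1)] B[OF that(2)]]])
    show "B (ae_scale c f) = ae_scale c (B f)" if "f \<in> Hplus p" for c f
      by (rule uniq[OF B[OF Hplus_lin(4)[OF p that]] Rscale[OF B[OF that]]])
    show "Lp_norm p (B f) \<le> 16 * C * Lp_norm p f" if "f \<in> Hplus p" for f by (rule bound[OF B[OF that]])
  qed
  moreover have "B r = A r" if r: "r \<in> ?D" for r
  proof (rule uniq[OF B[OF DH[OF r]]])
    have const: "aconv p (\<lambda>n. x) x" if "x \<in> Lp p" for x using that Lp_norm_zero[OF p] by (simp add: aconv_def)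
    show "R r (A r)"
      unfolding R_def using AH[OF r] r const[OF Hardy_Lp[OF DH[OF r]]] const[OF Hardy_Lp[OF AH[OF r]]]
      by (intro conjI exI[of _ "\<lambda>n. r"]) auto
  qed
  ultimately show ?thesis by blast
qed

text \<open>Restricting to \<open>Hplus p\<close> fixes the values outside, and density fixes those
  inside; this uniqueness is what gives meaning to the definite description.\<close>

lemma bounded_extension_props:
  assumes p: "1 < p" and ex: "\<exists>B. bounded_op p B \<and> (\<forall>r\<in>Rat0_plus p. B r = A r)"
  shows "bounded_op p (bounded_extension p A)" "\<And>r. r \<in> Rat0_plus p \<Longrightarrow> bounded_extension p A r = A r"
proof -
  obtain B where B: "bounded_op p B" "\<And>r. r \<in> Rat0_plus p \<Longrightarrow> B r = A r" using ex by blast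
  define B' where "B' = restrict B (Hplus p)"
  have op: "bounded_op p B'"
    using B(1) Hplus_lin(2,4)[OF p] unfolding bounded_op_def B'_def by (auto simp: restrict_apply)
  have DH: "r \<in> Rat0_plus p \<Longrightarrow> r \<in> Hplus p" for r by (simp add: Rat0_plus_def)
  have P: "bounded_op p B' \<and> (\<forall>r0\<in>Rat0_plus p. B' r0 = A r0) \<and> B' \<in> extensional (Hplus p)"
    using op B(2) DH by (auto simp: B'_def)
  have "bounded_extension p A = B'"
    unfolding bounded_extension_def
  proof (rule the_equality)
    show "bounded_op p B' \<and> (\<forall>r0\<in>Rat0_plus p. B' r0 = A r0) \<and> B' \<in> extensional (Hplus p)" by (rule P)
  next
    fix E assume E: "bounded_op p E \<and> (\<forall>r0\<in>Rat0_plus p. E r0 = A r0) \<and> E \<in> extensional (Hplus p)"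
    show "E = B'"
    proof (rule extensionalityI[of _ "Hplus p"])
      fix u assume u: "u \<in> Hplus p"
      show "E u = B' u"
        by (rule bounded_op_eq_on_dense[OF p _ op _ u]) (use E P in auto)
    qed (use E P in auto)
  qed
  then show "bounded_op p (bounded_extension p A)" "\<And>r. r \<in> Rat0_plus p \<Longrightarrow> bounded_extension p A r = A r"
    using P by auto
qed

section \<open>Toeplitz operators\<close>

lemma lborel_AE_False: "\<not> (AE t in (lborel :: real measure). False)"
  by (simp add: AE_iff_null null_sets_def)

lemma mult_ae_scale:
  "u * ae_scale c v = ae_scale c (u * v)" "ae_scale c u * v = ae_scale c (u * v)"
  by (transfer, simp add: ac_simps)+

lemma ae_cnj_mult: "ae_cnj (u * v) = ae_cnj u * ae_cnj v"
  by transfer simp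

lemma ae_cnj_inverse: "ae_cnj (inverse u) = inverse (ae_cnj u)"
  by transfer simp

lemma ae_class_sum: "finite A \<Longrightarrow> (\<Sum>i\<in>A. ae_class (f i)) = ae_class (\<lambda>t. \<Sum>i\<in>A. f i t)"
  by (induction A rule: finite_induct) (simp_all add: ae_ops)

lemma toeplitz_bounded_op:
  assumes p: "1 < p" and g: "g \<in> Linf"
  shows "bounded_op p (toeplitz g)"
proof -
  obtain C where C: "0 \<le> C" "\<And>u. u \<in> Lp p \<Longrightarrow> g * u \<in> Lp p \<and> Lp_norm p (g * u) \<le> C * Lp_norm p u"
    using Linf_mult_Lp[OF p g] by blast
  obtain D where D: "0 \<le> D" "\<And>u. u \<in> Lp p \<Longrightarrow> Lp_norm p (Pplus u) \<le> D * Lp_norm p u"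
    using Pplus_bounded[OF p] by blast
  have L: "g * f \<in> Lp p" if "f \<in> Hplus p" for f using C(2)[OF Hardy_Lp[OF that]] by simp
  show ?thesis
    unfolding bounded_op_def toeplitz_def
  proof (intro conjI ballI allI exI)
    show "Pplus (g * f) \<in> Hplus p" if "f \<in> Hplus p" for f by (rule Pplus_Lp(1)[OF p L[OF that]])
    show "Pplus (g * (f + h)) = Pplus (g * f) + Pplus (g * h)" if "f \<in> Hplus p" "h \<in> Hplus p" for f h
      using Pplus_add[OF p L[OF that(1)] L[OF that(2)]] by (simp add: distrib_left)
    show "Pplus (g * ae_scale c f) = ae_scale c (Pplus (g * f))" if "f \<in> Hplus p" for c f
      using Pplus_scale[OF p L[OF that], of c] by (simp add: mult_ae_scale)
    show "Lp_norm p (Pplus (g * f)) \<le> D * C * Lp_norm p f" if "f \<in> Hplus p" for f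
    proof -
      have "Lp_norm p (Pplus (g * f)) \<le> D * Lp_norm p (g * f)" by (rule D(2)[OF L[OF that]])
      also have "\<dots> \<le> D * (C * Lp_norm p f)" using C(2)[OF Hardy_Lp[OF that]] D(1) by (intro mult_left_mono) auto
      finally show ?thesis by (simp add: mult.assoc)
    qed
  qed
qed

text \<open>What the inner projection discards is a minus function, and multiplication by
  \<open>r_pow (- k)\<close> keeps it in the minus space, where the outer projection annihilates
  it.\<close>

lemma toeplitz_r_left:
  assumes p: "1 < p" and g: "g \<in> Linf" and f: "f \<in> Hplus p" and k: "0 \<le> k"
  shows "toeplitz (r_pow (- k)) (toeplitz g f) = toeplitz (r_pow (- k) * g) f"
proof -
  have L: "g * f \<in> Lp p" by (rule Linf_mult_in_Lp[OF p g Hardy_Lp[OF f]])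
  let ?a = "r_pow (- k) * Pplus (g * f)" and ?b = "r_pow (- k) * (g * f - Pplus (g * f))"
  have b: "?b \<in> Hardy (- 1) p" using k by (intro r_pow_Hminus[OF p] Pplus_Lp(2)[OF p L]) auto
  have a: "?a \<in> Lp p" by (rule Linf_mult_in_Lp[OF p r_pow_Linf Hardy_Lp[OF Pplus_Lp(1)[OF p L]]])
  have "r_pow (- k) * g * f = ?a + ?b" by (simp add: algebra_simps)
  then have "Pplus (r_pow (- k) * g * f) = Pplus ?a"
    using Pplus_add[OF p a Hardy_Lp[OF b]] Pplus_Hminus[OF p b] by simp
  then show ?thesis by (simp add: toeplitz_def)
qed

lemma toeplitz_r_pow:
  assumes p: "1 < p" and f: "f \<in> Hplus p" and k: "0 \<le> k"
  shows "toeplitz (r_pow k) f = r_pow k * f"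
  unfolding toeplitz_def by (rule Pplus_Hplus[OF p r_pow_Hplus[OF p k f]])

lemma Hminus_smirnov:
  assumes p: "1 < p" and u: "u \<in> Hardy (- 1) p" and v: "v \<in> Hardy (- 1) (conj_exp p)"
    and L: "lam (- 1) * u * v \<in> Lp p"
  shows "lam (- 1) * u * v \<in> Hardy (- 1) p"
proof -
  obtain f where f: "f \<in> Am p" "u = ae_class f" using u Hardy_minus[OF p] by auto
  obtain h where h: "h \<in> Am (conj_exp p)" "v = ae_class h" using v Hardy_minus conj_exp_facts(1)[OF p] by auto
  have eq: "lam (- 1) * u * v = ae_class (\<lambda>t. (complex_of_real t - \<i>) * f t * h t)"
    by (simp add: lam_def f h ae_ops)
  obtain w where w: "w \<in> Lfun p" "lam (- 1) * u * v = ae_class w" using L unfolding Lp_eq by auto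
  have m: "(\<lambda>t. (complex_of_real t - \<i>) * f t * h t) \<in> borel_measurable borel"
    using f(1) h(1) by (intro borel_measurable_times Lfun_measurable[of f p] Lfun_measurable[of h "conj_exp p"]) (auto simp: Am_def)
  have "(\<lambda>t. (complex_of_real t - \<i>) * f t * h t) \<in> Lfun p"
    using w eq m by (intro Lfun_cong_AE[OF _ w(1) m]) (simp add: ae_class_eq_iff eq_commute)
  from Am_smirnov[OF p f(1) h(1) this] show ?thesis unfolding eq Hardy_minus[OF p] by blast
qed

lemma Hplus_Hminus_zero:
  assumes p: "1 < p" and u: "u \<in> Hplus p" "u \<in> Hardy (- 1) p"
  shows "u = 0"
  using Pplus_Hplus[OF p u(1)] Pplus_Hminus[OF p u(2)] by simp

lemma bb_class_nonzero: "ae_class (bb j) \<noteq> 0"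
proof
  assume "ae_class (bb j) = 0"
  then have "AE t in lborel. bb j t = 0" by (simp add: zero_aefun.abs_eq ae_class_eq_iff)
  then have "AE t in (lborel :: real measure). False" by (simp add: bb_def)
  then show False using lborel_AE_False by blast
qed

lemma lam_plus_inverse: "lam 1 * ae_class (\<lambda>t. 1 / (complex_of_real t + \<i>)) = 1"
  by (simp add: lam_def ae_ops ae_class_eq_iff)

lemma lam_minus_eq: "lam (- 1) = r_pow 1 * lam 1"
  by (simp add: lam_def r_pow_eq ae_ops ae_class_eq_iff rr_def)

text \<open>A nonzero polynomial has finitely many roots, and by injectivity of \<open>rr\<close>
  their preimage is finite, hence a null set.\<close>

lemma rr_powers_independent:
  assumes "AE t in lborel. (\<Sum>j<n. c j * rr t ^ j) = 0" and "j < n"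
  shows "c j = 0"
proof -
  define P where "P = (\<Sum>j<n. monom (c j) j)"
  have P: "poly P z = (\<Sum>j<n. c j * z ^ j)" for z by (simp add: P_def poly_sum poly_monom)
  have "P = 0"
  proof (rule ccontr)
    assume "P \<noteq> 0"
    then have "finite {z. poly P z = 0}" by (rule poly_roots_finite)
    then have "finite (rr -` {z. poly P z = 0})" by (rule finite_vimageI[OF _ inj_rr])
    then have "AE t in lborel. t \<notin> rr -` {z. poly P z = 0}"
      by (intro AE_not_in finite_imp_null_set_lborel)
    with assms(1) have "AE t in (lborel :: real measure). False" by eventually_elim (simp add: P)
    then show False using lborel_AE_False by blast
  qed
  moreover have "coeff P j = c j" using assms(2) by (simp add: P_def coeff_sum)
  ultimately show ?thesis by simp
qed

text \<open>Here \<open>w = 1 / ((x + \<i>) g\<^sub>+)\<close>; the kernel turns out to be spanned by \<open>r^j w\<close>, \<open>j < n\<close>.\<close>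

locale negative_factorisation =
  fixes p :: real and g gm gp w :: aefun and n :: nat
  assumes p: "1 < p" and g: "g \<in> Linf" and geq: "g = gm * r_pow (- int n) * gp"
    and gp: "gp \<in> weighted_Hardy 1 (conj_exp p)" and gm: "gm \<in> weighted_Hardy (- 1) p"
    and gp1: "gp * inverse gp = 1" and gm1: "gm * inverse gm = 1"
    and w: "w \<in> Hplus p" and igp: "inverse gp = lam 1 * w"
    and igm: "inverse gm \<in> weighted_Hardy (- 1) (conj_exp p)"
begin

lemma gp_w: "gp * w = ae_class (\<lambda>t. 1 / (complex_of_real t + \<i>))"
proof -
  have "lam 1 * (gp * w) = 1" using gp1 igp by (simp add: ac_simps)
  then have "(ae_class (\<lambda>t. 1 / (complex_of_real t + \<i>)) * lam 1) * (gp * w) = ae_class (\<lambda>t. 1 / (complex_of_real t + \<i>))"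
    by (simp add: mult.assoc)
  then show ?thesis using lam_plus_inverse by (simp add: mult.commute)
qed

lemma w_cancel:
  assumes "u * w = v * w"
  shows "u = v"
proof -
  have "u * (w * gp * lam 1) = v * (w * gp * lam 1)" using assms by (simp add: mult.assoc[symmetric])
  moreover have "w * gp * lam 1 = 1" using gp1 igp by (simp add: ac_simps)
  ultimately show ?thesis by simp
qed

text \<open>With \<open>gm = lam (- 1) * w'\<close> and \<open>lam (- 1) = r_pow 1 * lam 1\<close>
  the product collapses to \<open>r_pow (1 - int n + int j) * w'\<close>. The exponent is at most 0
  exactly for \<open>j < n\<close>, so that the product is a minus function.\<close>

lemma kernel_basis:
  assumes "j < n"
  shows "r_pow (int j) * w \<in> ker_on (Hplus p) (toeplitz g)"
proof -
  obtain w' where w': "w' \<in> Hardy (- 1) p" "gm = lam (- 1) * w'" using gm unfolding weighted_Hardy_def by blast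
  have "g * (r_pow (int j) * w) = w' * lam (- 1) * r_pow (- int n) * r_pow (int j) * (gp * w)"
    unfolding geq w' by (simp add: ac_simps)
  also have "\<dots> = (r_pow 1 * (r_pow (- int n) * r_pow (int j))) * w' * (lam 1 * ae_class (\<lambda>t. 1 / (complex_of_real t + \<i>)))"
    unfolding gp_w lam_minus_eq by (simp add: ac_simps)
  also have "\<dots> = r_pow (1 + (- int n + int j)) * w'" unfolding lam_plus_inverse r_pow_mult by simp
  finally have "g * (r_pow (int j) * w) \<in> Hardy (- 1) p" using assms r_pow_Hminus[OF p _ w'(1)] by simp
  then have "toeplitz g (r_pow (int j) * w) = 0" unfolding toeplitz_def by (rule Pplus_Hminus[OF p])
  then show ?thesis using r_pow_Hplus[OF p _ w] by (simp add: ker_on_def)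
qed

text \<open>In \<open>inverse gm = lam (- 1) * v'\<close> the factor \<open>lam (- 1)\<close> is
  \<open>r_pow 1 * lam 1\<close>. Its \<open>lam 1\<close> cancels against the one in
  \<open>gp\<close>, and the additional power of \<open>r\<close> explains the exponent
  \<open>n + 1\<close> in the product identity.\<close>

lemma kernel_representation:
  assumes f: "f \<in> ker_on (Hplus p) (toeplitz g)"
  shows "\<exists>c. f = (\<Sum>j<n. ae_scale (c j) (r_pow (int j) * w))"
proof -
  let ?q = "conj_exp p" and ?i = "ae_class (\<lambda>t. 1 / (complex_of_real t + \<i>))"
  have q: "1 < ?q" by (rule conj_exp_facts(1)[OF p])
  have fH: "f \<in> Hplus p" and f0: "Pplus (g * f) = 0" using f by (auto simp: ker_on_def toeplitz_def)
  have h: "g * f \<in> Hardy (- 1) p" using Pplus_Lp(2)[OF p Linf_mult_in_Lp[OF p g Hardy_Lp[OF fH]]] f0 by simp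
  obtain v where v: "v \<in> Hplus ?q" "gp = lam 1 * v" using gp unfolding weighted_Hardy_def by blast
  obtain v' where v': "v' \<in> Hardy (- 1) ?q" "inverse gm = lam (- 1) * v'" using igm unfolding weighted_Hardy_def by blast
  have "inverse gm * (g * f) = (gm * inverse gm) * r_pow (- int n) * gp * f" unfolding geq by (simp add: ac_simps)
  then have "r_pow 1 * lam 1 * v' * (g * f) = r_pow (- int n) * (lam 1 * v) * f" using gm1 v v' lam_minus_eq by simp
  then have "?i * (r_pow 1 * lam 1 * v' * (g * f)) = ?i * (r_pow (- int n) * (lam 1 * v) * f)" by (rule arg_cong)
  then have "?i * lam 1 * (r_pow 1 * v' * (g * f)) = r_pow (- int n) * (?i * lam 1 * (v * f))" by (simp add: ac_simps)
  moreover have "?i * lam 1 = 1" using lam_plus_inverse by (simp add: mult.commute)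
  ultimately have "r_pow 1 * v' * (g * f) = r_pow (- int n) * (v * f)" by simp
  then have "r_pow (int n) * (r_pow 1 * v' * (g * f)) = v * f" using r_pow_cancel(1) by simp
  then have eq: "f * v = r_pow (int n + 1) * ((g * f) * v')" unfolding r_pow_mult[symmetric] by (simp add: ac_simps)
  obtain F where F: "F \<in> Ap p" "f = ae_class F" using fH Hardy_plus[OF p] by auto
  obtain V where V: "V \<in> Ap ?q" "v = ae_class V" using v Hardy_plus[OF q] by auto
  obtain H where H: "H \<in> Am p" "g * f = ae_class H" using h Hardy_minus[OF p] by auto
  obtain V' where V': "V' \<in> Am ?q" "v' = ae_class V'" using v' Hardy_minus[OF q] by auto
  have "AE t in lborel. F t * V t = rr t powi (int n + 1) * (H t * V' t)"
    using eq unfolding H(2) unfolding F(2) V(2) V'(2) by (simp add: r_pow_eq ae_ops ae_class_eq_iff)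
  from product_is_rational[OF p F(1) V(1) H(1) V'(1) this]
  obtain c where "AE t in lborel. F t * V t = (\<Sum>j<n. c j * (rr t powi int j / (complex_of_real t + \<i>)\<^sup>2))" by blast
  then have "ae_class (\<lambda>t. F t * V t) = ae_class (\<lambda>t. (\<Sum>j<n. c j * (rr t powi int j / (complex_of_real t + \<i>)\<^sup>2)))"
    by (simp add: ae_class_eq_iff)
  also have "\<dots> = (\<Sum>j<n. ae_scale (c j) (r_pow (int j))) * ?i * ?i"
    by (simp add: r_pow_eq ae_ops ae_class_sum ae_class_eq_iff sum_distrib_right sum_divide_distrib power2_eq_square)
  finally have fv: "f * v = (\<Sum>j<n. ae_scale (c j) (r_pow (int j))) * ?i * ?i" using F V by (simp add: ae_ops)
  \<comment> \<open>Since \<open>gp = lam 1 * v\<close> and \<open>inverse gp = lam 1 * w\<close>,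
    multiplying \<open>f * v\<close> by \<open>lam 1 * lam 1 * w\<close> recovers \<open>f\<close>,
    and the two factors \<open>lam 1\<close> cancel the denominators.\<close>
  have "f = f * (gp * inverse gp)" using gp1 by simp
  also have "\<dots> = f * v * lam 1 * lam 1 * w" unfolding igp by (simp only: v(2) ac_simps)
  also have "\<dots> = (\<Sum>j<n. ae_scale (c j) (r_pow (int j))) * (lam 1 * ?i) * (lam 1 * ?i) * w"
    unfolding fv by (simp add: ac_simps)
  also have "\<dots> = (\<Sum>j<n. ae_scale (c j) (r_pow (int j))) * w" unfolding lam_plus_inverse by simp
  also have "\<dots> = (\<Sum>j<n. ae_scale (c j) (r_pow (int j) * w))"
    by (simp add: sum_distrib_right mult_ae_scale)
  finally show ?thesis by blast
qed

lemma basis_coefficients: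
  assumes "(\<Sum>j<n. ae_scale (c j) (r_pow (int j) * w)) = 0" and "j < n"
  shows "c j = 0"
proof -
  have "(\<Sum>j<n. ae_scale (c j) (r_pow (int j))) * w = 0 * w"
    using assms(1) by (simp add: sum_distrib_right mult_ae_scale)
  then have "(\<Sum>j<n. ae_scale (c j) (r_pow (int j))) = 0" by (rule w_cancel)
  then have "AE t in lborel. (\<Sum>j<n. c j * rr t ^ j) = 0"
    by (simp add: r_pow_eq ae_ops ae_class_sum ae_class_eq_iff)
  then show ?thesis using assms(2) by (rule rr_powers_independent)
qed

lemma basis_inj: "inj_on (\<lambda>j. r_pow (int j) * w) {..<n}"
proof (rule inj_onI)
  fix i j assume ij: "i \<in> {..<n}" "j \<in> {..<n}" and eq: "r_pow (int i) * w = r_pow (int j) * w"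
  show "i = j"
  proof (rule ccontr)
    assume ne: "i \<noteq> j"
    define c :: "nat \<Rightarrow> complex" where "c l = (if l = i then 1 else if l = j then - 1 else 0)" for l
    have "ae_scale (c l) (r_pow (int l) * w) = (if l = i then r_pow (int i) * w else 0) - (if l = j then r_pow (int j) * w else 0)" for l
      using ne by (auto simp: c_def ae_scale_minus_one)
    then have "(\<Sum>l<n. ae_scale (c l) (r_pow (int l) * w)) = r_pow (int i) * w - r_pow (int j) * w"
      using ij by (simp add: sum_subtractf)
    then have "(\<Sum>l<n. ae_scale (c l) (r_pow (int l) * w)) = 0" using eq by simp
    then have "c i = 0" using ij by (intro basis_coefficients) auto
    then show False by (simp add: c_def)
  qed
qed

lemma kernel_dim: "aefun.dim (ker_on (Hplus p) (toeplitz g)) = n"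
proof -
  let ?b = "\<lambda>j. r_pow (int j) * w" and ?K = "ker_on (Hplus p) (toeplitz g)"
  let ?B = "?b ` {..<n}"
  have ind: "aefun.independent ?B"
  proof (rule aefun.independent_if_scalars_zero)
    fix f x assume s: "(\<Sum>x\<in>?B. ae_scale (f x) x) = 0" and x: "x \<in> ?B"
    then obtain j where j: "j < n" "x = ?b j" by auto
    have "(\<Sum>j<n. ae_scale (f (?b j)) (?b j)) = 0"
      using s by (simp add: sum.reindex[OF basis_inj] o_def)
    then have "f (?b j) = 0" by (rule basis_coefficients[where c = "\<lambda>j. f (?b j)"]) (rule j(1))
    then show "f x = 0" using j by simp
  qed simp
  have "?B \<subseteq> ?K" using kernel_basis by auto
  moreover have "?K \<subseteq> aefun.span ?B"
  proof
    fix f assume "f \<in> ?K"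
    then obtain c where "f = (\<Sum>j<n. ae_scale (c j) (?b j))" using kernel_representation by blast
    moreover have "(\<Sum>j<n. ae_scale (c j) (?b j)) \<in> aefun.span ?B"
      by (intro aefun.span_sum aefun.span_scale aefun.span_base) auto
    ultimately show "f \<in> aefun.span ?B" by simp
  qed
  ultimately have "aefun.dim ?K = card ?B" using ind by (intro aefun.dim_unique) auto
  then show ?thesis by (simp add: card_image[OF basis_inj])
qed

lemma w_nonzero: "w \<noteq> 0"
proof
  assume "w = 0"
  then show False using gp1 igp by simp
qed

end

lemma ae_cnj_weighted_Hardy:
  assumes "u \<in> weighted_Hardy s p"
  shows "ae_cnj u \<in> weighted_Hardy (- s) p"
proof -
  obtain h where h: "h \<in> Hardy s p" "u = lam s * h" using assms unfolding weighted_Hardy_def by blast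
  have "ae_cnj u = lam (- s) * ae_cnj h" using h by (simp add: ae_cnj_mult) (simp add: lam_def ae_ops)
  then show ?thesis using ae_cnj_Hardy[OF h(1)] unfolding weighted_Hardy_def by blast
qed

lemma negative_factorisation_toeplitz:
  assumes "1 < p" "g \<in> Linf" and f: "wiener_hopf_factorisation p g gm (- int n) gp"
  obtains w where "negative_factorisation p g gm gp w n"
  using assms unfolding wiener_hopf_factorisation_def negative_factorisation_def weighted_Hardy_def by blast

text \<open>Conjugation exchanges plus and minus, so the conjugate of \<open>gm\<close> becomes the
  plus factor and that of \<open>gp\<close> the minus factor, now for the exponent
  \<open>conj_exp p\<close>. The index changes sign because \<open>r\<close> has modulus 1.\<close>

lemma adjoint_kernel_dim:
  assumes p: "1 < p" and g: "g \<in> Linf" and fac: "wiener_hopf_factorisation p g gm (int n) gp"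
  shows "aefun.dim (ker_on (Hplus (conj_exp p)) (toeplitz_adj g)) = n"
proof -
  let ?q = "conj_exp p"
  have q: "1 < ?q" "conj_exp ?q = p" using conj_exp_facts[OF p] by auto
  have f: "g = gm * r_pow (int n) * gp" "gp \<in> weighted_Hardy 1 ?q" "gm \<in> weighted_Hardy (- 1) p"
    "gp * inverse gp = 1" "gm * inverse gm = 1" "inverse gp \<in> weighted_Hardy 1 p" "inverse gm \<in> weighted_Hardy (- 1) ?q"
    using fac unfolding wiener_hopf_factorisation_def by auto
  have one: "ae_cnj 1 = 1" by transfer simp
  obtain w where w: "w \<in> Hplus ?q" "ae_cnj (inverse gm) = lam 1 * w"
    using ae_cnj_weighted_Hardy[OF f(7)] unfolding weighted_Hardy_def by auto
  interpret negative_factorisation ?q "ae_cnj g" "ae_cnj gp" "ae_cnj gm" w n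
  proof
    show "ae_cnj g = ae_cnj gp * r_pow (- int n) * ae_cnj gm"
      unfolding f(1) ae_cnj_mult r_pow_cnj by (simp add: ac_simps)
    show "ae_cnj gm \<in> weighted_Hardy 1 (conj_exp ?q)" using ae_cnj_weighted_Hardy[OF f(3)] q by simp
    show "ae_cnj gp \<in> weighted_Hardy (- 1) ?q" using ae_cnj_weighted_Hardy[OF f(2)] by simp
    show "ae_cnj gm * inverse (ae_cnj gm) = 1" using f(5) one by (metis ae_cnj_mult ae_cnj_inverse)
    show "ae_cnj gp * inverse (ae_cnj gp) = 1" using f(4) one by (metis ae_cnj_mult ae_cnj_inverse)
    show "inverse (ae_cnj gp) \<in> weighted_Hardy (- 1) (conj_exp ?q)"
      using ae_cnj_weighted_Hardy[OF f(6)] q by (simp add: ae_cnj_inverse)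
  qed (use q w Linf_cnj[OF g] in \<open>simp_all add: ae_cnj_inverse\<close>)
  show ?thesis unfolding toeplitz_adj_def by (rule kernel_dim)
qed

text \<open>Multiplication by \<open>r_pow (- k)\<close> reduces everything to index zero. On a
  rational function the projection acts in the space with exponent \<open>conj_exp p\<close>; only
  the product with the symbol \<open>g0\<close> returns to exponent \<open>p\<close>, which is why
  the identities are checked there before continuity extends them.\<close>

lemma wh_op_extension:
  assumes p: "1 < p" and g: "g \<in> Linf" and fac: "wiener_hopf_factorisation p g gm k gp"
  defines "g0 \<equiv> r_pow (- k) * g" and "B \<equiv> bounded_extension p (wh_op gm gp)"
  shows "g0 \<in> Linf" "bounded_op p B" "\<And>f. f \<in> Hplus p \<Longrightarrow> toeplitz g0 (B f) = f"
    "\<And>f. f \<in> Hplus p \<Longrightarrow> B (toeplitz g0 f) = f"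
proof -
  let ?q = "conj_exp p"
  have q: "1 < ?q" using conj_exp_facts[OF p] by auto
  have f: "g = gm * r_pow k * gp" "gp \<in> weighted_Hardy 1 ?q" "gm \<in> weighted_Hardy (- 1) p"
    "gp * inverse gp = 1" "gm * inverse gm = 1" "inverse gp \<in> weighted_Hardy 1 p" "inverse gm \<in> weighted_Hardy (- 1) ?q"
    "\<And>r. r \<in> Rat0_plus p \<Longrightarrow> wh_op gm gp r \<in> Hplus p"
    using fac unfolding wiener_hopf_factorisation_def by auto
  obtain C where C: "\<And>r. r \<in> Rat0_plus p \<Longrightarrow> Lp_norm p (wh_op gm gp r) \<le> C * Lp_norm p r"
    using fac unfolding wiener_hopf_factorisation_def by auto
  have C': "Lp_norm p (wh_op gm gp r) \<le> max C 0 * Lp_norm p r" if "r \<in> Rat0_plus p" for r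
    using C[OF that] mult_right_mono[OF max.cobounded1[of C 0] Lp_norm_nonneg[of p r]] by linarith
  show g0: "g0 \<in> Linf" unfolding g0_def by (intro Linf_mult r_pow_Linf g)
  have "g0 = r_pow (- k) * (r_pow k * (gm * gp))" unfolding g0_def f(1) by (simp add: ac_simps)
  then have g0eq: "g0 = gm * gp" by (simp add: r_pow_cancel)
  obtain v' where v': "v' \<in> Hardy (- 1) ?q" "inverse gm = lam (- 1) * v'" using f(7) unfolding weighted_Hardy_def by blast
  obtain w' where w': "w' \<in> Hardy (- 1) p" "gm = lam (- 1) * w'" using f(3) unfolding weighted_Hardy_def by blast
  \<comment> \<open>\<open>inverse gm\<close> lies only in a weighted space; its weight
    \<open>lam (- 1)\<close> is absorbed by the decay of \<open>r\<close>.\<close>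
  have uL: "inverse gm * r \<in> Lp ?q" if r: "r \<in> Rat0_plus p" for r
  proof -
    have "(lam (- 1) * r) * v' \<in> Lp ?q" by (rule Linf_mult_in_Lp[OF q Rat0_plus_decay[OF p r] Hardy_Lp[OF v'(1)]])
    then show ?thesis unfolding v' by (simp add: ac_simps)
  qed
  have "\<exists>B. bounded_op p B \<and> (\<forall>r\<in>Rat0_plus p. B r = wh_op gm gp r)"
  proof (rule bounded_extension_exists[OF p f(8) _ _ _ C'])
    show "wh_op gm gp (r + s) = wh_op gm gp r + wh_op gm gp s" if "r \<in> Rat0_plus p" "s \<in> Rat0_plus p" for r s
      using Pplus_add[OF q uL[OF that(1)] uL[OF that(2)]] by (simp add: wh_op_def distrib_left)
    show "wh_op gm gp (ae_scale c r) = ae_scale c (wh_op gm gp r)" if "r \<in> Rat0_plus p" for r c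
      using Pplus_scale[OF q uL[OF that], of c] by (simp add: wh_op_def mult_ae_scale)
  qed simp_all
  from bounded_extension_props[OF p this]
  have B: "bounded_op p B" "\<And>r. r \<in> Rat0_plus p \<Longrightarrow> B r = wh_op gm gp r" unfolding B_def by auto
  show "bounded_op p B" by (rule B(1))
  have T: "bounded_op p (toeplitz g0)" by (rule toeplitz_bounded_op[OF p g0])
  have Id: "bounded_op p (\<lambda>f. f)" unfolding bounded_op_def by (auto intro: exI[of _ 1])
  have rat: "(toeplitz g0 \<circ> B) r = r" if r: "r \<in> Rat0_plus p" for r
  proof -
    let ?u = "inverse gm * r"
    let ?d = "?u - Pplus ?u"
    have rH: "r \<in> Hplus p" using r by (simp add: Rat0_plus_def)
    have "gm * ?u = (gm * inverse gm) * r" by (simp add: ac_simps)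
    then have 1: "gm * ?u = r" using f(5) by simp
    have "g0 * wh_op gm gp r = gm * (gp * inverse gp) * Pplus ?u" unfolding g0eq wh_op_def by (simp add: ac_simps)
    then have 2: "g0 * wh_op gm gp r = gm * Pplus ?u" using f(4) by simp
    \<comment> \<open>The left side displays the minus type of the product, the right side its
      membership in \<open>Lp p\<close>; \<open>Hminus_smirnov\<close> asks for both.\<close>
    have d: "lam (- 1) * w' * ?d = r - g0 * wh_op gm gp r"
      using 1 2 w'(2) by (simp add: right_diff_distrib)
    have L: "g0 * wh_op gm gp r \<in> Lp p" by (rule Linf_mult_in_Lp[OF p g0 Hardy_Lp[OF f(8)[OF r]]])
    have "lam (- 1) * w' * ?d \<in> Hardy (- 1) p"
      by (rule Hminus_smirnov[OF p w'(1) Pplus_Lp(2)[OF q uL[OF r]]]) (unfold d, rule Lp_diff(1)[OF p Hardy_Lp[OF rH] L])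
    then have H: "r - g0 * wh_op gm gp r \<in> Hardy (- 1) p" unfolding d .
    have "Pplus r = Pplus (g0 * wh_op gm gp r + (r - g0 * wh_op gm gp r))" by simp
    also have "\<dots> = Pplus (g0 * wh_op gm gp r)"
      using Pplus_add[OF p L Hardy_Lp[OF H]] Pplus_Hminus[OF p H] by simp
    finally show ?thesis using Pplus_Hplus[OF p rH] B(2)[OF r] by (simp add: toeplitz_def)
  qed
  show TB: "toeplitz g0 (B f) = f" if "f \<in> Hplus p" for f
    using bounded_op_eq_on_dense[OF p bounded_op_comp[OF T B(1)] Id rat that] by simp
  obtain w where w: "w \<in> Hplus p" "inverse gp = lam 1 * w" using f(6) unfolding weighted_Hardy_def by blast
  \<comment> \<open>With \<open>n = 0\<close> the kernel representation is an empty sum, that is,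
    injectivity.\<close>
  interpret negative_factorisation p g0 gm gp w 0
    by unfold_locales (use p g0 f w r_pow_0 g0eq in auto)
  show "B (toeplitz g0 f) = f" if fH: "f \<in> Hplus p" for f
  proof -
    have TH: "toeplitz g0 f \<in> Hplus p" by (rule bounded_op_lin(1)[OF p T fH])
    have BH: "B (toeplitz g0 f) \<in> Hplus p" by (rule bounded_op_lin(1)[OF p B(1) TH])
    have "toeplitz g0 (B (toeplitz g0 f) - f) = 0"
      using bounded_op_lin(4)[OF p T BH fH] TB[OF TH] by simp
    then have "B (toeplitz g0 f) - f \<in> ker_on (Hplus p) (toeplitz g0)"
      using Hplus_lin(3)[OF p BH fH] by (simp add: ker_on_def)
    from kernel_representation[OF this] have "B (toeplitz g0 f) - f = 0" by simp
    then show ?thesis by simp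
  qed
qed

theorem corollary5p11:
  fixes p :: real and g gm gp :: aefun and k :: int
  assumes "1 < p" and "g \<in> Linf" and "wiener_hopf_factorisation p g gm k gp"
  shows "(k = 0 \<longrightarrow> invertible_op p (toeplitz g)) \<and>
    (k > 0 \<longrightarrow> left_invertible_op p (toeplitz g) \<and> \<not> invertible_op p (toeplitz g)) \<and>
    (k < 0 \<longrightarrow> right_invertible_op p (toeplitz g) \<and> \<not> invertible_op p (toeplitz g)) \<and>
    (k > 0 \<longrightarrow>
      left_inverse_op p (bounded_extension p (wh_op gm gp) \<circ> toeplitz (r_pow (- k))) (toeplitz g) \<and>
      int (aefun.dim (ker_on (Hplus (conj_exp p)) (toeplitz_adj g))) = k) \<and>
    (k < 0 \<longrightarrow>
      right_inverse_op p (toeplitz (r_pow (- k)) \<circ> bounded_extension p (wh_op gm gp)) (toeplitz g) \<and>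
      int (aefun.dim (ker_on (Hplus p) (toeplitz g))) = \<bar>k\<bar>)"
proof -
  note p = assms(1) and g = assms(2) and fac = assms(3)
  define B where "B = bounded_extension p (wh_op gm gp)"
  define g0 where "g0 = r_pow (- k) * g"
  note E = wh_op_extension[OF p g fac, folded B_def g0_def]
  have T: "bounded_op p (toeplitz g)" by (rule toeplitz_bounded_op[OF p g])
  have R: "bounded_op p (toeplitz (r_pow j))" for j by (rule toeplitz_bounded_op[OF p r_pow_Linf])
  note Bl = bounded_op_lin(1)[OF p E(2)] and Tl = bounded_op_lin(1)[OF p T]
  have zero: "invertible_op p (toeplitz g)" if "k = 0"
  proof -
    have "g0 = g" using that by (simp add: g0_def r_pow_0)
    then have "left_inverse_op p B (toeplitz g) \<and> right_inverse_op p B (toeplitz g)"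
      unfolding left_inverse_op_def right_inverse_op_def using E T by auto
    then show ?thesis unfolding invertible_op_def by blast
  qed
  \<comment> \<open>\<open>toeplitz_r_left\<close> merges the two Toeplitz operators into the one of
    \<open>g0\<close>, which \<open>B\<close> inverts.\<close>
  have left: "left_inverse_op p (B \<circ> toeplitz (r_pow (- k))) (toeplitz g)" if k: "0 < k"
    unfolding left_inverse_op_def
  proof (intro conjI ballI T bounded_op_comp E(2) R)
    show "(B \<circ> toeplitz (r_pow (- k))) (toeplitz g f) = f" if "f \<in> Hplus p" for f
      using toeplitz_r_left[OF p g that, of k] E(4)[OF that] k by (simp add: g0_def)
  qed
  have right: "right_inverse_op p (toeplitz (r_pow (- k)) \<circ> B) (toeplitz g)" if k: "k < 0"
    unfolding right_inverse_op_def
  proof (intro conjI ballI T bounded_op_comp E(2) R)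
    fix f assume f: "f \<in> Hplus p"
    \<comment> \<open>For \<open>k < 0\<close> multiplication by \<open>r_pow (- k)\<close>
      preserves the plus space, so the inner Toeplitz operator is plain multiplication and merges
      with \<open>g\<close> into \<open>g0\<close>.\<close>
    have "toeplitz g (r_pow (- k) * B f) = toeplitz g0 (B f)" by (simp add: toeplitz_def g0_def ac_simps)
    then show "toeplitz g ((toeplitz (r_pow (- k)) \<circ> B) f) = f"
      using toeplitz_r_pow[OF p Bl[OF f], of "- k"] E(3)[OF f] k by simp
  qed
  \<comment> \<open>If \<open>toeplitz g\<close> reached the image of \<open>1 / (x + \<i>)\<close>
    under \<open>toeplitz g0\<close>, say at \<open>f\<close>, injectivity of the latter would give
    \<open>r_pow k * f = 1 / (x + \<i>)\<close>. Then \<open>f\<close> would be the class of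
    \<open>bb (- k)\<close>, a nonzero element of both Hardy spaces.\<close>
  have not_surj: "\<not> invertible_op p (toeplitz g)" if k: "0 < k"
  proof
    assume "invertible_op p (toeplitz g)"
    then obtain A where A: "right_inverse_op p A (toeplitz g)" unfolding invertible_op_def by blast
    let ?e = "ae_class (bb 0)" and ?m = "ae_class (bb (- k))"
    have e: "?e \<in> Hplus p" using bb_Ap[OF p, of 0] Hardy_plus[OF p] by auto
    have m: "?m \<in> Hardy (- 1) p" using bb_Am[OF p, of "- k"] Hardy_minus[OF p] k by auto
    let ?y = "toeplitz g0 ?e"
    have y: "?y \<in> Hplus p" by (rule bounded_op_lin(1)[OF p toeplitz_bounded_op[OF p E(1)] e])
    define f where "f = A ?y"
    have f: "f \<in> Hplus p" "toeplitz g f = ?y" using A y unfolding right_inverse_op_def bounded_op_def f_def by auto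
    have rf: "r_pow k * f \<in> Hplus p" using r_pow_Hplus[OF p _ f(1)] k by simp
    have "toeplitz g f = toeplitz g0 (r_pow k * f)"
      using r_pow_cancel(2)[of k "g * f"] by (simp add: toeplitz_def g0_def ac_simps)
    then have "B (toeplitz g0 (r_pow k * f)) = B (toeplitz g0 ?e)" using f(2) by simp
    then have "r_pow k * f = ?e" using E(4)[OF rf] E(4)[OF e] by simp
    then have "f = r_pow (- k) * ?e" using r_pow_cancel(2)[of k f] by simp
    also have "\<dots> = ?m" by (simp add: r_pow_eq ae_ops rr_powi_mult_bb ae_class_eq_iff)
    finally have "?m = 0" using Hplus_Hminus_zero[OF p _ m] f(1) by simp
    then show False using bb_class_nonzero by blast
  qed
  have neg: "\<not> invertible_op p (toeplitz g) \<and> int (aefun.dim (ker_on (Hplus p) (toeplitz g))) = \<bar>k\<bar>" if k: "k < 0"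
  proof -
    have "k = - int (nat (- k))" using k by simp
    then obtain w where "negative_factorisation p g gm gp w (nat (- k))"
      using negative_factorisation_toeplitz[OF p g, of gm "nat (- k)" gp] fac by auto
    then interpret negative_factorisation p g gm gp w "nat (- k)" .
    \<comment> \<open>\<open>w\<close> is the kernel element with \<open>j = 0\<close>, an
      admissible index because \<open>k < 0\<close>.\<close>
    have w0: "toeplitz g w = 0" using kernel_basis[of 0] k by (simp add: ker_on_def r_pow_0)
    have "\<not> invertible_op p (toeplitz g)"
    proof
      assume "invertible_op p (toeplitz g)"
      then obtain A where A: "left_inverse_op p A (toeplitz g)" unfolding invertible_op_def by blast
      then have "w = A 0" using w w0 unfolding left_inverse_op_def by force
      also have "\<dots> = 0" using A bounded_op_lin(5)[OF p] unfolding left_inverse_op_def by blast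
      finally show False using w_nonzero by simp
    qed
    then show ?thesis using kernel_dim k by simp
  qed
  have adj: "int (aefun.dim (ker_on (Hplus (conj_exp p)) (toeplitz_adj g))) = k" if k: "0 < k"
    using adjoint_kernel_dim[OF p g, of gm "nat k" gp] fac k by simp
  show ?thesis
    unfolding left_invertible_op_def right_invertible_op_def B_def[symmetric]
    using zero left right not_surj neg adj by blast
qed

end
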